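(* For $n$ even, the noncommutative $n$-torus $\mathcal{A}_\Theta$ satisfies the $N=(2,2)$ K\"ahler spectral data (i.e. it inherits a K\"ahler structure, so it is a noncommutative K\"ahler manifold). Moreover, there are at least $\prod_{j=1,\,j\text{ odd}}^{n}(n-j)$ different K\"ahler structures on $\mathcal{A}_\Theta$.
   Context: **Noncommutative torus.** Let $A$ be the universal $C^*$-algebra generated by unitaries $U_1,\dots,U_n$ with $U_jU_\ell=\exp(2\pi i\Theta_{\ell j})U_\ell U_j$, where $\Theta$ is a real skew-symmetric $n\times n$ matrix such that the lattice $\Lambda_\Theta$ generated by its columns makes $\Lambda_\Theta+\mathbb{Z}^n$ dense in $\mathbb{R}^n$. $\mathbb{T}^n$ acts by $\alpha_{\mathbf z}(U_\ell)=z_\ell U_\ell$; $\mathcal{A}=\mathcal{A}_\Theta$ is the smooth subalgebra, i.e. the series $\sum\alpha_{(m_1,\dots,m_n)}U_1^{m_1}\cdots U_n^{m_n}$ with rapidly decreasing (Schwartz) coefficients. $\tau(\sum\alpha_{m}U^m)=\alpha_{\mathbf 0}$ is the unique $\mathbb{T}^n$-invariant faithful trace; $L^2(\mathcal{A},\tau)\cong\ell^2(\mathbb{Z}^n)$ is the GNS space. Write $n=2k$, $N=2^k$; $\partial_j$ is the derivation $\partial_j(U_\ell)=i\delta_{j\ell}U_\ell$ (generator of the $j$-th circle). Let $\gamma_1,\dots,\gamma_{2k}\in M_N(\mathbb{C})$ give the irreducible Clifford representation: $\gamma_j^*=-\gamma_j$, $\gamma_j\gamma_l+\gamma_l\gamma_j=-2\delta_{jl}$;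 $\sigma\in M_N(\mathbb{C})$ is the grading ($\sigma=\sigma^*$, $\sigma^2=1$, $\sigma\gamma_j=-\gamma_j\sigma$); $J_N$ is an anti-unitary on $\mathbb{C}^N$ with $J_N^2=\varepsilon$, $J_N\gamma_j=\varepsilon'\gamma_jJ_N$, $J_N\sigma=\varepsilon''\sigma J_N$, where $(\varepsilon,\varepsilon',\varepsilon'')=(+,+,+),(-,+,-),(-,+,+),(+,+,-)$ for $2k\equiv 0,2,4,6 \pmod 8$. Put $\mathcal{H}=L^2(\mathcal{A},\tau)\otimes\mathbb{C}^N$, $J=J_0\otimes J_N$ with $J_0(a)=a^*$, $D$ the closure of $\sum_{j}\partial_j\otimes\gamma_j$ on $\mathcal{A}\otimes\mathbb{C}^N$. The $N=1$ data of $\mathcal{A}_\Theta$ is $(\mathcal{A}_\Theta,\mathcal{H},D,\sigma)$. **$N=1$ data** $(\mathcal{A},\mathcal{H},D,\gamma)$: $\mathcal{A}$ a unital $*$-algebra faithfully represented by bounded operators on a separable Hilbert space $\mathcal{H}$; $D$ self-adjoint, $[D,a]$ extends to a bounded operator for all $a\in\mathcal{A}$, $\exp(-\epsilon D^2)$ trace class for all $\epsilon>0$; $\gamma$ a $\mathbb{Z}_2$-grading with $[\gamma,a]=0$, $\{\gamma,D\}=0$. **$N=(1,1)$ data** $(\mathcal{A},\mathcal{H},d,\gamma,\star)$: $\mathcal{A},\mathcal{H}$ as before; $d$ densely defined closed, $d^2=0$, $[d,a]$ extends to a bounded operator for all $a$, $\exp(-\epsilon(dd^*+d^*d))$ trace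 class for all $\epsilon>0$; $\gamma$ a $\mathbb{Z}_2$-grading with $[\gamma,a]=0$, $\{\gamma,d\}=0$; $\star$ unitary with $[\star,a]=0$ and $\star d=\zeta d^*\star$ for some $\zeta\in\mathbb{S}^1$. **$N=(2,2)$ K\"ahler data** $(\mathcal{A},\mathcal{H},\partial,\overline\partial,T,\overline T,\gamma,\star)$: (1) $(\mathcal{A},\mathcal{H},\partial+\overline\partial,\gamma,\star)$ is $N=(1,1)$ data; (2) $T,\overline T$ bounded self-adjoint, $\partial,\overline\partial$ densely defined closed, $\partial^2=\overline\partial^2=0$, $\{\partial,\overline\partial\}=0$, $[T,\overline T]=0$, $[T,\partial]=\partial$, $[T,\overline\partial]=0$, $[\overline T,\partial]=0$, $[\overline T,\overline\partial]=\overline\partial$; (3) $[T,a]=[\overline T,a]=0$ and $[\partial,a],[\overline\partial,a],\{\partial,[\overline\partial,a]\}$ extend to bounded operators for all $a\in\mathcal{A}$; (4) $\{\gamma,\partial\}=\{\gamma,\overline\partial\}=0$, $[\gamma,T]=[\gamma,\overline T]=0$; (5) for some $\zeta\in\mathbb{S}^1$, $\star\partial=\zeta\overline\partial^*\star$ and $\star\overline\partial=\zeta\partial^*\star$; (6) $\{\partial,\overline\partial^*\}=\{\overline\partial,\partial^*\}=0$ and $\{\partial,\partial^*\}=\{\overline\partial,\overline\partial^*\}$. **Extension procedure.** Given $N=1$ data $(\mathcal{A},\mathcal{H},D,\gamma)$ with real structure $J$, let $\Omega^1_D(\mathcal{A})=\{\sum a_j[D,b_j]\}$ and $d_Da=[D,a]$.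 $\mathcal{H}$ is an $\mathcal{A}$-bimodule by $a\cdot\xi\cdot b=aJb^*J^*\xi$, with right action $\xi\cdot\omega=J\omega^*J^*\xi$ of $\Omega_D^1(\mathcal{A})$. Take a dense finitely generated projective left submodule $\mathcal{E}\subseteq\mathcal{H}$, stable under $J,\gamma$, with Hermitian structure $\langle\cdot,\cdot\rangle_\mathcal{A}$, and a connection $\nabla:\mathcal{E}\to\Omega^1_D(\mathcal{A})\otimes_\mathcal{A}\mathcal{E}$ (so $\nabla(a\xi)=a\nabla\xi+d_Da\otimes\xi$) which is compatible ($\langle\nabla\xi,\eta\rangle-\langle\xi,\nabla\eta\rangle=d_D\langle\xi,\eta\rangle_\mathcal{A}$, where $\langle\xi,\omega\otimes\eta\rangle=\langle\xi,\eta\rangle_{\mathcal A}\,\omega^*$ and $\langle\omega\otimes\xi,\eta\rangle=\omega\langle\xi,\eta\rangle_{\mathcal A}$) and commutes with $\gamma$. Let $\widetilde{\mathcal{H}}$ be the completion of $\mathcal{E}\otimes_\mathcal{A}\mathcal{E}$ for $\langle\xi\otimes\eta,\xi'\otimes\eta'\rangle=\langle\eta,\langle J\xi,J\xi'\rangle_\mathcal{A}\,\eta'\rangle_\mathcal{H}$. With $\Psi(\omega\otimes\xi)=J\xi\otimes\omega^*$, put $\overline\nabla\xi=-\Psi(\nabla J^*\xi)$, $\widetilde\nabla(\xi_1\otimes\xi_2)=\overline\nabla\xi_1\otimes\xi_2+\xi_1\otimes\nabla\xi_2$, $c(\xi_1\otimes\omega\otimes\xi_2)=\xi_1\otimes\omega\cdot\xi_2$,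 $\overline c(\xi_1\otimes\omega\otimes\xi_2)=\xi_1\cdot\omega\otimes\gamma\xi_2$, $\mathfrak{D}=c\circ\widetilde\nabla$, $\overline{\mathfrak{D}}=\overline c\circ\widetilde\nabla$ (not the closure of $\mathfrak D$). One requires $\mathfrak{D},\overline{\mathfrak{D}}$ essentially self-adjoint, $\mathfrak{D}^2=\overline{\mathfrak{D}}^2$ and $\{\mathfrak{D},\overline{\mathfrak{D}}\}=0$. The $N=1$ data *extends to $N=(1,1)$ data* if for some such $\mathcal{E},\nabla$ the tuple $(\mathcal{A},\widetilde{\mathcal{H}},d=\frac12(\mathfrak{D}-i\overline{\mathfrak{D}}),\gamma\otimes\gamma,\star=1\otimes\gamma)$ is $N=(1,1)$ data; it *extends to $N=(2,2)$ K\"ahler data* if moreover there are $\partial,\overline\partial,T,\overline T$ with $\partial+\overline\partial=d$ making $(\mathcal{A},\widetilde{\mathcal{H}},\partial,\overline\partial,T,\overline T,\gamma\otimes\gamma,\star)$ $N=(2,2)$ K\"ahler data. **Terminology.** $\mathcal{A}$ *inherits a K\"ahler structure* if its $N=1$ data extends to $N=(2,2)$ K\"ahler data over $\mathcal{A}$; different K\"ahler structures are distinct such octuples. *)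

theory Defs
  imports "HOL-Analysis.Analysis" "HOL-Algebra.Module"
begin

section \<open>Complex inner product spaces with explicit carrier\<close>

definition complex_field :: "complex ring" where
  "complex_field = \<lparr>carrier = UNIV, mult = (*), one = 1, zero = 0, add = (+)\<rparr>"

text \<open>The multiplicative fields inherited from the module record of HOL-Algebra are not used for
  vector spaces.\<close>

record 'v ip_space = "(complex, 'v) module" +
  ip :: "'v \<Rightarrow> 'v \<Rightarrow> complex"

definition nrm :: "'v ip_space \<Rightarrow> 'v \<Rightarrow> real" where
  "nrm V x = sqrt (Re (ip V x x))"

definition converges_to :: "'v ip_space \<Rightarrow> (nat \<Rightarrow> 'v) \<Rightarrow> 'v \<Rightarrow> bool" where
  "converges_to V s l \<longleftrightarrow> (\<forall>n. s n \<in> carrier V) \<and> l \<in> carrier V \<and>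
     (\<lambda>n. nrm V (s n \<ominus>\<^bsub>V\<^esub> l)) \<longlonglongrightarrow> 0"

definition cauchy_in :: "'v ip_space \<Rightarrow> (nat \<Rightarrow> 'v) \<Rightarrow> bool" where
  "cauchy_in V s \<longleftrightarrow> (\<forall>n. s n \<in> carrier V) \<and>
     (\<forall>e>0. \<exists>M. \<forall>m\<ge>M. \<forall>n\<ge>M. nrm V (s m \<ominus>\<^bsub>V\<^esub> s n) < e)"

definition hilbert_space :: "'v ip_space \<Rightarrow> bool" where
  "hilbert_space V \<longleftrightarrow>
     Module.module complex_field V \<and>
     (\<forall>x\<in>carrier V. \<forall>y\<in>carrier V. \<forall>z\<in>carrier V.
        ip V x (y \<oplus>\<^bsub>V\<^esub> z) = ip V x y + ip V x z) \<and>
     (\<forall>c. \<forall>x\<in>carrier V. \<forall>y\<in>carrier V. ip V x (c \<odot>\<^bsub>V\<^esub> y) = c * ip V x y) \<and>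
     (\<forall>x\<in>carrier V. \<forall>y\<in>carrier V. ip V y x = cnj (ip V x y)) \<and>
     (\<forall>x\<in>carrier V. 0 \<le> Re (ip V x x) \<and> (ip V x x = 0 \<longrightarrow> x = \<zero>\<^bsub>V\<^esub>)) \<and>
     (\<forall>s. cauchy_in V s \<longrightarrow> (\<exists>l. converges_to V s l))"

definition dense_in :: "'v ip_space \<Rightarrow> 'v set \<Rightarrow> bool" where
  "dense_in V S \<longleftrightarrow> S \<subseteq> carrier V \<and>
     (\<forall>x\<in>carrier V. \<exists>s. (\<forall>n. s n \<in> S) \<and> converges_to V s x)"

definition separable_space :: "'v ip_space \<Rightarrow> bool" where
  "separable_space V \<longleftrightarrow> (\<exists>S. countable S \<and> dense_in V S)"

definition orthonormal_basis :: "'v ip_space \<Rightarrow> 'v set \<Rightarrow> bool" where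
  "orthonormal_basis V B \<longleftrightarrow> B \<subseteq> carrier V \<and>
     (\<forall>e\<in>B. \<forall>f\<in>B. ip V e f = (if e = f then 1 else 0)) \<and>
     (\<forall>x\<in>carrier V. (\<forall>e\<in>B. ip V e x = 0) \<longrightarrow> x = \<zero>\<^bsub>V\<^esub>)"

definition vec_sum :: "'v ip_space \<Rightarrow> 'v list \<Rightarrow> 'v" where
  "vec_sum V xs = foldr (add V) xs \<zero>\<^bsub>V\<^esub>"

subsection \<open>The Hilbert space completion, by Cauchy sequences\<close>

text \<open>The form on \<open>V\<close> may be degenerate; vectors of norm zero are identified with zero.\<close>

definition cauchy_class :: "'v ip_space \<Rightarrow> (nat \<Rightarrow> 'v) \<Rightarrow> (nat \<Rightarrow> 'v) set" where
  "cauchy_class V s = {t. cauchy_in V t \<and> (\<lambda>n. nrm V (s n \<ominus>\<^bsub>V\<^esub> t n)) \<longlonglongrightarrow> 0}"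

definition rep_of :: "'x set \<Rightarrow> 'x" where
  "rep_of X = (SOME x. x \<in> X)"

definition completion :: "'v ip_space \<Rightarrow> (nat \<Rightarrow> 'v) set ip_space" where
  "completion V =
     \<lparr>carrier = cauchy_class V ` {s. cauchy_in V s}, mult = undefined, one = undefined,
      zero = cauchy_class V (\<lambda>_. \<zero>\<^bsub>V\<^esub>),
      add = (\<lambda>X Y. cauchy_class V (\<lambda>n. rep_of X n \<oplus>\<^bsub>V\<^esub> rep_of Y n)),
      smult = (\<lambda>c X. cauchy_class V (\<lambda>n. c \<odot>\<^bsub>V\<^esub> rep_of X n)),
      ip = (\<lambda>X Y. lim (\<lambda>n. ip V (rep_of X n) (rep_of Y n)))\<rparr>"

definition embed :: "'v ip_space \<Rightarrow> 'v \<Rightarrow> (nat \<Rightarrow> 'v) set" where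
  "embed V x = cauchy_class V (\<lambda>_. x)"

section \<open>Unbounded operators, as graphs\<close>

type_synonym 'v oper = "('v \<times> 'v) set"

definition ap :: "'v oper \<Rightarrow> 'v \<Rightarrow> 'v" where
  "ap T x = (THE y. (x, y) \<in> T)"

definition linear_op :: "'v ip_space \<Rightarrow> 'v oper \<Rightarrow> bool" where
  "linear_op V T \<longleftrightarrow> T \<subseteq> carrier V \<times> carrier V \<and> single_valued T \<and>
     (\<zero>\<^bsub>V\<^esub>, \<zero>\<^bsub>V\<^esub>) \<in> T \<and>
     (\<forall>x y x' y'. (x, y) \<in> T \<longrightarrow> (x', y') \<in> T \<longrightarrow> (x \<oplus>\<^bsub>V\<^esub> x', y \<oplus>\<^bsub>V\<^esub> y') \<in> T) \<and>
     (\<forall>c x y. (x, y) \<in> T \<longrightarrow> (c \<odot>\<^bsub>V\<^esub> x, c \<odot>\<^bsub>V\<^esub> y) \<in> T)"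

text \<open>Sums, products, commutators and anticommutators carry their natural domains.\<close>

definition op_id :: "'v ip_space \<Rightarrow> 'v oper" where
  "op_id V = Id_on (carrier V)"

definition op_zero_on :: "'v ip_space \<Rightarrow> 'v set \<Rightarrow> 'v oper" where
  "op_zero_on V S = S \<times> {\<zero>\<^bsub>V\<^esub>}"

definition op_add :: "'v ip_space \<Rightarrow> 'v oper \<Rightarrow> 'v oper \<Rightarrow> 'v oper" where
  "op_add V S T = {(x, y \<oplus>\<^bsub>V\<^esub> z) | x y z. (x, y) \<in> S \<and> (x, z) \<in> T}"

definition op_scale :: "'v ip_space \<Rightarrow> complex \<Rightarrow> 'v oper \<Rightarrow> 'v oper" where
  "op_scale V c T = {(x, c \<odot>\<^bsub>V\<^esub> y) | x y. (x, y) \<in> T}"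

definition op_comp :: "'v oper \<Rightarrow> 'v oper \<Rightarrow> 'v oper" where
  "op_comp S T = T O S"

definition op_sum :: "'v ip_space \<Rightarrow> 'v oper list \<Rightarrow> 'v oper" where
  "op_sum V Ts = foldr (op_add V) Ts (op_zero_on V (carrier V))"

definition comm :: "'v ip_space \<Rightarrow> 'v oper \<Rightarrow> 'v oper \<Rightarrow> 'v oper" where
  "comm V S T = op_add V (op_comp S T) (op_scale V (-1) (op_comp T S))"

definition acomm :: "'v ip_space \<Rightarrow> 'v oper \<Rightarrow> 'v oper \<Rightarrow> 'v oper" where
  "acomm V S T = op_add V (op_comp S T) (op_comp T S)"

definition op_adj :: "'v ip_space \<Rightarrow> 'v oper \<Rightarrow> 'v oper" where
  "op_adj V T = {(y, z). y \<in> carrier V \<and> z \<in> carrier V \<and> (\<forall>(x, w)\<in>T. ip V y w = ip V z x)}"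

definition op_closure :: "'v ip_space \<Rightarrow> 'v oper \<Rightarrow> 'v oper" where
  "op_closure V T = {(x, y). \<exists>s. (\<forall>n. s n \<in> T) \<and>
     converges_to V (\<lambda>n. fst (s n)) x \<and> converges_to V (\<lambda>n. snd (s n)) y}"

definition densely_defined_op :: "'v ip_space \<Rightarrow> 'v oper \<Rightarrow> bool" where
  "densely_defined_op V T \<longleftrightarrow> linear_op V T \<and> dense_in V (Domain T)"

definition closed_op :: "'v ip_space \<Rightarrow> 'v oper \<Rightarrow> bool" where
  "closed_op V T \<longleftrightarrow> densely_defined_op V T \<and> op_closure V T = T"

definition self_adjoint :: "'v ip_space \<Rightarrow> 'v oper \<Rightarrow> bool" where
  "self_adjoint V T \<longleftrightarrow> densely_defined_op V T \<and> op_adj V T = T"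

definition essentially_self_adjoint :: "'v ip_space \<Rightarrow> 'v oper \<Rightarrow> bool" where
  "essentially_self_adjoint V T \<longleftrightarrow> densely_defined_op V T \<and> self_adjoint V (op_closure V T)"

definition bounded_op :: "'v ip_space \<Rightarrow> 'v oper \<Rightarrow> bool" where
  "bounded_op V T \<longleftrightarrow> linear_op V T \<and> Domain T = carrier V \<and>
     (\<exists>C. \<forall>(x, y)\<in>T. nrm V y \<le> C * nrm V x)"

definition bounded_self_adjoint :: "'v ip_space \<Rightarrow> 'v oper \<Rightarrow> bool" where
  "bounded_self_adjoint V T \<longleftrightarrow> bounded_op V T \<and> op_adj V T = T"

definition unitary_op :: "'v ip_space \<Rightarrow> 'v oper \<Rightarrow> bool" where
  "unitary_op V U \<longleftrightarrow> bounded_op V U \<and>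
     op_comp (op_adj V U) U = op_id V \<and> op_comp U (op_adj V U) = op_id V"

definition positive_op :: "'v ip_space \<Rightarrow> 'v oper \<Rightarrow> bool" where
  "positive_op V T \<longleftrightarrow> bounded_op V T \<and> (\<forall>(x, y)\<in>T. Im (ip V x y) = 0 \<and> 0 \<le> Re (ip V x y))"

text \<open>For \<open>X\<close> a (graded) commutator of \<open>S\<close> with a bounded operator: \<open>X\<close> is defined on all of
  the domain of \<open>S\<close> (i.e. the bounded operator preserves that domain) and extends to a
  bounded operator.\<close>

definition extends_bounded :: "'v ip_space \<Rightarrow> 'v oper \<Rightarrow> 'v oper \<Rightarrow> bool" where
  "extends_bounded V S X \<longleftrightarrow> Domain X = Domain S \<and> (\<exists>B. bounded_op V B \<and> X \<subseteq> B)"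

definition vanishes_densely :: "'v ip_space \<Rightarrow> 'v oper \<Rightarrow> bool" where
  "vanishes_densely V X \<longleftrightarrow> dense_in V (Domain X) \<and> Range X \<subseteq> {\<zero>\<^bsub>V\<^esub>}"

subsection \<open>Borel functional calculus and trace class operators\<close>

definition spectral_dist :: "'v ip_space \<Rightarrow> (real set \<Rightarrow> 'v oper) \<Rightarrow> 'v \<Rightarrow> real measure" where
  "spectral_dist V E x = measure_of UNIV (sets borel) (\<lambda>B. ennreal (Re (ip V x (ap (E B) x))))"

definition spectral_measure :: "'v ip_space \<Rightarrow> (real set \<Rightarrow> 'v oper) \<Rightarrow> bool" where
  "spectral_measure V E \<longleftrightarrow>
     (\<forall>B\<in>sets borel. bounded_self_adjoint V (E B)) \<and>
     E UNIV = op_id V \<and>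
     (\<forall>A\<in>sets borel. \<forall>B\<in>sets borel. E (A \<inter> B) = op_comp (E A) (E B)) \<and>
     (\<forall>B :: nat \<Rightarrow> real set. range B \<subseteq> sets borel \<longrightarrow> disjoint_family B \<longrightarrow>
        (\<forall>x\<in>carrier V. (\<lambda>i. ip V x (ap (E (B i)) x)) sums ip V x (ap (E (\<Union>i. B i)) x)))"

text \<open>\<open>S = \<integral> \<lambda> dE(\<lambda>)\<close>\<close>

definition spectral_resolution :: "'v ip_space \<Rightarrow> (real set \<Rightarrow> 'v oper) \<Rightarrow> 'v oper \<Rightarrow> bool" where
  "spectral_resolution V E S \<longleftrightarrow> spectral_measure V E \<and> linear_op V S \<and>
     Domain S = {x \<in> carrier V. integrable (spectral_dist V E x) (\<lambda>t. t\<^sup>2)} \<and>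
     (\<forall>(x, y)\<in>S. ip V x y = of_real (\<integral>t. t \<partial>spectral_dist V E x))"

text \<open>\<open>B = f(S)\<close>, for a bounded operator \<open>B\<close>\<close>

definition functional_calculus ::
    "'v ip_space \<Rightarrow> 'v oper \<Rightarrow> (real \<Rightarrow> real) \<Rightarrow> 'v oper \<Rightarrow> bool" where
  "functional_calculus V S f B \<longleftrightarrow> bounded_op V B \<and>
     (\<exists>E. spectral_resolution V E S \<and>
       (\<forall>(x, y)\<in>B. integrable (spectral_dist V E x) f \<and>
          ip V x y = of_real (\<integral>t. f t \<partial>spectral_dist V E x)))"

text \<open>\<open>P\<close> is the absolute value of \<open>B\<close>.\<close>

definition trace_class :: "'v ip_space \<Rightarrow> 'v oper \<Rightarrow> bool" where
  "trace_class V B \<longleftrightarrow> bounded_op V B \<and>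
     (\<exists>P. positive_op V P \<and> op_comp P P = op_comp (op_adj V B) B \<and>
       (\<exists>\<B>. orthonormal_basis V \<B> \<and> (\<lambda>e. Re (ip V e (ap P e))) summable_on \<B>))"

definition heat_trace_class :: "'v ip_space \<Rightarrow> 'v oper \<Rightarrow> bool" where
  "heat_trace_class V S \<longleftrightarrow>
     (\<forall>\<epsilon>>0. \<exists>B. functional_calculus V S (\<lambda>t. exp (- \<epsilon> * t)) B \<and> trace_class V B)"

section \<open>Spectral data\<close>

record 'a star_algebra = "(complex, 'a) module" +
  star :: "'a \<Rightarrow> 'a"

definition unital_star_algebra :: "'a star_algebra \<Rightarrow> bool" where
  "unital_star_algebra A \<longleftrightarrow> Ring.ring A \<and> Module.module complex_field A \<and>
     (\<forall>c. \<forall>a\<in>carrier A. \<forall>b\<in>carrier A.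
        (c \<odot>\<^bsub>A\<^esub> a) \<otimes>\<^bsub>A\<^esub> b = c \<odot>\<^bsub>A\<^esub> (a \<otimes>\<^bsub>A\<^esub> b) \<and>
        a \<otimes>\<^bsub>A\<^esub> (c \<odot>\<^bsub>A\<^esub> b) = c \<odot>\<^bsub>A\<^esub> (a \<otimes>\<^bsub>A\<^esub> b)) \<and>
     (\<forall>a\<in>carrier A. star A a \<in> carrier A \<and> star A (star A a) = a) \<and>
     (\<forall>a\<in>carrier A. \<forall>b\<in>carrier A.
        star A (a \<oplus>\<^bsub>A\<^esub> b) = star A a \<oplus>\<^bsub>A\<^esub> star A b \<and>
        star A (a \<otimes>\<^bsub>A\<^esub> b) = star A b \<otimes>\<^bsub>A\<^esub> star A a) \<and>
     (\<forall>c. \<forall>a\<in>carrier A. star A (c \<odot>\<^bsub>A\<^esub> a) = cnj c \<odot>\<^bsub>A\<^esub> star A a)"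

record ('a, 'v) graded_rep =
  alg :: "'a star_algebra"
  spc :: "'v ip_space"
  rep :: "'a \<Rightarrow> 'v oper"
  grd :: "'v oper"

record ('a, 'v) N1_data = "('a, 'v) graded_rep" +
  dirac :: "'v oper"

record ('a, 'v) N11_data = "('a, 'v) graded_rep" +
  diff :: "'v oper"
  hodge :: "'v oper"

record ('a, 'v) N22_data = "('a, 'v) graded_rep" +
  del :: "'v oper"
  delbar :: "'v oper"
  Tdeg :: "'v oper"
  Tbar :: "'v oper"
  hodge :: "'v oper"

definition is_graded_rep :: "('a, 'v, 'more) graded_rep_scheme \<Rightarrow> bool" where
  "is_graded_rep X \<longleftrightarrow> (let A = alg X; V = spc X; \<pi> = rep X; \<gamma> = grd X in
     unital_star_algebra A \<and> hilbert_space V \<and> separable_space V \<and>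
     (\<forall>a\<in>carrier A. bounded_op V (\<pi> a) \<and> \<pi> (star A a) = op_adj V (\<pi> a)) \<and>
     \<pi> \<one>\<^bsub>A\<^esub> = op_id V \<and>
     (\<forall>a\<in>carrier A. \<forall>b\<in>carrier A.
        \<pi> (a \<oplus>\<^bsub>A\<^esub> b) = op_add V (\<pi> a) (\<pi> b) \<and> \<pi> (a \<otimes>\<^bsub>A\<^esub> b) = op_comp (\<pi> a) (\<pi> b)) \<and>
     (\<forall>c. \<forall>a\<in>carrier A. \<pi> (c \<odot>\<^bsub>A\<^esub> a) = op_scale V c (\<pi> a)) \<and>
     inj_on \<pi> (carrier A) \<and>
     bounded_self_adjoint V \<gamma> \<and> op_comp \<gamma> \<gamma> = op_id V \<and>
     (\<forall>a\<in>carrier A. comm V \<gamma> (\<pi> a) = op_zero_on V (carrier V)))"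

definition is_N1_data :: "('a, 'v) N1_data \<Rightarrow> bool" where
  "is_N1_data X \<longleftrightarrow> (let V = spc X; D = dirac X in
     is_graded_rep X \<and> self_adjoint V D \<and>
     (\<forall>a\<in>carrier (alg X). extends_bounded V D (comm V D (rep X a))) \<and>
     heat_trace_class V (op_comp D D) \<and>
     acomm V (grd X) D = op_zero_on V (Domain D))"

definition is_N11_data :: "('a, 'v) N11_data \<Rightarrow> bool" where
  "is_N11_data X \<longleftrightarrow> (let V = spc X; d = diff X; h = N11_data.hodge X in
     is_graded_rep X \<and> closed_op V d \<and> op_comp d d = op_zero_on V (Domain d) \<and>
     (\<forall>a\<in>carrier (alg X). extends_bounded V d (comm V d (rep X a))) \<and>
     heat_trace_class V (op_add V (op_comp d (op_adj V d)) (op_comp (op_adj V d) d)) \<and>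
     acomm V (grd X) d = op_zero_on V (Domain d) \<and>
     unitary_op V h \<and> (\<forall>a\<in>carrier (alg X). comm V h (rep X a) = op_zero_on V (carrier V)) \<and>
     (\<exists>\<zeta>. cmod \<zeta> = 1 \<and> op_comp h d = op_scale V \<zeta> (op_comp (op_adj V d) h)))"

text \<open>The operator sum \<open>\<partial> + \<partial>bar\<close> is in general closable but not closed, so the
  \<open>N = (1,1)\<close> differential is its closure.\<close>

definition N11_of_N22 :: "('a, 'v) N22_data \<Rightarrow> ('a, 'v) N11_data" where
  "N11_of_N22 K = \<lparr>alg = alg K, spc = spc K, rep = rep K, grd = grd K,
     diff = op_closure (spc K) (op_add (spc K) (del K) (delbar K)), hodge = N22_data.hodge K\<rparr>"

definition is_N22_Kaehler_data :: "('a, 'v) N22_data \<Rightarrow> bool" where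
  "is_N22_Kaehler_data K \<longleftrightarrow>
    (let V = spc K; \<pi> = rep K; \<gamma> = grd K; h = N22_data.hodge K;
         p = del K; q = delbar K; p' = op_adj V p; q' = op_adj V q; T = Tdeg K; T' = Tbar K;
         zero_everywhere = op_zero_on V (carrier V) in
     is_N11_data (N11_of_N22 K) \<and>
     bounded_self_adjoint V T \<and> bounded_self_adjoint V T' \<and>
     closed_op V p \<and> closed_op V q \<and>
     op_comp p p = op_zero_on V (Domain p) \<and> op_comp q q = op_zero_on V (Domain q) \<and>
     vanishes_densely V (acomm V p q) \<and>
     comm V T T' = zero_everywhere \<and>
     comm V T p = p \<and> comm V T q = op_zero_on V (Domain q) \<and>
     comm V T' p = op_zero_on V (Domain p) \<and> comm V T' q = q \<and>
     (\<forall>a\<in>carrier (alg K).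
        comm V T (\<pi> a) = zero_everywhere \<and> comm V T' (\<pi> a) = zero_everywhere \<and>
        extends_bounded V p (comm V p (\<pi> a)) \<and> extends_bounded V q (comm V q (\<pi> a)) \<and>
        extends_bounded V p (acomm V p (op_closure V (comm V q (\<pi> a))))) \<and>
     acomm V \<gamma> p = op_zero_on V (Domain p) \<and> acomm V \<gamma> q = op_zero_on V (Domain q) \<and>
     comm V \<gamma> T = zero_everywhere \<and> comm V \<gamma> T' = zero_everywhere \<and>
     (\<exists>\<zeta>. cmod \<zeta> = 1 \<and>
        op_comp h p = op_scale V \<zeta> (op_comp q' h) \<and> op_comp h q = op_scale V \<zeta> (op_comp p' h)) \<and>
     vanishes_densely V (acomm V p q') \<and> vanishes_densely V (acomm V q p') \<and>
     acomm V p p' = acomm V q q')"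

section \<open>Tensor products over a noncommutative algebra\<close>

text \<open>Formal finite sums are lists. The generated congruence makes concatenation a commutative
  sum; tensors are the congruence classes.\<close>

inductive formal_eq :: "('p list \<Rightarrow> 'p list \<Rightarrow> bool) \<Rightarrow> 'p list \<Rightarrow> 'p list \<Rightarrow> bool"
  for R where
  "formal_eq R xs xs"
| "formal_eq R xs ys \<Longrightarrow> formal_eq R ys xs"
| "formal_eq R xs ys \<Longrightarrow> formal_eq R ys zs \<Longrightarrow> formal_eq R xs zs"
| "formal_eq R xs ys \<Longrightarrow> formal_eq R (xs @ zs) (ys @ zs)"
| "formal_eq R (xs @ ys) (ys @ xs)"
| "R xs ys \<Longrightarrow> formal_eq R xs ys"

record ('a, 'x) bimodule = "('a, 'x) module" +
  ract :: "'x \<Rightarrow> 'a \<Rightarrow> 'x"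

inductive tensor2_rel ::
    "'a set \<Rightarrow> ('a, 'x) bimodule \<Rightarrow> ('a, 'y) bimodule \<Rightarrow> ('x \<times> 'y) list \<Rightarrow> ('x \<times> 'y) list \<Rightarrow> bool"
  for S X Y where
  "x \<in> carrier X \<Longrightarrow> x' \<in> carrier X \<Longrightarrow> y \<in> carrier Y \<Longrightarrow>
     tensor2_rel S X Y [(x \<oplus>\<^bsub>X\<^esub> x', y)] [(x, y), (x', y)]"
| "x \<in> carrier X \<Longrightarrow> y \<in> carrier Y \<Longrightarrow> y' \<in> carrier Y \<Longrightarrow>
     tensor2_rel S X Y [(x, y \<oplus>\<^bsub>Y\<^esub> y')] [(x, y), (x, y')]"
| "x \<in> carrier X \<Longrightarrow> y \<in> carrier Y \<Longrightarrow> a \<in> S \<Longrightarrow>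
     tensor2_rel S X Y [(ract X x a, y)] [(x, a \<odot>\<^bsub>Y\<^esub> y)]"
| "y \<in> carrier Y \<Longrightarrow> tensor2_rel S X Y [(\<zero>\<^bsub>X\<^esub>, y)] []"

inductive tensor3_rel ::
    "'a set \<Rightarrow> ('a, 'x) bimodule \<Rightarrow> ('a, 'y) bimodule \<Rightarrow> ('a, 'z) bimodule \<Rightarrow>
     ('x \<times> 'y \<times> 'z) list \<Rightarrow> ('x \<times> 'y \<times> 'z) list \<Rightarrow> bool"
  for S X Y Z where
  "x \<in> carrier X \<Longrightarrow> x' \<in> carrier X \<Longrightarrow> y \<in> carrier Y \<Longrightarrow> z \<in> carrier Z \<Longrightarrow>
     tensor3_rel S X Y Z [(x \<oplus>\<^bsub>X\<^esub> x', y, z)] [(x, y, z), (x', y, z)]"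
| "x \<in> carrier X \<Longrightarrow> y \<in> carrier Y \<Longrightarrow> y' \<in> carrier Y \<Longrightarrow> z \<in> carrier Z \<Longrightarrow>
     tensor3_rel S X Y Z [(x, y \<oplus>\<^bsub>Y\<^esub> y', z)] [(x, y, z), (x, y', z)]"
| "x \<in> carrier X \<Longrightarrow> y \<in> carrier Y \<Longrightarrow> z \<in> carrier Z \<Longrightarrow> z' \<in> carrier Z \<Longrightarrow>
     tensor3_rel S X Y Z [(x, y, z \<oplus>\<^bsub>Z\<^esub> z')] [(x, y, z), (x, y, z')]"
| "x \<in> carrier X \<Longrightarrow> y \<in> carrier Y \<Longrightarrow> z \<in> carrier Z \<Longrightarrow> a \<in> S \<Longrightarrow>
     tensor3_rel S X Y Z [(ract X x a, y, z)] [(x, a \<odot>\<^bsub>Y\<^esub> y, z)]"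
| "x \<in> carrier X \<Longrightarrow> y \<in> carrier Y \<Longrightarrow> z \<in> carrier Z \<Longrightarrow> a \<in> S \<Longrightarrow>
     tensor3_rel S X Y Z [(x, ract Y y a, z)] [(x, y, a \<odot>\<^bsub>Z\<^esub> z)]"
| "y \<in> carrier Y \<Longrightarrow> z \<in> carrier Z \<Longrightarrow> tensor3_rel S X Y Z [(\<zero>\<^bsub>X\<^esub>, y, z)] []"

definition tens2 :: "'a set \<Rightarrow> ('a, 'x) bimodule \<Rightarrow> ('a, 'y) bimodule \<Rightarrow>
    ('x \<times> 'y) list \<Rightarrow> ('x \<times> 'y) list set" where
  "tens2 S X Y xs = {ys. set ys \<subseteq> carrier X \<times> carrier Y \<and> formal_eq (tensor2_rel S X Y) xs ys}"

definition tensor2 :: "'a set \<Rightarrow> ('a, 'x) bimodule \<Rightarrow> ('a, 'y) bimodule \<Rightarrow>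
    ('x \<times> 'y) list set set" where
  "tensor2 S X Y = tens2 S X Y ` {xs. set xs \<subseteq> carrier X \<times> carrier Y}"

definition tens3 :: "'a set \<Rightarrow> ('a, 'x) bimodule \<Rightarrow> ('a, 'y) bimodule \<Rightarrow> ('a, 'z) bimodule \<Rightarrow>
    ('x \<times> 'y \<times> 'z) list \<Rightarrow> ('x \<times> 'y \<times> 'z) list set" where
  "tens3 S X Y Z xs = {ys. set ys \<subseteq> carrier X \<times> carrier Y \<times> carrier Z \<and>
     formal_eq (tensor3_rel S X Y Z) xs ys}"

section \<open>Finitely generated projective Hermitian modules\<close>

definition left_hom :: "'a star_algebra \<Rightarrow> ('a, 'x, 'm) module_scheme \<Rightarrow>
    ('a, 'y, 'k) module_scheme \<Rightarrow> ('x \<Rightarrow> 'y) \<Rightarrow> bool" where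
  "left_hom A X Y f \<longleftrightarrow> (\<forall>x\<in>carrier X. f x \<in> carrier Y) \<and>
     (\<forall>x\<in>carrier X. \<forall>x'\<in>carrier X. f (x \<oplus>\<^bsub>X\<^esub> x') = f x \<oplus>\<^bsub>Y\<^esub> f x') \<and>
     (\<forall>a\<in>carrier A. \<forall>x\<in>carrier X. f (a \<odot>\<^bsub>X\<^esub> x) = a \<odot>\<^bsub>Y\<^esub> f x)"

definition free_left_module :: "'a star_algebra \<Rightarrow> nat \<Rightarrow> ('a, nat \<Rightarrow> 'a) module" where
  "free_left_module A k =
     \<lparr>carrier = {..<k} \<rightarrow>\<^sub>E carrier A, mult = undefined, one = undefined,
      zero = (\<lambda>i\<in>{..<k}. \<zero>\<^bsub>A\<^esub>),
      add = (\<lambda>f g. \<lambda>i\<in>{..<k}. f i \<oplus>\<^bsub>A\<^esub> g i),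
      smult = (\<lambda>a f. \<lambda>i\<in>{..<k}. a \<otimes>\<^bsub>A\<^esub> f i)\<rparr>"

text \<open>A finitely generated projective module is a direct summand of some \<open>A\<^sup>k\<close>.\<close>

definition fg_projective :: "'a star_algebra \<Rightarrow> ('a, 'x, 'm) module_scheme \<Rightarrow> bool" where
  "fg_projective A X \<longleftrightarrow> (\<exists>k s r. left_hom A X (free_left_module A k) s \<and>
     left_hom A (free_left_module A k) X r \<and> (\<forall>x\<in>carrier X. r (s x) = x))"

text \<open>Positivity in \<open>A\<close> is positivity as an operator. The last clause says that
  \<open>\<xi> \<mapsto> \<langle>\<xi>, _\<rangle>\<close> is an isomorphism onto the conjugate-linear dual. The requirement that \<open>g\<close> be
  undefined off the module only fixes \<open>g\<close> as a function.\<close>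

definition hermitian_structure ::
    "('a, 'v, 'more) graded_rep_scheme \<Rightarrow> ('a, 'v, 'm) module_scheme \<Rightarrow> ('v \<Rightarrow> 'v \<Rightarrow> 'a) \<Rightarrow> bool" where
  "hermitian_structure X M g \<longleftrightarrow> (let A = alg X in
     (\<forall>\<xi> \<eta>. \<xi> \<notin> carrier M \<or> \<eta> \<notin> carrier M \<longrightarrow> g \<xi> \<eta> = undefined) \<and>
     (\<forall>\<xi>\<in>carrier M. \<forall>\<eta>\<in>carrier M. g \<xi> \<eta> \<in> carrier A \<and> star A (g \<xi> \<eta>) = g \<eta> \<xi>) \<and>
     (\<forall>\<xi>\<in>carrier M. \<forall>\<xi>'\<in>carrier M. \<forall>\<eta>\<in>carrier M.
        g (\<xi> \<oplus>\<^bsub>M\<^esub> \<xi>') \<eta> = g \<xi> \<eta> \<oplus>\<^bsub>A\<^esub> g \<xi>' \<eta> \<and> g \<eta> (\<xi> \<oplus>\<^bsub>M\<^esub> \<xi>') = g \<eta> \<xi> \<oplus>\<^bsub>A\<^esub> g \<eta> \<xi>') \<and>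
     (\<forall>a\<in>carrier A. \<forall>b\<in>carrier A. \<forall>\<xi>\<in>carrier M. \<forall>\<eta>\<in>carrier M.
        g (a \<odot>\<^bsub>M\<^esub> \<xi>) (b \<odot>\<^bsub>M\<^esub> \<eta>) = a \<otimes>\<^bsub>A\<^esub> g \<xi> \<eta> \<otimes>\<^bsub>A\<^esub> star A b) \<and>
     (\<forall>\<xi>\<in>carrier M. positive_op (spc X) (rep X (g \<xi> \<xi>))) \<and>
     (\<forall>\<phi>. (\<forall>\<eta>\<in>carrier M. \<phi> \<eta> \<in> carrier A) \<longrightarrow>
        (\<forall>\<eta>\<in>carrier M. \<forall>\<eta>'\<in>carrier M. \<phi> (\<eta> \<oplus>\<^bsub>M\<^esub> \<eta>') = \<phi> \<eta> \<oplus>\<^bsub>A\<^esub> \<phi> \<eta>') \<longrightarrow>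
        (\<forall>a\<in>carrier A. \<forall>\<eta>\<in>carrier M. \<phi> (a \<odot>\<^bsub>M\<^esub> \<eta>) = \<phi> \<eta> \<otimes>\<^bsub>A\<^esub> star A a) \<longrightarrow>
        (\<exists>!\<xi>. \<xi> \<in> carrier M \<and> (\<forall>\<eta>\<in>carrier M. g \<xi> \<eta> = \<phi> \<eta>))))"

section \<open>Extension of \<open>N = 1\<close> data\<close>

definition antiunitary :: "'v ip_space \<Rightarrow> ('v \<Rightarrow> 'v) \<Rightarrow> bool" where
  "antiunitary V J \<longleftrightarrow> J ` carrier V = carrier V \<and>
     (\<forall>x\<in>carrier V. \<forall>y\<in>carrier V.
        J (x \<oplus>\<^bsub>V\<^esub> y) = J x \<oplus>\<^bsub>V\<^esub> J y \<and> ip V (J x) (J y) = ip V y x) \<and>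
     (\<forall>c. \<forall>x\<in>carrier V. J (c \<odot>\<^bsub>V\<^esub> x) = cnj c \<odot>\<^bsub>V\<^esub> J x)"

text \<open>The adjoint \<open>J\<^sup>*\<close> of an antiunitary is its inverse.\<close>

definition Jstar :: "'v ip_space \<Rightarrow> ('v \<Rightarrow> 'v) \<Rightarrow> 'v \<Rightarrow> 'v" where
  "Jstar V J = inv_into (carrier V) J"

text \<open>The operator \<open>J T J\<^sup>*\<close>\<close>

definition Jconj :: "'v ip_space \<Rightarrow> ('v \<Rightarrow> 'v) \<Rightarrow> 'v oper \<Rightarrow> 'v oper" where
  "Jconj V J T = {(J x, J y) | x y. (x, y) \<in> T}"

text \<open>\<open>d\<^sub>D a\<close>, the bounded extension of \<open>[D, a]\<close>\<close>

definition dD :: "('a, 'v) N1_data \<Rightarrow> 'a \<Rightarrow> 'v oper" where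
  "dD X a = op_closure (spc X) (comm (spc X) (dirac X) (rep X a))"

definition real_structure :: "('a, 'v) N1_data \<Rightarrow> ('v \<Rightarrow> 'v) \<Rightarrow> bool" where
  "real_structure X J \<longleftrightarrow> (let A = alg X; V = spc X; \<pi> = rep X in
     antiunitary V J \<and>
     (\<exists>\<epsilon>\<in>{1, -1}. \<forall>x\<in>carrier V. J (J x) = \<epsilon> \<odot>\<^bsub>V\<^esub> x) \<and>
     (\<exists>\<epsilon>'\<in>{1, -1}. Jconj V J (dirac X) = op_scale V \<epsilon>' (dirac X)) \<and>
     (\<exists>\<epsilon>''\<in>{1, -1}. Jconj V J (grd X) = op_scale V \<epsilon>'' (grd X)) \<and>
     (\<forall>a\<in>carrier A. \<forall>b\<in>carrier A.
        comm V (\<pi> a) (Jconj V J (\<pi> b)) = op_zero_on V (carrier V) \<and>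
        comm V (dD X a) (Jconj V J (\<pi> b)) = op_zero_on V (carrier V)))"

definition Omega1 :: "('a, 'v) N1_data \<Rightarrow> 'v oper set" where
  "Omega1 X = {op_sum (spc X) (map (\<lambda>(a, b). op_comp (rep X a) (dD X b)) ps) | ps.
     set ps \<subseteq> carrier (alg X) \<times> carrier (alg X)}"

definition Omega_bimodule :: "('a, 'v) N1_data \<Rightarrow> ('a, 'v oper) bimodule" where
  "Omega_bimodule X =
     \<lparr>carrier = Omega1 X, mult = undefined, one = undefined,
      zero = op_zero_on (spc X) (carrier (spc X)), add = op_add (spc X),
      smult = (\<lambda>a \<omega>. op_comp (rep X a) \<omega>), ract = (\<lambda>\<omega> a. op_comp \<omega> (rep X a))\<rparr>"

text \<open>The right actions \<open>\<xi> \<cdot> b = J b\<^sup>* J\<^sup>* \<xi>\<close> and \<open>\<xi> \<cdot> \<omega> = J \<omega>\<^sup>* J\<^sup>* \<xi>\<close>\<close>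

definition right_act :: "('a, 'v) N1_data \<Rightarrow> ('v \<Rightarrow> 'v) \<Rightarrow> 'v \<Rightarrow> 'v oper \<Rightarrow> 'v" where
  "right_act X J \<xi> T = J (ap (op_adj (spc X) T) (Jstar (spc X) J \<xi>))"

definition sub_bimodule :: "('a, 'v) N1_data \<Rightarrow> ('v \<Rightarrow> 'v) \<Rightarrow> 'v set \<Rightarrow> ('a, 'v) bimodule" where
  "sub_bimodule X J \<E> =
     \<lparr>carrier = \<E>, mult = undefined, one = undefined, zero = \<zero>\<^bsub>spc X\<^esub>, add = add (spc X),
      smult = (\<lambda>a \<xi>. ap (rep X a) \<xi>), ract = (\<lambda>\<xi> a. right_act X J \<xi> (rep X a))\<rparr>"

abbreviation EE where
  "EE X J \<E> \<equiv> tens2 (carrier (alg X)) (sub_bimodule X J \<E>) (sub_bimodule X J \<E>)"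

abbreviation OE where
  "OE X J \<E> \<equiv> tens2 (carrier (alg X)) (Omega_bimodule X) (sub_bimodule X J \<E>)"

abbreviation EO where
  "EO X J \<E> \<equiv> tens2 (carrier (alg X)) (sub_bimodule X J \<E>) (Omega_bimodule X)"

abbreviation EOE where
  "EOE X J \<E> \<equiv> tens3 (carrier (alg X)) (sub_bimodule X J \<E>) (Omega_bimodule X) (sub_bimodule X J \<E>)"

text \<open>\<open>\<E> \<otimes>\<^sub>A \<E>\<close> with the form
  \<open>\<langle>\<xi> \<otimes> \<eta>, \<xi>' \<otimes> \<eta>'\<rangle> = \<langle>\<eta>, \<langle>J \<xi>, J \<xi>'\<rangle>\<^sub>A \<eta>'\<rangle>\<close>\<close>

definition tensor_space :: "('a, 'v) N1_data \<Rightarrow> ('v \<Rightarrow> 'v) \<Rightarrow> 'v set \<Rightarrow> ('v \<Rightarrow> 'v \<Rightarrow> 'a) \<Rightarrow>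
    ('v \<times> 'v) list set ip_space" where
  "tensor_space X J \<E> g =
    (let C = tensor2 (carrier (alg X)) (sub_bimodule X J \<E>) (sub_bimodule X J \<E>); V = spc X in
     \<lparr>carrier = C, mult = undefined, one = undefined, zero = EE X J \<E> [],
      add = (\<lambda>P\<in>C. \<lambda>Q\<in>C. EE X J \<E> (rep_of P @ rep_of Q)),
      smult = (\<lambda>c. \<lambda>P\<in>C. EE X J \<E> (map (\<lambda>(\<xi>, \<eta>). (c \<odot>\<^bsub>V\<^esub> \<xi>, \<eta>)) (rep_of P))),
      ip = (\<lambda>P\<in>C. \<lambda>Q\<in>C. \<Sum>(\<xi>, \<eta>)\<leftarrow>rep_of P. \<Sum>(\<xi>', \<eta>')\<leftarrow>rep_of Q.
              ip V \<eta> (ap (rep X (g (J \<xi>) (J \<xi>'))) \<eta>'))\<rparr>)"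

definition connection :: "('a, 'v) N1_data \<Rightarrow> ('v \<Rightarrow> 'v) \<Rightarrow> 'v set \<Rightarrow>
    ('v \<Rightarrow> ('v oper \<times> 'v) list set) \<Rightarrow> bool" where
  "connection X J \<E> nab \<longleftrightarrow>
     (\<forall>\<xi>\<in>\<E>. nab \<xi> \<in> tensor2 (carrier (alg X)) (Omega_bimodule X) (sub_bimodule X J \<E>)) \<and>
     (\<forall>\<xi>\<in>\<E>. \<forall>\<eta>\<in>\<E>. nab (\<xi> \<oplus>\<^bsub>spc X\<^esub> \<eta>) = OE X J \<E> (rep_of (nab \<xi>) @ rep_of (nab \<eta>))) \<and>
     (\<forall>a\<in>carrier (alg X). \<forall>\<xi>\<in>\<E>. nab (ap (rep X a) \<xi>) =
        OE X J \<E> (map (\<lambda>(\<omega>, \<eta>). (op_comp (rep X a) \<omega>, \<eta>)) (rep_of (nab \<xi>)) @ [(dD X a, \<xi>)]))"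

definition metric_compatible :: "('a, 'v) N1_data \<Rightarrow> 'v set \<Rightarrow> ('v \<Rightarrow> 'v \<Rightarrow> 'a) \<Rightarrow>
    ('v \<Rightarrow> ('v oper \<times> 'v) list set) \<Rightarrow> bool" where
  "metric_compatible X \<E> g nab \<longleftrightarrow> (let V = spc X in \<forall>\<xi>\<in>\<E>. \<forall>\<eta>\<in>\<E>.
     op_add V
       (op_sum V (map (\<lambda>(\<omega>, \<zeta>). op_comp \<omega> (rep X (g \<zeta> \<eta>))) (rep_of (nab \<xi>))))
       (op_scale V (-1)
         (op_sum V (map (\<lambda>(\<omega>, \<zeta>). op_comp (rep X (g \<xi> \<zeta>)) (op_adj V \<omega>)) (rep_of (nab \<eta>)))))
     = dD X (g \<xi> \<eta>))"

definition commutes_with_grading :: "('a, 'v) N1_data \<Rightarrow> ('v \<Rightarrow> 'v) \<Rightarrow> 'v set \<Rightarrow>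
    ('v \<Rightarrow> ('v oper \<times> 'v) list set) \<Rightarrow> bool" where
  "commutes_with_grading X J \<E> nab \<longleftrightarrow> (\<forall>\<xi>\<in>\<E>. nab (ap (grd X) \<xi>) =
     OE X J \<E> (map (\<lambda>(\<omega>, \<eta>). (\<omega>, ap (grd X) \<eta>)) (rep_of (nab \<xi>))))"

definition Psi :: "('a, 'v) N1_data \<Rightarrow> ('v \<Rightarrow> 'v) \<Rightarrow> 'v set \<Rightarrow>
    ('v oper \<times> 'v) list set \<Rightarrow> ('v \<times> 'v oper) list set" where
  "Psi X J \<E> P = EO X J \<E> (map (\<lambda>(\<omega>, \<xi>). (J \<xi>, op_adj (spc X) \<omega>)) (rep_of P))"

definition nabla_bar :: "('a, 'v) N1_data \<Rightarrow> ('v \<Rightarrow> 'v) \<Rightarrow> 'v set \<Rightarrow>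
    ('v \<Rightarrow> ('v oper \<times> 'v) list set) \<Rightarrow> 'v \<Rightarrow> ('v \<times> 'v oper) list set" where
  "nabla_bar X J \<E> nab \<xi> = EO X J \<E> (map (\<lambda>(\<eta>, \<omega>). (\<ominus>\<^bsub>spc X\<^esub> \<eta>, \<omega>))
     (rep_of (Psi X J \<E> (nab (Jstar (spc X) J \<xi>)))))"

definition nabla_tilde :: "('a, 'v) N1_data \<Rightarrow> ('v \<Rightarrow> 'v) \<Rightarrow> 'v set \<Rightarrow>
    ('v \<Rightarrow> ('v oper \<times> 'v) list set) \<Rightarrow> ('v \<times> 'v) list set \<Rightarrow> ('v \<times> 'v oper \<times> 'v) list set" where
  "nabla_tilde X J \<E> nab P = EOE X J \<E> (concat (map (\<lambda>(\<xi>\<^sub>1, \<xi>\<^sub>2).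
       map (\<lambda>(\<eta>, \<omega>). (\<eta>, \<omega>, \<xi>\<^sub>2)) (rep_of (nabla_bar X J \<E> nab \<xi>\<^sub>1)) @
       map (\<lambda>(\<omega>, \<eta>). (\<xi>\<^sub>1, \<omega>, \<eta>)) (rep_of (nab \<xi>\<^sub>2))) (rep_of P)))"

definition cliff :: "('a, 'v) N1_data \<Rightarrow> ('v \<Rightarrow> 'v) \<Rightarrow> 'v set \<Rightarrow>
    ('v \<times> 'v oper \<times> 'v) list set \<Rightarrow> ('v \<times> 'v) list set" where
  "cliff X J \<E> R = EE X J \<E> (map (\<lambda>(\<xi>\<^sub>1, \<omega>, \<xi>\<^sub>2). (\<xi>\<^sub>1, ap \<omega> \<xi>\<^sub>2)) (rep_of R))"

definition cliff_bar :: "('a, 'v) N1_data \<Rightarrow> ('v \<Rightarrow> 'v) \<Rightarrow> 'v set \<Rightarrow>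
    ('v \<times> 'v oper \<times> 'v) list set \<Rightarrow> ('v \<times> 'v) list set" where
  "cliff_bar X J \<E> R = EE X J \<E>
     (map (\<lambda>(\<xi>\<^sub>1, \<omega>, \<xi>\<^sub>2). (right_act X J \<xi>\<^sub>1 \<omega>, ap (grd X) \<xi>\<^sub>2)) (rep_of R))"

text \<open>A map of \<open>\<E> \<otimes>\<^sub>A \<E>\<close>, as a densely defined operator on the completion\<close>

definition op_on_completion ::
    "'v ip_space \<Rightarrow> ('v \<Rightarrow> 'v) \<Rightarrow> (nat \<Rightarrow> 'v) set oper" where
  "op_on_completion V f = {(embed V x, embed V (f x)) | x. x \<in> carrier V}"

definition ext_D :: "('a, 'v) N1_data \<Rightarrow> ('v \<Rightarrow> 'v) \<Rightarrow> 'v set \<Rightarrow> ('v \<Rightarrow> 'v \<Rightarrow> 'a) \<Rightarrow>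
    ('v \<Rightarrow> ('v oper \<times> 'v) list set) \<Rightarrow> (nat \<Rightarrow> ('v \<times> 'v) list set) set oper" where
  "ext_D X J \<E> g nab = op_on_completion (tensor_space X J \<E> g)
     (\<lambda>P. cliff X J \<E> (nabla_tilde X J \<E> nab P))"

definition ext_D_bar :: "('a, 'v) N1_data \<Rightarrow> ('v \<Rightarrow> 'v) \<Rightarrow> 'v set \<Rightarrow> ('v \<Rightarrow> 'v \<Rightarrow> 'a) \<Rightarrow>
    ('v \<Rightarrow> ('v oper \<times> 'v) list set) \<Rightarrow> (nat \<Rightarrow> ('v \<times> 'v) list set) set oper" where
  "ext_D_bar X J \<E> g nab = op_on_completion (tensor_space X J \<E> g)
     (\<lambda>P. cliff_bar X J \<E> (nabla_tilde X J \<E> nab P))"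

text \<open>Stability under \<open>\<Omega>\<^sup>1\<close> is what makes both Clifford actions take values in
  \<open>\<E> \<otimes>\<^sub>A \<E>\<close>.\<close>

definition extension_module :: "('a, 'v) N1_data \<Rightarrow> ('v \<Rightarrow> 'v) \<Rightarrow> 'v set \<Rightarrow> bool" where
  "extension_module X J \<E> \<longleftrightarrow> dense_in (spc X) \<E> \<and> \<zero>\<^bsub>spc X\<^esub> \<in> \<E> \<and>
     (\<forall>\<xi>\<in>\<E>. \<forall>\<eta>\<in>\<E>. \<xi> \<oplus>\<^bsub>spc X\<^esub> \<eta> \<in> \<E>) \<and>
     (\<forall>a\<in>carrier (alg X). \<forall>\<xi>\<in>\<E>. ap (rep X a) \<xi> \<in> \<E>) \<and>
     (\<forall>\<xi>\<in>\<E>. J \<xi> \<in> \<E> \<and> ap (grd X) \<xi> \<in> \<E>) \<and>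
     (\<forall>\<omega>\<in>Omega1 X. \<forall>\<xi>\<in>\<E>. ap \<omega> \<xi> \<in> \<E> \<and> right_act X J \<xi> \<omega> \<in> \<E>) \<and>
     fg_projective (alg X) (sub_bimodule X J \<E>)"

definition admissible_extension :: "('a, 'v) N1_data \<Rightarrow> ('v \<Rightarrow> 'v) \<Rightarrow> 'v set \<Rightarrow> ('v \<Rightarrow> 'v \<Rightarrow> 'a) \<Rightarrow>
    ('v \<Rightarrow> ('v oper \<times> 'v) list set) \<Rightarrow> bool" where
  "admissible_extension X J \<E> g nab \<longleftrightarrow>
    (let H = completion (tensor_space X J \<E> g);
         D = ext_D X J \<E> g nab; D' = ext_D_bar X J \<E> g nab in
     extension_module X J \<E> \<and>
     hermitian_structure X (sub_bimodule X J \<E>) g \<and>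
     connection X J \<E> nab \<and> metric_compatible X \<E> g nab \<and> commutes_with_grading X J \<E> nab \<and>
     essentially_self_adjoint H D \<and> essentially_self_adjoint H D' \<and>
     op_comp D D = op_comp D' D' \<and> acomm H D D' = op_zero_on H (Domain D))"

text \<open>Continuous extension of \<open>\<xi> \<otimes> \<eta> \<mapsto> S \<xi> \<otimes> T \<eta>\<close>\<close>

definition ext_op :: "('a, 'v) N1_data \<Rightarrow> ('v \<Rightarrow> 'v) \<Rightarrow> 'v set \<Rightarrow> ('v \<Rightarrow> 'v \<Rightarrow> 'a) \<Rightarrow>
    'v oper \<Rightarrow> 'v oper \<Rightarrow> (nat \<Rightarrow> ('v \<times> 'v) list set) set oper" where
  "ext_op X J \<E> g S T = op_closure (completion (tensor_space X J \<E> g))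
     (op_on_completion (tensor_space X J \<E> g)
       (\<lambda>P. EE X J \<E> (map (\<lambda>(\<xi>, \<eta>). (ap S \<xi>, ap T \<eta>)) (rep_of P))))"

text \<open>The differential is the closure of \<open>\<onehalf> (\<DD> - i \<DD>bar)\<close>.\<close>

definition extended_N11 :: "('a, 'v) N1_data \<Rightarrow> ('v \<Rightarrow> 'v) \<Rightarrow> 'v set \<Rightarrow> ('v \<Rightarrow> 'v \<Rightarrow> 'a) \<Rightarrow>
    ('v \<Rightarrow> ('v oper \<times> 'v) list set) \<Rightarrow> ('a, (nat \<Rightarrow> ('v \<times> 'v) list set) set) N11_data" where
  "extended_N11 X J \<E> g nab =
    (let H = completion (tensor_space X J \<E> g) in
     \<lparr>alg = alg X, spc = H,
      rep = (\<lambda>a. ext_op X J \<E> g (rep X a) (op_id (spc X))),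
      grd = ext_op X J \<E> g (grd X) (grd X),
      diff = op_closure H (op_scale H (1/2)
               (op_add H (ext_D X J \<E> g nab) (op_scale H (-\<i>) (ext_D_bar X J \<E> g nab)))),
      hodge = ext_op X J \<E> g (op_id (spc X)) (grd X)\<rparr>)"

definition Kaehler_structures :: "('a, 'v) N1_data \<Rightarrow> ('v \<Rightarrow> 'v) \<Rightarrow>
    ('a, (nat \<Rightarrow> ('v \<times> 'v) list set) set) N22_data set" where
  "Kaehler_structures X J = {K. is_N22_Kaehler_data K \<and>
     (\<exists>\<E> g nab. admissible_extension X J \<E> g nab \<and> is_N11_data (extended_N11 X J \<E> g nab) \<and>
        N11_of_N22 K = extended_N11 X J \<E> g nab)}"

definition inherits_Kaehler_structure :: "('a, 'v) N1_data \<Rightarrow> ('v \<Rightarrow> 'v) \<Rightarrow> bool" where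
  "inherits_Kaehler_structure X J \<longleftrightarrow>
     is_N1_data X \<and> real_structure X J \<and> Kaehler_structures X J \<noteq> {}"

section \<open>The noncommutative torus\<close>

type_synonym 'n multi_index = "(int, 'n) vec"
type_synonym 'n rmatrix = "((real, 'n) vec, 'n) vec"

text \<open>\<open>U\<^sup>m U\<^sup>p = exp (2\<pi>i phase m p) U\<^sup>m\<^sup>+\<^sup>p\<close> for \<open>U\<^sup>m = U\<^sub>1\<^bsup>m\<^sub>1\<^esup> \<cdots> U\<^sub>n\<^bsup>m\<^sub>n\<^esup>\<close>, the factors being
  ordered by the linear order on the index type.\<close>

definition phase :: "'n::{finite, linorder} rmatrix \<Rightarrow> 'n multi_index \<Rightarrow> 'n multi_index \<Rightarrow> real" where
  "phase \<Theta> m p = (\<Sum>j\<in>UNIV. \<Sum>l | l < j. \<Theta> $ l $ j * of_int (m $ j) * of_int (p $ l))"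

definition cocycle :: "'n::{finite, linorder} rmatrix \<Rightarrow> 'n multi_index \<Rightarrow> 'n multi_index \<Rightarrow> complex" where
  "cocycle \<Theta> m p = cis (2 * pi * phase \<Theta> m p)"

definition rapidly_decreasing :: "('n::finite multi_index \<Rightarrow> complex) \<Rightarrow> bool" where
  "rapidly_decreasing a \<longleftrightarrow>
     (\<forall>k::nat. \<exists>C. \<forall>m. (1 + (\<Sum>j\<in>UNIV. real_of_int \<bar>m $ j\<bar>)) ^ k * cmod (a m) \<le> C)"

text \<open>The smooth algebra: the series \<open>\<Sum>\<^sub>m a\<^sub>m U\<^sup>m\<close> is represented by its coefficients \<open>a\<close>.\<close>

definition nc_torus :: "'n::{finite, linorder} rmatrix \<Rightarrow> ('n multi_index \<Rightarrow> complex) star_algebra" where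
  "nc_torus \<Theta> =
     \<lparr>carrier = {a. rapidly_decreasing a},
      mult = (\<lambda>a b m. \<Sum>\<^sub>\<infinity>p. a p * b (m - p) * cocycle \<Theta> p (m - p)),
      one = (\<lambda>m. if m = 0 then 1 else 0),
      zero = (\<lambda>m. 0), add = (\<lambda>a b m. a m + b m),
      smult = (\<lambda>c a m. c * a m),
      star = (\<lambda>a m. cocycle \<Theta> m m * cnj (a (- m)))\<rparr>"

definition torus_gen :: "'n::finite \<Rightarrow> 'n multi_index \<Rightarrow> complex" where
  "torus_gen j m = (if m = axis j 1 then 1 else 0)"

definition torus_trace :: "('n::finite multi_index \<Rightarrow> complex) \<Rightarrow> complex" where
  "torus_trace a = a 0"

lemma infsum_single:
  fixes f :: "'b \<Rightarrow> complex"
  assumes "\<And>x. x \<noteq> y \<Longrightarrow> f x = 0"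
  shows "infsum f UNIV = f y"
proof -
  have "infsum f UNIV = infsum f {y}"
    by (rule infsum_cong_neutral) (use assms in auto)
  then show ?thesis by simp
qed

lemma nc_torus_mult_monomials:
  "(\<lambda>m. if m = p then 1 else 0) \<otimes>\<^bsub>nc_torus \<Theta>\<^esub> (\<lambda>m. if m = q then 1 else 0) =
    (\<lambda>m. if m = p + q then cocycle \<Theta> p q else 0)"
proof
  fix m
  have "(\<Sum>\<^sub>\<infinity>r. (if r = p then 1 else 0) * (if m - r = q then 1 else 0) * cocycle \<Theta> r (m - r)) =
      (if p = p then 1 else 0) * (if m - p = q then 1 else 0) * cocycle \<Theta> p (m - p)"
    by (rule infsum_single) simp
  then show "((\<lambda>m. if m = p then 1 else 0) \<otimes>\<^bsub>nc_torus \<Theta>\<^esub> (\<lambda>m. if m = q then 1 else 0)) m =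
      (if m = p + q then cocycle \<Theta> p q else 0)"
    by (auto simp: nc_torus_def algebra_simps)
qed

lemma phase_axis:
  "phase \<Theta> (axis j 1) (axis l 1) = (if l < j then \<Theta> $ l $ j else 0)"
proof -
  have ax: "real_of_int (axis i 1 $ k) = (if k = i then 1 else 0)" for i k :: 'a
    by (simp add: axis_def)
  have inner: "(\<Sum>k | k < i. \<Theta> $ k $ i * c * (if k = l then 1 else 0)) =
      (if l < i then \<Theta> $ l $ i * c else 0)" for i c
    by (simp add: if_distrib cong: if_cong)
  have "phase \<Theta> (axis j 1) (axis l 1) =
      (\<Sum>i\<in>UNIV. if i = j then (if l < i then \<Theta> $ l $ i else 0) else 0)"
    unfolding phase_def ax inner by (rule sum.cong) auto
  then show ?thesis by simp
qed

lemma torus_gen_commutation: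
  assumes "transpose \<Theta> = - \<Theta>"
  shows "torus_gen j \<otimes>\<^bsub>nc_torus \<Theta>\<^esub> torus_gen l =
    exp (2 * pi * \<i> * \<Theta> $ l $ j) \<odot>\<^bsub>nc_torus \<Theta>\<^esub> (torus_gen l \<otimes>\<^bsub>nc_torus \<Theta>\<^esub> torus_gen j)"
proof -
  have skew: "\<Theta> $ l $ j = - \<Theta> $ j $ l" for j l
    using arg_cong[OF assms, of "\<lambda>M. M $ j $ l"] by (simp add: transpose_def)
  have diag: "\<Theta> $ j $ j = 0" for j using skew[of j j] by simp
  have gen: "torus_gen i = (\<lambda>m. if m = axis i 1 then 1 else 0)" for i :: 'a
    by (auto simp: torus_gen_def)
  have coc: "cocycle \<Theta> (axis j 1) (axis l 1) =
      exp (2 * pi * \<i> * \<Theta> $ l $ j) * cocycle \<Theta> (axis l 1) (axis j 1)"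
  proof -
    have "cocycle \<Theta> (axis j 1) (axis l 1) =
        cis (2 * pi * \<Theta> $ l $ j) * cocycle \<Theta> (axis l 1) (axis j 1)"
      using skew[of l j] diag[of j]
      by (cases l j rule: linorder_cases) (auto simp: cocycle_def phase_axis cis_mult)
    then show ?thesis by (simp add: cis_conv_exp mult_ac)
  qed
  show ?thesis
    unfolding gen nc_torus_mult_monomials
    by (auto simp: fun_eq_iff coc nc_torus_def add.commute)
qed

lemma phase_minus: "phase \<Theta> (- m) p = - phase \<Theta> m p" "phase \<Theta> m (- p) = - phase \<Theta> m p"
  by (simp_all add: phase_def sum_negf)

lemma cocycle_cancel: "cocycle \<Theta> m m * cocycle \<Theta> m (- m) = 1"
  by (simp add: cocycle_def phase_minus cis_mult)

lemma torus_gen_unitary: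
  "star (nc_torus \<Theta>) (torus_gen j) \<otimes>\<^bsub>nc_torus \<Theta>\<^esub> torus_gen j = \<one>\<^bsub>nc_torus \<Theta>\<^esub>"
  "torus_gen j \<otimes>\<^bsub>nc_torus \<Theta>\<^esub> star (nc_torus \<Theta>) (torus_gen j) = \<one>\<^bsub>nc_torus \<Theta>\<^esub>"
proof -
  have gen: "torus_gen j = (\<lambda>m. if m = axis j 1 then 1 else 0)"
    by (auto simp: torus_gen_def)
  have "- m = axis j 1 \<longleftrightarrow> m = - axis j 1" for m :: "'a multi_index"
    by (metis minus_minus)
  then have st: "star (nc_torus \<Theta>) (torus_gen j) = (\<lambda>m. if m = - axis j 1 then 1 else 0)"
    by (auto simp: fun_eq_iff nc_torus_def torus_gen_def cocycle_def phase_minus phase_axis)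
  show "star (nc_torus \<Theta>) (torus_gen j) \<otimes>\<^bsub>nc_torus \<Theta>\<^esub> torus_gen j = \<one>\<^bsub>nc_torus \<Theta>\<^esub>"
    unfolding st unfolding gen nc_torus_mult_monomials
    by (auto simp: fun_eq_iff nc_torus_def cocycle_def phase_minus phase_axis)
  show "torus_gen j \<otimes>\<^bsub>nc_torus \<Theta>\<^esub> star (nc_torus \<Theta>) (torus_gen j) = \<one>\<^bsub>nc_torus \<Theta>\<^esub>"
    unfolding st unfolding gen nc_torus_mult_monomials
    by (auto simp: fun_eq_iff nc_torus_def cocycle_def phase_minus phase_axis)
qed

lemma torus_trace_star_mult:
  "torus_trace (star (nc_torus \<Theta>) a \<otimes>\<^bsub>nc_torus \<Theta>\<^esub> b) = (\<Sum>\<^sub>\<infinity>m. cnj (a m) * b m)"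
proof -
  have "star (nc_torus \<Theta>) a p * b (0 - p) * cocycle \<Theta> p (0 - p) = cnj (a (- p)) * b (- p)" for p
  proof -
    have "star (nc_torus \<Theta>) a p * b (0 - p) * cocycle \<Theta> p (0 - p) =
        (cocycle \<Theta> p p * cocycle \<Theta> p (- p)) * (cnj (a (- p)) * b (- p))"
      by (simp add: nc_torus_def)
    then show ?thesis by (simp only: cocycle_cancel mult_1)
  qed
  then have "torus_trace (star (nc_torus \<Theta>) a \<otimes>\<^bsub>nc_torus \<Theta>\<^esub> b) =
      (\<Sum>\<^sub>\<infinity>p. cnj (a (- p)) * b (- p))"
    by (subst infsum_cong[symmetric]) (auto simp: torus_trace_def nc_torus_def)
  also have "\<dots> = (\<Sum>\<^sub>\<infinity>m. cnj (a m) * b m)"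
    by (rule infsum_reindex_bij_betw[of uminus UNIV UNIV "\<lambda>m. cnj (a m) * b m"])
      (rule bij_uminus)
  finally show ?thesis .
qed

definition hdot :: "complex^'s::finite \<Rightarrow> complex^'s \<Rightarrow> complex" where
  "hdot v w = (\<Sum>i\<in>UNIV. cnj (v $ i) * w $ i)"

text \<open>\<open>L\<^sup>2(A, \<tau>) \<otimes> \<complex>\<^sup>N\<close>, where \<open>\<tau>(a\<^sup>* b) = \<Sum>\<^sub>m cnj (a\<^sub>m) b\<^sub>m\<close>\<close>

definition spinor_space :: "('n::finite multi_index \<Rightarrow> complex^'s::finite) ip_space" where
  "spinor_space =
     \<lparr>carrier = {F. (\<lambda>m. (norm (F m))\<^sup>2) summable_on UNIV}, mult = undefined, one = undefined,
      zero = (\<lambda>m. 0), add = (\<lambda>F G m. F m + G m), smult = (\<lambda>c F m. c *s F m),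
      ip = (\<lambda>F G. \<Sum>\<^sub>\<infinity>m. hdot (F m) (G m))\<rparr>"

text \<open>Left multiplication, tensored with the identity\<close>

definition torus_rep :: "'n::{finite, linorder} rmatrix \<Rightarrow> ('n multi_index \<Rightarrow> complex) \<Rightarrow>
    ('n multi_index \<Rightarrow> complex^'s::finite) oper" where
  "torus_rep \<Theta> a = {(F, \<lambda>m. \<Sum>\<^sub>\<infinity>p. (a p * cocycle \<Theta> p (m - p)) *s F (m - p)) | F.
     F \<in> carrier spinor_space}"

definition fiber_op :: "complex^'s^'s::finite \<Rightarrow> ('n::finite multi_index \<Rightarrow> complex^'s) oper" where
  "fiber_op M = {(F, \<lambda>m. M *v F m) | F. F \<in> carrier spinor_space}"

text \<open>On coefficients \<open>\<partial>\<^sub>j\<close> is multiplication by \<open>i m\<^sub>j\<close>.\<close>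

definition torus_dirac :: "('n::finite \<Rightarrow> complex^'s^'s::finite) \<Rightarrow>
    ('n multi_index \<Rightarrow> complex^'s) oper" where
  "torus_dirac \<gamma> = op_closure spinor_space
     {(F, \<lambda>m. \<Sum>j\<in>UNIV. (\<i> * of_int (m $ j)) *s (\<gamma> j *v F m)) | F.
       \<forall>i. rapidly_decreasing (\<lambda>m. F m $ i)}"

definition torus_J :: "'n::{finite, linorder} rmatrix \<Rightarrow> (complex^'s::finite \<Rightarrow> complex^'s) \<Rightarrow>
    ('n multi_index \<Rightarrow> complex^'s) \<Rightarrow> ('n multi_index \<Rightarrow> complex^'s)" where
  "torus_J \<Theta> J\<^sub>N F = (\<lambda>m. cocycle \<Theta> m m *s J\<^sub>N (F (- m)))"

definition torus_N1 :: "'n::{finite, linorder} rmatrix \<Rightarrow> ('n \<Rightarrow> complex^'s^'s::finite) \<Rightarrow>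
    complex^'s^'s \<Rightarrow> ('n multi_index \<Rightarrow> complex, 'n multi_index \<Rightarrow> complex^'s) N1_data" where
  "torus_N1 \<Theta> \<gamma> \<sigma> = \<lparr>alg = nc_torus \<Theta>, spc = spinor_space, rep = torus_rep \<Theta>,
     grd = fiber_op \<sigma>, dirac = torus_dirac \<gamma>\<rparr>"

definition column_lattice :: "real^'n^'n::finite \<Rightarrow> (real^'n) set" where
  "column_lattice \<Theta> = {\<Sum>j\<in>UNIV. of_int (p j) *s column j \<Theta> | p. True}"

definition integer_lattice :: "(real^'n::finite) set" where
  "integer_lattice = {x. \<forall>i. x $ i \<in> \<int>}"

definition torus_parameter :: "real^'n^'n::finite \<Rightarrow> bool" where
  "torus_parameter \<Theta> \<longleftrightarrow> transpose \<Theta> = - \<Theta> \<and>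
     closure {x + y | x y. x \<in> column_lattice \<Theta> \<and> y \<in> integer_lattice} = UNIV"

subsection \<open>Clifford data\<close>

definition ctranspose :: "complex^'s^'s::finite \<Rightarrow> complex^'s^'s" where
  "ctranspose M = (\<chi> i j. cnj (M $ j $ i))"

text \<open>\<open>(\<epsilon>, \<epsilon>', \<epsilon>'')\<close> in dimension \<open>n\<close>, for even \<open>n\<close>\<close>

definition KO_signs :: "nat \<Rightarrow> complex \<times> complex \<times> complex" where
  "KO_signs n = (if n mod 8 = 0 then (1, 1, 1) else if n mod 8 = 2 then (-1, 1, -1)
     else if n mod 8 = 4 then (-1, 1, 1) else (1, 1, -1))"

definition clifford_rep :: "('n::finite \<Rightarrow> complex^'s^'s::finite) \<Rightarrow> bool" where
  "clifford_rep \<gamma> \<longleftrightarrow>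
     (\<forall>j. ctranspose (\<gamma> j) = - \<gamma> j) \<and>
     (\<forall>j l. \<gamma> j ** \<gamma> l + \<gamma> l ** \<gamma> j = (if j = l then mat (-2) else 0)) \<and>
     (\<forall>S. vec.subspace S \<and> (\<forall>j. \<forall>v\<in>S. \<gamma> j *v v \<in> S) \<longrightarrow> S = {0} \<or> S = UNIV)"

definition clifford_grading :: "('n::finite \<Rightarrow> complex^'s^'s::finite) \<Rightarrow> complex^'s^'s \<Rightarrow> bool" where
  "clifford_grading \<gamma> \<sigma> \<longleftrightarrow>
     ctranspose \<sigma> = \<sigma> \<and> \<sigma> ** \<sigma> = mat 1 \<and> (\<forall>j. \<sigma> ** \<gamma> j = - (\<gamma> j ** \<sigma>))"

definition clifford_conjugation :: "('n::finite \<Rightarrow> complex^'s^'s::finite) \<Rightarrow> complex^'s^'s \<Rightarrow>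
    (complex^'s \<Rightarrow> complex^'s) \<Rightarrow> bool" where
  "clifford_conjugation \<gamma> \<sigma> J\<^sub>N \<longleftrightarrow> (case KO_signs CARD('n) of (\<epsilon>, \<epsilon>', \<epsilon>'') \<Rightarrow>
     surj J\<^sub>N \<and> (\<forall>v w. J\<^sub>N (v + w) = J\<^sub>N v + J\<^sub>N w) \<and> (\<forall>c v. J\<^sub>N (c *s v) = cnj c *s J\<^sub>N v) \<and>
     (\<forall>v w. hdot (J\<^sub>N v) (J\<^sub>N w) = hdot w v) \<and>
     (\<forall>v. J\<^sub>N (J\<^sub>N v) = \<epsilon> *s v) \<and>
     (\<forall>j v. J\<^sub>N (\<gamma> j *v v) = \<epsilon>' *s (\<gamma> j *v J\<^sub>N v)) \<and>
     (\<forall>v. J\<^sub>N (\<sigma> *v v) = \<epsilon>'' *s (\<sigma> *v J\<^sub>N v)))"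

end

theory Submission
  imports Defs
begin

text \<open>
  Coefficients turn every operator of the theorem into an explicit operator on square summable
  functions on the lattice with values in a finite dimensional fibre. On the spinor space the Dirac
  operator is multiplication by the symbol \<open>\<Sum>\<^sub>j i m\<^sub>j \<gamma>\<^sub>j\<close>, the algebra acts by twisted convolution, and
  commuting a symbol that is linear in the momentum past a convolution only differentiates the algebra
  element. Hence all commutators with the algebra are bounded, and all the analytic axioms (closedness,
  self-adjointness, trace class heat operators) are facts about multiplication operators.

  The extension uses the free module \<open>E\<close> of rapidly decreasing spinors, its standard Hermitian structure and
  the flat connection \<open>\<nabla>\<xi> = \<Sum>\<^sub>i d\<xi>\<^sub>i \<otimes> e\<^sub>i\<close>. Multiplying coefficients, \<open>\<xi> \<otimes> \<eta> \<mapsto> (\<xi>\<^sub>i \<eta>\<^sub>k)\<close>, identifies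
  \<open>E \<otimes> E\<close> isometrically with the rapidly decreasing functions with values in the matrices. The completion is
  therefore again a space of square summable functions, now with fibre the matrices, on which Clifford
  elements act on both indices. Because the connection is flat and \<open>J\<close> intertwines the left with the right
  action, the two extended Dirac operators have the symbols \<open>\<Sum>\<^sub>j i m\<^sub>j R\<^sub>j\<close> and \<open>- \<Sum>\<^sub>j i m\<^sub>j L\<^sub>j\<close>, where \<open>R\<^sub>j\<close>
  multiplies the right index by \<open>\<gamma>\<^sub>j\<close> and \<open>L\<^sub>j\<close> the left index by \<open>\<gamma>\<^sub>j\<close> and the right one by \<open>\<sigma>\<close>. These
  are two anticommuting Clifford families, so both Dirac operators have the square \<open>\<bar>m\<bar>\<^sup>2\<close> and anticommute.

  The differential has the symbol \<open>\<Sum>\<^sub>j i m\<^sub>j c\<^sub>j\<close> with \<open>c\<^sub>j = (R\<^sub>j + i L\<^sub>j) / 2\<close>, and the \<open>c\<^sub>j\<close> and their adjoints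
  satisfy the canonical anticommutation relations: the fibre is a Fock space and the differential is that of
  the de Rham complex of a flat torus. A constant orthogonal complex structure on the cotangent space, with
  projection \<open>\<alpha>\<close> onto the holomorphic directions, splits the creation operators and so splits the
  differential into \<open>\<partial>\<close> and \<open>\<partial>bar\<close>; the number operators of the two halves are \<open>T\<close> and \<open>Tbar\<close>. The Kaehler
  axioms reduce to the relations \<open>\<alpha>\<^sup>2 = \<alpha>\<close>, \<open>\<alpha> + \<alpha>\<^sup>T = 1\<close>, \<open>\<alpha>\<^sup>* = \<alpha>\<close>. Every perfect matching of the coordinates
  gives such an \<open>\<alpha>\<close>, rotating each matched pair in the direction given by the order of the indices. The
  symbol of \<open>\<partial>\<close> determines \<open>\<alpha>\<close>, which determines the matching, and there are
  \<open>(n - 1)(n - 3) \<cdots> 1\<close> matchings.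
\<close>

type_synonym ('n, 't) vf = "'n multi_index \<Rightarrow> complex^'t"

type_synonym 'n mi = "'n multi_index"

abbreviation "rd \<equiv> rapidly_decreasing"

section \<open>Absolutely summable families\<close>

lemma norm_summable_summable: "(%x. norm (f x)) summable_on A ==> f summable_on A"
 for f :: "'a => 'b::banach" by (rule abs_summable_summable)

lemma summable_on_le_nonneg:
 fixes f g :: "'a => real"
 assumes "f summable_on A" "!!x. x : A ==> 0 <= g x" "!!x. x : A ==> g x <= f x" shows "g summable_on A"
 using assms by (intro summable_on_comparison_test[OF assms(1)]) auto

lemma norm_summable_le:
 fixes f :: "'a => 'b::real_normed_vector" and g :: "'a => real"
 assumes "g summable_on A" "!!x. x : A ==> norm (f x) <= g x" shows "(%x. norm (f x)) summable_on A"
 using assms by (intro summable_on_le_nonneg[OF assms(1)]) auto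

lemma summable_on_prod_nonneg:
 fixes f :: "'a => real" and g :: "'b => real"
 assumes f: "f summable_on A" "!!x. 0 <= f x" and g: "g summable_on B" "!!x. 0 <= g x"
 shows "(%(x, y). f x * g y) summable_on (A \<times> B)"
proof (rule summable_on_SigmaI)
 show "!!x. x : A ==> ((%y. case (x, y) of (x, y) => f x * g y) has_sum (f x * infsum g B)) B"
  using g by (auto intro!: has_sum_cmult_right)
 show "(%x. f x * infsum g B) summable_on A" by (intro summable_on_cmult_left f)
 show "!!x y. x : A ==> y : B ==> 0 <= (case (x, y) of (x, y) => f x * g y)" using f g by auto
qed

lemma summable_on_finite_sum:
 fixes f :: "'i => 'a => 'b::real_normed_vector"
 assumes "!!i. i : I ==> f i summable_on A" shows "(%x. \<Sum>i\<in>I. f i x) summable_on A"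
  and "(\<Sum>\<^sub>\<infinity>x\<in>A. \<Sum>i\<in>I. f i x) = (\<Sum>i\<in>I. infsum (f i) A)"
proof -
 have "(%x. \<Sum>i\<in>I. f i x) summable_on A & (\<Sum>\<^sub>\<infinity>x\<in>A. \<Sum>i\<in>I. f i x) = (\<Sum>i\<in>I. infsum (f i) A)"
  using assms by (induction I rule: infinite_finite_induct) (auto simp: infsum_add intro: summable_on_add)
 then show "(%x. \<Sum>i\<in>I. f i x) summable_on A"
  and "(\<Sum>\<^sub>\<infinity>x\<in>A. \<Sum>i\<in>I. f i x) = (\<Sum>i\<in>I. infsum (f i) A)" by blast+
qed

lemma summable_on_UNIV_reindex:
 assumes "bij h" shows "(%x. f (h x)) summable_on UNIV \<longleftrightarrow> f summable_on UNIV"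
 using summable_on_reindex_bij_betw[of h UNIV UNIV f] assms by simp

lemma bij_diff_left: "bij (%p. m - p)" for m :: "'g::ab_group_add"
 by (rule bij_betw_byWitness[where f' = "%p. m - p"]) auto

lemma bij_diff_right: "bij (%m. m - p)" for p :: "'g::ab_group_add"
 by (rule bij_betw_byWitness[where f' = "%m. m + p"]) auto

lemma bij_shear: "bij (%(m, p). (p, m - p :: 'g::ab_group_add))"
 by (rule bij_betw_byWitness[where f' = "%(p, q). (p + q, p)"]) auto

lemma convolution_summable:
 fixes f g :: "'g::ab_group_add => real"
 assumes "f summable_on UNIV" "!!x. 0 <= f x" and "g summable_on UNIV" "!!x. 0 <= g x"
 shows "(%(m, p). f p * g (m - p)) summable_on UNIV"
proof -
 have "(%(x, y). f x * g y) summable_on UNIV" using summable_on_prod_nonneg[OF assms] by simp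
 then show ?thesis using summable_on_UNIV_reindex[OF bij_shear, of "%(x, y). f x * g y"]
  by (simp add: case_prod_unfold)
qed

lemma summable_on_Sigma_UNIV:
 fixes f :: "'a \<times> 'b => real"
 assumes "f summable_on UNIV"
 shows "(%x. \<Sum>\<^sub>\<infinity>y. f (x, y)) summable_on UNIV" "(%y. f (x, y)) summable_on UNIV"
proof -
 have f: "f summable_on (UNIV \<times> UNIV)" using assms by simp
 show "(%x. \<Sum>\<^sub>\<infinity>y. f (x, y)) summable_on UNIV"
  using summable_on_Sigma_banach[of "%x y. f (x, y)" UNIV "%_. UNIV"] f by simp
 show "(%y. f (x, y)) summable_on UNIV"
  using summable_on_SigmaD1[of "%x y. f (x, y)" UNIV "%_. UNIV" x] f by simp
qed

lemma summable_on_finite_sum_bound: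
 fixes f :: "'a => real"
 assumes "!!x. 0 <= f x" "!!F. finite F ==> sum f F <= C" shows "f summable_on UNIV" "infsum f UNIV <= C"
proof -
 show "f summable_on UNIV"
  by (rule nonneg_bdd_above_summable_on) (use assms in \<open>auto intro!: bdd_aboveI2[where M = C]\<close>)
 then show "infsum f UNIV <= C" by (rule infsum_le_finite_sums) (use assms in auto)
qed

section \<open>Rapidly decreasing functions on the lattice\<close>

definition wt :: "'n::finite multi_index => real" where
 "wt m = 1 + (\<Sum>j\<in>UNIV. real_of_int \<bar>m $ j\<bar>)"

lemma wt_ge_1: "1 <= wt m" by (simp add: wt_def sum_nonneg)

lemma wt_pos: "0 < wt m" using wt_ge_1[of m] by linarith

lemma wt_power_nonneg: "0 <= wt m ^ k" using wt_pos[of m] by simp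

lemma wt_uminus: "wt (- m) = wt m" by (simp add: wt_def)

lemma abs_component_le_wt: "real_of_int \<bar>m $ j\<bar> <= wt m"
proof -
 have "real_of_int \<bar>m $ j\<bar> <= (\<Sum>j\<in>UNIV. real_of_int \<bar>m $ j\<bar>)"
  by (rule member_le_sum) auto
 then show ?thesis by (simp add: wt_def)
qed

lemma wt_add_le: "wt (p + q) <= wt p * wt q"
proof -
 have "(\<Sum>j\<in>UNIV. real_of_int \<bar>(p + q) $ j\<bar>) \<le>
   (\<Sum>j\<in>UNIV. real_of_int \<bar>p $ j\<bar>) + (\<Sum>j\<in>UNIV. real_of_int \<bar>q $ j\<bar>)"
  unfolding sum.distrib[symmetric] by (rule sum_mono) auto
 moreover have "0 <= (\<Sum>j\<in>UNIV. real_of_int \<bar>p $ j\<bar>) * (\<Sum>j\<in>UNIV. real_of_int \<bar>q $ j\<bar>)"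
  by (intro mult_nonneg_nonneg sum_nonneg) auto
 ultimately show ?thesis unfolding wt_def distrib_left distrib_right by linarith
qed

lemma sum_inverse_squares_int_le:
 "(\<Sum>k\<in>{- int R..int R}. 1 / (1 + real_of_int \<bar>k\<bar>)\<^sup>2) <= 4 - 2 / (real R + 1)"
proof (induction R)
 case (Suc R)
 have "{- int (Suc R)..int (Suc R)} = insert (- int (Suc R)) (insert (int (Suc R)) {- int R..int R})"
  by auto
 then have "(\<Sum>k\<in>{- int (Suc R)..int (Suc R)}. 1 / (1 + real_of_int \<bar>k\<bar>)\<^sup>2) =
   2 / (real R + 2)\<^sup>2 + (\<Sum>k\<in>{- int R..int R}. 1 / (1 + real_of_int \<bar>k\<bar>)\<^sup>2)"
  by (simp add: add_ac)
 also have "... <= 2 / (real R + 2)\<^sup>2 + (4 - 2 / (real R + 1))" using Suc by simp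
 also have "2 / (real R + 2)\<^sup>2 <= 2 / ((real R + 1) * (real R + 2))"
  by (rule divide_left_mono) (auto simp: power2_eq_square)
 also have "2 / ((real R + 1) * (real R + 2)) = 2 / (real R + 1) - 2 / (real R + 2)"
  by (simp add: divide_simps)
 finally show ?case by (simp add: add.commute)
qed simp

lemma summable_inverse_wt_power: "(%m::'n::finite multi_index. 1 / wt m ^ (2 * CARD('n))) summable_on UNIV"
proof -
 let ?h = "%k::int. 1 / (1 + real_of_int \<bar>k\<bar>)\<^sup>2"
 have le: "1 / wt m ^ (2 * CARD('n)) <= (\<Prod>j\<in>UNIV. ?h (m $ j))" for m :: "'n mi"
 proof -
  have "1 / wt m ^ (2 * CARD('n)) = (\<Prod>j\<in>(UNIV::'n set). 1 / (wt m)\<^sup>2)"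
   by (simp add: power_divide power_mult[symmetric])
  also have "... <= (\<Prod>j\<in>UNIV. ?h (m $ j))"
  proof (intro prod_mono conjI divide_left_mono power_mono)
   fix j :: 'n
   have "real_of_int \<bar>m $ j\<bar> <= (\<Sum>j\<in>UNIV. real_of_int \<bar>m $ j\<bar>)"
    by (rule member_le_sum) auto
   then show "1 + real_of_int \<bar>m $ j\<bar> <= wt m" by (simp add: wt_def)
  qed (use wt_pos[of m] in \<open>auto intro!: mult_pos_pos zero_less_power\<close>)
  finally show ?thesis .
 qed
 have "(%m::'n mi. \<Prod>j\<in>UNIV. ?h (m $ j)) summable_on UNIV"
 proof (rule summable_on_finite_sum_bound(1)[where C = "4 ^ CARD('n)"])
  fix F :: "'n mi set" assume F: "finite F"
  obtain R where R: "!!m j. m : F ==> \<bar>m $ j\<bar> <= int R"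
  proof -
   have fin: "finite ((%(m, j). nat \<bar>m $ j\<bar>) ` (F \<times> UNIV))" using F by auto
   have "\<bar>m $ j\<bar> <= int (Max ((%(m, j). nat \<bar>m $ j\<bar>) ` (F \<times> UNIV)))" if "m : F" for m j
   proof -
    have "nat \<bar>m $ j\<bar> <= Max ((%(m, j). nat \<bar>m $ j\<bar>) ` (F \<times> UNIV))"
     by (rule Max_ge[OF fin]) (use that in force)
    then show ?thesis by linarith
   qed
   then show thesis using that by blast
  qed
  let ?B = "PiE (UNIV :: 'n set) (%_. {- int R..int R})"
  have inj: "inj_on vec_nth F" by (auto simp: inj_on_def vec_eq_iff)
  have "(\<Sum>m\<in>F. \<Prod>j\<in>UNIV. ?h (m $ j)) = (\<Sum>f\<in>vec_nth ` F. \<Prod>j\<in>UNIV. ?h (f j))"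
   by (simp add: sum.reindex[OF inj])
  also have "... <= (\<Sum>f\<in>?B. \<Prod>j\<in>UNIV. ?h (f j))"
  proof (rule sum_mono2)
   show "finite ?B" by (intro finite_PiE) auto
   show "vec_nth ` F <= ?B" using R by (auto simp: PiE_iff abs_le_iff) (smt (verit))
  qed (auto intro!: prod_nonneg)
  also have "... = (\<Prod>j\<in>(UNIV::'n set). \<Sum>k\<in>{- int R..int R}. ?h k)"
   by (subst prod_sum_PiE) auto
  also have "... <= (\<Prod>j\<in>(UNIV::'n set). 4)"
  proof (rule prod_mono, intro conjI sum_nonneg)
   have "0 <= 2 / (real R + 1)" by simp
   then show "(\<Sum>k\<in>{- int R..int R}. ?h k) <= 4"
    using sum_inverse_squares_int_le[of R] by linarith
  qed auto
  finally show "(\<Sum>m\<in>F. \<Prod>j\<in>UNIV. ?h (m $ j)) <= 4 ^ CARD('n)" by simp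
 qed (auto intro!: prod_nonneg)
 then show ?thesis by (rule summable_on_le_nonneg) (use le wt_pos in \<open>auto intro: less_imp_le\<close>)
qed

lemma rd_iff_summable:
 "rd a \<longleftrightarrow> (\<forall>k::nat. (%m. wt m ^ k * cmod (a m)) summable_on UNIV)"
 for a :: "'n::finite multi_index => complex"
proof
 assume a: "rd a"
 show "\<forall>k::nat. (%m. wt m ^ k * cmod (a m)) summable_on UNIV"
 proof
  fix k :: nat
  obtain C where C: "!!m. wt m ^ (k + 2 * CARD('n)) * cmod (a m) <= C"
   using a unfolding rapidly_decreasing_def wt_def by blast
  have "(%m::'n mi. C * (1 / wt m ^ (2 * CARD('n)))) summable_on UNIV"
   by (rule summable_on_cmult_right[OF summable_inverse_wt_power])
  then show "(%m. wt m ^ k * cmod (a m)) summable_on UNIV"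
  proof (rule summable_on_le_nonneg)
   fix m :: "'n mi"
   show "0 <= wt m ^ k * cmod (a m)" using wt_pos[of m] by simp
   show "wt m ^ k * cmod (a m) <= C * (1 / wt m ^ (2 * CARD('n)))"
    using C[of m] wt_pos[of m] by (simp add: field_simps power_add)
  qed
 qed
next
 assume s: "\<forall>k::nat. (%m. wt m ^ k * cmod (a m)) summable_on UNIV"
 show "rd a" unfolding rapidly_decreasing_def wt_def[symmetric]
 proof
  fix k :: nat
  have "wt m ^ k * cmod (a m) <= (\<Sum>\<^sub>\<infinity>m. wt m ^ k * cmod (a m))" for m
   using finite_sum_le_infsum[OF s[rule_format, of k], of "{m}"] by (auto simp: wt_power_nonneg)
  then show "\<exists>C. \<forall>m. wt m ^ k * cmod (a m) <= C" by blast
 qed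
qed

lemma rd_norm_summable: "rd a ==> (%m. cmod (a m)) summable_on UNIV"
 unfolding rd_iff_summable by (drule spec[of _ 0]) simp

lemma norm_le_infsum:
 assumes "(%m. norm (a m)) summable_on UNIV" shows "norm (a m) <= (\<Sum>\<^sub>\<infinity>m. norm (a m))"
 using finite_sum_le_infsum[OF assms, of "{m}"] by auto

lemma rd_le_power:
 assumes a: "rd a" and le: "!!m. cmod (b m) <= C * (wt m ^ l * cmod (a m))" shows "rd b"
 unfolding rd_iff_summable
proof
 fix k :: nat
 have "(%m. C * (wt m ^ (k + l) * cmod (a m))) summable_on UNIV"
  using a unfolding rd_iff_summable by (intro summable_on_cmult_right) blast
 then show "(%m. wt m ^ k * cmod (b m)) summable_on UNIV"
 proof (rule summable_on_le_nonneg)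
  fix m show "0 <= wt m ^ k * cmod (b m)" using wt_pos[of m] by simp
  have "wt m ^ k * cmod (b m) <= wt m ^ k * (C * (wt m ^ l * cmod (a m)))"
   using wt_pos[of m] le by (intro mult_left_mono) auto
  then show "wt m ^ k * cmod (b m) <= C * (wt m ^ (k + l) * cmod (a m))" by (simp add: power_add mult_ac)
 qed
qed

lemma rd_0: "rd (%m. 0)" by (simp add: rd_iff_summable)

lemma rd_add:
 assumes "rd a" "rd b" shows "rd (%m. a m + b m)" unfolding rd_iff_summable
proof
 fix k :: nat
 have "(%m. wt m ^ k * cmod (a m) + wt m ^ k * cmod (b m)) summable_on UNIV"
  using assms unfolding rd_iff_summable by (intro summable_on_add) auto
 then show "(%m. wt m ^ k * cmod (a m + b m)) summable_on UNIV" by (rule summable_on_le_nonneg)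
   (auto simp: distrib_left[symmetric] wt_power_nonneg intro!: mult_left_mono norm_triangle_ineq)
qed

lemma rd_cmult: "rd a ==> rd (%m. c * a m)"
 by (rule rd_le_power[where C = "cmod c" and l = 0]) (auto simp: norm_mult)

lemma rd_sum: "(!!i. i : I ==> rd (a i)) ==> rd (%m. \<Sum>i\<in>I. a i m)"
 by (induction I rule: infinite_finite_induct) (auto intro: rd_add simp: rd_0)

lemma rd_single: "rd (%m. if m = p then c else 0)" unfolding rapidly_decreasing_def wt_def[symmetric]
proof
 fix k :: nat
 show "\<exists>C. \<forall>m. wt m ^ k * cmod (if m = p then c else 0) <= C"
  by (intro exI[of _ "wt p ^ k * cmod c"]) (use wt_pos[of p] in auto)
qed

lemma rd_uminus_arg:
 assumes "rd a" shows "rd (%m. a (- m))" unfolding rd_iff_summable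
proof
 fix k :: nat
 have "(%m. wt m ^ k * cmod (a m)) summable_on UNIV" using assms unfolding rd_iff_summable by blast
 then show "(%m. wt m ^ k * cmod (a (- m))) summable_on UNIV"
  using summable_on_UNIV_reindex[OF bij_uminus, of "%m. wt m ^ k * cmod (a m)"] by (simp add: wt_uminus)
qed

lemma rd_unimodular: "rd a ==> (!!m. cmod (b m) = cmod (a m)) ==> rd b"
 by (rule rd_le_power[where C = 1 and l = 0]) auto

section \<open>Twisted convolution\<close>

lemma phase_add: "phase Th (m + p) q = phase Th m q + phase Th p q"
 "phase Th m (p + q) = phase Th m p + phase Th m q" by (simp_all add: phase_def sum.distrib algebra_simps)

lemma cocycle_add: "cocycle Th (m + p) q = cocycle Th m q * cocycle Th p q"
 "cocycle Th m (p + q) = cocycle Th m p * cocycle Th m q"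
 by (simp_all add: cocycle_def phase_add cis_mult algebra_simps)

lemma cocycle_minus: "cocycle Th (- m) q = cnj (cocycle Th m q)" "cocycle Th m (- q) = cnj (cocycle Th m q)"
 by (simp_all add: cocycle_def phase_minus cis_cnj)

lemma norm_cocycle [simp]: "cmod (cocycle Th m p) = 1" by (simp add: cocycle_def)

lemma cocycle_0 [simp]: "cocycle Th 0 m = 1" "cocycle Th m 0 = 1" by (simp_all add: cocycle_def phase_def)

lemma cocycle_cnj_mult [simp]: "cocycle Th m p * cnj (cocycle Th m p) = 1"
 "cnj (cocycle Th m p) * cocycle Th m p = 1" by (simp_all add: complex_norm_square[symmetric] mult.commute)

definition tconv :: "'n::{finite, linorder} rmatrix => ('n mi => complex) =>
  ('n mi => complex) => 'n mi => complex" where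
 "tconv Th a f m = (\<Sum>\<^sub>\<infinity>p. a p * f (m - p) * cocycle Th p (m - p))"

definition tstar :: "'n::{finite, linorder} rmatrix => ('n mi => complex) => 'n mi => complex" where
 "tstar Th a m = cocycle Th m m * cnj (a (- m))"

definition sq_summable :: "('g => complex) => bool" where
 "sq_summable f \<longleftrightarrow> (%m. (cmod (f m))\<^sup>2) summable_on UNIV"

lemma tstar_tstar: "tstar Th (tstar Th a) = a"
 by (simp add: fun_eq_iff tstar_def cocycle_minus mult.assoc[symmetric])

lemma norm_tstar: "cmod (tstar Th a m) = cmod (a (- m))" by (simp add: tstar_def norm_mult)

lemma norm_summable_tstar:
 "(%m. cmod (a m)) summable_on UNIV ==> (%m. cmod (tstar Th a m)) summable_on UNIV"
 using summable_on_UNIV_reindex[OF bij_uminus, of "%m. cmod (a m)"] by (simp add: norm_tstar)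

lemma rd_tstar: "rd a ==> rd (tstar Th a)" by (rule rd_unimodular[OF rd_uminus_arg]) (auto simp: norm_tstar)

lemma norm_summable_bounded_mult:
 fixes a f :: "'g => complex"
 assumes "(%p. cmod (a p)) summable_on UNIV" "!!p. cmod (f p) <= B"
 shows "(%p. cmod (a p) * cmod (f p)) summable_on UNIV"
proof (rule summable_on_le_nonneg)
 show "(%p. cmod (a p) * B) summable_on UNIV" using assms(1) by (rule summable_on_cmult_left)
qed (use assms(2) in \<open>auto intro!: mult_left_mono\<close>)

lemma infsum_pair:
 fixes f :: "'a \<times> 'b => 'c::banach"
 assumes "f summable_on UNIV"
 shows "(\<Sum>\<^sub>\<infinity>x. \<Sum>\<^sub>\<infinity>y. f (x, y)) = infsum f UNIV"
 using infsum_Sigma_banach[of f UNIV "%_. UNIV"] assms by simp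

lemma infsum_UNIV_reindex: "bij h ==> (\<Sum>\<^sub>\<infinity>x. f (h x)) = infsum f UNIV"
 using infsum_reindex_bij_betw[of h UNIV UNIV f] by simp

text \<open>Both iterated sums are sums of one family over pairs, reindexed by a shear. The hypothesis
 covers every bracketing in which two factors are summable and the third is bounded.\<close>

lemma tconv_assoc:
 assumes S: "(%(p, q). cmod (a p) * cmod (b q) * cmod (c (m - p - q))) summable_on UNIV"
 shows "tconv Th (tconv Th a b) c m = tconv Th a (tconv Th b c) m"
proof -
 define T where "T = (%(p, q). a p * b q * c (m - p - q) *
   (cocycle Th p q * cocycle Th p (m - p - q) * cocycle Th q (m - p - q)))"
 have sT: "T summable_on UNIV" by (rule norm_summable_summable, rule norm_summable_le[OF S])
   (auto simp: T_def norm_mult)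
 have sT': "(%(r, p). T (p, r - p)) summable_on UNIV"
  using summable_on_UNIV_reindex[OF bij_shear, of T] sT by (simp add: case_prod_unfold)
 have "tconv Th a (tconv Th b c) m = (\<Sum>\<^sub>\<infinity>p. \<Sum>\<^sub>\<infinity>q. T (p, q))"
  unfolding tconv_def
 proof (rule infsum_cong)
  fix p
  have "cocycle Th p (m - p) = cocycle Th p q * cocycle Th p (m - p - q)" for q
   using cocycle_add(2)[of Th p q "m - p - q"] by simp
  then show "a p * (\<Sum>\<^sub>\<infinity>q. b q * c (m - p - q) * cocycle Th q (m - p - q)) * cocycle Th p (m - p) =
    (\<Sum>\<^sub>\<infinity>q. T (p, q))"
   unfolding infsum_cmult_right'[symmetric] infsum_cmult_left'[symmetric]
   by (intro infsum_cong) (simp add: T_def mult_ac)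
 qed
 also have "... = infsum T UNIV" by (rule infsum_pair[OF sT])
 also have "... = (\<Sum>\<^sub>\<infinity>(r, p). T (p, r - p))"
  using infsum_UNIV_reindex[OF bij_shear, of T] by (simp add: case_prod_unfold)
 also have "... = (\<Sum>\<^sub>\<infinity>r. \<Sum>\<^sub>\<infinity>p. T (p, r - p))"
  using infsum_pair[OF sT'] by simp
 also have "... = tconv Th (tconv Th a b) c m" unfolding tconv_def
 proof (rule infsum_cong)
  fix r
  have "cocycle Th r (m - r) = cocycle Th p (m - r) * cocycle Th (r - p) (m - r)" for p
   using cocycle_add(1)[of Th p "r - p" "m - r"] by simp
  then show "(\<Sum>\<^sub>\<infinity>p. T (p, r - p)) =
    (\<Sum>\<^sub>\<infinity>p. a p * b (r - p) * cocycle Th p (r - p)) * c (m - r) * cocycle Th r (m - r)"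
   unfolding infsum_cmult_left'[symmetric] by (intro infsum_cong) (simp add: T_def mult_ac)
 qed
 finally show ?thesis ..
qed

lemma summable_on_prod_UNIV:
 fixes f g :: "'g => complex"
 assumes "(%p. cmod (f p)) summable_on UNIV" "(%p. cmod (g p)) summable_on UNIV"
 shows "(%(p, q). cmod (f p) * cmod (g q)) summable_on UNIV"
 using summable_on_prod_nonneg[OF assms(1) _ assms(2)] by simp

lemma tconv_assoc_left:
 assumes a: "(%p. cmod (a p)) summable_on UNIV" and b: "(%p. cmod (b p)) summable_on UNIV"
  and c: "!!p. cmod (c p) <= B" shows "tconv Th (tconv Th a b) c = tconv Th a (tconv Th b c)"
proof
 fix m
 have "(%x. case x of (p, q) => cmod (a p) * cmod (b q) * B) summable_on UNIV"
  using summable_on_cmult_left[OF summable_on_prod_UNIV[OF a b], of B] by (simp add: case_prod_unfold)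
 then have "(%(p, q). cmod (a p) * cmod (b q) * cmod (c (m - p - q))) summable_on UNIV"
  by (rule summable_on_le_nonneg) (auto intro!: mult_left_mono c)
 then show "tconv Th (tconv Th a b) c m = tconv Th a (tconv Th b c) m" by (rule tconv_assoc)
qed

lemma tconv_assoc_mid:
 assumes a: "(%p. cmod (a p)) summable_on UNIV" and c: "(%p. cmod (c p)) summable_on UNIV"
  and b: "!!p. cmod (b p) <= B" shows "tconv Th (tconv Th a b) c = tconv Th a (tconv Th b c)"
proof
 fix m :: "'a multi_index"
 have B: "(%x. case x of (p, q) => cmod (a p) * cmod (c q) * B) summable_on UNIV"
  using summable_on_cmult_left[OF summable_on_prod_UNIV[OF a c], of B] by (simp add: case_prod_unfold)
 have bij: "bij (%(p, q). (p, m - p - q))"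
  by (rule bij_betw_byWitness[where f' = "%(p, q). (p, m - p - q)"]) (auto simp: vec_eq_iff)
 have "(%x. case x of (p, q) => cmod (a p) * cmod (c (m - p - q)) * B) summable_on UNIV"
  using B summable_on_UNIV_reindex[OF bij, of "%(p, q). cmod (a p) * cmod (c q) * B"]
  by (simp add: case_prod_unfold)
 then have "(%(p, q). cmod (a p) * cmod (b q) * cmod (c (m - p - q))) summable_on UNIV"
  by (rule summable_on_le_nonneg) (auto intro!: mult_left_mono mult_mono b simp: mult.assoc mult.commute[of "cmod (b _)"])
 then show "tconv Th (tconv Th a b) c m = tconv Th a (tconv Th b c) m" by (rule tconv_assoc)
qed

lemma summable_tconv_term:
 assumes a: "(%p. cmod (a p)) summable_on UNIV" and c: "!!p. cmod (f p) <= B"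
 shows "(%p. cmod (a p * f (m - p) * cocycle Th p (m - p))) summable_on UNIV"
 using norm_summable_bounded_mult[OF a, of "%p. f (m - p)" B] c by (simp add: norm_mult)

lemma norm_tconv_le:
 assumes a: "(%p. cmod (a p)) summable_on UNIV" and c: "!!p. cmod (f p) <= B"
 shows "cmod (tconv Th a f m) <= (\<Sum>\<^sub>\<infinity>p. cmod (a p) * cmod (f (m - p)))"
 unfolding tconv_def using norm_infsum_bound[OF summable_tconv_term[OF a c, where Th = Th and m = m]]
 by (simp add: norm_mult)

lemma rd_tconv:
 assumes a: "rd a" and b: "rd b" shows "rd (tconv Th a b)" unfolding rd_iff_summable
proof
 fix k :: nat
 let ?f = "%a m. wt m ^ k * cmod (a m)"
 have pair: "(%(m, p). ?f a p * ?f b (m - p)) summable_on UNIV"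
  by (rule convolution_summable) (use a b in \<open>auto simp: rd_iff_summable wt_power_nonneg\<close>)
 have "(%m. \<Sum>\<^sub>\<infinity>p. ?f a p * ?f b (m - p)) summable_on UNIV"
  using summable_on_Sigma_UNIV(1)[OF pair] by simp
 then show "(%m. ?f (tconv Th a b) m) summable_on UNIV"
 proof (rule summable_on_le_nonneg)
  fix m
  show "0 <= ?f (tconv Th a b) m" by (simp add: wt_power_nonneg)
  have a1: "(%p. cmod (a p)) summable_on UNIV" and b1: "(%p. cmod (b p)) summable_on UNIV"
   using a b by (auto intro: rd_norm_summable)
  note bb = norm_le_infsum[OF b1]
  have "?f (tconv Th a b) m <= wt m ^ k * (\<Sum>\<^sub>\<infinity>p. cmod (a p) * cmod (b (m - p)))"
   by (intro mult_left_mono norm_tconv_le[OF a1 bb] wt_power_nonneg)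
  also have "... = (\<Sum>\<^sub>\<infinity>p. wt m ^ k * (cmod (a p) * cmod (b (m - p))))"
   by (simp add: infsum_cmult_right')
  also have "... <= (\<Sum>\<^sub>\<infinity>p. ?f a p * ?f b (m - p))"
  proof (rule infsum_mono)
   show "(%p. wt m ^ k * (cmod (a p) * cmod (b (m - p)))) summable_on UNIV"
    by (intro summable_on_cmult_right norm_summable_bounded_mult[OF a1 bb])
   show "(%p. ?f a p * ?f b (m - p)) summable_on UNIV"
    using summable_on_Sigma_UNIV(2)[OF pair, of m] by simp
   fix p
   have "wt m ^ k <= wt p ^ k * wt (m - p) ^ k"
    using power_mono[OF wt_add_le[of p "m - p"], of k] wt_pos[of m] by (simp add: power_mult_distrib)
   then have "wt m ^ k * (cmod (a p) * cmod (b (m - p))) \<le>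
     (wt p ^ k * wt (m - p) ^ k) * (cmod (a p) * cmod (b (m - p)))" by (intro mult_right_mono) auto
   then show "wt m ^ k * (cmod (a p) * cmod (b (m - p))) <= ?f a p * ?f b (m - p)" by (simp add: mult_ac)
  qed
  finally show "?f (tconv Th a b) m <= (\<Sum>\<^sub>\<infinity>p. ?f a p * ?f b (m - p))" .
 qed
qed

lemma tconv_add_left:
 assumes "(%p. cmod (a p)) summable_on UNIV" "(%p. cmod (a' p)) summable_on UNIV"
  and "!!p. cmod (f p) <= B" shows "tconv Th (%p. a p + a' p) f m = tconv Th a f m + tconv Th a' f m"
 unfolding tconv_def distrib_right
 by (rule infsum_add) (rule norm_summable_summable, rule summable_tconv_term, fact, fact)+

lemma tconv_add_right:
 assumes "(%p. cmod (a p)) summable_on UNIV" and "!!p. cmod (f p) <= B" "!!p. cmod (g p) <= B'"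
 shows "tconv Th a (%p. f p + g p) m = tconv Th a f m + tconv Th a g m"
 unfolding tconv_def distrib_left distrib_right
 by (rule infsum_add) (rule norm_summable_summable, rule summable_tconv_term, fact, fact)+

lemma tconv_cmult: "tconv Th (%p. c * a p) f m = c * tconv Th a f m"
 "tconv Th a (%p. c * f p) m = c * tconv Th a f m" unfolding tconv_def infsum_cmult_right'[symmetric]
 by (rule infsum_cong, simp add: mult_ac)+

lemma tconv_0 [simp]: "tconv Th (%_. 0) f m = 0" "tconv Th a (%_. 0) m = 0" by (simp_all add: tconv_def)

lemma tconv_unit: "tconv Th (%m. if m = 0 then 1 else 0) f m = f m"
 "tconv Th f (%m. if m = 0 then 1 else 0) m = f m" unfolding tconv_def
 by (subst infsum_single[where y = 0]; simp) (subst infsum_single[where y = m]; simp)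

lemma infsum_shift_left: "(\<Sum>\<^sub>\<infinity>p. f (m - p)) = infsum f UNIV"
 for m :: "'g::ab_group_add" by (rule infsum_UNIV_reindex[OF bij_diff_left])

lemma tstar_tconv: "tstar Th (tconv Th a b) = tconv Th (tstar Th b) (tstar Th a)"
proof
 fix m
 have "tconv Th (tstar Th b) (tstar Th a) m =
   (\<Sum>\<^sub>\<infinity>p. tstar Th b (m - p) * tstar Th a (m - (m - p)) * cocycle Th (m - p) (m - (m - p)))"
  unfolding tconv_def by (rule infsum_shift_left[where m = m and
    f = "%p. tstar Th b p * tstar Th a (m - p) * cocycle Th p (m - p)", symmetric])
 also have "... = (\<Sum>\<^sub>\<infinity>p. cocycle Th m m * cnj (a (- p) * b (- m - (- p)) * cocycle Th (- p) (- m - (- p))))"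
 proof (rule infsum_cong)
  fix p
  define s where "s = m - p"
  have m: "m = p + s" by (simp add: s_def)
  have "- m - (- p) = - s" "m - p = s" "m - (m - p) = p" by (simp_all add: s_def)
  then show "tstar Th b (m - p) * tstar Th a (m - (m - p)) * cocycle Th (m - p) (m - (m - p)) =
    cocycle Th m m * cnj (a (- p) * b (- m - (- p)) * cocycle Th (- p) (- m - (- p)))"
   by (simp add: tstar_def m cocycle_add cocycle_minus)
 qed
 also have "... = cocycle Th m m * cnj (\<Sum>\<^sub>\<infinity>p. a (- p) * b (- m - (- p)) * cocycle Th (- p) (- m - (- p)))"
  by (simp only: infsum_cmult_right' infsum_cnj)
 also have "... = tstar Th (tconv Th a b) m" unfolding tstar_def tconv_def
  by (subst infsum_UNIV_reindex[OF bij_uminus, of "%p. a p * b (- m - p) * cocycle Th p (- m - p)"]) simp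
 finally show "tstar Th (tconv Th a b) m = tconv Th (tstar Th b) (tstar Th a) m" ..
qed

section \<open>Square summable functions\<close>

lemma sq_summable_bounded:
 assumes "sq_summable f"
 obtains B where "!!p. cmod (f p) <= B"
proof -
 have "cmod (f p) <= sqrt (\<Sum>\<^sub>\<infinity>p. (cmod (f p))\<^sup>2)" for p
 proof (rule real_le_rsqrt)
  show "(cmod (f p))\<^sup>2 <= (\<Sum>\<^sub>\<infinity>p. (cmod (f p))\<^sup>2)"
   using finite_sum_le_infsum[of "%p. (cmod (f p))\<^sup>2" UNIV "{p}"] assms
   by (auto simp: sq_summable_def)
 qed
 then show thesis by (rule that)
qed

lemma rd_sq_summable:
 assumes "rd f" shows "sq_summable f" unfolding sq_summable_def
proof (rule summable_on_le_nonneg)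
 note s = rd_norm_summable[OF assms]
 show "(%m. cmod (f m) * (\<Sum>\<^sub>\<infinity>m. cmod (f m))) summable_on UNIV"
  by (rule summable_on_cmult_left[OF s])
 show "(cmod (f m))\<^sup>2 <= cmod (f m) * (\<Sum>\<^sub>\<infinity>m. cmod (f m))" for m
  using norm_le_infsum[OF s, of m] by (simp add: power2_eq_square mult_left_mono)
qed auto

lemma infsum_Cauchy_Schwarz:
 fixes u v :: "'a => real"
 assumes u: "(%x. (u x)\<^sup>2) summable_on UNIV" "!!x. 0 <= u x"
  and v: "(%x. (v x)\<^sup>2) summable_on UNIV" "!!x. 0 <= v x" shows "(%x. u x * v x) summable_on UNIV"
  "(\<Sum>\<^sub>\<infinity>x. u x * v x) <= sqrt (\<Sum>\<^sub>\<infinity>x. (u x)\<^sup>2) * sqrt (\<Sum>\<^sub>\<infinity>x. (v x)\<^sup>2)"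
proof -
 have le: "(\<Sum>x\<in>F. u x * v x) <= sqrt (\<Sum>\<^sub>\<infinity>x. (u x)\<^sup>2) * sqrt (\<Sum>\<^sub>\<infinity>x. (v x)\<^sup>2)"
  if "finite F" for F
 proof -
  have "(\<Sum>x\<in>F. u x * v x) <= L2_set u F * L2_set v F"
   using L2_set_mult_ineq[of u v F] u(2) v(2) by simp
  also have "... <= sqrt (\<Sum>\<^sub>\<infinity>x. (u x)\<^sup>2) * sqrt (\<Sum>\<^sub>\<infinity>x. (v x)\<^sup>2)"
   unfolding L2_set_def by (intro mult_mono real_sqrt_le_mono finite_sum_le_infsum u v that)
    (auto intro!: infsum_nonneg sum_nonneg)
  finally show ?thesis .
 qed
 show "(%x. u x * v x) summable_on UNIV" by (rule summable_on_finite_sum_bound(1)) (use u v le in auto)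
 show "(\<Sum>\<^sub>\<infinity>x. u x * v x) <= sqrt (\<Sum>\<^sub>\<infinity>x. (u x)\<^sup>2) * sqrt (\<Sum>\<^sub>\<infinity>x. (v x)\<^sup>2)"
  by (rule summable_on_finite_sum_bound(2)) (use u v le in auto)
qed

lemma convolution_infsum:
 fixes f g :: "'g::ab_group_add => real"
 assumes "f summable_on UNIV" "!!x. 0 <= f x" "g summable_on UNIV" "!!x. 0 <= g x"
 shows "(\<Sum>\<^sub>\<infinity>m. \<Sum>\<^sub>\<infinity>p. f p * g (m - p)) = infsum f UNIV * infsum g UNIV"
proof -
 have "(\<Sum>\<^sub>\<infinity>m. \<Sum>\<^sub>\<infinity>p. f p * g (m - p)) = (\<Sum>\<^sub>\<infinity>p. \<Sum>\<^sub>\<infinity>m. f p * g (m - p))"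
  using infsum_swap_banach[of "%m p. f p * g (m - p)" UNIV UNIV] convolution_summable[OF assms] by simp
 also have "... = (\<Sum>\<^sub>\<infinity>p. f p * infsum g UNIV)"
  by (simp only: infsum_cmult_right' infsum_UNIV_reindex[OF bij_diff_right])
 finally show ?thesis by (simp add: infsum_cmult_left')
qed

text \<open>Young's inequality, by the Cauchy-Schwarz inequality for the measure with weights
 \<open>\<bar>a p\<bar>\<close>.\<close>

lemma tconv_sq_summable:
 assumes a: "(%p. cmod (a p)) summable_on UNIV" and f: "sq_summable f" shows "sq_summable (tconv Th a f)"
  and "(\<Sum>\<^sub>\<infinity>m. (cmod (tconv Th a f m))\<^sup>2) <= (\<Sum>\<^sub>\<infinity>p. cmod (a p))\<^sup>2 * (\<Sum>\<^sub>\<infinity>m. (cmod (f m))\<^sup>2)"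
proof -
 let ?A = "\<Sum>\<^sub>\<infinity>p. cmod (a p)"
 let ?s = "%m p. cmod (a p) * (cmod (f (m - p)))\<^sup>2"
 have f2: "(%m. (cmod (f m))\<^sup>2) summable_on UNIV" using f by (simp add: sq_summable_def)
 obtain B where B: "!!p. cmod (f p) <= B" using sq_summable_bounded[OF f] by blast
 have pair: "(%(m, p). ?s m p) summable_on UNIV" by (rule convolution_summable[OF a _ f2]) auto
 have sec: "(%p. ?s m p) summable_on UNIV" for m using summable_on_Sigma_UNIV(2)[OF pair, of m] by simp
 have A0: "0 <= ?A" by (simp add: infsum_nonneg)
 have le: "(cmod (tconv Th a f m))\<^sup>2 <= ?A * (\<Sum>\<^sub>\<infinity>p. ?s m p)" for m
 proof -
  have "cmod (tconv Th a f m) <= (\<Sum>\<^sub>\<infinity>p. cmod (a p) * cmod (f (m - p)))"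
   by (rule norm_tconv_le[OF a B])
  also have "... = (\<Sum>\<^sub>\<infinity>p. sqrt (cmod (a p)) * (sqrt (cmod (a p)) * cmod (f (m - p))))"
   by (simp add: mult.assoc[symmetric])
  also have "... <= sqrt (\<Sum>\<^sub>\<infinity>p. (sqrt (cmod (a p)))\<^sup>2) *
    sqrt (\<Sum>\<^sub>\<infinity>p. (sqrt (cmod (a p)) * cmod (f (m - p)))\<^sup>2)"
   by (rule infsum_Cauchy_Schwarz(2)) (use a sec in \<open>auto simp: power_mult_distrib\<close>)
  also have "... = sqrt (?A * (\<Sum>\<^sub>\<infinity>p. ?s m p))"
   by (simp add: power_mult_distrib real_sqrt_mult)
  finally have "(cmod (tconv Th a f m))\<^sup>2 <= (sqrt (?A * (\<Sum>\<^sub>\<infinity>p. ?s m p)))\<^sup>2"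
   by (rule power_mono) simp
  then show ?thesis using A0 by (simp add: infsum_nonneg)
 qed
 have sum: "(%m. ?A * (\<Sum>\<^sub>\<infinity>p. ?s m p)) summable_on UNIV"
  using summable_on_Sigma_UNIV(1)[OF pair] by (intro summable_on_cmult_right) simp
 show sq: "sq_summable (tconv Th a f)"
  unfolding sq_summable_def by (rule summable_on_le_nonneg[OF sum]) (use le in auto)
 have "(\<Sum>\<^sub>\<infinity>m. (cmod (tconv Th a f m))\<^sup>2) <= (\<Sum>\<^sub>\<infinity>m. ?A * (\<Sum>\<^sub>\<infinity>p. ?s m p))"
  by (rule infsum_mono[OF _ sum]) (use sq le in \<open>auto simp: sq_summable_def\<close>)
 also have "... = ?A * (?A * (\<Sum>\<^sub>\<infinity>m. (cmod (f m))\<^sup>2))"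
  using convolution_infsum[OF a _ f2] by (simp add: infsum_cmult_right')
 finally show "(\<Sum>\<^sub>\<infinity>m. (cmod (tconv Th a f m))\<^sup>2) <= ?A\<^sup>2 * (\<Sum>\<^sub>\<infinity>m. (cmod (f m))\<^sup>2)"
  by (simp add: power2_eq_square mult.assoc)
qed

lemma sq_summable_mult:
 assumes "sq_summable f" "sq_summable g" shows "(%m. cmod (cnj (f m) * g m)) summable_on UNIV"
 using infsum_Cauchy_Schwarz(1)[of "%m. cmod (f m)" "%m. cmod (g m)"] assms
 by (simp add: sq_summable_def norm_mult)

lemma tconv_adjoint:
 assumes a: "(%p. cmod (a p)) summable_on UNIV" and f: "sq_summable f" and g: "sq_summable g"
 shows "(\<Sum>\<^sub>\<infinity>m. cnj (g m) * tconv Th a f m) = (\<Sum>\<^sub>\<infinity>m. cnj (tconv Th (tstar Th a) g m) * f m)"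
proof -
 define T where "T = (%(m, p). cnj (g m) * (a p * f (m - p) * cocycle Th p (m - p)))"
 have f2: "(%m. (cmod (f m))\<^sup>2) summable_on UNIV" and g2: "(%m. (cmod (g m))\<^sup>2) summable_on UNIV"
  using f g by (auto simp: sq_summable_def)
 have "(%(p, m). cmod (a p) * (cmod (g m))\<^sup>2) summable_on UNIV"
  using summable_on_prod_nonneg[OF a _ g2] by simp
 then have s1: "(%(m, p). cmod (a p) * (cmod (g m))\<^sup>2) summable_on UNIV"
  using summable_on_UNIV_reindex[OF bij_swap, of "%(p, m). cmod (a p) * (cmod (g m))\<^sup>2"]
  by (simp add: case_prod_unfold prod.swap_def)
 have s2: "(%(m, p). cmod (a p) * (cmod (f (m - p)))\<^sup>2) summable_on UNIV"
  by (rule convolution_summable[OF a _ f2]) auto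
 have "(%x. (case x of (m, p) => cmod (a p) * (cmod (g m))\<^sup>2) +
   (case x of (m, p) => cmod (a p) * (cmod (f (m - p)))\<^sup>2)) summable_on UNIV"
  by (rule summable_on_add[OF s1 s2])
 then have "(%x. norm (T x)) summable_on UNIV"
 proof (rule norm_summable_le)
  fix x :: "'a multi_index \<times> 'a multi_index"
  obtain m p where x: "x = (m, p)" by (cases x)
  have "cmod (g m) * cmod (f (m - p)) <= (cmod (g m))\<^sup>2 + (cmod (f (m - p)))\<^sup>2"
   using sum_squares_bound[of "cmod (g m)" "cmod (f (m - p))"]
    mult_nonneg_nonneg[OF norm_ge_zero[of "g m"] norm_ge_zero[of "f (m - p)"]] by linarith
  then have "cmod (a p) * (cmod (g m) * cmod (f (m - p))) \<le>
    cmod (a p) * ((cmod (g m))\<^sup>2 + (cmod (f (m - p)))\<^sup>2)" by (rule mult_left_mono) simp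
  then show "norm (T x) <= (case x of (m, p) => cmod (a p) * (cmod (g m))\<^sup>2) +
    (case x of (m, p) => cmod (a p) * (cmod (f (m - p)))\<^sup>2)"
   by (simp add: x T_def norm_mult distrib_left mult_ac)
 qed
 then have sT: "T summable_on UNIV" by (rule norm_summable_summable)
 have bij: "bij (%(q, p). (q - p, - p) :: 'a multi_index \<times> 'a multi_index)"
  by (rule bij_betw_byWitness[where f' = "%(q, p). (q - p, - p)"]) auto
 have sT': "(%(q, p). T (q - p, - p)) summable_on UNIV"
  using summable_on_UNIV_reindex[OF bij, of T] sT by (simp add: case_prod_unfold)
 have "(\<Sum>\<^sub>\<infinity>m. cnj (g m) * tconv Th a f m) = (\<Sum>\<^sub>\<infinity>m. \<Sum>\<^sub>\<infinity>p. T (m, p))"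
  unfolding tconv_def by (simp add: infsum_cmult_right' T_def)
 also have "... = infsum T UNIV" by (rule infsum_pair[OF sT])
 also have "... = (\<Sum>\<^sub>\<infinity>(q, p). T (q - p, - p))"
  using infsum_UNIV_reindex[OF bij, of T] by (simp add: case_prod_unfold)
 also have "... = (\<Sum>\<^sub>\<infinity>q. \<Sum>\<^sub>\<infinity>p. T (q - p, - p))"
  using infsum_pair[OF sT'] by simp
 also have "... = (\<Sum>\<^sub>\<infinity>q. cnj (tconv Th (tstar Th a) g q) * f q)"
 proof (rule infsum_cong)
  fix q
  have "T (q - p, - p) = cnj (tstar Th a p * g (q - p) * cocycle Th p (q - p)) * f q" for p
  proof -
   define r where "r = q - p"
   have q: "q = r + p" by (simp add: r_def)
   show ?thesis by (simp add: T_def tstar_def q cocycle_add cocycle_minus)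
  qed
  then show "(\<Sum>\<^sub>\<infinity>p. T (q - p, - p)) = cnj (tconv Th (tstar Th a) g q) * f q"
   unfolding tconv_def by (simp add: infsum_cmult_left' flip: infsum_cnj)
 qed
 finally show ?thesis .
qed

section \<open>The Hilbert space of square summable vector valued functions\<close>

definition l2 :: "('n::finite multi_index => complex^'t::finite) set" where
 "l2 = {F. (%m. (norm (F m))\<^sup>2) summable_on UNIV}"

definition l2_ip :: "('n::finite multi_index => complex^'t::finite) => (('n,'t) vf) => complex" where
 "l2_ip F G = (\<Sum>\<^sub>\<infinity>m. hdot (F m) (G m))"

definition nl2 :: "('n::finite multi_index => complex^'t::finite) => real" where
 "nl2 F = sqrt (\<Sum>\<^sub>\<infinity>m. (norm (F m))\<^sup>2)"

definition fin_supp :: "('n::finite multi_index => complex^'t::finite) set" where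
 "fin_supp = {F. finite {m. F m ~= 0}}"

definition delta :: "'n::finite multi_index => complex^'t::finite => ('n,'t) vf" where
 "delta m v = (%p. if p = m then v else 0)"

subsection \<open>The Hermitian form on the fibre\<close>

lemma norm_vec_power2: "(norm (v::complex^'t::finite))\<^sup>2 = (\<Sum>i\<in>UNIV. (cmod (v $ i))\<^sup>2)"
 by (simp add: norm_vec_def L2_set_def sum_nonneg)

lemma norm_smult [simp]: "norm (c *s (v::complex^'t::finite)) = cmod c * norm v"
proof (rule power2_eq_imp_eq)
 show "(norm (c *s v))\<^sup>2 = (cmod c * norm v)\<^sup>2"
  by (simp add: norm_vec_power2 norm_mult power_mult_distrib sum_distrib_left)
qed auto

lemma hdot_add: "hdot v (w + w') = hdot v w + hdot v w'" "hdot (v + v') w = hdot v w + hdot v' w"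
 by (simp_all add: hdot_def distrib_left distrib_right sum.distrib)

lemma hdot_smult: "hdot v (c *s w) = c * hdot v w" "hdot (c *s v) w = cnj c * hdot v w"
 by (simp_all add: hdot_def sum_distrib_left mult_ac)

lemma hdot_zero [simp]: "hdot v 0 = 0" "hdot 0 v = 0" by (simp_all add: hdot_def)

lemma hdot_minus: "hdot v (- w) = - hdot v w" "hdot (- v) w = - hdot v w"
 by (simp_all add: hdot_def sum_negf)

lemma hdot_diff: "hdot v (w - w') = hdot v w - hdot v w'" "hdot (v - v') w = hdot v w - hdot v' w"
 by (simp_all add: hdot_def algebra_simps sum_subtractf)

lemma hdot_sum: "hdot v (\<Sum>i\<in>I. f i) = (\<Sum>i\<in>I. hdot v (f i))"
 "hdot (\<Sum>i\<in>I. f i) v = (\<Sum>i\<in>I. hdot (f i) v)"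
 by (induction I rule: infinite_finite_induct) (auto simp: hdot_add)

lemma hdot_cnj: "cnj (hdot v w) = hdot w v" by (simp add: hdot_def mult.commute)

lemma hdot_self: "hdot v v = of_real ((norm v)\<^sup>2)"
 by (simp add: hdot_def norm_vec_power2 complex_norm_square mult.commute del: of_real_power)

lemma norm_hdot_le: "cmod (hdot v w) <= norm v * norm w"
proof -
 have "cmod (hdot v w) <= (\<Sum>i\<in>UNIV. \<bar>cmod (v $ i)\<bar> * \<bar>cmod (w $ i)\<bar>)"
  unfolding hdot_def by (rule norm_sum[THEN order_trans]) (simp add: norm_mult)
 also have "... <= norm v * norm w" unfolding norm_vec_def by (rule L2_set_mult_ineq)
 finally show ?thesis .
qed

lemma hdot_axis: "hdot (axis i 1) v = v $ i" "hdot v (axis i 1) = cnj (v $ i)"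
proof -
 have "(if k = i then 1 else (0::complex)) * x = (if k = i then x else 0)"
  "x * (if k = i then 1 else (0::complex)) = (if k = i then x else 0)" for k x by auto
 then show "hdot (axis i 1) v = v $ i" "hdot v (axis i 1) = cnj (v $ i)"
  by (simp_all add: hdot_def axis_def if_distrib[of cnj] cong: if_cong)
qed

lemma hdot_eqI: "(!!w. hdot v w = hdot v' w) ==> v = v'"
 by (simp add: vec_eq_iff) (metis complex_cnj_cancel_iff hdot_axis(2))

subsection \<open>Norm and inner product\<close>

lemma l2_iff_components: "F : l2 \<longleftrightarrow> (\<forall>i. sq_summable (%m. F m $ i))"
proof
 assume F: "F : l2"
 show "\<forall>i. sq_summable (%m. F m $ i)"
 proof
  fix i show "sq_summable (%m. F m $ i)" unfolding sq_summable_def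
  proof (rule summable_on_le_nonneg)
   show "(%m. (norm (F m))\<^sup>2) summable_on UNIV" using F by (simp add: l2_def)
   show "(cmod (F m $ i))\<^sup>2 <= (norm (F m))\<^sup>2" for m
    by (rule power_mono[OF Finite_Cartesian_Product.norm_nth_le]) simp
  qed simp
 qed
next
 assume "\<forall>i. sq_summable (%m. F m $ i)"
 then show "F : l2" by (simp add: l2_def norm_vec_power2 sq_summable_def summable_on_finite_sum(1))
qed

lemma l2_power2_norm: "F : l2 ==> (nl2 F)\<^sup>2 = (\<Sum>i\<in>UNIV. \<Sum>\<^sub>\<infinity>m. (cmod (F m $ i))\<^sup>2)"
 by (simp add: nl2_def infsum_nonneg norm_vec_power2 l2_iff_components sq_summable_def
   summable_on_finite_sum(2) sum_nonneg)

lemma nl2_nonneg [simp]: "0 <= nl2 F" by (simp add: nl2_def infsum_nonneg)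

lemma l2_power2: "(nl2 F)\<^sup>2 = (\<Sum>\<^sub>\<infinity>m. (norm (F m))\<^sup>2)"
 by (simp add: nl2_def infsum_nonneg)

lemma l2_summable: "F : l2 ==> (%m. (norm (F m))\<^sup>2) summable_on UNIV" by (simp add: l2_def)

lemma l2_le:
 assumes "F : l2" "!!m. norm (G m) <= C * norm (F m)" shows "G : l2" unfolding l2_def mem_Collect_eq
proof (rule summable_on_le_nonneg)
 show "(%m. C\<^sup>2 * (norm (F m))\<^sup>2) summable_on UNIV"
  using assms(1) by (intro summable_on_cmult_right l2_summable)
 show "(norm (G m))\<^sup>2 <= C\<^sup>2 * (norm (F m))\<^sup>2" for m
  using power_mono[OF assms(2)[of m], of 2] by (simp add: power_mult_distrib)
qed simp

lemma nl2_le: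
 assumes "F : l2" "!!m. norm (G m) <= C * norm (F m)" "0 <= C" shows "nl2 G <= C * nl2 F"
proof -
 have "(\<Sum>\<^sub>\<infinity>m. (norm (G m))\<^sup>2) <= (\<Sum>\<^sub>\<infinity>m. C\<^sup>2 * (norm (F m))\<^sup>2)"
 proof (rule infsum_mono)
  show "(%m. C\<^sup>2 * (norm (F m))\<^sup>2) summable_on UNIV"
   using assms(1) by (intro summable_on_cmult_right l2_summable)
  show "(%m. (norm (G m))\<^sup>2) summable_on UNIV" by (rule l2_summable[OF l2_le[OF assms(1,2)]])
  show "(norm (G m))\<^sup>2 <= C\<^sup>2 * (norm (F m))\<^sup>2" for m
   using power_mono[OF assms(2)[of m], of 2] by (simp add: power_mult_distrib)
 qed
 then have "sqrt (\<Sum>\<^sub>\<infinity>m. (norm (G m))\<^sup>2) <= sqrt (C\<^sup>2 * (\<Sum>\<^sub>\<infinity>m. (norm (F m))\<^sup>2))"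
  by (simp add: infsum_cmult_right')
 then show ?thesis using assms(3) by (simp add: nl2_def real_sqrt_mult)
qed

lemma l2_ip_summable:
 assumes "F : l2" "G : l2" shows "(%m. cmod (hdot (F m) (G m))) summable_on UNIV"
proof (rule norm_summable_le)
 show "(%m. norm (F m) * norm (G m)) summable_on UNIV"
  using assms by (intro infsum_Cauchy_Schwarz(1)) (auto simp: l2_def)
qed (rule norm_hdot_le)

lemma l2_Cauchy_Schwarz:
 assumes "F : l2" "G : l2" shows "cmod (l2_ip F G) <= nl2 F * nl2 G"
proof -
 have "cmod (l2_ip F G) <= (\<Sum>\<^sub>\<infinity>m. cmod (hdot (F m) (G m)))"
  unfolding l2_ip_def by (rule norm_infsum_bound[OF l2_ip_summable[OF assms]])
 also have "... <= (\<Sum>\<^sub>\<infinity>m. norm (F m) * norm (G m))"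
  using assms by (intro infsum_mono l2_ip_summable norm_hdot_le infsum_Cauchy_Schwarz(1)) (auto simp: l2_def)
 also have "... <= nl2 F * nl2 G"
  unfolding nl2_def using assms by (intro infsum_Cauchy_Schwarz(2)) (auto simp: l2_def)
 finally show ?thesis .
qed

lemma l2_zero [simp]: "(%_. 0) : l2" by (simp add: l2_def)

lemma l2_smult [simp]: "F : l2 ==> (%m. c *s F m) : l2" by (erule l2_le[where C = "cmod c"]) simp

lemma l2_add [simp]:
 assumes "F : l2" "G : l2" shows "(%m. F m + G m) : l2" unfolding l2_def mem_Collect_eq
proof (rule summable_on_le_nonneg)
 show "(%m. 2 * (norm (F m))\<^sup>2 + 2 * (norm (G m))\<^sup>2) summable_on UNIV"
  using assms by (intro summable_on_add summable_on_cmult_right l2_summable)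
 show "(norm (F m + G m))\<^sup>2 <= 2 * (norm (F m))\<^sup>2 + 2 * (norm (G m))\<^sup>2" for m
 proof -
  have "(norm (F m + G m))\<^sup>2 <= (norm (F m) + norm (G m))\<^sup>2"
   by (rule power_mono[OF norm_triangle_ineq]) simp
  also have "... <= 2 * (norm (F m))\<^sup>2 + 2 * (norm (G m))\<^sup>2"
   using sum_squares_bound[of "norm (F m)" "norm (G m)"] by (simp add: power2_sum)
  finally show ?thesis .
 qed
qed simp

lemma l2_uminus [simp]: "F : l2 ==> (%m. - F m) : l2" by (erule l2_le[where C = 1]) simp

lemma l2_diff [simp]: "F : l2 ==> G : l2 ==> (%m. F m - G m) : l2" using l2_add[of F "%m. - G m"] by simp

lemma l2_sum [simp]: "(!!i. i : I ==> F i : l2) ==> (%m. \<Sum>i\<in>I. F i m) : l2"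
 by (induction I rule: infinite_finite_induct) auto

lemma l2_uminus_arg: "F : l2 ==> (%m. F (- m)) : l2"
 using summable_on_UNIV_reindex[OF bij_uminus, of "%m. (norm (F m))\<^sup>2"] by (simp add: l2_def)

lemma l2_ip_add:
 assumes "F : l2" "G : l2" "H : l2" shows "l2_ip H (%m. F m + G m) = l2_ip H F + l2_ip H G"
  "l2_ip (%m. F m + G m) H = l2_ip F H + l2_ip G H" unfolding l2_ip_def hdot_add
 by (rule infsum_add; rule norm_summable_summable[OF l2_ip_summable]; fact)+

lemma l2_ip_smult: "l2_ip F (%m. c *s G m) = c * l2_ip F G" "l2_ip (%m. c *s F m) G = cnj c * l2_ip F G"
 by (simp_all add: l2_ip_def hdot_smult infsum_cmult_right')

lemma l2_ip_zero [simp]: "l2_ip F (%_. 0) = 0" "l2_ip (%_. 0) F = 0" by (simp_all add: l2_ip_def)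

lemma l2_ip_cnj: "cnj (l2_ip F G) = l2_ip G F"
 unfolding l2_ip_def infsum_cnj[symmetric] hdot_cnj by (rule refl)

lemma infsum_of_real_complex: "(\<Sum>\<^sub>\<infinity>x\<in>A. complex_of_real (f x)) = of_real (infsum f A)"
proof (cases "f summable_on A")
 case True
 then show ?thesis by (intro infsumI has_sum_of_real has_sum_infsum)
next
 case False
 have "\<not> (%x. complex_of_real (f x)) summable_on A"
  using summable_on_Re[of "%x. complex_of_real (f x)" A] False by auto
 then show ?thesis using False by (simp add: infsum_not_exists)
qed

lemma l2_ip_self: "l2_ip F F = of_real ((nl2 F)\<^sup>2)"
 unfolding l2_ip_def l2_power2 hdot_self by (rule infsum_of_real_complex)

lemma nl2_triangle:
 assumes "F : l2" "G : l2" shows "nl2 (%m. F m + G m) <= nl2 F + nl2 G"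
proof (rule power2_le_imp_le)
 have "l2_ip (%m. F m + G m) (%m. F m + G m) = l2_ip F F + l2_ip F G + (l2_ip G F + l2_ip G G)"
  using l2_ip_add(2)[OF assms l2_add[OF assms]] l2_ip_add(1)[OF assms assms(1)]
   l2_ip_add(1)[OF assms assms(2)] by simp
 then have "Re (complex_of_real ((nl2 (%m. F m + G m))\<^sup>2)) =
   Re (l2_ip F F + l2_ip F G + (l2_ip G F + l2_ip G G))" unfolding l2_ip_self by (rule arg_cong)
 then have "(nl2 (%m. F m + G m))\<^sup>2 = Re (l2_ip F F + l2_ip F G + (l2_ip G F + l2_ip G G))"
  by (simp only: Re_complex_of_real)
 also have "... <= (nl2 F)\<^sup>2 + nl2 F * nl2 G + (nl2 G * nl2 F + (nl2 G)\<^sup>2)"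
  using order_trans[OF complex_Re_le_cmod l2_Cauchy_Schwarz[OF assms]]
   order_trans[OF complex_Re_le_cmod l2_Cauchy_Schwarz[OF assms(2,1)]]
  unfolding l2_ip_self plus_complex.sel Re_complex_of_real by linarith
 also have "... = (nl2 F + nl2 G)\<^sup>2" by (simp only: power2_sum) simp
 finally show "(nl2 (%m. F m + G m))\<^sup>2 <= (nl2 F + nl2 G)\<^sup>2" .
qed (intro add_nonneg_nonneg nl2_nonneg)

lemma nl2_minus_commute: "nl2 (%m. F m - G m) = nl2 (%m. G m - F m)"
 by (simp add: nl2_def norm_minus_commute)

lemma nl2_triangle_diff:
 assumes "F : l2" "G : l2" "H : l2"
 shows "nl2 (%m. F m - G m) <= nl2 (%m. F m - H m) + nl2 (%m. H m - G m)"
 using nl2_triangle[of "%m. F m - H m" "%m. H m - G m"] assms by simp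

lemma norm_le_nl2:
 assumes "F : l2" shows "norm (F m) <= nl2 F"
proof (rule power2_le_imp_le)
 show "(norm (F m))\<^sup>2 <= (nl2 F)\<^sup>2"
  unfolding l2_power2 using finite_sum_le_infsum[OF l2_summable[OF assms], of "{m}"] by simp
qed simp

lemma nl2_eq_0: "F : l2 ==> nl2 F = 0 ==> F = (%_. 0)" using norm_le_nl2[of F] by fastforce

lemma nl2_zero [simp]: "nl2 (%_. 0) = 0" by (simp add: nl2_def)

lemma l2_bounded_components:
 assumes "F : l2" shows "cmod (F m $ i) <= nl2 F"
 using Finite_Cartesian_Product.norm_nth_le[of "F m" i] norm_le_nl2[OF assms, of m] by linarith

subsection \<open>Finitely supported functions\<close>

lemma fin_supp_l2: "fin_supp <= l2"
proof
 fix F :: "'a multi_index => complex^'b" assume "F : fin_supp"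
 then have "finite {m. F m ~= 0}" by (simp add: fin_supp_def)
 then have "(%m. (norm (F m))\<^sup>2) summable_on {m. F m ~= 0}" by simp
 also have "?this \<longleftrightarrow> (%m. (norm (F m))\<^sup>2) summable_on UNIV"
  by (rule summable_on_cong_neutral) auto
 finally show "F : l2" by (simp add: l2_def)
qed

lemma delta_fin_supp: "delta m v : fin_supp"
 by (rule CollectI[THEN fin_supp_def[THEN equalityD2, THEN subsetD]])
  (rule finite_subset[of _ "{m}"], auto simp: delta_def)

lemma delta_l2 [simp]: "delta m v : l2" using delta_fin_supp fin_supp_l2 by blast

lemma l2_ip_delta: "l2_ip F (delta m v) = hdot (F m) v" "l2_ip (delta m v) F = hdot v (F m)"
 unfolding l2_ip_def delta_def by (subst infsum_single[where y = m]; simp)+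

lemma l2_eq_by_fin_supp:
 assumes "!!H. H : fin_supp ==> l2_ip F H = l2_ip G H" shows "F = G"
proof
 fix m show "F m = G m"
  by (rule hdot_eqI) (use assms[OF delta_fin_supp, of m] in \<open>simp add: l2_ip_delta\<close>)
qed

definition lbox :: "nat => 'n::finite multi_index set" where
 "lbox R = {m. \<forall>j. \<bar>m $ j\<bar> <= int R}"

definition trunc :: "nat => ('n::finite multi_index => complex^'t::finite) => ('n,'t) vf" where
 "trunc R F m = (if m : lbox R then F m else 0)"

lemma finite_lbox: "finite (lbox R)"
proof (rule finite_imageD[of vec_nth])
 show "finite (vec_nth ` lbox R)" by (rule finite_subset[of _ "PiE UNIV (%_. {- int R..int R})"])
   (auto simp: lbox_def abs_le_iff minus_le_iff intro!: finite_PiE)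
qed (auto simp: inj_on_def vec_eq_iff)

lemma trunc_fin_supp: "trunc R F : fin_supp" unfolding fin_supp_def mem_Collect_eq
 by (rule finite_subset[OF _ finite_lbox[of R]]) (auto simp: trunc_def)

lemma finite_subset_lbox:
 assumes "finite A" shows "\<exists>R. \<forall>n\<ge>R. A <= lbox n" using assms
proof (induction A)
 case (insert m A)
 then obtain R where R: "\<forall>n\<ge>R. A <= lbox n" by blast
 let ?k = "Max (range (%j. nat \<bar>m $ j\<bar>))"
 have k: "nat \<bar>m $ j\<bar> <= ?k" for j by (rule Max_ge) auto
 have "m : lbox n" if "n \<ge> ?k" for n
  unfolding lbox_def using order_trans[OF k that] by (simp add: nat_le_iff)
 then have "\<forall>n\<ge>max R ?k. insert m A <= lbox n" using R by auto
 then show ?case by blast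
qed simp

lemma filterlim_lbox: "filterlim lbox (finite_subsets_at_top UNIV) sequentially"
 unfolding filterlim_finite_subsets_at_top
proof (intro allI impI)
 fix A :: "'a multi_index set" assume "finite A & A <= UNIV"
 then obtain R where "\<forall>n\<ge>R. A <= lbox n" using finite_subset_lbox by blast
 then show "\<forall>\<^sub>F n in sequentially. finite (lbox n) & A <= lbox n & lbox n <= UNIV"
  unfolding eventually_sequentially by (intro exI[of _ R]) (simp add: finite_lbox)
qed

lemma trunc_tendsto:
 assumes "F : l2" shows "(%R. nl2 (%m. F m - trunc R F m)) \<longlonglongrightarrow> 0"
proof -
 let ?f = "%m. (norm (F m))\<^sup>2"
 have s: "?f summable_on UNIV" using assms by (simp add: l2_def)
 have "(%R. \<Sum>m\<in>lbox R. ?f m) \<longlonglongrightarrow> infsum ?f UNIV"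
  using filterlim_compose[OF infsum_tendsto[OF s] filterlim_lbox] .
 then have "(%R. sqrt (infsum ?f UNIV - (\<Sum>m\<in>lbox R. ?f m))) \<longlonglongrightarrow> sqrt (infsum ?f UNIV - infsum ?f UNIV)"
  by (intro tendsto_intros)
 moreover have "nl2 (%m. F m - trunc R F m) = sqrt (infsum ?f UNIV - (\<Sum>m\<in>lbox R. ?f m))" for R
 proof -
  have "(\<Sum>\<^sub>\<infinity>m. (norm (F m - trunc R F m))\<^sup>2) = infsum ?f (UNIV - lbox R)"
   by (rule infsum_cong_neutral) (auto simp: trunc_def)
  also have "... = infsum ?f UNIV - infsum ?f (lbox R)"
   by (rule infsum_Diff[OF s]) (simp_all add: finite_lbox)
  finally show ?thesis by (simp add: nl2_def finite_lbox)
 qed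
 ultimately show ?thesis by simp
qed

subsection \<open>Completeness\<close>

lemma l2_complete:
 fixes s :: "nat => 'n::finite multi_index => complex^'t::finite"
 assumes s: "!!n. s n : l2"
  and c: "!!e. e > 0 ==> \<exists>M. \<forall>m\<ge>M. \<forall>n\<ge>M. nl2 (%k. s m k - s n k) < e"
 shows "\<exists>F\<in>l2. (%n. nl2 (%k. s n k - F k)) \<longlonglongrightarrow> 0"
proof -
 have "Cauchy (%n. s n k)" for k unfolding Cauchy_def
 proof (intro allI impI)
  fix e :: real assume "e > 0"
  then obtain M where M: "\<forall>m\<ge>M. \<forall>n\<ge>M. nl2 (%k. s m k - s n k) < e" using c by blast
  have "dist (s m k) (s n k) < e" if "m \<ge> M" "n \<ge> M" for m n
   using norm_le_nl2[of "%k. s m k - s n k" k] M that s by (force simp: dist_norm intro: le_less_trans)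
  then show "\<exists>M. \<forall>m\<ge>M. \<forall>n\<ge>M. dist (s m k) (s n k) < e" by blast
 qed
 then have "\<forall>k. \<exists>l. (%n. s n k) \<longlonglongrightarrow> l"
  by (simp add: Cauchy_convergent_iff convergent_def)
 then obtain F where F: "!!k. (%n. s n k) \<longlonglongrightarrow> F k" by metis
 have tail: "\<exists>M. \<forall>n\<ge>M. (%k. s n k - F k) : l2 & nl2 (%k. s n k - F k) <= e" if "e > 0" for e
 proof -
  obtain M where M: "\<forall>m\<ge>M. \<forall>n\<ge>M. nl2 (%k. s m k - s n k) < e" using c \<open>e > 0\<close> by blast
  have "(%k. s n k - F k) : l2 & nl2 (%k. s n k - F k) <= e" if n: "n \<ge> M" for n
  proof -
   have fin: "(\<Sum>k\<in>A. (norm (s n k - F k))\<^sup>2) <= e\<^sup>2" if "finite A" for A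
   proof (rule tendsto_upperbound)
    show "(%m. \<Sum>k\<in>A. (norm (s n k - s m k))\<^sup>2) \<longlonglongrightarrow> (\<Sum>k\<in>A. (norm (s n k - F k))\<^sup>2)"
     by (intro tendsto_intros F)
    have "(\<Sum>k\<in>A. (norm (s n k - s m k))\<^sup>2) <= e\<^sup>2" if "m \<ge> M" for m
    proof -
     have "(\<Sum>k\<in>A. (norm (s n k - s m k))\<^sup>2) <= (nl2 (%k. s n k - s m k))\<^sup>2"
      unfolding l2_power2 by (intro finite_sum_le_infsum l2_summable l2_diff s \<open>finite A\<close>) auto
     also have "... <= e\<^sup>2" using M n that by (intro power_mono) (auto intro: less_imp_le)
     finally show ?thesis .
    qed
    then show "\<forall>\<^sub>F m in sequentially. (\<Sum>k\<in>A. (norm (s n k - s m k))\<^sup>2) <= e\<^sup>2"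
     by (auto simp: eventually_sequentially)
   qed simp
   have "(%k. s n k - F k) : l2"
    unfolding l2_def mem_Collect_eq by (rule summable_on_finite_sum_bound(1)[OF _ fin]) auto
   moreover have "(nl2 (%k. s n k - F k))\<^sup>2 <= e\<^sup>2"
    unfolding l2_power2 by (rule summable_on_finite_sum_bound(2)[OF _ fin]) auto
   then have "nl2 (%k. s n k - F k) <= e" using \<open>e > 0\<close> by (rule power2_le_imp_le[OF _ less_imp_le])
   ultimately show ?thesis by simp
  qed
  then show ?thesis by blast
 qed
 obtain M where "(%k. s M k - F k) : l2" using tail[of 1] by auto
 then have "(%k. s M k - (s M k - F k)) : l2" by (rule l2_diff[OF s])
 then have "F : l2" by simp
 moreover have "(%n. nl2 (%k. s n k - F k)) \<longlonglongrightarrow> 0"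
 proof (rule LIMSEQ_I)
  fix r :: real assume "r > 0"
  then obtain M where "\<forall>n\<ge>M. nl2 (%k. s n k - F k) <= r / 2" using tail[of "r / 2"] by auto
  then show "\<exists>M. \<forall>n\<ge>M. norm (nl2 (%k. s n k - F k) - 0) < r"
   using \<open>r > 0\<close> by (intro exI[of _ M]) fastforce
 qed
 ultimately show ?thesis by blast
qed

lemma l2_limit_pointwise:
 assumes "!!n. s n : l2" "F : l2" "(%n. nl2 (%k. s n k - F k)) \<longlonglongrightarrow> 0"
 shows "(%n. s n m) \<longlonglongrightarrow> F m"
proof -
 have "(%n. norm (s n m - F m)) \<longlonglongrightarrow> 0"
  by (rule tendsto_sandwich[OF _ _ tendsto_const assms(3)])
   (use assms norm_le_nl2[OF l2_diff[OF assms(1,2)]] in auto)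
 then show ?thesis by (simp add: LIM_zero_iff tendsto_norm_zero_iff)
qed

lemma countable_multi_index: "countable (UNIV :: 'n::finite multi_index set)"
proof -
 have "countable {m\<in>UNIV::'n mi set. 1 / wt m ^ (2 * CARD('n)) ~= 0}"
  using summable_countable_real[OF summable_inverse_wt_power] .
 then show ?thesis using wt_pos by (simp add: less_imp_neq[symmetric])
qed

lemma l2_countable_dense:
 "\<exists>S :: ('n::finite multi_index => complex^'t::finite) set. countable S & S <= l2 \<and>
  (\<forall>F\<in>l2. \<forall>e>0. \<exists>G\<in>S. nl2 (%m. G m - F m) < e)"
proof -
 obtain D :: "(complex^'t) set" where D: "countable D"
  and dense: "!!X. open X ==> X ~= {} ==> \<exists>d\<in>D. d : X" using countable_dense_exists by blast
 define F where "F = (%xs::('n mi \<times> (complex^'t)) list. %m. case map_of xs m of None => 0 | Some d => d)"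
 let ?S = "F ` lists (UNIV \<times> D)"
 have "countable (lists (UNIV \<times> D) :: ('n mi \<times> (complex^'t)) list set)"
  by (intro countable_lists countable_SIGMA countable_multi_index D)
 then have c: "countable ?S" by simp
 have Sl: "?S <= l2"
 proof -
  have "finite {m. F xs m ~= 0}" for xs by (rule finite_subset[of _ "fst ` set xs"])
    (auto simp: F_def split: option.splits dest!: map_of_SomeD intro: rev_image_eqI)
  then show ?thesis using fin_supp_l2 by (auto simp: fin_supp_def)
 qed
 have d: "\<exists>G\<in>?S. nl2 (%m. G m - H m) < e" if H: "H : l2" and e: "e > 0" for H e
 proof -
  have "eventually (%R. nl2 (%m. H m - trunc R H m) < e / 2) sequentially"
   using order_tendstoD(2)[OF trunc_tendsto[OF H], of "e / 2"] e by simp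
  then obtain R where R: "nl2 (%m. H m - trunc R H m) < e / 2" by (auto simp: eventually_sequentially)
  define N where "N = real (card (lbox R :: 'n mi set)) + 1"
  have N: "N > 0" by (simp add: N_def)
  have "\<exists>d\<in>D. dist (H m) d < e / (2 * N)" for m
  proof -
   have "H m : ball (H m) (e / (2 * N))" using e N by simp
   then show ?thesis using dense[of "ball (H m) (e / (2 * N))"] by auto
  qed
  then obtain d where d: "!!m. d m : D" "!!m. norm (d m - H m) < e / (2 * N)"
   by (metis dist_norm dist_commute)
  obtain ms :: "'n mi list" where ms: "set ms = lbox R" using finite_list[OF finite_lbox] by blast
  define xs where "xs = map (%m. (m, d m)) ms"
  have Fxs: "F xs m = (if m : lbox R then d m else 0)" for m
   by (simp add: F_def xs_def map_of_map_restrict restrict_map_def ms)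
  have xsS: "F xs : ?S" using d(1) by (intro imageI) (auto simp: xs_def lists_eq_set)
  have "(nl2 (%m. F xs m - trunc R H m))\<^sup>2 <= (e / 2)\<^sup>2"
  proof -
   have "(nl2 (%m. F xs m - trunc R H m))\<^sup>2 = (\<Sum>\<^sub>\<infinity>m\<in>lbox R. (norm (d m - H m))\<^sup>2)"
    unfolding l2_power2 by (rule infsum_cong_neutral) (simp_all add: Fxs trunc_def)
   also have "... = (\<Sum>m\<in>lbox R. (norm (d m - H m))\<^sup>2)" by (simp add: finite_lbox)
   also have "... <= (\<Sum>m\<in>(lbox R::'n mi set). (e / (2 * N))\<^sup>2)"
    by (intro sum_mono power_mono d(2)[THEN less_imp_le]) auto
   also have "... = real (card (lbox R :: 'n mi set)) * (e / (2 * N))\<^sup>2" by simp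
   also have "... <= N\<^sup>2 * (e / (2 * N))\<^sup>2"
   proof (rule mult_right_mono)
    have "N <= N\<^sup>2" by (rule self_le_power) (auto simp: N_def)
    then show "real (card (lbox R :: 'n mi set)) <= N\<^sup>2" by (simp add: N_def)
   qed simp
   also have "... = (e / 2)\<^sup>2" using N by (simp add: power_divide power_mult_distrib)
   finally show ?thesis .
  qed
  then have le: "nl2 (%m. F xs m - trunc R H m) <= e / 2" by (rule power2_le_imp_le) (use e in auto)
  have tl: "trunc R H : l2" using trunc_fin_supp fin_supp_l2 by blast
  have "F xs : l2" using xsS Sl by blast
  from nl2_triangle_diff[OF this H tl] le R
  have "nl2 (%m. F xs m - H m) < e" by (simp add: nl2_minus_commute[of "trunc R H"])
  then show ?thesis using xsS by blast
 qed
 show ?thesis by (intro exI[of _ ?S] conjI c Sl ballI allI impI) (rule d)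
qed

lemma fin_supp_add:
 assumes "F : fin_supp" "G : fin_supp" shows "(%m. F m + G m) : fin_supp"
proof -
 have "finite ({m. F m ~= 0} \<union> {m. G m ~= 0})" using assms by (simp add: fin_supp_def)
 then show ?thesis unfolding fin_supp_def mem_Collect_eq by (rule rev_finite_subset) auto
qed

lemma fin_supp_smult: "F : fin_supp ==> (%m. c *s F m) : fin_supp"
 unfolding fin_supp_def mem_Collect_eq by (erule rev_finite_subset) auto

section \<open>Hilbert spaces with a coefficient isomorphism\<close>

text \<open>The coefficient map \<open>W\<close> is kept abstract because the theory is used twice: for the spinor space, where it is
  the identity, and for the completion of the tensor square.\<close>

locale l2_model =
 fixes V :: "'v ip_space" and W :: "'v => 'n::finite multi_index => complex^'t::finite"
 assumes W_bij: "bij_betw W (carrier V) l2"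
  and zero_carrier [simp]: "\<zero>\<^bsub>V\<^esub> : carrier V" and W_zero [simp]: "W \<zero>\<^bsub>V\<^esub> = (%m. 0)"
  and add_carrier: "!!x y. x : carrier V ==> y : carrier V ==> x \<oplus>\<^bsub>V\<^esub> y : carrier V"
  and W_add: "!!x y. x : carrier V ==> y : carrier V ==> W (x \<oplus>\<^bsub>V\<^esub> y) = (%m. W x m + W y m)"
  and smult_carrier: "!!c x. x : carrier V ==> c \<odot>\<^bsub>V\<^esub> x : carrier V"
  and W_smult: "!!c x. x : carrier V ==> W (c \<odot>\<^bsub>V\<^esub> x) = (%m. c *s W x m)"
  and W_ip: "!!x y. x : carrier V ==> y : carrier V ==> ip V x y = l2_ip (W x) (W y)"
begin

lemma W_l2 [simp]: "x : carrier V ==> W x : l2" using W_bij bij_betwE by blast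

lemma W_eq_iff: "x : carrier V ==> y : carrier V ==> W x = W y \<longleftrightarrow> x = y"
 using W_bij by (auto simp: bij_betw_def inj_on_def)

definition Winv :: "(('n,'t) vf) => 'v" where "Winv = inv_into (carrier V) W"

lemma Winv_carrier [simp]: "F : l2 ==> Winv F : carrier V"
 unfolding Winv_def using W_bij by (metis bij_betw_def inv_into_into)

lemma W_Winv [simp]: "F : l2 ==> W (Winv F) = F"
 unfolding Winv_def using W_bij by (metis bij_betw_def f_inv_into_f)

lemma Winv_W [simp]: "x : carrier V ==> Winv (W x) = x" using W_eq_iff[of "Winv (W x)" x] by simp

lemma W_eq_zero_iff: "x : carrier V ==> W x = (%m. 0) \<longleftrightarrow> x = \<zero>\<^bsub>V\<^esub>"
 using W_eq_iff[of x "\<zero>\<^bsub>V\<^esub>"] by simp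

lemma eq_by_W: "x : carrier V ==> y : carrier V ==> (!!m. W x m = W y m) ==> x = y" using W_eq_iff by blast

lemma abelian_group_V: "abelian_group V"
proof (rule abelian_groupI)
 show "\<exists>y\<in>carrier V. y \<oplus>\<^bsub>V\<^esub> x = \<zero>\<^bsub>V\<^esub>" if "x : carrier V" for x
  by (rule bexI[of _ "(-1) \<odot>\<^bsub>V\<^esub> x"]; (rule eq_by_W)?)
   (use that in \<open>auto simp: W_add W_smult smult_carrier add_carrier vec_eq_iff\<close>)
qed (auto intro!: eq_by_W simp: add_carrier W_add algebra_simps)

lemma cring_complex_field: "cring complex_field"
proof (rule cringI)
 show "abelian_group complex_field"
 proof (rule abelian_groupI)
  show "\<exists>y\<in>carrier complex_field. y \<oplus>\<^bsub>complex_field\<^esub> x = \<zero>\<^bsub>complex_field\<^esub>" for x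
   by (rule bexI[of _ "- x"]) (auto simp: complex_field_def)
 qed (auto simp: complex_field_def)
 show "comm_monoid complex_field" by (rule comm_monoidI) (auto simp: complex_field_def)
qed (auto simp: complex_field_def algebra_simps)

lemma module_V: "Module.module complex_field V"
proof (rule moduleI[OF cring_complex_field abelian_group_V])
qed (auto intro!: eq_by_W simp: add_carrier smult_carrier W_add W_smult complex_field_def
  vector_add_ldistrib vector_sadd_rdistrib vector_smult_assoc)

lemma minus_carrier: "x : carrier V ==> y : carrier V ==> x \<ominus>\<^bsub>V\<^esub> y : carrier V"
 by (rule abelian_group.minus_closed[OF abelian_group_V])

lemma W_minus:
 assumes "x : carrier V" "y : carrier V" shows "W (x \<ominus>\<^bsub>V\<^esub> y) = (%m. W x m - W y m)"
proof -
 interpret abelian_group V by (rule abelian_group_V)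
 have "(x \<ominus>\<^bsub>V\<^esub> y) \<oplus>\<^bsub>V\<^esub> y = x"
  using assms by (simp add: a_minus_def a_assoc l_neg)
 then have "(%m. W (x \<ominus>\<^bsub>V\<^esub> y) m + W y m) = W x"
  using W_add[OF minus_carrier[OF assms] assms(2)] by simp
 then show ?thesis by (auto simp: fun_eq_iff algebra_simps)
qed

lemma W_uminus: "x : carrier V ==> W (\<ominus>\<^bsub>V\<^esub> x) = (%m. - W x m)"
proof -
 assume x: "x : carrier V"
 interpret abelian_group V by (rule abelian_group_V)
 have "\<ominus>\<^bsub>V\<^esub> x = \<zero>\<^bsub>V\<^esub> \<ominus>\<^bsub>V\<^esub> x" using x by (simp add: a_minus_def)
 then show ?thesis using W_minus[OF zero_carrier x] by simp
qed

lemma nrm_W: "x : carrier V ==> nrm V x = nl2 (W x)"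
 by (simp add: nrm_def W_ip l2_ip_self del: of_real_power)

lemma converges_to_iff:
 "converges_to V s l \<longleftrightarrow> (\<forall>n. s n : carrier V) & l : carrier V \<and>
  (%n. nl2 (%m. W (s n) m - W l m)) \<longlonglongrightarrow> 0"
 by (auto simp: converges_to_def nrm_W minus_carrier W_minus)

lemma cauchy_in_iff: "cauchy_in V s \<longleftrightarrow> (\<forall>n. s n : carrier V) \<and>
  (\<forall>e>0. \<exists>M. \<forall>m\<ge>M. \<forall>n\<ge>M. nl2 (%k. W (s m) k - W (s n) k) < e)"
 by (auto simp: cauchy_in_def nrm_W minus_carrier W_minus)

lemma hilbert_space_V: "hilbert_space V" unfolding hilbert_space_def
proof (intro conjI allI impI ballI)
 show "Module.module complex_field V" by (rule module_V)
 show "\<exists>l. converges_to V s l" if cs: "cauchy_in V s" for s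
 proof -
  have s: "s n : carrier V" for n using cs by (simp add: cauchy_in_def)
  obtain F where F: "F : l2" "(%n. nl2 (%k. W (s n) k - F k)) \<longlonglongrightarrow> 0"
  proof -
   have "\<exists>F\<in>l2. (%n. nl2 (%k. W (s n) k - F k)) \<longlonglongrightarrow> 0"
    by (rule l2_complete) (use cs s in \<open>auto simp: cauchy_in_iff\<close>)
   then show thesis using that by blast
  qed
  then show ?thesis by (intro exI[of _ "Winv F"]) (simp add: converges_to_iff s)
 qed
 fix x assume x: "x : carrier V"
 show "0 <= Re (ip V x x)" using x by (simp add: W_ip l2_ip_self del: of_real_power)
 show "x = \<zero>\<^bsub>V\<^esub>" if "ip V x x = 0"
 proof -
  have "W x = (%_. 0)" using that x by (intro nl2_eq_0) (auto simp: W_ip l2_ip_self)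
  then show ?thesis using W_eq_iff[OF x zero_carrier] by simp
 qed
qed (auto simp: W_ip W_add W_smult add_carrier smult_carrier l2_ip_add l2_ip_smult l2_ip_cnj)

lemma dense_inI:
 assumes "S <= carrier V" and "!!F e. F : l2 ==> e > 0 ==> \<exists>y\<in>S. nl2 (%m. W y m - F m) < e"
 shows "dense_in V S" unfolding dense_in_def
proof (intro conjI ballI)
 fix x assume x: "x : carrier V"
 have "\<forall>n. \<exists>y\<in>S. nl2 (%m. W y m - W x m) < 1 / real (Suc n)"
  using assms(2)[OF W_l2[OF x]] by simp
 then obtain s where s: "!!n. s n : S" "!!n. nl2 (%m. W (s n) m - W x m) < 1 / real (Suc n)" by metis
 have "(%n. nl2 (%m. W (s n) m - W x m)) \<longlonglongrightarrow> 0"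
  by (rule tendsto_sandwich[OF _ _ tendsto_const lim_1_over_n[THEN LIMSEQ_Suc]])
   (use s(2) in \<open>auto intro!: always_eventually less_imp_le\<close>)
 then show "\<exists>s. (\<forall>n. s n : S) & converges_to V s x"
  using s(1) assms(1) x by (intro exI[of _ s]) (auto simp: converges_to_iff)
qed fact

lemma separable_V: "separable_space V"
proof -
 obtain S :: "(('n,'t) vf) set" where S: "countable S" "S <= l2"
  "!!F e. F : l2 ==> e > 0 ==> \<exists>G\<in>S. nl2 (%m. G m - F m) < e"
  using l2_countable_dense by metis
 have "dense_in V (Winv ` S)" by (rule dense_inI) (use S(2,3) in \<open>auto simp: subset_iff\<close>)
 then show ?thesis using S(1) by (auto simp: separable_space_def)
qed

subsection \<open>Operators given by maps of coefficients\<close>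

text \<open>The graph of the operator that acts on coefficients as \<open>f\<close>, with domain \<open>D\<close>. Sums, products,
  commutators and adjoints of such graphs can be computed on coefficients.\<close>

definition lop :: "(('n,'t) vf) set => ((('n,'t) vf) => ('n,'t) vf) => 'v oper" where
 "lop D f = {(x, y). x : carrier V & y : carrier V & W x : D & W y = f (W x)}"

lemma lop_cong: "D = E ==> (!!F. F : l2 ==> F : E ==> f F = g F) ==> lop D f = lop E g"
 by (auto simp: lop_def)

lemma in_lop_iff: "x : carrier V ==> f (W x) : l2 ==> (x, y) : lop D f \<longleftrightarrow> W x : D & y = Winv (f (W x))"
 by (auto simp: lop_def) (metis Winv_W)

lemma ap_lop: "x : carrier V ==> W x : D ==> f (W x) : l2 ==> ap (lop D f) x = Winv (f (W x))"
 unfolding ap_def by (rule the_equality) (auto simp: in_lop_iff)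

lemma lop_mono: "D <= E ==> (!!F. F : D ==> f F = g F) ==> lop D f <= lop E g" by (auto simp: lop_def)

lemma Domain_lop:
 assumes "!!F. F : D ==> f F : l2" shows "Domain (lop D f) = {x : carrier V. W x : D}"
 using assms by (auto simp: lop_def) (metis W_Winv Winv_carrier)

lemma op_id_lop: "op_id V = lop l2 (%F. F)" by (auto simp: op_id_def lop_def W_eq_iff)

lemma op_zero_lop: "op_zero_on V (carrier V) = lop l2 (%F m. 0)"
 by (auto simp: op_zero_on_def lop_def W_eq_zero_iff)

lemma op_zero_Domain: "(!!F. F : D ==> f F : l2) ==> op_zero_on V (Domain (lop D f)) = lop D (%F m. 0)"
 unfolding op_zero_on_def by (subst Domain_lop) (auto simp: lop_def W_eq_zero_iff)

lemma op_add_lop: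
 assumes "!!F. F : D ==> f F : l2" "!!F. F : E ==> g F : l2"
 shows "op_add V (lop D f) (lop E g) = lop (D \<inter> E) (%F m. f F m + g F m)"
proof (intro equalityI subsetI)
 fix p assume "p : op_add V (lop D f) (lop E g)"
 then show "p : lop (D \<inter> E) (%F m. f F m + g F m)"
  by (auto simp: op_add_def lop_def add_carrier W_add)
next
 fix p assume p: "p : lop (D \<inter> E) (%F m. f F m + g F m)"
 obtain x y where xy: "p = (x, y)" by (cases p)
 have x: "x : carrier V" "y : carrier V" "W x : D" "W x : E" "W y = (%m. f (W x) m + g (W x) m)"
  using p xy by (auto simp: lop_def)
 have "y = Winv (f (W x)) \<oplus>\<^bsub>V\<^esub> Winv (g (W x))"
  by (rule eq_by_W) (use x assms in \<open>auto simp: add_carrier W_add\<close>)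
 moreover have "(x, Winv (f (W x))) : lop D f" "(x, Winv (g (W x))) : lop E g"
  using x assms by (auto simp: lop_def)
 ultimately show "p : op_add V (lop D f) (lop E g)" unfolding op_add_def xy by blast
qed

lemma op_scale_lop:
 assumes "!!F. F : D ==> f F : l2" shows "op_scale V c (lop D f) = lop D (%F m. c *s f F m)"
proof (intro equalityI subsetI)
 fix p assume "p : op_scale V c (lop D f)"
 then show "p : lop D (%F m. c *s f F m)" by (auto simp: op_scale_def lop_def smult_carrier W_smult)
next
 fix p assume p: "p : lop D (%F m. c *s f F m)"
 obtain x y where xy: "p = (x, y)" by (cases p)
 have x: "x : carrier V" "y : carrier V" "W x : D" "W y = (%m. c *s f (W x) m)"
  using p xy by (auto simp: lop_def)
 have "y = c \<odot>\<^bsub>V\<^esub> Winv (f (W x))"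
  by (rule eq_by_W) (use x assms in \<open>auto simp: smult_carrier W_smult\<close>)
 moreover have "(x, Winv (f (W x))) : lop D f" using x assms by (auto simp: lop_def)
 ultimately show "p : op_scale V c (lop D f)" unfolding op_scale_def xy by blast
qed

lemma op_comp_lop:
 assumes "!!F. F : E ==> g F : l2" shows "op_comp (lop D f) (lop E g) = lop {F : E. g F : D} (%F. f (g F))"
proof (intro equalityI subsetI)
 fix p assume "p : op_comp (lop D f) (lop E g)"
 then show "p : lop {F : E. g F : D} (%F. f (g F))" by (auto simp: op_comp_def lop_def)
next
 fix p assume p: "p : lop {F : E. g F : D} (%F. f (g F))"
 obtain x y where xy: "p = (x, y)" by (cases p)
 have x: "x : carrier V" "y : carrier V" "W x : E" "g (W x) : D" "W y = f (g (W x))"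
  using p xy by (auto simp: lop_def)
 have "(x, Winv (g (W x))) : lop E g" "(Winv (g (W x)), y) : lop D f" using x assms by (auto simp: lop_def)
 then show "p : op_comp (lop D f) (lop E g)" unfolding op_comp_def xy by blast
qed

lemma comm_lop:
 assumes "!!F. F : D ==> f F : l2" "!!F. F : E ==> g F : l2" shows "comm V (lop D f) (lop E g) =
  lop {F. F : D & F : E & g F : D & f F : E} (%F m. f (g F) m - g (f F) m)" unfolding comm_def
 by (subst op_comp_lop, use assms in blast, subst op_comp_lop, use assms in blast,
   subst op_scale_lop, use assms in blast, subst op_add_lop)
  (use assms in \<open>auto intro!: lop_cong simp: fun_eq_iff vec_eq_iff\<close>)

lemma acomm_lop:
 assumes "!!F. F : D ==> f F : l2" "!!F. F : E ==> g F : l2" shows "acomm V (lop D f) (lop E g) =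
  lop {F. F : D & F : E & g F : D & f F : E} (%F m. f (g F) m + g (f F) m)" unfolding acomm_def
 by (subst op_comp_lop, use assms in blast, subst op_comp_lop, use assms in blast, subst op_add_lop)
  (use assms in \<open>auto intro!: lop_cong\<close>)

lemma linear_op_lop:
 assumes "D <= l2" "!!F. F : D ==> f F : l2" "(%_. 0) : D" "f (%_. 0) = (%_. 0)"
  and "!!F G. F : D ==> G : D ==> (%m. F m + G m) : D & f (%m. F m + G m) = (%m. f F m + f G m)"
  and "!!c F. F : D ==> (%m. c *s F m) : D & f (%m. c *s F m) = (%m. c *s f F m)"
 shows "linear_op V (lop D f)" unfolding linear_op_def
proof (intro conjI allI impI)
 show "single_valued (lop D f)" by (auto simp: single_valued_def lop_def) (metis W_eq_iff)
qed (use assms in \<open>auto simp: lop_def add_carrier smult_carrier W_add W_smult\<close>)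

lemma densely_defined_lop:
 assumes "linear_op V (lop D f)" "fin_supp <= D" "!!F. F : D ==> f F : l2"
 shows "densely_defined_op V (lop D f)" unfolding densely_defined_op_def
proof (intro conjI dense_inI)
 have dom: "Domain (lop D f) = {x : carrier V. W x : D}" using assms(3) by (rule Domain_lop)
 fix F :: "('n,'t) vf" and e :: real assume F: "F : l2" and e: "e > 0"
 have "eventually (%R. nl2 (%m. F m - trunc R F m) < e) sequentially"
  using order_tendstoD(2)[OF trunc_tendsto[OF F], of e] e by simp
 then obtain R where R: "nl2 (%m. F m - trunc R F m) < e" by (auto simp: eventually_sequentially)
 have t: "trunc R F : fin_supp" by (rule trunc_fin_supp)
 then have "trunc R F : l2" using fin_supp_l2 by blast
 then show "\<exists>y\<in>Domain (lop D f). nl2 (%m. W y m - F m) < e" unfolding dom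
  by (intro bexI[of _ "Winv (trunc R F)"]) (use R t assms(2) in \<open>auto simp: nl2_minus_commute\<close>)
qed (use assms(1) in \<open>auto simp: lop_def\<close>)

lemma dense_Domain_lop:
 assumes "fin_supp <= D" "D <= l2" "!!F. F : D ==> f F : l2" shows "dense_in V (Domain (lop D f))"
proof -
 have d: "densely_defined_op V (lop l2 (%F m. 0))"
  by (rule densely_defined_lop[OF linear_op_lop]) (auto simp: fin_supp_l2)
 have "densely_defined_op V (lop fin_supp (%F m. 0))"
 proof (rule densely_defined_lop[OF linear_op_lop])
  fix F G :: "('n,'t) vf" and c assume F: "F : fin_supp"
  show "(%m. c *s F m) : fin_supp & (%m::'n mi. 0::complex^'t) = (%m. c *s 0)"
   using fin_supp_smult[OF F] by simp
  assume "G : fin_supp"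
  then show "(%m. F m + G m) : fin_supp & (%m::'n mi. 0::complex^'t) = (%m. 0 + 0)"
   using fin_supp_add[OF F] by simp
 qed (use fin_supp_l2 in \<open>auto simp: fin_supp_def\<close>)
 then have dd: "dense_in V {x : carrier V. W x : fin_supp}"
  using fin_supp_l2 by (simp add: densely_defined_op_def Domain_lop)
 have dom: "Domain (lop D f) = {x : carrier V. W x : D}" using assms(3) by (rule Domain_lop)
 show ?thesis unfolding dense_in_def unfolding dom
 proof (intro conjI ballI)
  fix x assume "x : carrier V"
  then obtain s where "\<forall>n. s n : {x : carrier V. W x : fin_supp}" "converges_to V s x"
   using dd unfolding dense_in_def by blast
  then show "\<exists>s. (\<forall>n. s n : {x : carrier V. W x : D}) & converges_to V s x"
   using assms(1) by blast
 qed auto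
qed

lemma vanishes_densely_lop:
 assumes "fin_supp <= D" "D <= l2" "!!F. F : D ==> f F = (%m. 0)" shows "vanishes_densely V (lop D f)"
 unfolding vanishes_densely_def
proof
 show "dense_in V (Domain (lop D f))" by (rule dense_Domain_lop[OF assms(1,2)]) (use assms(3) in auto)
 show "Range (lop D f) <= {\<zero>\<^bsub>V\<^esub>}" using assms(3) by (auto simp: lop_def W_eq_zero_iff)
qed

lemma lop_eq_zeroI:
 assumes "!!F. F : D ==> F : l2 ==> f F = (%m. 0)" "D = E" shows "lop D f = lop E (%F m. 0)"
 by (rule lop_cong) (use assms in auto)

subsection \<open>Bounded operators\<close>

definition bdd_map :: "((('n,'t) vf) => ('n,'t) vf) => bool" where
 "bdd_map f \<longleftrightarrow> (\<forall>F\<in>l2. f F : l2) \<and>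
  (\<forall>F\<in>l2. \<forall>G\<in>l2. f (%m. F m + G m) = (%m. f F m + f G m)) \<and>
  (\<forall>c. \<forall>F\<in>l2. f (%m. c *s F m) = (%m. c *s f F m)) \<and>
  (\<exists>C. \<forall>F\<in>l2. nl2 (f F) <= C * nl2 F)"

lemma bdd_map_l2: "bdd_map f ==> F : l2 ==> f F : l2" by (simp add: bdd_map_def)

lemma bdd_map_diff:
 assumes f: "bdd_map f" and F: "F : l2" "G : l2" shows "f (%m. F m - G m) = (%m. f F m - f G m)"
proof -
 have *: "(%m. F m - G m) = (%m. F m + (-1) *s G m)" by (auto simp: fun_eq_iff vec_eq_iff)
 have a: "(%m. (-1) *s G m) : l2" by (rule l2_smult[OF F(2)])
 have "f (%m. F m + (-1) *s G m) = (%m. f F m + f (%m. (-1) *s G m) m)"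
  using f[unfolded bdd_map_def, THEN conjunct2, THEN conjunct1, rule_format, OF F(1) a] .
 moreover have "f (%m. (-1) *s G m) = (%m. (-1) *s f G m)" using f F(2) unfolding bdd_map_def by blast
 ultimately show ?thesis unfolding * by (auto simp: fun_eq_iff vec_eq_iff)
qed

lemma linear_op_bdd:
 assumes f: "bdd_map f" shows "linear_op V (lop l2 f)"
proof (rule linear_op_lop)
 have "f (%m. 0 *s (0::complex^'t)) = (%m. 0 *s f (%m. 0) m)"
  using f[unfolded bdd_map_def, THEN conjunct2, THEN conjunct2, THEN conjunct1, rule_format, OF l2_zero, of 0] .
 then show "f (%_. 0) = (%_. 0)" by (simp add: vec_eq_iff fun_eq_iff)
qed (use f in \<open>auto simp: bdd_map_def\<close>)

lemma bounded_op_lop: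
 assumes f: "bdd_map f" shows "bounded_op V (lop l2 f)" unfolding bounded_op_def
proof (intro conjI)
 show "linear_op V (lop l2 f)" by (rule linear_op_bdd[OF f])
 show "Domain (lop l2 f) = carrier V" using f by (subst Domain_lop) (auto simp: bdd_map_def)
 obtain C where "\<forall>F\<in>l2. nl2 (f F) <= C * nl2 F" using f unfolding bdd_map_def by blast
 then show "\<exists>C. \<forall>(x, y)\<in>lop l2 f. nrm V y <= C * nrm V x"
  by (intro exI[of _ C]) (auto simp: lop_def nrm_W)
qed

lemma op_adj_bdd:
 assumes f: "bdd_map f" and f': "!!F. F : l2 ==> f' F : l2"
  and adj: "!!F G. F : l2 ==> G : l2 ==> l2_ip G (f F) = l2_ip (f' G) F"
  and D: "fin_supp <= D" "D <= l2" shows "op_adj V (lop D f) = lop l2 f'"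
proof (intro equalityI subsetI)
 fix p assume p: "p : op_adj V (lop D f)"
 obtain y z where yz: "p = (y, z)" by (cases p)
 have y: "y : carrier V" "z : carrier V" and
  t: "!!x w. (x, w) : lop D f ==> ip V y w = ip V z x" using p yz by (auto simp: op_adj_def)
 have "W z = f' (W y)"
 proof (rule l2_eq_by_fin_supp)
  fix H :: "('n,'t) vf" assume H: "H : fin_supp"
  have Hl: "H : l2" using H fin_supp_l2 by blast
  have "(Winv H, Winv (f H)) : lop D f" using H D Hl bdd_map_l2[OF f] by (auto simp: lop_def)
  from t[OF this] show "l2_ip (W z) H = l2_ip (f' (W y)) H"
   using y Hl bdd_map_l2[OF f] adj[of H "W y"] by (simp add: W_ip)
 qed
 then show "p : lop l2 f'" using y by (simp add: yz lop_def)
next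
 fix p assume "p : lop l2 f'"
 then show "p : op_adj V (lop D f)" using adj by (auto simp: op_adj_def lop_def W_ip)
qed

lemma bounded_self_adjoint_lop:
 assumes "bdd_map f" "!!F G. F : l2 ==> G : l2 ==> l2_ip G (f F) = l2_ip (f G) F"
 shows "bounded_self_adjoint V (lop l2 f)" unfolding bounded_self_adjoint_def
proof
 show "bounded_op V (lop l2 f)" by (rule bounded_op_lop[OF assms(1)])
 show "op_adj V (lop l2 f) = lop l2 f"
  by (rule op_adj_bdd[OF assms(1) bdd_map_l2[OF assms(1)] assms(2) fin_supp_l2 order_refl])
qed

lemma op_closure_bdd:
 assumes f: "bdd_map f" and D: "fin_supp <= D" "D <= l2" shows "op_closure V (lop D f) = lop l2 f"
proof (intro equalityI subsetI)
 fix p assume p: "p : op_closure V (lop D f)"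
 obtain x y where xy: "p = (x, y)" by (cases p)
 obtain s where s: "!!n. s n : lop D f" "converges_to V (%n. fst (s n)) x" "converges_to V (%n. snd (s n)) y"
  using p xy by (auto simp: op_closure_def)
 have c: "fst (s n) : carrier V" "snd (s n) : carrier V" "W (snd (s n)) = f (W (fst (s n)))" for n
  using s(1)[of n] by (auto simp: lop_def)
 have xc: "x : carrier V" "y : carrier V" using s(2,3) by (auto simp: converges_to_iff)
 obtain C where C: "\<forall>F\<in>l2. nl2 (f F) <= C * nl2 F" using f unfolding bdd_map_def by blast
 have eq: "(%k. W (snd (s n)) k - f (W x) k) = f (%m. W (fst (s n)) m - W x m)" for n
  unfolding c(3) by (rule bdd_map_diff[OF f, symmetric]) (use c xc in auto)
 have lim: "(%n. W (snd (s n)) m) \<longlonglongrightarrow> f (W x) m" for m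
 proof (rule l2_limit_pointwise)
  show "(%n. nl2 (%k. W (snd (s n)) k - f (W x) k)) \<longlonglongrightarrow> 0"
  proof (rule tendsto_sandwich[OF always_eventually always_eventually tendsto_const])
   have "(%n. C * nl2 (%m. W (fst (s n)) m - W x m)) \<longlonglongrightarrow> C * 0"
    using s(2) by (intro tendsto_mult_left) (simp add: converges_to_iff)
   then show "(%n. C * nl2 (%m. W (fst (s n)) m - W x m)) \<longlonglongrightarrow> 0" by simp
   show "\<forall>n. nl2 (%k. W (snd (s n)) k - f (W x) k) <= C * nl2 (%m. W (fst (s n)) m - W x m)"
    unfolding eq using C c(1) xc(1) by simp
  qed simp
 qed (use c xc bdd_map_l2[OF f] in auto)
 have "(%n. W (snd (s n)) m) \<longlonglongrightarrow> W y m" for m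
  by (rule l2_limit_pointwise) (use s(3) c(1,2) xc in \<open>auto simp: converges_to_iff\<close>)
 then have "W y = f (W x)" using lim LIMSEQ_unique by blast
 then show "p : lop l2 f" using xc by (simp add: xy lop_def)
next
 fix p assume p: "p : lop l2 f"
 obtain x y where xy: "p = (x, y)" by (cases p)
 have x: "x : carrier V" "y : carrier V" "W y = f (W x)" using p xy by (auto simp: lop_def)
 obtain C where C: "\<forall>F\<in>l2. nl2 (f F) <= C * nl2 F" using f unfolding bdd_map_def by blast
 let ?t = "%n. trunc n (W x)"
 have t: "?t n : fin_supp" "?t n : l2" for n using trunc_fin_supp fin_supp_l2 by blast+
 let ?s = "%n. (Winv (?t n), Winv (f (?t n)))"
 have tt: "(%n. nl2 (%m. ?t n m - W x m)) \<longlonglongrightarrow> 0"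
  using trunc_tendsto[OF W_l2[OF x(1)]] by (simp add: nl2_minus_commute)
 have eq: "(%k. f (?t n) k - f (W x) k) = f (%m. ?t n m - W x m)" for n
  by (rule bdd_map_diff[OF f, symmetric]) (use t x in auto)
 have "(%n. nl2 (%k. f (?t n) k - f (W x) k)) \<longlonglongrightarrow> 0"
 proof (rule tendsto_sandwich[OF always_eventually always_eventually tendsto_const])
  show "(%n. C * nl2 (%m. ?t n m - W x m)) \<longlonglongrightarrow> 0"
   using tendsto_mult_left[OF tt, of C] by simp
  show "\<forall>n. nl2 (%k. f (?t n) k - f (W x) k) <= C * nl2 (%m. ?t n m - W x m)"
   unfolding eq using C t x(1) by simp
 qed simp
 then have "converges_to V (%n. snd (?s n)) y" using x t bdd_map_l2[OF f] by (simp add: converges_to_iff)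
 moreover have "converges_to V (%n. fst (?s n)) x" using x t tt by (simp add: converges_to_iff)
 moreover have "\<forall>n. ?s n : lop D f" using t D bdd_map_l2[OF f] by (auto simp: lop_def)
 ultimately show "p : op_closure V (lop D f)" unfolding op_closure_def xy by (auto intro!: exI[of _ ?s])
qed

lemma extends_bounded_lop:
 assumes "bdd_map g" "D <= l2" "!!F. F : D ==> f F : l2" "!!F. F : D ==> h F = g F"
 shows "extends_bounded V (lop D f) (lop D h)" unfolding extends_bounded_def
proof
 have "h F : l2" if "F : D" for F using that assms(2,4) bdd_map_l2[OF assms(1)] by auto
 then have "Domain (lop D h) = {x : carrier V. W x : D}" by (rule Domain_lop)
 moreover have "Domain (lop D f) = {x : carrier V. W x : D}" by (rule Domain_lop) (rule assms(3))
 ultimately show "Domain (lop D h) = Domain (lop D f)" by simp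
 show "\<exists>B. bounded_op V B & lop D h <= B"
  by (intro exI[of _ "lop l2 g"] conjI bounded_op_lop assms(1) lop_mono assms(2) assms(4))
qed

end

section \<open>Multiplication operators\<close>

definition flin :: "(complex^'t::finite => complex^'t) => bool" where
 "flin L \<longleftrightarrow> (\<forall>v w. L (v + w) = L v + L w) & (\<forall>c v. L (c *s v) = c *s L v)"

lemma flin_add: "flin L ==> L (v + w) = L v + L w" and flin_smult: "flin L ==> L (c *s v) = c *s L v"
 by (auto simp: flin_def)

lemma flin_0: "flin L ==> L 0 = 0" using flin_smult[of L 0 0] by simp

lemma flin_minus: "flin L ==> L (- v) = - L v"
 using flin_smult[of L "-1" v] by (simp add: vector_sneg_minus1[symmetric])

lemma flin_diff: "flin L ==> L (v - w) = L v - L w" using flin_add[of L v "- w"] by (simp add: flin_minus)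

lemma flin_sum: "flin L ==> L (\<Sum>i\<in>I. v i) = (\<Sum>i\<in>I. L (v i))"
 by (induction I rule: infinite_finite_induct) (auto simp: flin_0 flin_add)

lemma scaleR_eq_smult: "r *\<^sub>R (v::complex^'t::finite) = of_real r *s v"
 by (simp add: vec_eq_iff scaleR_conv_of_real[where 'a = complex])

lemma flin_bounded_linear: "flin L ==> bounded_linear L" unfolding linear_conv_bounded_linear[symmetric]
 by (rule linearI) (auto simp: flin_add flin_smult scaleR_eq_smult)

lemma flin_bound:
 assumes "flin L" obtains B where "B \<ge> 0" "!!v. norm (L v) <= B * norm v"
 using bounded_linear.nonneg_bounded[OF flin_bounded_linear[OF assms]] by (metis mult.commute)

lemma flin_intros: "flin (%v. v)" "flin (%v. 0)" "flin L ==> flin (%v. c *s L v)"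
 "flin L ==> flin M ==> flin (%v. L v + M v)"
 "flin L ==> flin M ==> flin (%v. L v - M v)"
 "flin L ==> flin (%v. - L v)" by (auto simp: flin_def vec_eq_iff algebra_simps)

lemma flin_comp: "flin L ==> flin M ==> flin (%v. L (M v))" by (simp add: flin_def)

lemma flin_sumI: "(!!i. i : I ==> flin (L i)) ==> flin (%v. \<Sum>i\<in>I. L i v)"
 by (induction I rule: infinite_finite_induct) (auto intro: flin_intros)

definition mf :: "('n::finite multi_index => complex^'t::finite => complex^'t) =>
  (('n,'t) vf) => ('n,'t) vf" where
 "mf L F = (%m. L m (F m))"

definition md :: "('n::finite multi_index => complex^'t::finite => complex^'t) => (('n,'t) vf) set" where
 "md L = {F : l2. mf L F : l2}"

lemma md_l2: "md L <= l2" and md_mf: "F : md L ==> mf L F : l2" and mdD: "F : md L ==> F : l2"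
 by (auto simp: md_def)

lemma fin_supp_mf:
 assumes "!!m. flin (L m)" "F : fin_supp" shows "mf L F : fin_supp"
 using assms(2) unfolding fin_supp_def mem_Collect_eq
 by (rule rev_finite_subset) (auto simp: mf_def flin_0[OF assms(1)])

lemma fin_supp_md: "(!!m. flin (L m)) ==> fin_supp <= md L"
 using fin_supp_l2 fin_supp_mf by (auto simp: md_def)

lemma mf_delta: "(!!m. flin (L m)) ==> mf L (delta m v) = delta m (L m v)"
 by (auto simp: mf_def delta_def fun_eq_iff flin_0)

lemma mf_trunc: "(!!m. flin (L m)) ==> mf L (trunc n F) = trunc n (mf L F)"
 by (auto simp: mf_def trunc_def fun_eq_iff flin_0)

context l2_model
begin

definition mop :: "('n mi => complex^'t => complex^'t) => 'v oper" where "mop L = lop (md L) (mf L)"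

lemma linear_op_mf:
 assumes L: "!!m. flin (L m)" and D: "D <= md L" "(%_. 0) : D"
  "!!F G. F : D ==> G : D ==> (%m. F m + G m) : D" "!!c F. F : D ==> (%m. c *s F m) : D"
 shows "linear_op V (lop D (mf L))" by (rule linear_op_lop)
  (use D in \<open>auto simp: md_def mf_def flin_0[OF L] flin_add[OF L] flin_smult[OF L]\<close>)

lemma linear_op_mop: "(!!m. flin (L m)) ==> linear_op V (mop L)" unfolding mop_def by (rule linear_op_mf)
  (auto simp: md_def mf_def flin_0 flin_add flin_smult)

text \<open>Testing against finitely supported vectors determines the adjoint pointwise, so it is the
 maximal multiplication operator, whatever the domain between these vectors and \<open>md L\<close>.\<close>

lemma op_adj_mf:
 assumes L: "!!m. flin (L m)" and adj: "!!m v w. hdot (L m v) w = hdot v (L' m w)"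
  and D: "fin_supp <= D" "D <= md L" shows "op_adj V (lop D (mf L)) = mop L'"
proof (intro equalityI subsetI)
 have adj': "hdot w (L m v) = hdot (L' m w) v" for m v w
  using arg_cong[OF adj[of m v w], of cnj] by (simp add: hdot_cnj)
 fix p assume p: "p : op_adj V (lop D (mf L))"
 obtain y z where yz: "p = (y, z)" by (cases p)
 have y: "y : carrier V" "z : carrier V" and
  t: "!!x w. (x, w) : lop D (mf L) ==> ip V y w = ip V z x" using p yz by (auto simp: op_adj_def)
 have "W z = mf L' (W y)"
 proof
  fix m show "W z m = mf L' (W y) m"
  proof (rule hdot_eqI)
   fix v
   have "(Winv (delta m v), Winv (delta m (L m v))) : lop D (mf L)"
    using D delta_fin_supp[of m v] by (auto simp: lop_def mf_delta[OF L])
   from t[OF this] show "hdot (W z m) v = hdot (mf L' (W y) m) v"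
    using y by (simp add: W_ip l2_ip_delta adj' mf_def)
  qed
 qed
 then show "p : mop L'" using y W_l2[OF y(2)] by (simp add: yz mop_def lop_def md_def)
next
 have adj': "hdot w (L m v) = hdot (L' m w) v" for m v w
  using arg_cong[OF adj[of m v w], of cnj] by (simp add: hdot_cnj)
 fix p assume "p : mop L'"
 then show "p : op_adj V (lop D (mf L))"
  by (auto simp: mop_def op_adj_def lop_def W_ip l2_ip_def mf_def adj')
qed

lemma op_adj_mop:
 assumes "!!m. flin (L m)" "!!m v w. hdot (L m v) w = hdot v (L' m w)" shows "op_adj V (mop L) = mop L'"
 unfolding mop_def[of L] by (rule op_adj_mf[OF assms fin_supp_md[OF assms(1)] order_refl])

lemma op_closure_mf:
 assumes L: "!!m. flin (L m)" and D: "fin_supp <= D" "D <= md L"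
 shows "op_closure V (lop D (mf L)) = mop L"
proof (intro equalityI subsetI)
 fix p assume p: "p : op_closure V (lop D (mf L))"
 obtain x y where xy: "p = (x, y)" by (cases p)
 obtain s where s: "!!n. s n : lop D (mf L)" "converges_to V (%n. fst (s n)) x" "converges_to V (%n. snd (s n)) y"
  using p xy by (auto simp: op_closure_def)
 have c: "fst (s n) : carrier V" "snd (s n) : carrier V" "W (snd (s n)) = mf L (W (fst (s n)))" for n
  using s(1)[of n] by (auto simp: lop_def)
 have xc: "x : carrier V" "y : carrier V" using s(2,3) by (auto simp: converges_to_iff)
 have "W y m = mf L (W x) m" for m
 proof -
  have "(%n. W (fst (s n)) m) \<longlonglongrightarrow> W x m"
   by (rule l2_limit_pointwise) (use s(2) c xc in \<open>auto simp: converges_to_iff\<close>)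
  then have "(%n. L m (W (fst (s n)) m)) \<longlonglongrightarrow> L m (W x m)"
   by (rule bounded_linear.tendsto[OF flin_bounded_linear[OF L]])
  then have "(%n. W (snd (s n)) m) \<longlonglongrightarrow> L m (W x m)" by (simp add: c mf_def)
  moreover have "(%n. W (snd (s n)) m) \<longlonglongrightarrow> W y m"
   by (rule l2_limit_pointwise) (use s(3) c(1,2) xc in \<open>auto simp: converges_to_iff\<close>)
  ultimately show ?thesis using LIMSEQ_unique by (auto simp: mf_def)
 qed
 then have "W y = mf L (W x)" by blast
 then show "p : mop L" using xc W_l2[OF xc(2)] by (simp add: xy mop_def lop_def md_def)
next
 fix p assume p: "p : mop L"
 obtain x y where xy: "p = (x, y)" by (cases p)
 have x: "x : carrier V" "y : carrier V" "W y = mf L (W x)" using p xy by (auto simp: mop_def lop_def)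
 have t: "trunc n F : fin_supp" "trunc n F : l2" for n and F :: "('n,'t) vf"
  using trunc_fin_supp fin_supp_l2 by blast+
 let ?s = "%n. (Winv (trunc n (W x)), Winv (trunc n (W y)))"
 have "converges_to V (%n. fst (?s n)) x" "converges_to V (%n. snd (?s n)) y"
  using x t trunc_tendsto[OF W_l2[OF x(1)]] trunc_tendsto[OF W_l2[OF x(2)]]
  by (simp_all add: converges_to_iff nl2_minus_commute)
 moreover have "\<forall>n. ?s n : lop D (mf L)" using t D x(3) by (auto simp: lop_def mf_trunc[OF L])
 ultimately show "p : op_closure V (lop D (mf L))"
  unfolding op_closure_def xy by (auto intro!: exI[of _ ?s])
qed

lemma closed_op_mop:
 assumes L: "!!m. flin (L m)" shows "closed_op V (mop L)" unfolding closed_op_def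
proof
 show "densely_defined_op V (mop L)" using linear_op_mop[OF L] unfolding mop_def
  by (rule densely_defined_lop) (auto simp: md_mf fin_supp_md[OF L, THEN subsetD])
 show "op_closure V (mop L) = mop L"
  unfolding mop_def[of L] by (subst op_closure_mf[OF L fin_supp_md[OF L]]) (auto simp: mop_def)
qed

lemma self_adjoint_mop:
 assumes L: "!!m. flin (L m)" "!!m v w. hdot (L m v) w = hdot v (L m w)" shows "self_adjoint V (mop L)"
 using closed_op_mop[OF L(1)] op_adj_mop[OF L] by (simp add: self_adjoint_def closed_op_def)

lemma essentially_self_adjoint_mf:
 assumes L: "!!m. flin (L m)" "!!m v w. hdot (L m v) w = hdot v (L m w)" and D: "fin_supp <= D" "D <= md L"
  "!!F G. F : D ==> G : D ==> (%m. F m + G m) : D" "!!c F. F : D ==> (%m. c *s F m) : D"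
 shows "essentially_self_adjoint V (lop D (mf L))" unfolding essentially_self_adjoint_def
proof
 have "(%_. 0) : D" using D(1) by (auto simp: fin_supp_def)
 then have "linear_op V (lop D (mf L))" by (rule linear_op_mf[OF L(1) D(2) _ D(3,4)])
 then show "densely_defined_op V (lop D (mf L))"
  by (rule densely_defined_lop) (use D in \<open>auto simp: md_mf subset_iff\<close>)
 show "self_adjoint V (op_closure V (lop D (mf L)))"
  unfolding op_closure_mf[OF L(1) D(1,2)] by (rule self_adjoint_mop[OF L])
qed

lemma bdd_map_mf:
 assumes L: "!!m. flin (L m)" and C: "!!m v. norm (L m v) <= C * norm v" shows "bdd_map (mf L)" "md L = l2"
proof -
 have C0: "0 <= C"
 proof -
  have "0 <= C * norm (axis (undefined::'t) (1::complex))" using norm_ge_zero C by (rule order_trans)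
  then show ?thesis by (simp add: zero_le_mult_iff)
 qed
 have l: "F : l2 ==> mf L F : l2" for F by (erule l2_le[where C = C]) (simp add: mf_def C)
 then show "md L = l2" by (auto simp: md_def)
 show "bdd_map (mf L)" unfolding bdd_map_def
 proof (intro conjI exI[of _ C] ballI)
  show "nl2 (mf L F) <= C * nl2 F" if "F : l2" for F by (rule nl2_le[OF that _ C0]) (simp add: mf_def C)
 qed (auto simp: l l[unfolded mf_def] mf_def flin_add[OF L] flin_smult[OF L])
qed

lemma bdd_map_fibre:
 assumes L: "flin L" shows "bdd_map (mf (%_. L))" "md (%_::'n mi. L) = l2"
proof -
 obtain B where "!!v. norm (L v) <= B * norm v" using flin_bound[OF L] by blast
 then show "bdd_map (mf (%_. L))" "md (%_::'n mi. L) = l2" using bdd_map_mf[of "%_. L" B] L by auto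
qed

lemma bounded_self_adjoint_mop:
 assumes "flin L" "!!v w. hdot (L v) w = hdot v (L w)" shows "bounded_self_adjoint V (mop (%_. L))"
 using bounded_op_lop[OF bdd_map_fibre(1)[OF assms(1)]] bdd_map_fibre(2)[OF assms(1)]
  op_adj_mop[of "%_. L" "%_. L"] assms by (simp add: bounded_self_adjoint_def mop_def)

end

section \<open>Functional calculus and heat operators of multiplication operators\<close>

definition atomic_measure :: "('a => real) => ('a => real) => real measure" where
 "atomic_measure n lam = distr (density (count_space UNIV) (%m. ennreal (n m))) borel lam"

lemma integrable_count_space_iff:
 "integrable (count_space UNIV) f \<longleftrightarrow> (%x. norm (f x)) summable_on UNIV"
 for f :: "'a => real"
 using abs_summable_equivalent[of f UNIV] by (simp add: Infinite_Set_Sum.abs_summable_on_def)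

lemma integral_count_space_infsum:
 fixes f :: "'a => real"
 assumes "(%x. norm (f x)) summable_on UNIV" shows "integral\<^sup>L (count_space UNIV) f = infsum f UNIV"
 using infsetsum_infsum[of f UNIV] assms abs_summable_equivalent[of f UNIV] by (simp add: infsetsum_def)

lemma atomic_measure_sets [simp]: "sets (atomic_measure n lam) = sets borel"
 and atomic_measure_space [simp]: "space (atomic_measure n lam) = UNIV"
 by (simp_all add: atomic_measure_def)

lemma atomic_measure_integrable:
 assumes n: "!!m. 0 <= n m" and f: "f : borel_measurable borel"
 shows "integrable (atomic_measure n lam) f \<longleftrightarrow> (%m. \<bar>n m * f (lam m)\<bar>) summable_on UNIV"
proof -
 have "integrable (atomic_measure n lam) f \<longleftrightarrow>
   integrable (density (count_space UNIV) (%m. ennreal (n m))) (%m. f (lam m))"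
  unfolding atomic_measure_def by (rule integrable_distr_eq) (auto simp: f)
 also have "... \<longleftrightarrow> integrable (count_space UNIV) (%m. n m *\<^sub>R f (lam m))"
  by (rule integrable_density) (auto simp: n)
 finally show ?thesis by (simp add: integrable_count_space_iff)
qed

lemma atomic_measure_integral:
 assumes n: "!!m. 0 <= n m" and f: "f : borel_measurable borel"
  and s: "(%m. \<bar>n m * f (lam m)\<bar>) summable_on UNIV"
 shows "integral\<^sup>L (atomic_measure n lam) f = (\<Sum>\<^sub>\<infinity>m. n m * f (lam m))"
proof -
 have "integral\<^sup>L (atomic_measure n lam) f =
   integral\<^sup>L (density (count_space UNIV) (%m. ennreal (n m))) (%m. f (lam m))"
  unfolding atomic_measure_def by (rule integral_distr) (auto simp: f)
 also have "... = integral\<^sup>L (count_space UNIV) (%m. n m *\<^sub>R f (lam m))"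
  by (rule integral_density) (auto simp: n)
 also have "... = (\<Sum>\<^sub>\<infinity>m. n m * f (lam m))"
  using s by (subst integral_count_space_infsum) auto
 finally show ?thesis .
qed

lemma emeasure_atomic_measure:
 assumes n: "!!m. 0 <= n m" "n summable_on UNIV" and B: "B : sets borel"
 shows "emeasure (atomic_measure n lam) B = ennreal (\<Sum>\<^sub>\<infinity>m. if lam m : B then n m else 0)"
proof -
 let ?g = "%m. if lam m : B then n m else 0"
 have s: "(%m. norm (?g m)) summable_on UNIV" by (rule summable_on_le_nonneg[OF n(2)]) (use n(1) in auto)
 have "emeasure (atomic_measure n lam) B =
   (\<integral>\<^sup>+ m. ennreal (n m) * indicator (lam -` B) m \<partial>count_space UNIV)"
  unfolding atomic_measure_def using B by (subst emeasure_distr) (auto simp: emeasure_density)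
 also have "... = (\<integral>\<^sup>+ m. ennreal (?g m) \<partial>count_space UNIV)"
  by (rule nn_integral_cong) (auto simp: indicator_def)
 also have "... = ennreal (integral\<^sup>L (count_space UNIV) ?g)"
  by (rule nn_integral_eq_integral) (use s n(1) in \<open>auto simp only: integrable_count_space_iff\<close>, auto simp: n)
 also have "integral\<^sup>L (count_space UNIV) ?g = infsum ?g UNIV"
  by (rule integral_count_space_infsum[OF s])
 finally show ?thesis .
qed

context l2_model
begin

definition spec_proj :: "('n mi => real) => real set => 'v oper" where
 "spec_proj lam B = mop (%m v. if lam m : B then v else 0)"

lemma spec_proj_lop: "spec_proj lam B = lop l2 (mf (%m v. if lam m : B then v else 0))"
 and bdd_spec_proj: "bdd_map (mf (%m v. if lam m : B then v else 0))"
proof -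
 have L: "flin (%v. if lam m : B then v else 0)" for m by (auto simp: flin_def)
 from bdd_map_mf[where L = "%m v. if lam m : B then v else 0" and C = 1, OF L]
 show "bdd_map (mf (%m v. if lam m : B then v else 0))"
  "spec_proj lam B = lop l2 (mf (%m v. if lam m : B then v else 0))" by (auto simp: spec_proj_def mop_def)
qed

lemma ip_spec_proj:
 assumes x: "x : carrier V" shows "ip V x (ap (spec_proj lam B) x) =
  of_real (\<Sum>\<^sub>\<infinity>m. if lam m : B then (norm (W x m))\<^sup>2 else 0)"
proof -
 let ?f = "mf (%m v. if lam m : B then v else 0)"
 have fx: "?f (W x) : l2" using bdd_map_l2[OF bdd_spec_proj] x by simp
 have "ip V x (ap (spec_proj lam B) x) = l2_ip (W x) (?f (W x))"
  using x fx by (simp add: spec_proj_lop ap_lop W_ip)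
 also have "... = (\<Sum>\<^sub>\<infinity>m. of_real (if lam m : B then (norm (W x m))\<^sup>2 else 0))"
  unfolding l2_ip_def by (rule infsum_cong) (auto simp: mf_def hdot_self)
 finally show ?thesis by (simp only: infsum_of_real_complex)
qed

lemma spectral_dist_spec_proj:
 assumes x: "x : carrier V"
 shows "spectral_dist V (spec_proj lam) x = atomic_measure (%m. (norm (W x m))\<^sup>2) lam"
proof -
 let ?N = "atomic_measure (%m. (norm (W x m))\<^sup>2) lam"
 have "spectral_dist V (spec_proj lam) x = measure_of UNIV (sets borel) (emeasure ?N)"
  unfolding spectral_dist_def
 proof (rule measure_of_eq)
  fix B :: "real set" assume "B : sigma_sets UNIV (sets borel)"
  then have "B : sets borel" using sets.sigma_sets_eq[of "borel :: real measure"] by simp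
  then show "ennreal (Re (ip V x (ap (spec_proj lam B) x))) = emeasure ?N B"
   using l2_summable[OF W_l2[OF x]] by (simp add: ip_spec_proj[OF x] emeasure_atomic_measure)
 qed simp
 also have "... = ?N" using measure_of_of_measure[of ?N] by simp
 finally show ?thesis .
qed

lemma spectral_measure_spec_proj: "spectral_measure V (spec_proj lam)" unfolding spectral_measure_def
proof (intro conjI ballI allI impI)
 fix B :: "real set"
 show "bounded_self_adjoint V (spec_proj lam B)" unfolding spec_proj_lop
  by (rule bounded_self_adjoint_lop[OF bdd_spec_proj]) (auto simp: l2_ip_def mf_def intro!: infsum_cong)
 show "spec_proj lam UNIV = op_id V"
  unfolding spec_proj_lop op_id_lop by (rule lop_cong) (auto simp: mf_def)
 fix A :: "real set"
 show "spec_proj lam (A \<inter> B) = op_comp (spec_proj lam A) (spec_proj lam B)" unfolding spec_proj_lop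
  by (subst op_comp_lop) (auto intro!: bdd_map_l2[OF bdd_spec_proj] bdd_map_l2[OF bdd_spec_proj, unfolded mf_def] lop_cong simp: mf_def)
next
 fix B :: "nat => real set" and x
 assume B: "range B <= sets borel" "disjoint_family B" and x: "x : carrier V"
 let ?N = "atomic_measure (%m. (norm (W x m))\<^sup>2) lam"
 have em: "emeasure ?N C = ennreal (\<Sum>\<^sub>\<infinity>m. if lam m : C then (norm (W x m))\<^sup>2 else 0)"
  if "C : sets borel" for C
  by (rule emeasure_atomic_measure) (use that l2_summable[OF W_l2[OF x]] in auto)
 interpret finite_measure ?N by standard (simp add: em)
 have "measure ?N C = Re (ip V x (ap (spec_proj lam C) x))" if "C : sets borel" for C
  using em[OF that] by (simp add: measure_def ip_spec_proj[OF x] infsum_nonneg)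
 then have "(%i. Re (ip V x (ap (spec_proj lam (B i)) x))) sums Re (ip V x (ap (spec_proj lam (\<Union>i. B i)) x))"
  using finite_measure_UNION[of B] B by (auto simp: subset_iff)
 then show "(%i. ip V x (ap (spec_proj lam (B i)) x)) sums ip V x (ap (spec_proj lam (\<Union>i. B i)) x)"
  unfolding ip_spec_proj[OF x] by (simp add: sums_of_real_iff)
qed

abbreviation scalar_mop :: "('n mi => real) => 'v oper" where
 "scalar_mop lam \<equiv> mop (%m v. of_real (lam m) *s v)"

lemma flin_scalar: "flin (%v. c *s v)" by (intro flin_intros)

lemma spectral_resolution_scalar: "spectral_resolution V (spec_proj lam) (scalar_mop lam)"
 unfolding spectral_resolution_def
proof (intro conjI)
 show "spectral_measure V (spec_proj lam)" by (rule spectral_measure_spec_proj)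
 show "linear_op V (scalar_mop lam)" by (rule linear_op_mop) (rule flin_scalar)
 have int: "integrable (spectral_dist V (spec_proj lam) x) (%t. t\<^sup>2) \<longleftrightarrow> W x : md (%m v. of_real (lam m) *s v)"
  if x: "x : carrier V" for x unfolding spectral_dist_spec_proj[OF x] by (subst atomic_measure_integrable)
   (use x l2_summable[OF W_l2[OF x]] in \<open>auto simp: md_def mf_def l2_def power_mult_distrib mult.commute\<close>)
 show "Domain (scalar_mop lam) = {x : carrier V. integrable (spectral_dist V (spec_proj lam) x) (%t. t\<^sup>2)}"
  unfolding mop_def using int by (subst Domain_lop) (auto simp: md_mf)
 show "\<forall>(x, y)\<in>scalar_mop lam. ip V x y = of_real (\<integral>t. t \<partial>spectral_dist V (spec_proj lam) x)"
 proof clarify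
  fix x y assume "(x, y) : scalar_mop lam"
  then have x: "x : carrier V" "y : carrier V" "W y = (%m. of_real (lam m) *s W x m)"
   by (auto simp: mop_def lop_def mf_def)
  have h: "hdot (W x m) (W y m) = of_real ((norm (W x m))\<^sup>2 * lam m)" for m
   by (simp add: x(3) hdot_smult hdot_self mult.commute)
  have s: "(%m. \<bar>(norm (W x m))\<^sup>2 * lam m\<bar>) summable_on UNIV"
   using l2_ip_summable[OF W_l2[OF x(1)] W_l2[OF x(2)]] unfolding h norm_of_real .
  show "ip V x y = of_real (\<integral>t. t \<partial>spectral_dist V (spec_proj lam) x)"
   unfolding spectral_dist_spec_proj[OF x(1)]
   by (subst atomic_measure_integral[OF _ _ s]) (auto simp only: W_ip[OF x(1,2)] l2_ip_def h infsum_of_real_complex, auto)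
 qed
qed

lemma heat_trace_class_scalar:
 assumes lam: "!!m. 0 <= lam m" and s: "!!ep. ep > 0 ==> (%m. exp (- ep * lam m)) summable_on UNIV"
 shows "heat_trace_class V (scalar_mop lam)" unfolding heat_trace_class_def
proof (intro allI impI)
 fix ep :: real assume ep: "ep > 0"
 let ?e = "%m. exp (- ep * lam m)"
 let ?f = "mf (%m v. of_real (?e m) *s v) :: _ => ('n,'t) vf"
 have e1: "?e m <= 1" for m using lam[of m] ep by simp
 have bdd: "bdd_map ?f"
  by (rule bdd_map_mf(1)[where C = 1]) (use lam ep in \<open>auto intro: flin_scalar intro!: mult_left_le_one_le\<close>)
 let ?B = "lop l2 ?f"
 have B: "bounded_op V ?B" by (rule bounded_op_lop[OF bdd])
 have sa: "op_adj V ?B = ?B" by (rule op_adj_bdd[OF bdd bdd_map_l2[OF bdd] _ fin_supp_l2 order_refl])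
   (auto simp: l2_ip_def mf_def hdot_smult intro!: infsum_cong)
 have ipB: "ip V x y = of_real (\<Sum>\<^sub>\<infinity>m. (norm (W x m))\<^sup>2 * ?e m)" if "(x, y) : ?B" for x y
 proof -
  have x: "x : carrier V" "y : carrier V" "W y = ?f (W x)" using that by (auto simp: lop_def)
  have "hdot (W x m) (W y m) = of_real ((norm (W x m))\<^sup>2 * ?e m)" for m
   by (simp add: x(3) mf_def hdot_smult hdot_self mult.commute)
  then show ?thesis by (simp only: W_ip[OF x(1,2)] l2_ip_def infsum_of_real_complex)
 qed
 have "functional_calculus V (scalar_mop lam) (%t. exp (- ep * t)) ?B" unfolding functional_calculus_def
 proof (intro conjI B exI[of _ "spec_proj lam"] spectral_resolution_scalar)
  show "\<forall>(x, y)\<in>?B. integrable (spectral_dist V (spec_proj lam) x) (%t. exp (- ep * t)) \<and>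
    ip V x y = of_real (\<integral>t. exp (- ep * t) \<partial>spectral_dist V (spec_proj lam) x)"
  proof clarify
   fix x y assume xy: "(x, y) : ?B"
   then have x: "x : carrier V" by (auto simp: lop_def)
   have ss: "(%m. \<bar>(norm (W x m))\<^sup>2 * ?e m\<bar>) summable_on UNIV"
    by (rule summable_on_le_nonneg[OF l2_summable[OF W_l2[OF x]]])
     (use lam ep in \<open>auto simp: abs_mult intro!: mult_right_le_one_le\<close>)
   show "integrable (spectral_dist V (spec_proj lam) x) (%t. exp (- ep * t)) \<and>
     ip V x y = of_real (\<integral>t. exp (- ep * t) \<partial>spectral_dist V (spec_proj lam) x)"
    unfolding spectral_dist_spec_proj[OF x] ipB[OF xy]
    by (subst atomic_measure_integrable, simp, simp, subst atomic_measure_integral, simp, simp)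
     (use ss in auto)
  qed
 qed
 moreover have "trace_class V ?B" unfolding trace_class_def
 proof (intro conjI B exI[of _ ?B])
  show "positive_op V ?B" unfolding positive_op_def using B ipB by (auto intro!: infsum_nonneg)
  show "op_comp ?B ?B = op_comp (op_adj V ?B) ?B" by (simp only: sa)
  let ?b = "%(m::'n mi, i::'t). Winv (delta m (axis i 1))"
  have ne: "hdot (axis i 1) (axis j 1) = (if i = j then 1 else 0)" for i j :: 't
   unfolding hdot_axis by (simp add: axis_def)
  have ip: "ip V (?b (m, i)) (?b (p, j)) = (if m = p & i = j then 1 else 0)" for m p i j
   by (simp add: W_ip l2_ip_delta) (auto simp: delta_def ne)
  have inj: "inj ?b"
  proof (rule injI)
   fix a c assume ac: "?b a = ?b c"
   obtain m i p j where [simp]: "a = (m, i)" "c = (p, j)" by fastforce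
   have "ip V (?b (m, i)) (?b (p, j)) = 1" using ac ip[of m i m i] by simp
   then show "a = c" using ip[of m i p j] by (auto split: if_splits)
  qed
  show "\<exists>\<B>. orthonormal_basis V \<B> & (%e. Re (ip V e (ap ?B e))) summable_on \<B>"
  proof (intro exI[of _ "range ?b"] conjI)
   show "orthonormal_basis V (range ?b)" unfolding orthonormal_basis_def
   proof (intro conjI ballI impI)
    fix e f assume "e : range ?b" "f : range ?b"
    then obtain m i p j where ef: "e = ?b (m, i)" "f = ?b (p, j)" by auto
    show "ip V e f = (if e = f then 1 else 0)"
     unfolding ef ip using inj_eq[OF inj, of "(m, i)" "(p, j)"] by simp
   next
    fix x assume x: "x : carrier V" "\<forall>e\<in>range ?b. ip V e x = 0"
    have "W x m $ i = 0" for m i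
    proof -
     have "ip V (?b (m, i)) x = 0" using x(2) by (rule bspec) (rule rangeI)
     then show ?thesis using x(1) by (simp add: W_ip l2_ip_delta hdot_axis)
    qed
    then show "x = \<zero>\<^bsub>V\<^esub>" by (intro eq_by_W x) (auto simp: vec_eq_iff)
   qed auto
   have "Re (ip V (?b q) (ap ?B (?b q))) = ?e (fst q)" for q
   proof -
    obtain m i where q: "q = (m, i)" by fastforce
    have "?f (delta m (axis i 1)) = delta m (of_real (?e m) *s axis i 1)"
     by (rule mf_delta) (rule flin_scalar)
    then show ?thesis by (simp add: q ap_lop W_ip l2_ip_delta) (simp add: delta_def hdot_smult ne)
   qed
   moreover have "(%q::'n mi \<times> 't. ?e (fst q)) summable_on UNIV"
    using summable_on_prod_nonneg[OF s[OF ep], of "%_::'t. 1" UNIV] by (simp add: case_prod_unfold)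
   ultimately have "((%e. Re (ip V e (ap ?B e))) \<circ> ?b) summable_on UNIV" by (simp add: o_def)
   then show "(%e. Re (ip V e (ap ?B e))) summable_on range ?b"
    using summable_on_reindex[OF inj] by blast
  qed
 qed
 ultimately show "\<exists>B. functional_calculus V (scalar_mop lam) (%t. exp (- ep * t)) B & trace_class V B"
  by blast
qed

end

section \<open>The Laplacian symbol\<close>

definition msq :: "'n::finite multi_index => real" where
 "msq m = (\<Sum>j\<in>UNIV. (real_of_int (m $ j))\<^sup>2)"

lemma msq_nonneg [simp]: "0 <= msq m" by (simp add: msq_def sum_nonneg)

lemma wt_le_msq: "wt m <= 1 + msq m" unfolding wt_def msq_def
proof (intro add_left_mono sum_mono)
 fix j
 have "\<bar>m $ j\<bar> * 1 <= \<bar>m $ j\<bar> * \<bar>m $ j\<bar>"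
  by (cases "m $ j = 0") (auto intro!: mult_left_mono simp del: abs_mult_self_eq mult_1_right)
 also have "\<bar>m $ j\<bar> * \<bar>m $ j\<bar> = (m $ j)\<^sup>2" by (simp add: power2_eq_square abs_mult_self_eq)
 finally have "\<bar>m $ j\<bar> <= (m $ j)\<^sup>2" by simp
 then have "real_of_int \<bar>m $ j\<bar> <= real_of_int ((m $ j)\<^sup>2)" by (rule of_int_le_iff[THEN iffD2])
 then show "real_of_int \<bar>m $ j\<bar> <= (real_of_int (m $ j))\<^sup>2" by simp
qed

lemma summable_exp_msq:
 assumes "ep > 0" shows "(%m::'n::finite multi_index. exp (- ep * msq m)) summable_on UNIV"
proof -
 let ?k = "2 * CARD('n)"
 define \<delta> where "\<delta> = ep / real ?k"
 have \<delta>: "\<delta> > 0" using assms by (simp add: \<delta>_def)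
 define c where "c = min 1 \<delta>"
 have c: "c > 0" "c <= 1" "c <= \<delta>" using \<delta> by (auto simp: c_def)
 have "(%m::'n mi. (1 / c) ^ ?k * (1 / wt m ^ ?k)) summable_on UNIV"
  by (intro summable_on_cmult_right summable_inverse_wt_power)
 then show ?thesis
 proof (rule summable_on_le_nonneg)
  fix m :: "'n mi"
  have "c * wt m <= c * (1 + msq m)" using c(1) wt_le_msq[of m] by (intro mult_left_mono) auto
  also have "... <= 1 + \<delta> * msq m"
   using c(2) mult_right_mono[OF c(3) msq_nonneg[of m]] by (simp add: distrib_left)
  also have "... <= exp (\<delta> * msq m)" by (rule exp_ge_add_one_self)
  finally have "(c * wt m) ^ ?k <= exp (\<delta> * msq m) ^ ?k"
   using c(1) wt_pos[of m] by (intro power_mono) auto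
  also have "exp (\<delta> * msq m) ^ ?k = exp (ep * msq m)"
   by (simp add: \<delta>_def exp_of_nat_mult[symmetric])
  finally have "(c * wt m) ^ ?k <= exp (ep * msq m)" .
  then have "1 / exp (ep * msq m) <= 1 / (c * wt m) ^ ?k"
   using c(1) wt_pos[of m] by (intro divide_left_mono) auto
  then show "exp (- ep * msq m) <= (1 / c) ^ ?k * (1 / wt m ^ ?k)"
   by (simp add: exp_minus divide_inverse power_mult_distrib power_inverse)
 qed simp
qed

section \<open>The smooth algebra of the noncommutative torus\<close>

lemma nc_torus_sel [simp]: "carrier (nc_torus Th) = {a. rd a}" "mult (nc_torus Th) = tconv Th"
 "one (nc_torus Th) = (%m. if m = 0 then 1 else 0)" "zero (nc_torus Th) = (%m. 0)"
 "add (nc_torus Th) = (%a b m. a m + b m)" "module.smult (nc_torus Th) = (%c a m. c * a m)"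
 "star (nc_torus Th) = tstar Th" by (simp_all add: nc_torus_def tconv_def tstar_def fun_eq_iff)

definition l1 :: "('n::finite multi_index => complex) => bool" where
 "l1 a \<longleftrightarrow> (%m. cmod (a m)) summable_on UNIV"

lemma l1_rd [simp]: "rd a ==> l1 a" by (simp add: l1_def rd_norm_summable)

lemma l1_bounded: assumes "l1 a" obtains B where "!!m. cmod (a m) <= B"
 using norm_le_infsum[OF assms[unfolded l1_def]] by blast

lemma rd_bounded:
 assumes "rd a" obtains B where "!!m. cmod (a m) <= B" using l1_bounded[OF l1_rd[OF assms]] by blast

lemma tconv_assoc_rd:
 assumes "rd a" "rd b" "rd c" shows "tconv Th (tconv Th a b) c = tconv Th a (tconv Th b c)"
proof -
 obtain B where "!!m. cmod (c m) <= B" using rd_bounded[OF assms(3)] by blast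
 then show ?thesis by (intro tconv_assoc_left rd_norm_summable assms)
qed

lemma tconv_add_rd:
 assumes "rd a" "rd b" "rd c" shows "tconv Th (%m. a m + b m) c = (%m. tconv Th a c m + tconv Th b c m)"
  "tconv Th c (%m. a m + b m) = (%m. tconv Th c a m + tconv Th c b m)"
proof -
 obtain A where "!!m. cmod (a m) <= A" using rd_bounded[OF assms(1)] by blast
 moreover obtain B where "!!m. cmod (b m) <= B" using rd_bounded[OF assms(2)] by blast
 moreover obtain C where "!!m. cmod (c m) <= C" using rd_bounded[OF assms(3)] by blast
 ultimately have b: "!!m. cmod (a m) <= A" "!!m. cmod (b m) <= B" "!!m. cmod (c m) <= C" by auto
 note n = assms[THEN rd_norm_summable]
 show "tconv Th (%m. a m + b m) c = (%m. tconv Th a c m + tconv Th b c m)"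
  by (rule ext, rule tconv_add_left[OF n(1,2) b(3)])
 show "tconv Th c (%m. a m + b m) = (%m. tconv Th c a m + tconv Th c b m)"
  by (rule ext, rule tconv_add_right[OF n(3) b(1,2)])
qed

lemma tconv_sum_rd:
 assumes "!!i. i : I ==> rd (a i)" "rd c"
 shows "tconv Th (%m. \<Sum>i\<in>I. a i m) c = (%m. \<Sum>i\<in>I. tconv Th (a i) c m)"
  "tconv Th c (%m. \<Sum>i\<in>I. a i m) = (%m. \<Sum>i\<in>I. tconv Th c (a i) m)"
proof -
 have "tconv Th (%m. \<Sum>i\<in>I. a i m) c = (%m. \<Sum>i\<in>I. tconv Th (a i) c m) \<and>
  tconv Th c (%m. \<Sum>i\<in>I. a i m) = (%m. \<Sum>i\<in>I. tconv Th c (a i) m)" using assms(1)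
 proof (induction I rule: infinite_finite_induct)
  case (insert x F)
  then show ?case by (simp add: tconv_add_rd[OF _ rd_sum assms(2)])
 qed (auto simp: fun_eq_iff)
 then show "tconv Th (%m. \<Sum>i\<in>I. a i m) c = (%m. \<Sum>i\<in>I. tconv Th (a i) c m)"
  "tconv Th c (%m. \<Sum>i\<in>I. a i m) = (%m. \<Sum>i\<in>I. tconv Th c (a i) m)" by blast+
qed

lemma rd_unit: "rd (%m. if m = 0 then 1 else 0)" by (rule rd_single)

lemma tconv_unit' [simp]: "tconv Th (%m. if m = 0 then 1 else 0) f = f"
 "tconv Th f (%m. if m = 0 then 1 else 0) = f" by (auto simp: fun_eq_iff tconv_unit)

lemma tstar_add: "tstar Th (%m. a m + b m) = (%m. tstar Th a m + tstar Th b m)"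
 and tstar_cmult: "tstar Th (%m. c * a m) = (%m. cnj c * tstar Th a m)"
 and tstar_unit: "tstar Th (%m. if m = 0 then 1 else 0) = (%m. if m = 0 then 1 else 0)"
 by (auto simp: tstar_def fun_eq_iff algebra_simps)

lemma abelian_group_nc_torus: "abelian_group (nc_torus Th)"
proof (rule abelian_groupI)
 show "\<exists>y\<in>carrier (nc_torus Th). y \<oplus>\<^bsub>nc_torus Th\<^esub> x = \<zero>\<^bsub>nc_torus Th\<^esub>"
  if "x : carrier (nc_torus Th)" for x
  by (rule bexI[of _ "%m. (-1) * x m"]) (use that rd_cmult[of x "-1"] in auto)
qed (auto intro: rd_add simp: rd_0 algebra_simps)

lemma unital_star_algebra_nc_torus: "unital_star_algebra (nc_torus Th)"
proof -
 have "monoid (nc_torus Th)" by (rule monoidI) (auto intro: rd_tconv rd_unit tconv_assoc_rd)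
 then have "Ring.ring (nc_torus Th)" by (intro ringI abelian_group_nc_torus) (auto simp: tconv_add_rd)
 moreover have "Module.module complex_field (nc_torus Th)"
 proof (rule moduleI[OF _ abelian_group_nc_torus])
  show "cring complex_field"
  proof (rule cringI)
   show "abelian_group complex_field"
   proof (rule abelian_groupI)
    show "\<exists>y\<in>carrier complex_field. y \<oplus>\<^bsub>complex_field\<^esub> x = \<zero>\<^bsub>complex_field\<^esub>" for x
     by (rule bexI[of _ "- x"]) (auto simp: complex_field_def)
   qed (auto simp: complex_field_def)
   show "comm_monoid complex_field" by (rule comm_monoidI) (auto simp: complex_field_def)
  qed (auto simp: complex_field_def algebra_simps)
 qed (auto simp: complex_field_def algebra_simps intro: rd_cmult)
 ultimately show ?thesis unfolding unital_star_algebra_def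
  by (auto simp: fun_eq_iff tconv_cmult tstar_tstar tstar_add tstar_tconv tstar_cmult intro: rd_tstar)
qed

section \<open>The regular representation on vector valued functions\<close>

definition conv :: "'n::{finite, linorder} rmatrix => ('n mi => complex) =>
  ('n mi => complex^'t::finite) => ('n,'t) vf" where
 "conv Th a F m = (\<Sum>\<^sub>\<infinity>p. (a p * cocycle Th p (m - p)) *s F (m - p))"

definition rconv :: "'n::{finite, linorder} rmatrix => ('n mi => complex^'t::finite) =>
  ('n mi => complex) => ('n,'t) vf" where
 "rconv Th F b m = (\<chi> i. tconv Th (%p. F p $ i) b m)"

lemma bounded_linear_nth: "bounded_linear (%v::complex^'t::finite. v $ i)" by (rule bounded_linear_vec_nth)

lemma conv_has_sum:
 fixes F :: "'n::{finite, linorder} multi_index => complex^'t::finite"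
 assumes a: "l1 a" and F: "F : l2"
 shows "((%p. (a p * cocycle Th p (m - p)) *s F (m - p)) has_sum conv Th a F m) UNIV"
proof -
 have "(%p. norm ((a p * cocycle Th p (m - p)) *s F (m - p))) summable_on UNIV"
 proof (rule norm_summable_le)
  show "(%p. cmod (a p) * nl2 F) summable_on UNIV"
   using a unfolding l1_def by (rule summable_on_cmult_left)
  show "norm ((a p * cocycle Th p (m - p)) *s F (m - p)) <= cmod (a p) * nl2 F" for p
   using norm_le_nl2[OF F, of "m - p"] by (simp add: norm_mult mult_left_mono)
 qed
 then show ?thesis unfolding conv_def by (rule has_sum_infsum[OF norm_summable_summable])
qed

lemma conv_component:
 assumes "l1 a" "F : l2" shows "conv Th a F m $ i = tconv Th a (%m. F m $ i) m"
proof -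
 have "((%p. ((a p * cocycle Th p (m - p)) *s F (m - p)) $ i) has_sum conv Th a F m $ i) UNIV"
  using has_sum_bounded_linear[OF bounded_linear_nth conv_has_sum[OF assms]] by (simp add: o_def)
 then show ?thesis unfolding tconv_def by (intro infsumI[symmetric]) (simp add: mult_ac)
qed

lemma conv_eq_vec: "l1 a ==> F : l2 ==> conv Th a F = (%m. \<chi> i. tconv Th a (%m. F m $ i) m)"
 by (simp add: fun_eq_iff vec_eq_iff conv_component)

lemma rconv_component [simp]: "rconv Th F b m $ i = tconv Th (%p. F p $ i) b m" by (simp add: rconv_def)

lemma l2_component: "F : l2 ==> sq_summable (%m. F m $ i)" by (simp add: l2_iff_components)

lemma conv_l2:
 assumes a: "l1 a" and F: "F : l2" shows "conv Th a F : l2"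
 unfolding l2_iff_components conv_component[OF assms]
 using tconv_sq_summable(1)[OF a[unfolded l1_def] l2_component[OF F]] by simp

lemma conv_norm:
 assumes a: "l1 a" and F: "F : l2"
 shows "nl2 (conv Th a F) <= (\<Sum>\<^sub>\<infinity>p. cmod (a p)) * nl2 F"
proof (rule power2_le_imp_le)
 have "(nl2 (conv Th a F))\<^sup>2 = (\<Sum>i\<in>UNIV. \<Sum>\<^sub>\<infinity>m. (cmod (tconv Th a (%m. F m $ i) m))\<^sup>2)"
  by (simp add: l2_power2_norm conv_l2 assms conv_component)
 also have "... <= (\<Sum>i\<in>UNIV. (\<Sum>\<^sub>\<infinity>p. cmod (a p))\<^sup>2 * (\<Sum>\<^sub>\<infinity>m. (cmod (F m $ i))\<^sup>2))"
  by (intro sum_mono tconv_sq_summable(2) a[unfolded l1_def] l2_component F)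
 also have "... = ((\<Sum>\<^sub>\<infinity>p. cmod (a p)) * nl2 F)\<^sup>2"
  by (simp add: l2_power2_norm F power_mult_distrib sum_distrib_left)
 finally show "(nl2 (conv Th a F))\<^sup>2 <= ((\<Sum>\<^sub>\<infinity>p. cmod (a p)) * nl2 F)\<^sup>2" .
qed (simp add: infsum_nonneg)

lemma conv_add_vec:
 assumes "l1 a" "F : l2" "G : l2" shows "conv Th a (%m. F m + G m) = (%m. conv Th a F m + conv Th a G m)"
proof -
 have "tconv Th a (%m. F m $ i + G m $ i) m = tconv Th a (%m. F m $ i) m + tconv Th a (%m. G m $ i) m" for i m
  by (rule tconv_add_right[OF assms(1)[unfolded l1_def] l2_bounded_components l2_bounded_components])
   (use assms in auto)
 then show ?thesis by (simp add: conv_eq_vec assms fun_eq_iff vec_eq_iff)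
qed

lemma conv_smult_vec: "l1 a ==> F : l2 ==> conv Th a (%m. c *s F m) = (%m. c *s conv Th a F m)"
 by (simp add: conv_eq_vec fun_eq_iff vec_eq_iff tconv_cmult)

lemma conv_add:
 assumes "l1 a" "l1 b" "F : l2" shows "conv Th (%m. a m + b m) F = (%m. conv Th a F m + conv Th b F m)"
proof -
 have ab: "l1 (%m. a m + b m)" unfolding l1_def
  by (rule norm_summable_le[OF summable_on_add[OF assms(1,2)[unfolded l1_def]]]) (rule norm_triangle_ineq)
 have "tconv Th (%m. a m + b m) (%m. F m $ i) m = tconv Th a (%m. F m $ i) m + tconv Th b (%m. F m $ i) m" for i m
  by (rule tconv_add_left[OF assms(1,2)[unfolded l1_def] l2_bounded_components]) (use assms in auto)
 then show ?thesis by (simp add: conv_eq_vec assms ab fun_eq_iff vec_eq_iff)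
qed

lemma l1_cmult: "l1 a ==> l1 (%m. c * a m)" unfolding l1_def norm_mult by (rule summable_on_cmult_right)

lemma conv_cmult: "l1 a ==> F : l2 ==> conv Th (%m. c * a m) F = (%m. c *s conv Th a F m)"
 by (simp add: conv_eq_vec l1_cmult fun_eq_iff vec_eq_iff tconv_cmult)

lemma conv_unit: "F : l2 ==> conv Th (%m. if m = 0 then 1 else 0) F = F" by (simp add: conv_eq_vec rd_unit)

lemma conv_0: "F : l2 ==> conv Th (%m. 0) F = (%m. 0)" by (simp add: conv_eq_vec rd_0 fun_eq_iff vec_eq_iff)

lemma conv_tconv:
 assumes a: "rd a" "rd b" and F: "F : l2" shows "conv Th (tconv Th a b) F = conv Th a (conv Th b F)"
proof -
 have "tconv Th (tconv Th a b) (%m. F m $ i) = tconv Th a (tconv Th b (%m. F m $ i))" for i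
  by (rule tconv_assoc_left[OF _ _ l2_bounded_components[OF F]])
   (use a in \<open>auto intro: rd_norm_summable\<close>)
 moreover have "tconv Th b (%m. F m $ i) = (%m. conv Th b F m $ i)" for i
  using conv_component[OF l1_rd[OF a(2)] F] by (simp add: fun_eq_iff)
 ultimately have "conv Th (tconv Th a b) F m $ i = conv Th a (conv Th b F) m $ i" for m i
  using conv_component[OF l1_rd[OF rd_tconv[OF a]] F]
   conv_component[OF l1_rd[OF a(1)] conv_l2[OF l1_rd[OF a(2)] F]] by simp
 then show ?thesis by (intro ext iffD2[OF vec_eq_iff] allI)
qed

lemma conv_rconv:
 assumes a: "l1 a" and b: "l1 b" and F: "F : l2" and r: "rconv Th F b : l2"
 shows "conv Th a (rconv Th F b) = rconv Th (conv Th a F) b"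
proof -
 have "tconv Th (tconv Th a (%m. F m $ i)) b = tconv Th a (tconv Th (%m. F m $ i) b)" for i
  by (rule tconv_assoc_mid[OF a[unfolded l1_def] b[unfolded l1_def] l2_bounded_components[OF F]])
 then show ?thesis by (simp add: fun_eq_iff vec_eq_iff conv_component a r F)
qed

lemma l2_ip_components:
 assumes "F : l2" "G : l2"
 shows "l2_ip F G = (\<Sum>i\<in>UNIV. \<Sum>\<^sub>\<infinity>m. cnj (F m $ i) * G m $ i)"
 unfolding l2_ip_def hdot_def by (rule summable_on_finite_sum(2))
  (rule norm_summable_summable[OF sq_summable_mult[OF l2_component[OF assms(1)] l2_component[OF assms(2)]]])

lemma l1_tstar: "l1 a ==> l1 (tstar Th a)" unfolding l1_def by (rule norm_summable_tstar)

lemma conv_adj: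
 assumes a: "l1 a" and F: "F : l2" "G : l2"
 shows "l2_ip G (conv Th a F) = l2_ip (conv Th (tstar Th a) G) F"
 by (simp add: l2_ip_components conv_l2 l1_tstar conv_component assms
   tconv_adjoint[OF a[unfolded l1_def] l2_component[OF F(1)] l2_component[OF F(2)]])

lemma conv_fibre:
 assumes L: "flin L" and a: "l1 a" and F: "F : l2" shows "L (conv Th a F m) = conv Th a (%m. L (F m)) m"
proof -
 have "((%p. L ((a p * cocycle Th p (m - p)) *s F (m - p))) has_sum L (conv Th a F m)) UNIV"
  using has_sum_bounded_linear[OF flin_bounded_linear[OF L] conv_has_sum[OF a F]] by (simp add: o_def)
 then show ?thesis unfolding conv_def[of Th a "%m. L (F m)"]
  by (intro infsumI[symmetric]) (simp add: flin_smult[OF L])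
qed

lemma l2_fibre: "flin L ==> F : l2 ==> (%m. L (F m)) : l2" by (metis flin_bound l2_le)

lemma conv_delta: "conv Th a (delta 0 v) m = a m *s v"
proof -
 have "conv Th a (delta 0 v) m = (\<Sum>\<^sub>\<infinity>p\<in>{m}. (a p * cocycle Th p (m - p)) *s delta 0 v (m - p))"
  unfolding conv_def by (rule infsum_cong_neutral) (auto simp: delta_def)
 then show ?thesis by (simp add: delta_def)
qed

section \<open>First order symbols\<close>

definition pd :: "'n::finite => ('n mi => complex) => 'n mi => complex" where
 "pd j a m = \<i> * of_int (m $ j) * a m"

definition fo :: "('n::finite => complex^'t::finite => complex^'t) => 'n mi =>
  complex^'t => complex^'t" where
 "fo A m v = (\<Sum>j\<in>UNIV. (\<i> * of_int (m $ j)) *s A j v)"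

text \<open>The bounded extension of a commutator of a first order symbol with the algebra has this form, with
  \<open>b\<^sub>j\<close> the \<open>j\<close>-th derivative of the algebra element.\<close>

definition oneform :: "'n::{finite, linorder} rmatrix => ('n => complex^'t::finite => complex^'t) =>
  ('n => 'n mi => complex) => (('n,'t) vf) => ('n,'t) vf" where
 "oneform Th A b F m = (\<Sum>j\<in>UNIV. A j (conv Th (b j) F m))"

lemma rd_pd: "rd a ==> rd (pd j a)" by (rule rd_le_power[where C = 1 and l = 1])
  (auto simp: pd_def norm_mult intro!: mult_right_mono abs_component_le_wt[simplified])

lemma fo_linear: "(!!j. flin (A j)) ==> flin (fo A m)" unfolding fo_def by (intro flin_sumI flin_intros)

lemma fo_diff: "fo A (m - p) v = fo A m v - fo A p v"
 by (simp add: fo_def sum_subtractf vec_eq_iff algebra_simps)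

lemma has_sum_sum_fin:
 fixes f :: "'i => 'a => 'b::real_normed_vector"
 assumes "!!i. i : I ==> (f i has_sum S i) A"
 shows "((%x. \<Sum>i\<in>I. f i x) has_sum (\<Sum>i\<in>I. S i)) A"
 using assms by (induction I rule: infinite_finite_induct) (auto intro: has_sum_add)

text \<open>The symbol is additive in the momentum, so commuting it past a twisted convolution leaves
 the symbol evaluated at the momentum of the algebra element, which differentiates it.\<close>

lemma fo_conv:
 assumes A: "!!j. flin (A j)" and a: "rd a" and F: "F : l2" "mf (fo A) F : l2"
 shows "fo A m (conv Th a F m) = conv Th a (mf (fo A) F) m + oneform Th A (%j. pd j a) F m"
proof -
 note la = l1_rd[OF a]
 let ?c = "%p. cocycle Th p (m - p)"
 have 1: "((%p. fo A m ((a p * ?c p) *s F (m - p))) has_sum fo A m (conv Th a F m)) UNIV"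
  using has_sum_bounded_linear[OF flin_bounded_linear[OF fo_linear[of A, OF A]] conv_has_sum[OF la F(1)]]
  by (simp add: o_def)
 have 2: "((%p. (a p * ?c p) *s mf (fo A) F (m - p)) has_sum conv Th a (mf (fo A) F) m) UNIV"
  by (rule conv_has_sum[OF la F(2)])
 have "((%p. A j ((pd j a p * ?c p) *s F (m - p))) has_sum A j (conv Th (pd j a) F m)) UNIV" for j
  using has_sum_bounded_linear[OF flin_bounded_linear[OF A] conv_has_sum[OF l1_rd[OF rd_pd[OF a]] F(1)]]
  by (simp add: o_def)
 then have 3: "((%p. \<Sum>j\<in>UNIV. A j ((pd j a p * ?c p) *s F (m - p))) has_sum oneform Th A (%j. pd j a) F m) UNIV"
  unfolding oneform_def by (rule has_sum_sum_fin)
 have "fo A m ((a p * ?c p) *s F (m - p)) = (a p * ?c p) *s mf (fo A) F (m - p) +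
   (\<Sum>j\<in>UNIV. A j ((pd j a p * ?c p) *s F (m - p)))" for p
 proof -
  have "(\<Sum>j\<in>UNIV. A j ((pd j a p * ?c p) *s F (m - p))) = (a p * ?c p) *s fo A p (F (m - p))"
   by (simp add: fo_def flin_smult[OF A] pd_def vec_eq_iff sum_distrib_left mult_ac)
  then show ?thesis
   by (simp add: mf_def fo_diff flin_smult[OF fo_linear[of A, OF A]] vec_eq_iff algebra_simps)
 qed
 then have "((%p. fo A m ((a p * ?c p) *s F (m - p))) has_sum
   (conv Th a (mf (fo A) F) m + oneform Th A (%j. pd j a) F m)) UNIV" using has_sum_add[OF 2 3] by simp
 with 1 show ?thesis by (rule has_sum_unique)
qed

definition RD :: "('n::finite multi_index => complex^'t::finite) set" where
 "RD = {F. \<forall>i. rd (%m. F m $ i)}"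

lemma RD_l2: "RD <= l2" by (auto simp: RD_def l2_iff_components rd_sq_summable)

lemma RD_add: "F : RD ==> G : RD ==> (%m. F m + G m) : RD" by (simp add: RD_def rd_add)

lemma RD_smult: "F : RD ==> (%m. c *s F m) : RD" by (simp add: RD_def rd_cmult)

lemma RD_zero: "(%m. 0) : RD" by (simp add: RD_def rd_0)

lemma RD_sum: "(!!i. i : I ==> F i : RD) ==> (%m. \<Sum>i\<in>I. F i m) : RD"
 by (induction I rule: infinite_finite_induct) (auto intro: RD_add simp: RD_zero)

lemma fin_supp_RD: "fin_supp <= RD"
proof
 fix F :: "'a multi_index => complex^'b" assume "F : fin_supp"
 then have fin: "finite {m. F m ~= 0}" by (simp add: fin_supp_def)
 have "F m $ i = (\<Sum>p\<in>{m. F m ~= 0}. if m = p then F p $ i else 0)" for m i using fin by simp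
 then have "(%m. F m $ i) = (%m. \<Sum>p\<in>{m. F m ~= 0}. if m = p then F p $ i else 0)" for i by blast
 moreover have "rd (%m. \<Sum>p\<in>{m. F m ~= 0}. if m = p then F p $ i else 0)" for i
  by (rule rd_sum) (rule rd_single)
 ultimately show "F : RD" by (simp add: RD_def)
qed

lemma RD_fibre:
 assumes L: "flin L" and F: "F : RD" shows "(%m. L (F m)) : RD"
proof -
 have eq: "L v = (\<Sum>k\<in>UNIV. v $ k *s L (axis k 1))" for v
 proof -
  have "v = (\<Sum>k\<in>UNIV. v $ k *s axis k 1)" by (simp add: basis_expansion)
  then have "L v = L (\<Sum>k\<in>UNIV. v $ k *s axis k 1)" by simp
  then show ?thesis by (simp add: flin_sum[OF L] flin_smult[OF L])
 qed
 have "L (F m) $ i = (\<Sum>k\<in>UNIV. L (axis k 1) $ i * F m $ k)" for i m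
  using arg_cong[OF eq[of "F m"], of "%v. v $ i"] by (simp add: mult.commute)
 then show ?thesis using F unfolding RD_def by (auto intro!: rd_sum rd_cmult)
qed

lemma RD_mult_coord: "F : RD ==> (%m. (\<i> * of_int (m $ j)) *s F m) : RD"
 using rd_pd by (auto simp: RD_def pd_def[abs_def])

lemma RD_fo: "(!!j. flin (A j)) ==> F : RD ==> mf (fo A) F : RD"
 unfolding mf_def fo_def by (rule RD_sum, rule RD_mult_coord, rule RD_fibre)

lemma RD_md_fo: "(!!j. flin (A j)) ==> RD <= md (fo A)" using RD_l2 RD_fo by (fastforce simp: md_def)

lemma RD_conv:
 assumes "rd a" "F : RD" shows "conv Th a F : RD"
proof -
 have "F : l2" using assms(2) RD_l2 by blast
 then show ?thesis using assms by (auto simp: RD_def conv_component intro: rd_tconv)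
qed

lemma conv_md_fo:
 assumes A: "!!j. flin (A j)" and a: "rd a" and F: "F : md (fo A)" shows "conv Th a F : md (fo A)"
  and "(%m. mf (fo A) (conv Th a F) m - conv Th a (mf (fo A) F) m) = oneform Th A (%j. pd j a) F"
proof -
 have F': "F : l2" "mf (fo A) F : l2" using F by (auto simp: md_def)
 have eq: "mf (fo A) (conv Th a F) = (%m. conv Th a (mf (fo A) F) m + oneform Th A (%j. pd j a) F m)"
  unfolding mf_def[of "fo A" "conv Th a F"] using fo_conv[OF A a F'] by blast
 have "oneform Th A (%j. pd j a) F : l2" unfolding oneform_def
  by (intro l2_sum l2_fibre[OF A] conv_l2 l1_rd rd_pd a F')
 then show "conv Th a F : md (fo A)" using F' a by (simp add: md_def eq conv_l2)
 show "(%m. mf (fo A) (conv Th a F) m - conv Th a (mf (fo A) F) m) = oneform Th A (%j. pd j a) F"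
  unfolding eq by (simp add: fun_eq_iff)
qed

lemma oneform_l2:
 assumes "!!j. flin (A j)" "!!j. l1 (b j)" "F : l2" shows "oneform Th A b F : l2"
 unfolding oneform_def by (intro l2_sum l2_fibre[OF assms(1)] conv_l2 assms(2,3))

lemma nl2_sum_le: "(!!i. i : I ==> F i : l2) ==> nl2 (%m. \<Sum>i\<in>I. F i m) <= (\<Sum>i\<in>I. nl2 (F i))"
proof (induction I rule: infinite_finite_induct)
 case (insert x I)
 then show ?case using nl2_triangle[of "F x" "%m. \<Sum>i\<in>I. F i m"] by force
qed auto

locale torus_model = l2_model V W
 for V :: "'v ip_space" and W :: "'v => 'n::{finite, linorder} multi_index => complex^'t::finite" +
 fixes Th :: "'n rmatrix"
begin

lemma bdd_conv: "l1 a ==> bdd_map (conv Th a)" unfolding bdd_map_def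
 by (auto simp: conv_l2 conv_add_vec conv_smult_vec intro!: exI[of _ "\<Sum>\<^sub>\<infinity>p. cmod (a p)"] conv_norm)

lemma bdd_oneform:
 assumes A: "!!j. flin (A j)" and b: "!!j. l1 (b j)" shows "bdd_map (oneform Th A b)"
proof -
 have "\<forall>j. \<exists>B\<ge>0. \<forall>v. norm (A j v) <= B * norm v" using flin_bound[OF A] by metis
 then obtain B where B: "!!j. B j \<ge> 0" "!!j v. norm (A j v) <= B j * norm v" by metis
 have norm: "nl2 (oneform Th A b F) <= (\<Sum>j\<in>UNIV. B j * (\<Sum>\<^sub>\<infinity>p. cmod (b j p))) * nl2 F" if F: "F : l2" for F
 proof -
  have "nl2 (oneform Th A b F) <= (\<Sum>j\<in>UNIV. nl2 (%m. A j (conv Th (b j) F m)))"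
   unfolding oneform_def by (intro nl2_sum_le l2_fibre[OF A] conv_l2 b F)
  also have "... <= (\<Sum>j\<in>UNIV. B j * ((\<Sum>\<^sub>\<infinity>p. cmod (b j p)) * nl2 F))"
  proof (rule sum_mono)
   fix j
   have "nl2 (%m. A j (conv Th (b j) F m)) <= B j * nl2 (conv Th (b j) F)"
    by (rule nl2_le[OF conv_l2[OF b F] B(2,1)])
   also have "... <= B j * ((\<Sum>\<^sub>\<infinity>p. cmod (b j p)) * nl2 F)"
    by (intro mult_left_mono conv_norm b F B)
   finally show "nl2 (%m. A j (conv Th (b j) F m)) <= B j * ((\<Sum>\<^sub>\<infinity>p. cmod (b j p)) * nl2 F)" .
  qed
  finally show ?thesis by (simp add: sum_distrib_right mult.assoc)
 qed
 show ?thesis unfolding bdd_map_def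
 proof (intro conjI ballI allI exI)
  fix F G :: "('n,'t) vf" assume F: "F : l2" "G : l2"
  show "oneform Th A b (%m. F m + G m) = (%m. oneform Th A b F m + oneform Th A b G m)"
   by (simp add: oneform_def fun_eq_iff conv_add_vec b F flin_add[OF A] sum.distrib)
 next
  fix F :: "('n,'t) vf" and c assume F: "F : l2"
  show "oneform Th A b F : l2" by (rule oneform_l2[OF A b F])
  show "oneform Th A b (%m. c *s F m) = (%m. c *s oneform Th A b F m)"
   by (simp add: oneform_def fun_eq_iff conv_smult_vec b F flin_smult[OF A] vec_eq_iff sum_distrib_left)
  show "nl2 (oneform Th A b F) <= (\<Sum>j\<in>UNIV. B j * (\<Sum>\<^sub>\<infinity>p. cmod (b j p))) * nl2 F"
   by (rule norm[OF F])
 qed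
qed

definition lrep :: "('n mi => complex) => 'v oper" where "lrep a = lop l2 (conv Th a)"

end

section \<open>Spectral data of first order symbols\<close>

lemma fo_adj:
 assumes "!!j v w. hdot (A j v) w = hdot v (A' j w)" shows "hdot (fo A m v) w = hdot v (- fo A' m w)"
 by (simp add: fo_def hdot_sum hdot_smult hdot_minus assms sum_negf[symmetric])

lemma fo_comp:
 assumes "!!j. flin (A j)"
 shows "fo A m (fo B m v) = (\<Sum>j\<in>UNIV. \<Sum>l\<in>UNIV. (- of_int (m $ j) * of_int (m $ l)) *s A j (B l v))"
proof -
 have i: "\<i> * (x * (\<i> * y)) = - x * y" for x y :: complex
 proof -
  have "\<i> * (x * (\<i> * y)) = (\<i> * \<i>) * (x * y)" by (simp only: mult_ac)
  then show ?thesis by simp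
 qed
 show ?thesis by (simp add: fo_def flin_sum[OF assms] flin_smult[OF assms] vec_eq_iff
    sum_distrib_left mult.assoc i)
qed

lemma fo_anticommute:
 assumes A: "!!j. flin (A j)" and B: "!!j. flin (B j)" and ac: "!!i j v. A i (B j v) = - B j (A i v)"
 shows "fo A m (fo B m v) = - fo B m (fo A m v)"
proof -
 have "fo A m (fo B m v) = (\<Sum>j\<in>UNIV. \<Sum>l\<in>UNIV. (- of_int (m $ j) * of_int (m $ l)) *s A j (B l v))"
  by (rule fo_comp[of A, OF A])
 also have "... = (\<Sum>l\<in>UNIV. \<Sum>j\<in>UNIV. (- of_int (m $ j) * of_int (m $ l)) *s A j (B l v))"
  by (rule sum.swap)
 also have "... = - (\<Sum>l\<in>UNIV. \<Sum>j\<in>UNIV. (- of_int (m $ l) * of_int (m $ j)) *s B l (A j v))"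
  unfolding sum_negf[symmetric] by (intro sum.cong refl) (simp add: ac vec_eq_iff mult.commute)
 also have "... = - fo B m (fo A m v)" by (simp only: fo_comp[of B, OF B])
 finally show ?thesis .
qed

lemma fo_square_zero:
 assumes A: "!!j. flin (A j)" and ac: "!!i j v. A i (A j v) = - A j (A i v)" shows "fo A m (fo A m v) = 0"
proof -
 have "fo A m (fo A m v) = - fo A m (fo A m v)" by (rule fo_anticommute[OF A A ac])
 then show ?thesis by (simp add: vec_eq_iff)
qed

lemma vec_half:
 assumes "w + w = (2 * z) *s v" shows "w = z *s (v::complex^'t::finite)"
proof -
 have "w $ i + w $ i = (2 * z) * v $ i" for i using arg_cong[OF assms, of "%x. x $ i"] by simp
 then have "2 * w $ i = 2 * (z * v $ i)" for i by (simp only: mult_2[symmetric] mult.assoc)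
 then have "w $ i = z * v $ i" for i by (simp only: mult_cancel_left) simp
 then show ?thesis by (simp add: vec_eq_iff)
qed

text \<open>Only the symmetric part of the anticommutators \<open>{A\<^sub>i, B\<^sub>j}\<close> is seen by the symbols.\<close>

lemma fo_anticommutator:
 assumes A: "!!j. flin (A j)" and B: "!!j. flin (B j)"
  and ac: "!!i j v. (A i (B j v) + B j (A i v)) + (A j (B i v) + B i (A j v)) = (if i = j then (2 * c) *s v else 0)"
 shows "fo A m (fo B m v) + fo B m (fo A m v) = - (c * of_real (msq m)) *s v"
proof -
 let ?k = "%j l. - complex_of_int (m $ j) * of_int (m $ l)"
 let ?K = "%j l. A j (B l v) + B l (A j v)"
 have "fo A m (fo B m v) + fo B m (fo A m v) =
   (\<Sum>j\<in>UNIV. \<Sum>l\<in>UNIV. ?k j l *s A j (B l v)) + (\<Sum>l\<in>UNIV. \<Sum>j\<in>UNIV. ?k l j *s B l (A j v))"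
  by (simp only: fo_comp[of A, OF A] fo_comp[of B, OF B])
 also have "(\<Sum>l\<in>UNIV. \<Sum>j\<in>UNIV. ?k l j *s B l (A j v)) = (\<Sum>j\<in>UNIV. \<Sum>l\<in>UNIV. ?k l j *s B l (A j v))"
  by (rule sum.swap)
 also have "(\<Sum>j\<in>UNIV. \<Sum>l\<in>UNIV. ?k j l *s A j (B l v)) + ... = (\<Sum>j\<in>UNIV. \<Sum>l\<in>UNIV. ?k j l *s ?K j l)"
  by (simp add: sum.distrib[symmetric] vector_add_ldistrib mult.commute)
 finally have S: "fo A m (fo B m v) + fo B m (fo A m v) = (\<Sum>j\<in>UNIV. \<Sum>l\<in>UNIV. ?k j l *s ?K j l)" .
 have "(\<Sum>j\<in>UNIV. \<Sum>l\<in>UNIV. ?k j l *s ?K j l) = (\<Sum>l\<in>UNIV. \<Sum>j\<in>UNIV. ?k j l *s ?K j l)"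
  by (rule sum.swap)
 then have "(\<Sum>j\<in>UNIV. \<Sum>l\<in>UNIV. ?k j l *s ?K j l) + (\<Sum>j\<in>UNIV. \<Sum>l\<in>UNIV. ?k j l *s ?K j l) =
   (\<Sum>j\<in>UNIV. \<Sum>l\<in>UNIV. ?k j l *s ?K j l) + (\<Sum>l\<in>UNIV. \<Sum>j\<in>UNIV. ?k j l *s ?K j l)" by simp
 also have "... = (\<Sum>j\<in>UNIV. \<Sum>l\<in>UNIV. ?k j l *s (?K j l + ?K l j))"
  by (simp add: sum.distrib[symmetric] vector_add_ldistrib mult.commute)
 also have "... = (\<Sum>j\<in>UNIV. \<Sum>l\<in>UNIV. ?k j l *s (if j = l then (2 * c) *s v else 0))"
  by (simp only: ac)
 also have "... = (\<Sum>j\<in>UNIV. ?k j j *s ((2 * c) *s v))"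
  by (intro sum.cong refl) (simp add: if_distrib[of "%x. _ *s x"] cong: if_cong)
 also have "... = (2 * (- (c * of_real (msq m)))) *s v"
  by (simp add: vec_eq_iff msq_def sum_distrib_left sum_distrib_right sum_negf power2_eq_square mult_ac)
 finally show ?thesis unfolding S by (rule vec_half)
qed

context torus_model
begin

lemma bdd_map_minus_sum:
 assumes "!!i. i : I ==> bdd_map (f i)" shows "bdd_map (%F m. - (\<Sum>i\<in>I. f i F m))"
proof -
 have "\<forall>i\<in>I. \<exists>C. \<forall>F\<in>l2. nl2 (f i F) <= C * nl2 F" using assms unfolding bdd_map_def by blast
 then obtain C where C: "!!i F. i : I ==> F : l2 ==> nl2 (f i F) <= C i * nl2 F" by metis
 note l = bdd_map_l2[OF assms]
 show ?thesis unfolding bdd_map_def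
 proof (intro conjI ballI allI exI)
  fix F G :: "('n,'t) vf" assume F: "F : l2" "G : l2"
  have "(\<Sum>i\<in>I. f i (%m. F m + G m) m) = (\<Sum>i\<in>I. f i F m + f i G m)" for m
   by (rule sum.cong) (use assms F in \<open>auto simp: bdd_map_def\<close>)
  then show "(%m. - (\<Sum>i\<in>I. f i (%m. F m + G m) m)) = (%m. - (\<Sum>i\<in>I. f i F m) + - (\<Sum>i\<in>I. f i G m))"
   by (simp add: sum.distrib)
 next
  fix F :: "('n,'t) vf" and c assume F: "F : l2"
  show "(%m. - (\<Sum>i\<in>I. f i F m)) : l2" by (intro l2_uminus l2_sum l F)
  have "(\<Sum>i\<in>I. f i (%m. c *s F m) m) = (\<Sum>i\<in>I. c *s f i F m)" for m
   by (rule sum.cong) (use assms F in \<open>auto simp: bdd_map_def\<close>)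
  then show "(%m. - (\<Sum>i\<in>I. f i (%m. c *s F m) m)) = (%m. c *s (- (\<Sum>i\<in>I. f i F m)))"
   by (simp add: vec_eq_iff fun_eq_iff sum_distrib_left)
  have "nl2 (%m. - (\<Sum>i\<in>I. f i F m)) = nl2 (%m. \<Sum>i\<in>I. f i F m)" by (simp add: nl2_def)
  also have "... <= (\<Sum>i\<in>I. nl2 (f i F))" by (rule nl2_sum_le) (rule l[OF _ F])
  also have "... <= (\<Sum>i\<in>I. C i * nl2 F)" by (rule sum_mono) (rule C[OF _ F])
  finally show "nl2 (%m. - (\<Sum>i\<in>I. f i F m)) <= (\<Sum>i\<in>I. C i) * nl2 F"
   by (simp add: sum_distrib_right)
 qed
qed

lemma lop_fibre: "flin L ==> mop (%_. L) = lop l2 (mf (%_. L))" by (simp add: mop_def bdd_map_fibre(2))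

lemma bounded_lrep: "l1 a ==> bounded_op V (lrep a)"
 unfolding lrep_def by (rule bounded_op_lop[OF bdd_conv])

lemma op_adj_lrep: "l1 a ==> op_adj V (lrep a) = lrep (tstar Th a)" unfolding lrep_def
 by (rule op_adj_bdd[OF bdd_conv conv_l2[OF l1_tstar] conv_adj fin_supp_l2 order_refl])

lemma lrep_inj: "inj_on lrep {a. rd a}"
proof (rule inj_onI)
 fix a b assume "a : {a. rd a}" "b : {a. rd a}" and eq: "lrep a = lrep b"
 then have l: "l1 a" "l1 b" by auto
 let ?d = "delta 0 (axis undefined 1) :: ('n,'t) vf"
 have "(Winv ?d, Winv (conv Th a ?d)) : lrep a" by (simp add: lrep_def lop_def conv_l2 l)
 then have eqd: "conv Th a ?d = conv Th b ?d" unfolding eq by (simp add: lrep_def lop_def conv_l2 l)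
 have "a m = b m" for m using fun_cong[OF eqd, of m] by (simp add: conv_delta)
 then show "a = b" by blast
qed

lemma comm_fibre_lrep:
 assumes L: "flin L" and a: "l1 a" shows "comm V (mop (%_. L)) (lrep a) = op_zero_on V (carrier V)"
 unfolding lop_fibre[OF L] lrep_def op_zero_lop by (subst comm_lop)
  (use a L in \<open>auto simp: conv_l2 mf_def l2_fibre[OF L] conv_fibre[OF L a] intro!: lop_eq_zeroI\<close>)

lemma is_graded_rep_model:
 fixes X :: "('n mi => complex, 'v, 'more) graded_rep_scheme"
 assumes X: "alg X = nc_torus Th" "spc X = V" "grd X = mop (%_. S)"
  and rep: "!!a. rd a ==> rep X a = lrep a"
  and S: "flin S" "!!v w. hdot (S v) w = hdot v (S w)" "!!v. S (S v) = v" shows "is_graded_rep X"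
 unfolding is_graded_rep_def Let_def X
proof (intro conjI ballI allI)
 show "unital_star_algebra (nc_torus Th)" by (rule unital_star_algebra_nc_torus)
 show "hilbert_space V" by (rule hilbert_space_V)
 show "separable_space V" by (rule separable_V)
 show "bounded_self_adjoint V (mop (%_. S))" by (rule bounded_self_adjoint_mop[OF S(1,2)])
 show "op_comp (mop (%_. S)) (mop (%_. S)) = op_id V" unfolding lop_fibre[OF S(1)] op_id_lop
  by (subst op_comp_lop) (auto intro!: lop_cong simp: mf_def l2_fibre[OF S(1)] S(3))
 show "rep X \<one>\<^bsub>nc_torus Th\<^esub> = op_id V"
  unfolding nc_torus_sel rep[OF rd_unit] lrep_def op_id_lop by (rule lop_cong) (auto simp: conv_unit)
 show "inj_on (rep X) (carrier (nc_torus Th))" using lrep_inj by (simp add: rep inj_on_def)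
 fix a assume "a : carrier (nc_torus Th)"
 then have a: "rd a" by simp
 note la = l1_rd[OF a]
 show "bounded_op V (rep X a)" by (simp add: rep a bounded_lrep)
 show "rep X (star (nc_torus Th) a) = op_adj V (rep X a)" by (simp add: rep a rd_tstar op_adj_lrep)
 show "comm V (mop (%_. S)) (rep X a) = op_zero_on V (carrier V)" by (simp add: rep a comm_fibre_lrep S)
 show "rep X (c \<odot>\<^bsub>nc_torus Th\<^esub> a) = op_scale V c (rep X a)" for c
  unfolding nc_torus_sel rep[OF a] rep[OF rd_cmult[OF a]] lrep_def
  by (subst op_scale_lop) (auto intro!: lop_cong simp: conv_cmult la conv_l2)
 fix b assume "b : carrier (nc_torus Th)"
 then have b: "rd b" by simp
 note lb = l1_rd[OF b]
 show "rep X (a \<oplus>\<^bsub>nc_torus Th\<^esub> b) = op_add V (rep X a) (rep X b)"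
  unfolding nc_torus_sel rep[OF a] rep[OF b] rep[OF rd_add[OF a b]] lrep_def
  by (subst op_add_lop) (auto intro!: lop_cong simp: conv_add la lb conv_l2)
 show "rep X (a \<otimes>\<^bsub>nc_torus Th\<^esub> b) = op_comp (rep X a) (rep X b)"
  unfolding nc_torus_sel rep[OF a] rep[OF b] rep[OF rd_tconv[OF a b]] lrep_def
  by (subst op_comp_lop) (auto intro!: lop_cong simp: conv_tconv a b la lb conv_l2)
qed

subsection \<open>Commutators with the algebra\<close>

lemma comm_fo_lrep:
 assumes A: "!!j. flin (A j)" and a: "rd a"
 shows "comm V (mop (fo A)) (lrep a) = lop (md (fo A)) (oneform Th A (%j. pd j a))"
 unfolding mop_def lrep_def by (subst comm_lop)
  (use conv_md_fo[OF A a] a in \<open>auto intro!: lop_cong simp: md_mf conv_l2 mdD\<close>)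

lemma extends_bounded_fo_lrep:
 assumes A: "!!j. flin (A j)" and a: "rd a"
 shows "extends_bounded V (mop (fo A)) (comm V (mop (fo A)) (lrep a))"
 unfolding comm_fo_lrep[OF assms] unfolding mop_def
 by (rule extends_bounded_lop[OF bdd_oneform[OF A l1_rd[OF rd_pd[OF a]]] md_l2 md_mf]) auto

lemma op_closure_comm_fo_lrep:
 assumes A: "!!j. flin (A j)" and a: "rd a"
 shows "op_closure V (comm V (mop (fo A)) (lrep a)) = lop l2 (oneform Th A (%j. pd j a))"
 unfolding comm_fo_lrep[OF assms] by (rule op_closure_bdd[OF bdd_oneform[OF A l1_rd[OF rd_pd[OF a]]]
    fin_supp_md[OF fo_linear[of A, OF A]] md_l2])

lemma extends_bounded_acomm:
 assumes P: "!!j. flin (P j)" and Q: "!!j. flin (Q j)"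
  and ac: "!!i j v. P i (Q j v) = - Q j (P i v)" and a: "rd a"
 shows "extends_bounded V (mop (fo P)) (acomm V (mop (fo P)) (op_closure V (comm V (mop (fo Q)) (lrep a))))"
proof -
 let ?b = "%j. pd j a"
 let ?o = "oneform Th Q ?b"
 let ?g = "%F m. - (\<Sum>j\<in>UNIV. Q j (oneform Th P (%l. pd l (?b j)) F m))"
 have rb: "rd (?b j)" for j by (rule rd_pd[OF a])
 have lb: "l1 (?b j)" for j using rb by simp
 have PQ: "fo P m (Q j v) = - Q j (fo P m v)" for m j v
  by (simp add: fo_def flin_sum[OF Q] flin_smult[OF Q] ac vec_eq_iff sum_negf)
 note lP = fo_linear[of P, OF P]
 have key: "mf (fo P) (?o F) = (%m. - ?o (mf (fo P) F) m + ?g F m)" "?o F : md (fo P)"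
  if F: "F : md (fo P)" for F
 proof -
  have F2: "F : l2" "mf (fo P) F : l2" using F by (auto simp: md_def)
  show eq: "mf (fo P) (?o F) = (%m. - ?o (mf (fo P) F) m + ?g F m)"
  proof
   fix m
   have "mf (fo P) (?o F) m = (\<Sum>j\<in>UNIV. - Q j (fo P m (conv Th (?b j) F m)))"
    by (simp add: mf_def oneform_def[of Th Q] flin_sum[OF lP] PQ)
   also have "... = (\<Sum>j\<in>UNIV. - Q j (conv Th (?b j) (mf (fo P) F) m) - Q j (oneform Th P (%l. pd l (?b j)) F m))"
    by (intro sum.cong refl) (simp add: fo_conv[OF P rb F2] flin_add[OF Q])
   finally show "mf (fo P) (?o F) m = - ?o (mf (fo P) F) m + ?g F m"
    by (simp add: sum_subtractf sum_negf oneform_def[of Th Q])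
  qed
  have o: "?o F : l2" "?o (mf (fo P) F) : l2" by (intro oneform_l2 Q lb F2)+
  have g: "?g F : l2" by (intro l2_uminus l2_sum l2_fibre[OF Q] oneform_l2 P l1_rd rd_pd a F2)
  have "mf (fo P) (?o F) : l2" unfolding eq by (rule l2_add[OF l2_uminus[OF o(2)] g])
  with o(1) show "?o F : md (fo P)" by (simp add: md_def)
 qed
 have bg: "bdd_map ?g"
 proof -
  have b1: "bdd_map (%F m. Q j (oneform Th P (%l. pd l (?b j)) F m))" for j
  proof -
   have "(%F m. Q j (oneform Th P (%l. pd l (?b j)) F m)) =
     oneform Th (%l v. Q j (P l v)) (%l. pd l (?b j))"
    by (simp add: oneform_def fun_eq_iff flin_sum[OF Q])
   moreover have "bdd_map (oneform Th (%l v. Q j (P l v)) (%l. pd l (?b j)))"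
   proof (rule bdd_oneform)
    show "flin (%v. Q j (P l v))" for l by (rule flin_comp[OF Q P])
    show "l1 (pd l (?b j))" for l by (rule l1_rd[OF rd_pd[OF rb]])
   qed
   ultimately show ?thesis by (simp only:)
  qed
  have "bdd_map (%F m. - (\<Sum>j\<in>I. Q j (oneform Th P (%l. pd l (?b j)) F m)))" for I
   by (rule bdd_map_minus_sum) (rule b1)
  then show ?thesis .
 qed
 have ol: "F : l2 ==> ?o F : l2" for F by (intro oneform_l2 Q lb)
 have ac': "acomm V (mop (fo P)) (lop l2 ?o) = lop (md (fo P)) (%F m. mf (fo P) (?o F) m + ?o (mf (fo P) F) m)"
  unfolding mop_def
  by (subst acomm_lop) (use key ol in \<open>auto intro!: lop_cong simp: md_mf mdD\<close>)
 show ?thesis unfolding op_closure_comm_fo_lrep[OF Q a] ac' unfolding mop_def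
  by (rule extends_bounded_lop[OF bg md_l2 md_mf]) (use key in \<open>auto simp: fun_eq_iff\<close>)
qed

subsection \<open>Commutators with operators on the fibre\<close>

lemma md_fibre:
 assumes B: "flin B" "flin B'" and LB: "!!m v. L m (B v) = B' (L m v)" and F: "F : md L"
 shows "mf (%_. B) F : md L" using F l2_fibre[OF B(1), of F] l2_fibre[OF B(2), of "mf L F"]
 by (auto simp: md_def mf_def LB)

lemma acomm_fibre_mop:
 assumes B: "flin B" and L: "!!m v. L m (B v) = - B (L m v)"
 shows "acomm V (mop (%_. B)) (mop L) = op_zero_on V (Domain (mop L))"
  and "acomm V (mop L) (mop (%_. B)) = op_zero_on V (Domain (mop L))"
proof -
 note st = md_fibre[OF B flin_intros(6)[OF B], of L, OF L]
 have e: "op_zero_on V (Domain (mop L)) = lop (md L) (%F m. 0)"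
  unfolding mop_def by (rule op_zero_Domain) (rule md_mf)
 show "acomm V (mop (%_. B)) (mop L) = op_zero_on V (Domain (mop L))"
  unfolding e unfolding lop_fibre[OF B] unfolding mop_def by (subst acomm_lop)
   (use st in \<open>auto intro!: lop_eq_zeroI simp: md_mf md_mf[where L = L, unfolded mf_def] mdD l2_fibre[OF B] mf_def L\<close>)
 show "acomm V (mop L) (mop (%_. B)) = op_zero_on V (Domain (mop L))"
  unfolding e unfolding lop_fibre[OF B] unfolding mop_def by (subst acomm_lop)
   (use st in \<open>auto intro!: lop_eq_zeroI simp: md_mf md_mf[where L = L, unfolded mf_def] mdD l2_fibre[OF B] mf_def L\<close>)
qed

lemma comm_fibre_mop:
 assumes B: "flin B" "flin B'" and L: "!!m v. L m (B v) = B' (L m v)"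
 shows "comm V (mop (%_. B)) (mop L) = lop (md L) (%F m. B (L m (F m)) - B' (L m (F m)))"
proof -
 note st = md_fibre[OF B, of L, OF L]
 show ?thesis unfolding lop_fibre[OF B(1)] unfolding mop_def by (subst comm_lop)
   (use st in \<open>auto intro!: lop_cong simp: md_mf md_mf[where L = L, unfolded mf_def] mdD l2_fibre[OF B(1)] mf_def L\<close>)
qed

lemma comm_fibre_mop_zero:
 assumes B: "flin B" and L: "!!m v. L m (B v) = B (L m v)"
 shows "comm V (mop (%_. B)) (mop L) = op_zero_on V (Domain (mop L))"
 unfolding comm_fibre_mop[where B = B and B' = B and L = L, OF B B L] unfolding mop_def
 by (subst op_zero_Domain) (auto simp: md_mf intro!: lop_eq_zeroI)

lemma comm_fibre_mop_self:
 assumes B: "flin B" and L: "!!m v. B (L m v) = L m (B v) + L m v"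
 shows "comm V (mop (%_. B)) (mop L) = mop L"
proof -
 have L': "L m (B v) = B (L m v) - L m v" for m v by (simp add: L)
 show ?thesis unfolding comm_fibre_mop[OF B flin_intros(5)[OF B flin_intros(1)], of L, OF L']
  unfolding mop_def by (rule lop_cong) (auto simp: mf_def)
qed

lemma comm_fibre_fibre:
 assumes "flin B" "flin C" "!!v. B (C v) = C (B v)"
 shows "comm V (mop (%_. B)) (mop (%_. C)) = op_zero_on V (carrier V)"
 unfolding comm_fibre_mop_zero[OF assms(1), of "%_. C", OF assms(3)[symmetric]]
 using bounded_op_lop[OF bdd_map_fibre(1)[OF assms(2)]]
 by (simp add: bounded_op_def lop_fibre[OF assms(2)])

lemma unitary_fibre:
 assumes "flin B" "!!v w. hdot (B v) w = hdot v (B w)" "!!v. B (B v) = v"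
 shows "unitary_op V (mop (%_. B))"
proof -
 have "op_comp (mop (%_. B)) (mop (%_. B)) = op_id V" unfolding lop_fibre[OF assms(1)] op_id_lop
  by (subst op_comp_lop) (auto intro!: lop_cong simp: mf_def l2_fibre[OF assms(1)] assms(3))
 then show ?thesis using bounded_self_adjoint_mop[OF assms(1,2)]
  by (simp add: unitary_op_def bounded_self_adjoint_def)
qed

lemma hodge_mop:
 assumes h: "flin h" "!!v. h (h v) = v" and hL: "!!m v. h (L m v) = - L' m (h v)"
 shows "op_comp (mop (%_. h)) (mop L) = op_scale V (-1) (op_comp (mop L') (mop (%_. h)))"
proof -
 have bh: "F : l2 ==> (%m. h (F m)) : l2" for F by (rule l2_fibre[OF h(1)])
 have dom: "F : md L \<longleftrightarrow> F : l2 & mf (%_. h) F : md L'" for F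
 proof -
  have 1: "mf L' (mf (%_. h) F) = (%m. - h (mf L F m))" by (simp add: mf_def hL)
  have 2: "mf L F = (%m. h (- mf L' (mf (%_. h) F) m))" by (simp add: 1 h(2))
  show ?thesis
  proof
   assume "F : md L"
   then have "F : l2" "mf L F : l2" by (auto simp: md_def)
   then have "F : l2" "mf (%_. h) F : l2" "mf L' (mf (%_. h) F) : l2"
    unfolding 1 by (auto simp: mf_def[of "%_. h"] intro: l2_uminus[OF bh] bh)
   then show "F : l2 & mf (%_. h) F : md L'" by (simp add: md_def)
  next
   assume a: "F : l2 & mf (%_. h) F : md L'"
   have "mf L F : l2" by (subst 2, rule bh, rule l2_uminus, rule md_mf) (use a in blast)
   then show "F : md L" using a by (simp add: md_def)
  qed
 qed
 have e1: "op_comp (mop (%_. h)) (mop L) = lop (md L) (%F. mf (%_. h) (mf L F))"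
  unfolding lop_fibre[OF h(1)] unfolding mop_def
  by (subst op_comp_lop, erule md_mf, rule lop_cong) (auto simp: md_mf)
 have e2: "op_comp (mop L') (mop (%_. h)) = lop (md L) (%F. mf L' (mf (%_. h) F))"
  unfolding lop_fibre[OF h(1)] unfolding mop_def
  by (subst op_comp_lop, simp add: mf_def bh, rule lop_cong) (auto simp: dom)
 have l2: "mf L' (mf (%_. h) F) : l2" if "F : md L" for F using that by (intro md_mf) (simp add: dom)
 show ?thesis unfolding e1 e2
  by (subst op_scale_lop, erule l2, rule lop_cong) (auto simp: mf_def hL vector_sneg_minus1[symmetric])
qed

subsection \<open>Squares and Laplacians\<close>

lemma md_msq_bound:
 assumes F: "F : l2" "(%m. of_real (q m) *s F m) : l2" and q: "!!m. 0 <= q m"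
  and le: "!!m. (norm (G m))\<^sup>2 <= q m * (norm (F m))\<^sup>2" shows "G : l2"
 unfolding l2_def mem_Collect_eq
proof (rule summable_on_le_nonneg)
 show "(%m. (norm (F m))\<^sup>2 + (norm (of_real (q m) *s F m))\<^sup>2) summable_on UNIV"
  by (intro summable_on_add l2_summable F)
 fix m
 have "q m <= 1 + (q m)\<^sup>2" using sum_squares_bound[of "q m" 1] q[of m] by simp
 then have "q m * (norm (F m))\<^sup>2 <= (1 + (q m)\<^sup>2) * (norm (F m))\<^sup>2" by (rule mult_right_mono) simp
 then show "(norm (G m))\<^sup>2 <= (norm (F m))\<^sup>2 + (norm (of_real (q m) *s F m))\<^sup>2"
  using le[of m] by (simp add: power_mult_distrib algebra_simps)
qed simp

lemma op_comp_square:
 assumes L: "!!m. flin (L m)" and sa: "!!m v w. hdot (L m v) w = hdot v (L m w)"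
  and sq: "!!m v. L m (L m v) = of_real (q m) *s v" and q: "!!m. 0 <= q m"
 shows "op_comp (mop L) (mop L) = scalar_mop q"
proof -
 have n: "(norm (L m v))\<^sup>2 = q m * (norm v)\<^sup>2" for m v
 proof -
  have "complex_of_real ((norm (L m v))\<^sup>2) = of_real (q m * (norm v)\<^sup>2)"
   using sa[of m v "L m v"] by (simp add: sq hdot_self hdot_smult del: of_real_power)
  then show ?thesis by (simp only: of_real_eq_iff)
 qed
 have s: "mf L (mf L F) = mf (%m v. of_real (q m) *s v) F" for F by (simp add: mf_def sq)
 show ?thesis unfolding mop_def
 proof (subst op_comp_lop, erule md_mf, rule lop_cong)
  show "{F : md L. mf L F : md L} = md (%m v. of_real (q m) *s v)"
  proof (intro equalityI subsetI)
   fix F :: "('n,'t) vf"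
   assume F: "F : md (%m v. of_real (q m) *s v)"
   have "mf L F : l2"
    by (rule md_msq_bound[where q = q and F = F]) (use F q n in \<open>auto simp: md_def mf_def\<close>)
   then show "F : {F : md L. mf L F : md L}" using F by (simp add: md_def s)
  qed (auto simp: md_def s)
 qed (simp add: s)
qed

lemma laplacian_mop:
 assumes L: "!!m. flin (L m)" "!!m. flin (L' m)" and adj: "!!m v w. hdot (L m v) w = hdot v (L' m w)"
  and z: "!!m v. L m (L m v) = 0" "!!m v. L' m (L' m v) = 0"
  and sq: "!!m v. L m (L' m v) + L' m (L m v) = of_real (q m) *s v" and q: "!!m. 0 <= q m"
 shows "op_add V (op_comp (mop L) (mop L')) (op_comp (mop L') (mop L)) = scalar_mop q"
proof -
 have adj': "hdot (L' m v) w = hdot v (L m w)" for m v w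
  using arg_cong[OF adj[of m w v], of cnj] by (simp add: hdot_cnj)
 have n: "(norm (L m v))\<^sup>2 + (norm (L' m v))\<^sup>2 = q m * (norm v)\<^sup>2" for m v
 proof -
  have "complex_of_real ((norm (L m v))\<^sup>2 + (norm (L' m v))\<^sup>2) = hdot v (L' m (L m v)) + hdot v (L m (L' m v))"
   using adj[of m v "L m v"] adj'[of m v "L' m v"] by (simp add: hdot_self del: of_real_power)
  also have "... = of_real (q m * (norm v)\<^sup>2)"
   unfolding hdot_add[symmetric] add.commute[of "L' m (L m v)"] sq
   by (simp add: hdot_smult hdot_self del: of_real_power)
  finally show ?thesis by (simp only: of_real_eq_iff)
 qed
 have n2: "(norm (L m (L' m v)))\<^sup>2 + (norm (L' m (L m v)))\<^sup>2 = (norm (of_real (q m) *s v))\<^sup>2" for m v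
 proof -
  have o: "hdot (L m (L' m v)) (L' m (L m v)) = 0" "hdot (L' m (L m v)) (L m (L' m v)) = 0"
   by (simp_all add: adj adj' z flin_0[OF L(1)] flin_0[OF L(2)])
  have "complex_of_real ((norm (of_real (q m) *s v))\<^sup>2) =
    complex_of_real ((norm (L m (L' m v)))\<^sup>2 + (norm (L' m (L m v)))\<^sup>2)"
   unfolding sq[symmetric] hdot_self[symmetric] of_real_add by (simp add: hdot_add o)
  then show ?thesis by (simp only: of_real_eq_iff)
 qed
 have d: "F : md L & F : md L' & mf L F : md L' & mf L' F : md L" if F: "F : md (%m v. of_real (q m) *s v)" for F
 proof -
  have F': "F : l2" "(%m. of_real (q m) *s F m) : l2" using F by (auto simp: md_def mf_def)
  have le: "(norm (L m (F m)))\<^sup>2 <= q m * (norm (F m))\<^sup>2" "(norm (L' m (F m)))\<^sup>2 <= q m * (norm (F m))\<^sup>2" for m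
   using n[of m "F m"] by (simp_all add: add_increasing add_increasing2 flip: n)
  have 1: "mf L F : l2" "mf L' F : l2"
   using md_msq_bound[OF F' q, of "mf L F"] md_msq_bound[OF F' q, of "mf L' F"] le by (auto simp: mf_def)
  have le2: "(norm (L m (L' m (F m))))\<^sup>2 <= (norm (of_real (q m) *s F m))\<^sup>2"
   "(norm (L' m (L m (F m))))\<^sup>2 <= (norm (of_real (q m) *s F m))\<^sup>2" for m
   unfolding n2[of m "F m", symmetric] by simp_all
  have le3: "norm (L m (L' m (F m))) <= 1 * norm (of_real (q m) *s F m)"
   "norm (L' m (L m (F m))) <= 1 * norm (of_real (q m) *s F m)" for m
   using power2_le_imp_le[OF le2(1)[of m]] power2_le_imp_le[OF le2(2)[of m]] by simp_all
  have "mf L (mf L' F) : l2" "mf L' (mf L F) : l2"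
   unfolding mf_def by (rule l2_le[OF F'(2) le3(1)], rule l2_le[OF F'(2) le3(2)])
  with 1 show ?thesis using F' by (simp add: md_def)
 qed
 have s: "(%m. mf L (mf L' F) m + mf L' (mf L F) m) = mf (%m v. of_real (q m) *s v) F" for F
  by (simp add: mf_def sq)
 show ?thesis unfolding mop_def
 proof (subst op_comp_lop, erule md_mf, subst op_comp_lop, erule md_mf, subst op_add_lop)
  show "lop ({F : md L'. mf L' F : md L} \<inter> {F : md L. mf L F : md L'})
    (%F m. mf L (mf L' F) m + mf L' (mf L F) m) =
   lop (md (%m v. of_real (q m) *s v)) (mf (%m v. of_real (q m) *s v))"
  proof (rule lop_cong)
   show "{F : md L'. mf L' F : md L} \<inter> {F : md L. mf L F : md L'} = md (%m v. of_real (q m) *s v)"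
   proof (intro equalityI subsetI)
    fix F assume "F : {F : md L'. mf L' F : md L} \<inter> {F : md L. mf L F : md L'}"
    then have "F : l2" "(%m. mf L (mf L' F) m + mf L' (mf L F) m) : l2" by (auto simp: md_mf mdD)
    then show "F : md (%m v. of_real (q m) *s v)" by (simp add: s md_def)
   qed (use d in blast)
  qed (simp add: s)
 qed (auto simp: md_mf)
qed

lemma op_comp_zero:
 assumes L: "!!m v. L m (L m v) = 0" shows "op_comp (mop L) (mop L) = op_zero_on V (Domain (mop L))"
 unfolding mop_def by (subst op_comp_lop, erule md_mf, subst op_zero_Domain, erule md_mf)
  (auto intro!: lop_cong simp: md_def mf_def L)

lemma vanishes_densely_acomm:
 assumes L: "!!m. flin (L m)" "!!m. flin (M m)" and ac: "!!m v. L m (M m v) = - M m (L m v)"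
 shows "vanishes_densely V (acomm V (mop L) (mop M))" unfolding mop_def
proof (subst acomm_lop, erule md_mf, erule md_mf, rule vanishes_densely_lop)
 show "fin_supp <= {F. F : md L & F : md M & mf M F : md L & mf L F : md M}"
 proof
  fix F :: "('n,'t) vf" assume F: "F : fin_supp"
  have "mf M F : fin_supp" "mf L F : fin_supp"
   by (rule fin_supp_mf[of M, OF L(2) F], rule fin_supp_mf[of L, OF L(1) F])
  with F show "F : {F. F : md L & F : md M & mf M F : md L & mf L F : md M}"
   using fin_supp_md[of L, OF L(1)] fin_supp_md[of M, OF L(2)] by (simp add: subset_iff)
 qed
qed (auto simp: md_def mf_def ac)

end

section \<open>Spectral data from Clifford and Kaehler symbols\<close>

lemma fo_uminus: "fo (%j v. - A j v) m v = - fo A m v" by (simp add: fo_def vec_eq_iff sum_negf)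

lemma fo_plus: "fo (%j v. A j v + B j v) m v = fo A m v + fo B m v"
 by (simp add: fo_def vec_eq_iff distrib_left sum.distrib)

lemma fo_adj_uminus:
 assumes "!!j v w. hdot (A j v) w = hdot v (A' j w)"
 shows "hdot (fo A m v) w = hdot v (fo (%j v. - A' j v) m w)"
 using fo_adj[of A A' m v w, OF assms] by (simp add: fo_uminus)

lemma fo_fibre:
 assumes "flin B" "!!j v. B (A j v) = C j (B v)" shows "B (fo A m v) = fo C m (B v)"
 by (simp add: fo_def flin_sum[OF assms(1)] flin_smult[OF assms(1)] assms(2))

text \<open>The fibre part of the Kaehler axioms: \<open>P\<close>, \<open>Q\<close> are the coefficients of the symbols of the two differentials,
  \<open>P'\<close>, \<open>Q'\<close> their adjoints, \<open>h\<close> the Hodge operator, \<open>S\<close> the grading and \<open>T\<close>, \<open>T'\<close> the two degrees.\<close>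

locale kaehler_fibre =
 fixes P Q P' Q' :: "'n::finite => complex^'t::finite => complex^'t"
  and h S T T' :: "complex^'t => complex^'t"
 assumes lin: "flin (P j)" "flin (Q j)" "flin (P' j)" "flin (Q' j)" "flin h" "flin S" "flin T" "flin T'"
  and adj: "hdot (P j v) w = hdot v (P' j w)" "hdot (Q j v) w = hdot v (Q' j w)"
  and ac: "P i (P j v) = - P j (P i v)" "Q i (Q j v) = - Q j (Q i v)" "P i (Q j v) = - Q j (P i v)"
   "P i (Q' j v) = - Q' j (P i v)" "Q i (P' j v) = - P' j (Q i v)"
  and lapP: "(P i (P' j v) + P' j (P i v)) + (P j (P' i v) + P' i (P j v)) = (if i = j then v else 0)"
  and lapQ: "(Q i (Q' j v) + Q' j (Q i v)) + (Q j (Q' i v) + Q' i (Q j v)) = (if i = j then v else 0)"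
  and selfadj: "hdot (h v) w = hdot v (h w)" "hdot (S v) w = hdot v (S w)"
   "hdot (T v) w = hdot v (T w)" "hdot (T' v) w = hdot v (T' w)"
  and inv: "h (h v) = v" "S (S v) = v"
  and hP: "h (P j v) = Q' j (h v)" and hQ: "h (Q j v) = P' j (h v)"
  and SP: "S (P j v) = - P j (S v)" and SQ: "S (Q j v) = - Q j (S v)"
  and TP: "T (P j v) = P j (T v) + P j v" and TQ: "T (Q j v) = Q j (T v)"
  and T'P: "T' (P j v) = P j (T' v)" and T'Q: "T' (Q j v) = Q j (T' v) + Q j v"
  and TT': "T (T' v) = T' (T v)" and ST: "S (T v) = T (S v)" and ST': "S (T' v) = T' (S v)"
begin

abbreviation "Pa \<equiv> %j v. - P' j v"
abbreviation "Qa \<equiv> %j v. - Q' j v"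
abbreviation "A \<equiv> %j v. P j v + Q j v"
abbreviation "Aa \<equiv> %j v. - (P' j v + Q' j v)"

lemma lin': "flin (Pa j)" "flin (Qa j)" "flin (A j)" "flin (Aa j)" by (rule flin_intros lin)+

lemma adj_cnj: "hdot (P' j v) w = hdot v (P j w)" "hdot (Q' j v) w = hdot v (Q j w)"
 using arg_cong[OF adj(1)[of j w v], of cnj] arg_cong[OF adj(2)[of j w v], of cnj] by (simp_all add: hdot_cnj)

lemma ac': "P' i (P' j v) = - P' j (P' i v)" "Q' i (Q' j v) = - Q' j (Q' i v)" "P' i (Q' j v) = - Q' j (P' i v)"
proof -
 show "P' i (P' j v) = - P' j (P' i v)" by (rule hdot_eqI) (simp add: adj_cnj hdot_minus ac(1)[of j i])
 show "Q' i (Q' j v) = - Q' j (Q' i v)" by (rule hdot_eqI) (simp add: adj_cnj hdot_minus ac(2)[of j i])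
 show "P' i (Q' j v) = - Q' j (P' i v)" by (rule hdot_eqI) (simp add: adj_cnj hdot_minus ac(3))
qed

lemma fo_linear': "flin (fo P m)" "flin (fo Q m)" "flin (fo Pa m)"
 "flin (fo Qa m)" "flin (fo A m)" "flin (fo Aa m)" by (rule fo_linear, rule lin lin')+

lemma fo_adj': "hdot (fo P m v) w = hdot v (fo Pa m w)" "hdot (fo Q m v) w = hdot v (fo Qa m w)"
 "hdot (fo A m v) w = hdot v (fo Aa m w)" by (rule fo_adj_uminus, simp add: adj hdot_add)+

lemma fo_adj_cnj: "hdot (fo Pa m v) w = hdot v (fo P m w)" "hdot (fo Qa m v) w = hdot v (fo Q m w)"
 "hdot (fo Aa m v) w = hdot v (fo A m w)"
 using arg_cong[OF fo_adj'(1)[of m w v], of cnj] arg_cong[OF fo_adj'(2)[of m w v], of cnj]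
  arg_cong[OF fo_adj'(3)[of m w v], of cnj] unfolding hdot_cnj by (simp_all only:)

lemma fo_zero: "fo P m (fo P m v) = 0" "fo Q m (fo Q m v) = 0" "fo A m (fo A m v) = 0" "fo Aa m (fo Aa m v) = 0"
 "fo Pa m (fo Pa m v) = 0" "fo Qa m (fo Qa m v) = 0"
proof -
 show p: "fo P m (fo P m v) = 0" for v by (rule fo_square_zero[OF lin(1) ac(1)])
 show q: "fo Q m (fo Q m v) = 0" for v by (rule fo_square_zero[OF lin(2) ac(2)])
 have pq: "fo P m (fo Q m v) = - fo Q m (fo P m v)" for v by (rule fo_anticommute[OF lin(1,2) ac(3)])
 show a: "fo A m (fo A m v) = 0" for v
  by (simp add: fo_plus flin_add[OF fo_linear'(1)] flin_add[OF fo_linear'(2)] p q pq)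
 show "fo Aa m (fo Aa m v) = 0" by (rule hdot_eqI) (simp only: fo_adj_cnj a hdot_zero)
 show "fo Pa m (fo Pa m v) = 0" by (rule hdot_eqI) (simp only: fo_adj_cnj p hdot_zero)
 show "fo Qa m (fo Qa m v) = 0" by (rule hdot_eqI) (simp only: fo_adj_cnj q hdot_zero)
qed

lemma laplacians: "fo P m (fo Pa m v) + fo Pa m (fo P m v) = of_real (msq m / 2) *s v"
 "fo Q m (fo Qa m v) + fo Qa m (fo Q m v) = of_real (msq m / 2) *s v"
 "fo A m (fo Aa m v) + fo Aa m (fo A m v) = of_real (msq m) *s v"
proof -
 have p: "fo P m (fo P' m v) + fo P' m (fo P m v) = - (1/2 * of_real (msq m)) *s v"
  by (rule fo_anticommutator[OF lin(1,3)]) (simp add: lapP)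
 have q: "fo Q m (fo Q' m v) + fo Q' m (fo Q m v) = - (1/2 * of_real (msq m)) *s v"
  by (rule fo_anticommutator[OF lin(2,4)]) (simp add: lapQ)
 have m: "- w + - z = - (w + z)" for w z :: "complex^'t" by simp
 show 1: "fo P m (fo Pa m v) + fo Pa m (fo P m v) = of_real (msq m / 2) *s v"
  by (simp only: fo_uminus flin_minus[OF fo_linear'(1)] m p) (simp add: vec_eq_iff)
 show 2: "fo Q m (fo Qa m v) + fo Qa m (fo Q m v) = of_real (msq m / 2) *s v"
  by (simp only: fo_uminus flin_minus[OF fo_linear'(2)] m q) (simp add: vec_eq_iff)
 have c1: "fo P m (fo Qa m v) = - fo Qa m (fo P m v)"
  by (rule fo_anticommute[OF lin(1) lin'(2)]) (simp add: ac(4) flin_minus[OF lin(1)])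
 have c2: "fo Q m (fo Pa m v) = - fo Pa m (fo Q m v)"
  by (rule fo_anticommute[OF lin(2) lin'(1)]) (simp add: ac(5) flin_minus[OF lin(2)])
 have Aa: "fo Aa m w = fo Pa m w + fo Qa m w" for w by (simp only: fo_uminus fo_plus) simp
 have "fo A m (fo Aa m v) + fo Aa m (fo A m v) =
   (fo P m (fo Pa m v) + fo Pa m (fo P m v)) + (fo Q m (fo Qa m v) + fo Qa m (fo Q m v))"
  unfolding Aa fo_plus flin_add[OF fo_linear'(1)] flin_add[OF fo_linear'(2)]
   flin_add[OF fo_linear'(3)] flin_add[OF fo_linear'(4)] c1 c2 by simp
 also have "... = of_real (msq m) *s v" unfolding 1 2 by (simp add: vec_eq_iff field_simps)
 finally show "fo A m (fo Aa m v) + fo Aa m (fo A m v) = of_real (msq m) *s v" .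
qed

lemma fibre_fo:
 "S (fo P m v) = - fo P m (S v)" "S (fo Q m v) = - fo Q m (S v)" "S (fo A m v) = - fo A m (S v)"
 "h (fo P m v) = - fo Qa m (h v)" "h (fo Q m v) = - fo Pa m (h v)" "h (fo A m v) = - fo Aa m (h v)"
 "T (fo P m v) = fo P m (T v) + fo P m v" "T (fo Q m v) = fo Q m (T v)"
 "T' (fo P m v) = fo P m (T' v)" "T' (fo Q m v) = fo Q m (T' v) + fo Q m v"
proof -
 show "S (fo P m v) = - fo P m (S v)"
  using fo_fibre[OF lin(6), of P "%j v. - P j v" m v] by (simp add: SP fo_uminus)
 show "S (fo Q m v) = - fo Q m (S v)"
  using fo_fibre[OF lin(6), of Q "%j v. - Q j v" m v] by (simp add: SQ fo_uminus)
 show "S (fo A m v) = - fo A m (S v)"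
 proof -
  have "S (fo A m v) = fo (%j v. - (P j v + Q j v)) m (S v)"
   by (rule fo_fibre[OF lin(6)]) (simp add: SP SQ flin_add[OF lin(6)])
  then show ?thesis by (simp only: fo_uminus)
 qed
 show "h (fo P m v) = - fo Qa m (h v)" using fo_fibre[OF lin(5), of P Q' m v] by (simp add: hP fo_uminus)
 show "h (fo Q m v) = - fo Pa m (h v)" using fo_fibre[OF lin(5), of Q P' m v] by (simp add: hQ fo_uminus)
 show "h (fo A m v) = - fo Aa m (h v)"
 proof -
  have "h (fo A m v) = fo (%j v. P' j v + Q' j v) m (h v)"
   by (rule fo_fibre[OF lin(5)]) (simp add: hP hQ flin_add[OF lin(5)] add.commute)
  then show ?thesis by (simp only: fo_uminus minus_minus)
 qed
 have T: "U (fo B m v) = fo B m (U v) + c *s fo B m v"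
  if "flin U" "!!j. flin (B j)" "!!j v. U (B j v) = B j (U v) + c *s B j v" for U B c
  by (simp add: fo_def flin_sum[OF that(1)] flin_smult[OF that(1)] that(3)
    vector_add_ldistrib sum.distrib vec_eq_iff sum_distrib_left mult_ac)
 show "T (fo P m v) = fo P m (T v) + fo P m v" using T[where c = 1, OF lin(7) lin(1)] by (simp add: TP)
 show "T (fo Q m v) = fo Q m (T v)" using T[where c = 0, OF lin(7) lin(2)] by (simp add: TQ)
 show "T' (fo P m v) = fo P m (T' v)" using T[where c = 0, OF lin(8) lin(1)] by (simp add: T'P)
 show "T' (fo Q m v) = fo Q m (T' v) + fo Q m v" using T[where c = 1, OF lin(8) lin(2)] by (simp add: T'Q)
qed

end

context torus_model
begin

lemma is_N1_model:
 assumes X: "alg X = nc_torus Th" "spc X = V" "grd X = mop (%_. S)" "dirac X = mop (fo A)"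
  and rep: "!!a. rd a ==> rep X a = lrep a"
  and S: "flin S" "!!v w. hdot (S v) w = hdot v (S w)" "!!v. S (S v) = v"
  and A: "!!j. flin (A j)" "!!j v w. hdot (A j v) w = - hdot v (A j w)"
  and cliff: "!!i j v. A i (A j v) + A j (A i v) = (if i = j then (-2) *s v else 0)"
  and SA: "!!j v. S (A j v) = - A j (S v)" shows "is_N1_data X"
proof -
 have sa: "hdot (fo A m v) w = hdot v (fo A m w)" for m v w
  using fo_adj_uminus[of A "%j v. - A j v" m v w] by (simp add: A(2) hdot_minus)
 have "fo A m (fo A m v) + fo A m (fo A m v) = - ((-2) * of_real (msq m)) *s v" for m v
  by (rule fo_anticommutator[OF A(1) A(1)]) (simp only: cliff, simp add: vec_eq_iff)
 then have "fo A m (fo A m v) + fo A m (fo A m v) = (2 * of_real (msq m)) *s v" for m v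
  by (simp only: mult_minus_left minus_minus)
 then have sq: "fo A m (fo A m v) = of_real (msq m) *s v" for m v by (rule vec_half)
 have SL: "fo A m (S v) = - S (fo A m v)" for m v
  using fo_fibre[OF S(1), of A "%j v. - A j v" m v] by (simp add: SA fo_uminus)
 note lA = fo_linear[of A, OF A(1)]
 show ?thesis unfolding is_N1_data_def Let_def X(1,2,3,4)
 proof (intro conjI ballI)
  show "is_graded_rep X" by (rule is_graded_rep_model[OF X(1-3) rep S])
  show "self_adjoint V (mop (fo A))" by (rule self_adjoint_mop[OF lA sa])
  show "extends_bounded V (mop (fo A)) (comm V (mop (fo A)) (rep X a))" if "a : carrier (nc_torus Th)" for a
   using that by (simp add: rep extends_bounded_fo_lrep A)
  show "heat_trace_class V (op_comp (mop (fo A)) (mop (fo A)))"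
   unfolding op_comp_square[of "fo A" msq, OF lA sa sq msq_nonneg]
   by (rule heat_trace_class_scalar[OF msq_nonneg summable_exp_msq])
  show "acomm V (mop (%_. S)) (mop (fo A)) = op_zero_on V (Domain (mop (fo A)))"
   by (rule acomm_fibre_mop(1)[where B = S and L = "fo A", OF S(1) SL])
 qed
qed

lemma is_N11_model:
 fixes P Q P' Q' :: "'n => complex^'t => complex^'t"
 assumes K: "kaehler_fibre P Q P' Q' h S T T'"
  and X: "alg X = nc_torus Th" "spc X = V" "grd X = mop (%_. S)"
   "diff X = mop (fo (%j v. P j v + Q j v))" "N11_data.hodge X = mop (%_. h)"
  and rep: "!!a. rd a ==> rep X a = lrep a" shows "is_N11_data X"
proof -
 interpret kaehler_fibre P Q P' Q' h S T T' by (rule K)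
 have adjA: "op_adj V (mop (fo A)) = mop (fo Aa)"
  by (rule op_adj_mop[of "fo A" "fo Aa", OF fo_linear'(5) fo_adj'(3)])
 show ?thesis unfolding is_N11_data_def Let_def X(1,2,3,4,5) adjA
 proof (intro conjI ballI exI[of _ "-1"])
  show "is_graded_rep X" by (rule is_graded_rep_model[OF X(1-3) rep lin(6) selfadj(2) inv(2)])
  show "closed_op V (mop (fo A))" by (rule closed_op_mop[OF fo_linear'(5)])
  show "op_comp (mop (fo A)) (mop (fo A)) = op_zero_on V (Domain (mop (fo A)))"
   by (rule op_comp_zero[of "fo A", OF fo_zero(3)])
  show "heat_trace_class V (op_add V (op_comp (mop (fo A)) (mop (fo Aa))) (op_comp (mop (fo Aa)) (mop (fo A))))"
   unfolding laplacian_mop[of "fo A" "fo Aa" msq, OF fo_linear'(5,6) fo_adj'(3) fo_zero(3,4) laplacians(3) msq_nonneg]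
   by (rule heat_trace_class_scalar[OF msq_nonneg summable_exp_msq])
  show "acomm V (mop (%_. S)) (mop (fo A)) = op_zero_on V (Domain (mop (fo A)))"
   by (rule acomm_fibre_mop(1)[where B = S, OF lin(6)]) (simp add: fibre_fo(3))
  show "unitary_op V (mop (%_. h))" by (rule unitary_fibre[where B = h, OF lin(5) selfadj(1) inv(1)])
  show "op_comp (mop (%_. h)) (mop (fo A)) = op_scale V (- 1) (op_comp (mop (fo Aa)) (mop (%_. h)))"
   by (rule hodge_mop[where h = h and L = "fo A" and L' = "fo Aa", OF lin(5) inv(1) fibre_fo(6)])
  fix a assume a: "a : carrier (nc_torus Th)"
  show "extends_bounded V (mop (fo A)) (comm V (mop (fo A)) (rep X a))"
   using a by (simp add: rep extends_bounded_fo_lrep[OF lin'(3)])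
  show "comm V (mop (%_. h)) (rep X a) = op_zero_on V (carrier V)"
   using a by (simp add: rep comm_fibre_lrep lin)
 qed simp
qed

lemma closure_sum_fo:
 assumes P: "!!j. flin (P j)" and Q: "!!j. flin (Q j)"
 shows "op_closure V (op_add V (mop (fo P)) (mop (fo Q))) = mop (fo (%j v. P j v + Q j v))"
proof -
 note lP = fo_linear[of P, OF P] and lQ = fo_linear[of Q, OF Q]
 let ?A = "%j v. P j v + Q j v"
 have s: "(%F m. mf (fo P) F m + mf (fo Q) F m) = mf (fo ?A)" by (simp add: fun_eq_iff mf_def fo_plus)
 have "op_add V (mop (fo P)) (mop (fo Q)) = lop (md (fo P) \<inter> md (fo Q)) (mf (fo ?A))"
  unfolding mop_def by (subst op_add_lop, erule md_mf, erule md_mf) (simp only: s)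
 then show ?thesis
 proof (simp only:, intro op_closure_mf)
  show "flin (fo ?A m)" for m by (intro fo_linear flin_intros P Q)
  show "fin_supp <= md (fo P) \<inter> md (fo Q)" using fin_supp_md[of "fo P", OF lP] fin_supp_md[of "fo Q", OF lQ] by simp
  show "md (fo P) \<inter> md (fo Q) <= md (fo ?A)"
  proof
   fix F assume "F : md (fo P) \<inter> md (fo Q)"
   then have "F : l2" "(%m. mf (fo P) F m + mf (fo Q) F m) : l2" by (auto simp: md_mf mdD)
   then show "F : md (fo ?A)" using fun_cong[OF s, of F] by (simp add: md_def)
  qed
 qed
qed

lemma is_N22_model:
 fixes P Q P' Q' :: "'n => complex^'t => complex^'t"
 assumes K: "kaehler_fibre P Q P' Q' h S T T'"
  and X: "alg X = nc_torus Th" "spc X = V" "grd X = mop (%_. S)"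
   "del X = mop (fo P)" "delbar X = mop (fo Q)" "Tdeg X = mop (%_. T)" "Tbar X = mop (%_. T')"
   "N22_data.hodge X = mop (%_. h)"
  and rep: "!!a. rd a ==> rep X a = lrep a" shows "is_N22_Kaehler_data X"
proof -
 interpret kaehler_fibre P Q P' Q' h S T T' by (rule K)
 have adjP: "op_adj V (mop (fo P)) = mop (fo Pa)"
  by (rule op_adj_mop[of "fo P" "fo Pa", OF fo_linear'(1) fo_adj'(1)])
 have adjQ: "op_adj V (mop (fo Q)) = mop (fo Qa)"
  by (rule op_adj_mop[of "fo Q" "fo Qa", OF fo_linear'(2) fo_adj'(2)])
 have q: "0 <= msq m / 2" for m :: "'n mi" by simp
 have c1: "fo P m (fo Qa m v) = - fo Qa m (fo P m v)" for m v
  by (rule fo_anticommute[OF lin(1) lin'(2)]) (simp add: ac(4) flin_minus[OF lin(1)])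
 have c2: "fo Q m (fo Pa m v) = - fo Pa m (fo Q m v)" for m v
  by (rule fo_anticommute[OF lin(2) lin'(1)]) (simp add: ac(5) flin_minus[OF lin(2)])
 have c3: "fo P m (fo Q m v) = - fo Q m (fo P m v)" for m v by (rule fo_anticommute[OF lin(1,2) ac(3)])
 show ?thesis unfolding is_N22_Kaehler_data_def Let_def X(1,2,3,4,5,6,7,8) adjP adjQ
 proof (intro conjI ballI exI[of _ "-1"])
  show "is_N11_data (N11_of_N22 X)" by (rule is_N11_model[OF K])
    (simp_all add: N11_of_N22_def X rep closure_sum_fo[OF lin(1,2)])
  show "bounded_self_adjoint V (mop (%_. T))" "bounded_self_adjoint V (mop (%_. T'))"
   by (rule bounded_self_adjoint_mop[OF lin(7) selfadj(3)], rule bounded_self_adjoint_mop[OF lin(8) selfadj(4)])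
  show "closed_op V (mop (fo P))" "closed_op V (mop (fo Q))"
   by (rule closed_op_mop[OF fo_linear'(1)], rule closed_op_mop[OF fo_linear'(2)])
  show "op_comp (mop (fo P)) (mop (fo P)) = op_zero_on V (Domain (mop (fo P)))"
   "op_comp (mop (fo Q)) (mop (fo Q)) = op_zero_on V (Domain (mop (fo Q)))"
   by (rule op_comp_zero[of "fo P", OF fo_zero(1)], rule op_comp_zero[of "fo Q", OF fo_zero(2)])
  show "vanishes_densely V (acomm V (mop (fo P)) (mop (fo Q)))"
   by (rule vanishes_densely_acomm[where L = "fo P" and M = "fo Q", OF fo_linear'(1,2) c3])
  show "vanishes_densely V (acomm V (mop (fo P)) (mop (fo Qa)))"
   by (rule vanishes_densely_acomm[where L = "fo P" and M = "fo Qa", OF fo_linear'(1,4) c1])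
  show "vanishes_densely V (acomm V (mop (fo Q)) (mop (fo Pa)))"
   by (rule vanishes_densely_acomm[where L = "fo Q" and M = "fo Pa", OF fo_linear'(2,3) c2])
  show "comm V (mop (%_. T)) (mop (%_. T')) = op_zero_on V (carrier V)"
   by (rule comm_fibre_fibre[where B = T and C = T', OF lin(7,8) TT'])
  show "comm V (mop (%_. S)) (mop (%_. T)) = op_zero_on V (carrier V)"
   by (rule comm_fibre_fibre[where B = S and C = T, OF lin(6,7) ST])
  show "comm V (mop (%_. S)) (mop (%_. T')) = op_zero_on V (carrier V)"
   by (rule comm_fibre_fibre[where B = S and C = T', OF lin(6,8) ST'])
  show "comm V (mop (%_. T)) (mop (fo P)) = mop (fo P)"
   by (rule comm_fibre_mop_self[where B = T and L = "fo P", OF lin(7) fibre_fo(7)])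
  show "comm V (mop (%_. T')) (mop (fo Q)) = mop (fo Q)"
   by (rule comm_fibre_mop_self[where B = T' and L = "fo Q", OF lin(8) fibre_fo(10)])
  show "comm V (mop (%_. T)) (mop (fo Q)) = op_zero_on V (Domain (mop (fo Q)))"
   by (rule comm_fibre_mop_zero[where B = T and L = "fo Q", OF lin(7) fibre_fo(8)[symmetric]])
  show "comm V (mop (%_. T')) (mop (fo P)) = op_zero_on V (Domain (mop (fo P)))"
   by (rule comm_fibre_mop_zero[where B = T' and L = "fo P", OF lin(8) fibre_fo(9)[symmetric]])
  show "acomm V (mop (%_. S)) (mop (fo P)) = op_zero_on V (Domain (mop (fo P)))"
   by (rule acomm_fibre_mop(1)[where B = S, OF lin(6)]) (simp add: fibre_fo(1))
  show "acomm V (mop (%_. S)) (mop (fo Q)) = op_zero_on V (Domain (mop (fo Q)))"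
   by (rule acomm_fibre_mop(1)[where B = S, OF lin(6)]) (simp add: fibre_fo(2))
  show "op_comp (mop (%_. h)) (mop (fo P)) = op_scale V (- 1) (op_comp (mop (fo Qa)) (mop (%_. h)))"
   by (rule hodge_mop[where h = h and L = "fo P" and L' = "fo Qa", OF lin(5) inv(1) fibre_fo(4)])
  show "op_comp (mop (%_. h)) (mop (fo Q)) = op_scale V (- 1) (op_comp (mop (fo Pa)) (mop (%_. h)))"
   by (rule hodge_mop[where h = h and L = "fo Q" and L' = "fo Pa", OF lin(5) inv(1) fibre_fo(5)])
  show "acomm V (mop (fo P)) (mop (fo Pa)) = acomm V (mop (fo Q)) (mop (fo Qa))" unfolding acomm_def
    laplacian_mop[of "fo P" "fo Pa" "%m. msq m / 2", OF fo_linear'(1,3) fo_adj'(1) fo_zero(1,5) laplacians(1) q]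
    laplacian_mop[of "fo Q" "fo Qa" "%m. msq m / 2", OF fo_linear'(2,4) fo_adj'(2) fo_zero(2,6) laplacians(2) q] ..
  fix a assume a: "a : carrier (nc_torus Th)"
  show "comm V (mop (%_. T)) (rep X a) = op_zero_on V (carrier V)"
   "comm V (mop (%_. T')) (rep X a) = op_zero_on V (carrier V)"
   using a by (simp_all add: rep comm_fibre_lrep lin)
  show "extends_bounded V (mop (fo P)) (comm V (mop (fo P)) (rep X a))"
   "extends_bounded V (mop (fo Q)) (comm V (mop (fo Q)) (rep X a))"
   using a by (simp_all add: rep extends_bounded_fo_lrep lin)
  show "extends_bounded V (mop (fo P)) (acomm V (mop (fo P)) (op_closure V (comm V (mop (fo Q)) (rep X a))))"
   using a by (simp add: rep extends_bounded_acomm[of P Q, OF lin(1,2) ac(3)])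
 qed simp
qed

end

section \<open>Creation and annihilation operators\<close>

locale clifford_pair =
 fixes G Gb :: "'n::finite => complex^'t::finite => complex^'t" and h S :: "complex^'t => complex^'t"
 assumes G_lin: "flin (G j)" and Gb_lin: "flin (Gb j)" and h_lin: "flin h" and S_lin: "flin S"
  and G_skew: "hdot (G j v) w = - hdot v (G j w)" and Gb_skew: "hdot (Gb j v) w = - hdot v (Gb j w)"
  and GG: "G i (G j v) + G j (G i v) = (if i = j then (-2) *s v else 0)"
  and GbGb: "Gb i (Gb j v) + Gb j (Gb i v) = (if i = j then (-2) *s v else 0)"
  and GGb: "G i (Gb j v) + Gb j (G i v) = 0"
  and h_sym: "hdot (h v) w = hdot v (h w)" and S_sym: "hdot (S v) w = hdot v (S w)"
  and h_inv: "h (h v) = v" and S_inv: "S (S v) = v"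
  and hG: "h (G j v) = - G j (h v)" and hGb: "h (Gb j v) = Gb j (h v)"
  and SG: "S (G j v) = - G j (S v)" and SGb: "S (Gb j v) = - Gb j (S v)"
begin

text \<open>Two anticommuting Clifford families combine to creation operators; the annihilation operators are their
  adjoints since the families are skew, and the Hodge operator exchanges the two because it anticommutes with
  the first family and commutes with the second.\<close>

definition cr :: "'n => complex^'t => complex^'t" where "cr j v = (1/2) *s (G j v + \<i> *s Gb j v)"

definition an :: "'n => complex^'t => complex^'t" where "an j v = (1/2) *s (\<i> *s Gb j v - G j v)"

lemmas lin_simps = flin_add[OF G_lin] flin_add[OF Gb_lin] flin_diff[OF G_lin]
 flin_diff[OF Gb_lin] flin_smult[OF G_lin] flin_smult[OF Gb_lin]

lemma cr_lin: "flin (cr j)" and an_lin: "flin (an j)"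
 by (auto simp: flin_def cr_def an_def lin_simps vec_eq_iff algebra_simps)

lemma cr_cr: "cr i (cr j v) + cr j (cr i v) = 0"
proof -
 have "cr i (cr j v) + cr j (cr i v) = (1/4) *s ((G i (G j v) + G j (G i v)) +
   \<i> *s (G i (Gb j v) + Gb j (G i v)) + \<i> *s (G j (Gb i v) + Gb i (G j v)) - (Gb i (Gb j v) + Gb j (Gb i v)))"
  by (simp add: cr_def lin_simps vec_eq_iff field_simps)
 then show ?thesis by (simp only: GG GbGb GGb) simp
qed

lemma an_an: "an i (an j v) + an j (an i v) = 0"
proof -
 have "an i (an j v) + an j (an i v) = (1/4) *s ((G i (G j v) + G j (G i v)) -
   \<i> *s (G i (Gb j v) + Gb j (G i v)) - \<i> *s (G j (Gb i v) + Gb i (G j v)) - (Gb i (Gb j v) + Gb j (Gb i v)))"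
  by (simp add: an_def lin_simps vec_eq_iff field_simps)
 then show ?thesis by (simp only: GG GbGb GGb) simp
qed

lemma cr_an: "cr i (an j v) + an j (cr i v) = (if i = j then v else 0)"
proof -
 have "cr i (an j v) + an j (cr i v) = (1/4) *s (- (G i (G j v) + G j (G i v)) +
   \<i> *s (G i (Gb j v) + Gb j (G i v)) - \<i> *s (G j (Gb i v) + Gb i (G j v)) - (Gb i (Gb j v) + Gb j (Gb i v)))"
  by (simp add: cr_def an_def lin_simps vec_eq_iff field_simps)
 then show ?thesis by (simp only: GG GbGb GGb) (simp add: vec_eq_iff)
qed

lemma cr_adj: "hdot (cr j v) w = hdot v (an j w)"
 by (simp add: cr_def an_def hdot_smult hdot_add hdot_diff G_skew Gb_skew algebra_simps)

lemma h_cr: "h (cr j v) = an j (h v)"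
 by (simp add: cr_def an_def flin_add[OF h_lin] flin_smult[OF h_lin] hG hGb vec_eq_iff)

lemma S_cr: "S (cr j v) = - cr j (S v)" and S_an: "S (an j v) = - an j (S v)"
 by (simp_all add: cr_def an_def flin_add[OF S_lin] flin_diff[OF S_lin] flin_smult[OF S_lin] SG SGb
   vec_eq_iff algebra_simps)

definition cc :: "('n => complex) => complex^'t => complex^'t" where
 "cc x v = (\<Sum>l\<in>UNIV. x l *s cr l v)"

definition ca :: "('n => complex) => complex^'t => complex^'t" where
 "ca x v = (\<Sum>l\<in>UNIV. x l *s an l v)"

lemma cc_lin: "flin (cc x)" and ca_lin: "flin (ca x)"
 unfolding cc_def ca_def by (rule flin_sumI, rule flin_intros, rule cr_lin an_lin)+

lemma bilinear_anticommutator: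
 fixes A B :: "'n => complex^'t => complex^'t"
 assumes A: "!!l. flin (A l)" and B: "!!l. flin (B l)"
  and ac: "!!i j v. A i (B j v) + B j (A i v) = (if i = j then c *s v else 0)"
 shows "(\<Sum>l\<in>UNIV. x l *s A l (\<Sum>k\<in>UNIV. y k *s B k v)) + (\<Sum>k\<in>UNIV. y k *s B k (\<Sum>l\<in>UNIV. x l *s A l v)) =
  (\<Sum>l\<in>UNIV. x l * y l * c) *s v"
proof -
 have "(\<Sum>k\<in>UNIV. y k *s B k (\<Sum>l\<in>UNIV. x l *s A l v)) = (\<Sum>k\<in>UNIV. \<Sum>l\<in>UNIV. (x l * y k) *s B k (A l v))"
  by (simp add: flin_sum[OF B] flin_smult[OF B] vec_eq_iff sum_distrib_left mult_ac)
 also have "... = (\<Sum>l\<in>UNIV. \<Sum>k\<in>UNIV. (x l * y k) *s B k (A l v))" by (rule sum.swap)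
 moreover have "(\<Sum>l\<in>UNIV. x l *s A l (\<Sum>k\<in>UNIV. y k *s B k v)) = (\<Sum>l\<in>UNIV. \<Sum>k\<in>UNIV. (x l * y k) *s A l (B k v))"
  by (simp add: flin_sum[OF A] flin_smult[OF A] vec_eq_iff sum_distrib_left mult_ac)
 ultimately have "(\<Sum>l\<in>UNIV. x l *s A l (\<Sum>k\<in>UNIV. y k *s B k v)) + (\<Sum>k\<in>UNIV. y k *s B k (\<Sum>l\<in>UNIV. x l *s A l v)) =
   (\<Sum>l\<in>UNIV. \<Sum>k\<in>UNIV. (x l * y k) *s (A l (B k v) + B k (A l v)))"
  by (simp add: sum.distrib vector_add_ldistrib)
 also have "... = (\<Sum>l\<in>UNIV. \<Sum>k\<in>UNIV. (x l * y k) *s (if l = k then c *s v else 0))" by (simp only: ac)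
 also have "... = (\<Sum>l\<in>UNIV. \<Sum>k\<in>UNIV. if l = k then (x l * y k) *s (c *s v) else 0)"
  by (intro sum.cong refl) simp
 also have "... = (\<Sum>l\<in>UNIV. (x l * y l) *s (c *s v))"
  by (intro sum.cong refl) (subst sum.delta', auto)
 finally show ?thesis by (simp add: vec_eq_iff sum_distrib_left sum_distrib_right mult_ac)
qed

lemma cc_cc: "cc x (cc y v) + cc y (cc x v) = 0"
 unfolding cc_def by (subst bilinear_anticommutator[of cr cr 0]) (auto simp: cr_lin cr_cr)

lemma cc_ca: "cc x (ca y v) + ca y (cc x v) = (\<Sum>l\<in>UNIV. x l * y l) *s v"
 unfolding cc_def ca_def by (subst bilinear_anticommutator[of cr an 1]) (auto simp: cr_lin an_lin cr_an)

lemma ca_ca: "ca x (ca y v) + ca y (ca x v) = 0"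
 unfolding ca_def by (subst bilinear_anticommutator[of an an 0]) (auto simp: an_lin an_an)

lemma cc_adj: "hdot (cc x v) w = hdot v (ca (%l. cnj (x l)) w)"
 by (simp add: cc_def ca_def hdot_sum hdot_smult cr_adj)

lemma h_cc: "h (cc x v) = ca x (h v)"
 by (simp add: cc_def ca_def flin_sum[OF h_lin] flin_smult[OF h_lin] h_cr)

lemma S_cc: "S (cc x v) = - cc x (S v)" and S_ca: "S (ca x v) = - ca x (S v)"
 by (simp_all add: cc_def ca_def flin_sum[OF S_lin] flin_smult[OF S_lin] S_cr S_an sum_negf vec_eq_iff)

lemma cc_inj:
 assumes "!!v. cc x v = cc y v" shows "x = y"
proof
 fix j :: 'n
 let ?d = "%l. if l = j then (1::complex) else 0" and ?v = "axis undefined 1 :: complex^'t"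
 have s: "(\<Sum>l\<in>UNIV. x l * ?d l) = x j" for x :: "'n => complex"
  by (simp add: if_distrib[of "%z. _ * z"] cong: if_cong)
 have "x j *s ?v = y j *s ?v" using cc_ca[of x ?d ?v] cc_ca[of y ?d ?v] unfolding s by (simp add: assms)
 then show "x j = y j" by simp
qed

text \<open>A complex structure on the cotangent space, given by the projection \<open>al\<close> of its
 complexification onto the holomorphic directions.\<close>

definition holo :: "('n => 'n => complex) => bool" where
 "holo al \<longleftrightarrow> (\<forall>i j. (\<Sum>l\<in>UNIV. al i l * al l j) = al i j) \<and>
  (\<forall>i j. al i j + al j i = (if i = j then 1 else 0)) & (\<forall>i j. cnj (al i j) = al j i)"

definition Pf :: "('n => 'n => complex) => 'n => complex^'t => complex^'t" where "Pf al j = cc (%l. al j l)"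
definition Qf :: "('n => 'n => complex) => 'n => complex^'t => complex^'t" where "Qf al j = cc (%l. al l j)"
definition Pf' :: "('n => 'n => complex) => 'n => complex^'t => complex^'t" where "Pf' al j = ca (%l. al l j)"
definition Qf' :: "('n => 'n => complex) => 'n => complex^'t => complex^'t" where "Qf' al j = ca (%l. al j l)"
definition Tf :: "('n => 'n => complex) => complex^'t => complex^'t" where "Tf al v = (\<Sum>j\<in>UNIV. Pf al j (Pf' al j v))"
definition Tf' :: "('n => 'n => complex) => complex^'t => complex^'t" where "Tf' al v = (\<Sum>j\<in>UNIV. Qf al j (Qf' al j v))"

text \<open>The anticommutator of a combination of creation operators with one of annihilation operators is the scalar
  product of the coefficient vectors. So the mixed relations hold as the rows of \<open>\<alpha>\<close> are orthogonal to those
  of its complement, and the degree operators count because \<open>\<alpha>\<close> is a projection.\<close>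

lemma kaehler_fibre_holo:
 assumes "holo al" shows "kaehler_fibre (Pf al) (Qf al) (Pf' al) (Qf' al) h S (Tf al) (Tf' al)"
proof -
 have idem: "(\<Sum>l\<in>UNIV. al i l * al l j) = al i j" and tr: "al i j + al j i = (if i = j then 1 else 0)"
  and cn: "cnj (al i j) = al j i" for i j using assms by (auto simp: holo_def)
 have tr': "al j i = (if i = j then 1 else 0) - al i j" for i j using tr[of i j] by (auto simp: algebra_simps)
 have o1: "(\<Sum>l\<in>UNIV. al i l * al j l) = 0" for i j
 proof -
  have "(\<Sum>l\<in>UNIV. al i l * al j l) = (\<Sum>l\<in>UNIV. (if l = j then al i l else 0) - al i l * al l j)"
   by (rule sum.cong) (auto simp: tr'[of j] algebra_simps)
  then show ?thesis by (simp add: sum_subtractf idem)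
 qed
 have o2: "(\<Sum>l\<in>UNIV. al l i * al l j) = 0" for i j
 proof -
  have "(\<Sum>l\<in>UNIV. al l i * al l j) = (\<Sum>l\<in>UNIV. (if l = i then al l j else 0) - al i l * al l j)"
   by (rule sum.cong) (auto simp: tr'[of _ i] algebra_simps)
  then show ?thesis by (simp add: sum_subtractf idem)
 qed
 have PP': "Pf al i (Pf' al j v) + Pf' al j (Pf al i v) = al i j *s v" for i j v
  unfolding Pf_def Pf'_def cc_ca idem ..
 have QQ': "Qf al i (Qf' al j v) + Qf' al j (Qf al i v) = al j i *s v" for i j v
  unfolding Qf_def Qf'_def cc_ca by (simp add: mult.commute[of "al _ i"] idem)
 have PQ': "Pf al i (Qf' al j v) + Qf' al j (Pf al i v) = 0" for i j v
  unfolding Pf_def Qf'_def cc_ca o1 by simp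
 have QP': "Qf al i (Pf' al j v) + Pf' al j (Qf al i v) = 0" for i j v
  unfolding Qf_def Pf'_def cc_ca o2 by simp
 have PP: "Pf al i (Pf al j v) = - Pf al j (Pf al i v)" "Qf al i (Qf al j v) = - Qf al j (Qf al i v)"
  "Pf al i (Qf al j v) = - Qf al j (Pf al i v)" for i j v
  using cc_cc unfolding Pf_def Qf_def by (simp_all add: eq_neg_iff_add_eq_0)
 have l: "flin (Pf al j)" "flin (Qf al j)" "flin (Pf' al j)" "flin (Qf' al j)" for j
  unfolding Pf_def Qf_def Pf'_def Qf'_def by (rule cc_lin ca_lin)+
 have T: "flin (Tf al)" "flin (Tf' al)" unfolding Tf_def[abs_def] Tf'_def[abs_def]
  by (rule flin_sumI, rule flin_comp, rule l, rule l)+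
 have aP: "hdot (Pf al j v) w = hdot v (Pf' al j w)" and aQ: "hdot (Qf al j v) w = hdot v (Qf' al j w)" for j v w
  by (simp_all add: Pf_def Pf'_def Qf_def Qf'_def cc_adj cn)
 have aP': "hdot (Pf' al j v) w = hdot v (Pf al j w)" and aQ': "hdot (Qf' al j v) w = hdot v (Qf al j w)" for j v w
  using arg_cong[OF aP[of j w v], of cnj] arg_cong[OF aQ[of j w v], of cnj] by (simp_all add: hdot_cnj)
 have sP: "(\<Sum>j\<in>UNIV. al k j *s Pf al j v) = Pf al k v" for k v
 proof -
  have "(\<Sum>j\<in>UNIV. al k j *s Pf al j v) = (\<Sum>j\<in>UNIV. \<Sum>l\<in>UNIV. (al k j * al j l) *s cr l v)"
   by (simp add: Pf_def cc_def vec_eq_iff sum_distrib_left mult_ac)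
  also have "... = (\<Sum>l\<in>UNIV. \<Sum>j\<in>UNIV. (al k j * al j l) *s cr l v)" by (rule sum.swap)
  also have "... = Pf al k v" by (simp add: Pf_def cc_def vec_eq_iff sum_distrib_right[symmetric] idem)
  finally show ?thesis .
 qed
 have sQ: "(\<Sum>j\<in>UNIV. al j k *s Qf al j v) = Qf al k v" for k v
 proof -
  have "(\<Sum>j\<in>UNIV. al j k *s Qf al j v) = (\<Sum>j\<in>UNIV. \<Sum>l\<in>UNIV. (al l j * al j k) *s cr l v)"
   by (simp add: Qf_def cc_def vec_eq_iff sum_distrib_left mult_ac)
  also have "... = (\<Sum>l\<in>UNIV. \<Sum>j\<in>UNIV. (al l j * al j k) *s cr l v)" by (rule sum.swap)
  also have "... = Qf al k v" by (simp add: Qf_def cc_def vec_eq_iff sum_distrib_right[symmetric] idem)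
  finally show ?thesis .
 qed
 have TP: "Tf al (Pf al k v) = Pf al k (Tf al v) + Pf al k v" for k v
 proof -
  have "Pf' al j (Pf al k v) = al k j *s v - Pf al k (Pf' al j v)" for j
   using PP'[of k j v] by (simp add: eq_diff_eq add.commute)
  then have "Tf al (Pf al k v) = (\<Sum>j\<in>UNIV. al k j *s Pf al j v + Pf al k (Pf al j (Pf' al j v)))"
   unfolding Tf_def by (intro sum.cong refl)
    (simp add: flin_diff[OF l(1)] flin_smult[OF l(1)] PP(1)[of _ k "Pf' al _ v"])
  then show ?thesis by (simp add: sum.distrib sP Tf_def flin_sum[OF l(1)])
 qed
 have T'Q: "Tf' al (Qf al k v) = Qf al k (Tf' al v) + Qf al k v" for k v
 proof -
  have "Qf' al j (Qf al k v) = al j k *s v - Qf al k (Qf' al j v)" for j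
   using QQ'[of k j v] by (simp add: eq_diff_eq add.commute)
  then have "Tf' al (Qf al k v) = (\<Sum>j\<in>UNIV. al j k *s Qf al j v + Qf al k (Qf al j (Qf' al j v)))"
   unfolding Tf'_def by (intro sum.cong refl)
    (simp add: flin_diff[OF l(2)] flin_smult[OF l(2)] PP(2)[of _ k "Qf' al _ v"])
  then show ?thesis by (simp add: sum.distrib sQ Tf'_def flin_sum[OF l(2)])
 qed
 have P'Q: "Pf' al j (Qf al k v) = - Qf al k (Pf' al j v)" for j k v
  using QP'[of k j v] by (simp add: eq_neg_iff_add_eq_0 add.commute)
 have Q'P: "Qf' al j (Pf al k v) = - Pf al k (Qf' al j v)" for j k v
  using PQ'[of k j v] by (simp add: eq_neg_iff_add_eq_0 add.commute)
 have P'Q': "Pf' al j (Qf' al k v) = - Qf' al k (Pf' al j v)" for j k v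
  using ca_ca unfolding Pf'_def Qf'_def by (simp add: eq_neg_iff_add_eq_0)
 have TQ: "Tf al (Qf al k v) = Qf al k (Tf al v)" for k v
  by (simp add: Tf_def P'Q flin_minus[OF l(1)] PP(3) flin_sum[OF l(2)])
 have QP: "Qf al j (Pf al k v) = - Pf al k (Qf al j v)" for j k v by (simp add: PP(3))
 have T'P: "Tf' al (Pf al k v) = Pf al k (Tf' al v)" for k v
  by (simp add: Tf'_def Q'P flin_minus[OF l(2)] QP flin_sum[OF l(1)])
 have TQ': "Tf al (Qf' al k v) = Qf' al k (Tf al v)" for k v
  by (simp add: Tf_def P'Q' Q'P flin_minus[OF l(1)] flin_sum[OF l(4)])
 have TT': "Tf al (Tf' al v) = Tf' al (Tf al v)" for v by (simp add: Tf'_def flin_sum[OF T(1)] TQ TQ')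
 have SPs: "S (Pf al j v) = - Pf al j (S v)" "S (Qf al j v) = - Qf al j (S v)"
  "S (Pf' al j v) = - Pf' al j (S v)" "S (Qf' al j v) = - Qf' al j (S v)" for j v
  unfolding Pf_def Qf_def Pf'_def Qf'_def by (rule S_cc S_ca)+
 show ?thesis
 proof
  show "Pf al i (Pf' al j v) + Pf' al j (Pf al i v) + (Pf al j (Pf' al i v) + Pf' al i (Pf al j v)) =
    (if i = j then v else 0)" for i j v unfolding PP' vector_sadd_rdistrib[symmetric] tr by simp
  show "Qf al i (Qf' al j v) + Qf' al j (Qf al i v) + (Qf al j (Qf' al i v) + Qf' al i (Qf al j v)) =
    (if i = j then v else 0)" for i j v unfolding QQ' vector_sadd_rdistrib[symmetric] tr by auto
  show "hdot (Tf al v) w = hdot v (Tf al w)" "hdot (Tf' al v) w = hdot v (Tf' al w)" for v w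
   by (simp_all add: Tf_def Tf'_def hdot_sum aP aP' aQ aQ')
  show "h (Pf al j v) = Qf' al j (h v)" "h (Qf al j v) = Pf' al j (h v)" for j v
   by (simp_all add: Pf_def Qf'_def Qf_def Pf'_def h_cc)
  show "S (Tf al v) = Tf al (S v)" "S (Tf' al v) = Tf' al (S v)" for v
   by (simp_all add: Tf_def Tf'_def flin_sum[OF S_lin] SPs flin_minus[OF l(1)] flin_minus[OF l(2)])
  show "Pf al i (Qf' al j v) = - Qf' al j (Pf al i v)" "Qf al i (Pf' al j v) = - Pf' al j (Qf al i v)" for i j v
   using PQ' QP' by (simp_all add: eq_neg_iff_add_eq_0)
 qed (rule l h_lin S_lin T aP aQ PP h_sym S_sym h_inv S_inv SPs TP TQ T'P T'Q TT')+
qed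

lemma Pf_plus_Qf:
 assumes "holo al" shows "Pf al j v + Qf al j v = cr j v"
proof -
 have "al j l + al l j = (if l = j then 1 else 0)" for l using assms by (auto simp: holo_def)
 then have "Pf al j v + Qf al j v = (\<Sum>l\<in>UNIV. (if l = j then 1 else 0) *s cr l v)"
  by (simp add: Pf_def Qf_def cc_def sum.distrib[symmetric] vector_sadd_rdistrib[symmetric])
 also have "... = (\<Sum>l\<in>UNIV. if l = j then cr l v else 0)" by (rule sum.cong) auto
 finally show ?thesis by simp
qed

text \<open>Anticommuting with the annihilation operators recovers the coefficients.\<close>

lemma Pf_inj:
 assumes "!!m v. fo (Pf al) m v = fo (Pf \<beta>) m v" shows "al = \<beta>"
proof -
 have e: "fo A (axis j 1) v = \<i> *s A j v" for A :: "'n => complex^'t => complex^'t" and j v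
 proof -
  have "fo A (axis j 1) v = (\<Sum>l\<in>UNIV. if l = j then \<i> *s A l v else 0)"
   unfolding fo_def by (rule sum.cong) (auto simp: axis_def)
  then show ?thesis by simp
 qed
 have "Pf al j v = Pf \<beta> j v" for j v using assms[of "axis j 1" v] unfolding e by simp
 then have "(%l. al j l) = (%l. \<beta> j l)" for j unfolding Pf_def by (rule cc_inj)
 then show ?thesis by blast
qed

end

section \<open>The spinor space of the torus\<close>

lemma spinor_sel [simp]:
 "carrier (spinor_space :: ('n::finite multi_index => complex^'s::finite) ip_space) = l2"
 "\<zero>\<^bsub>spinor_space :: ('n::finite multi_index => complex^'s::finite) ip_space\<^esub> = (%m. 0)"
 "add (spinor_space :: ('n::finite multi_index => complex^'s::finite) ip_space) = (%F G m. F m + G m)"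
 "module.smult (spinor_space :: ('n::finite multi_index => complex^'s::finite) ip_space) = (%c F m. c *s F m)"
 "ip (spinor_space :: ('n::finite multi_index => complex^'s::finite) ip_space) = l2_ip"
 by (simp_all add: spinor_space_def l2_def l2_ip_def fun_eq_iff)

lemma spinor_torus_model:
 "torus_model (spinor_space :: ('n::{finite, linorder} multi_index => complex^'s::finite) ip_space) (%F. F)"
 unfolding torus_model_def by unfold_locales (auto simp: bij_betw_def)

lemma flin_matrix: "flin ((*v) M)" by (simp add: flin_def matrix_vector_right_distrib vector_scalar_commute)

lemma hdot_matrix: "hdot (M *v v) w = hdot v (ctranspose M *v w)"
proof -
 have "hdot (M *v v) w = (\<Sum>i\<in>UNIV. \<Sum>k\<in>UNIV. cnj (v $ k) * (cnj (M $ i $ k) * w $ i))"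
  by (simp add: hdot_def matrix_vector_mult_def sum_distrib_left sum_distrib_right mult_ac)
 also have "... = (\<Sum>k\<in>UNIV. \<Sum>i\<in>UNIV. cnj (v $ k) * (cnj (M $ i $ k) * w $ i))" by (rule sum.swap)
 also have "... = hdot v (ctranspose M *v w)"
  by (simp add: hdot_def matrix_vector_mult_def ctranspose_def sum_distrib_left)
 finally show ?thesis .
qed

lemma matrix_uminus_vector: "(- M) *v v = - (M *v v)" for M :: "complex^'s^'s::finite"
 by (simp add: matrix_vector_mult_def vec_eq_iff sum_negf)

lemma matrix_mat_vector: "mat c *v v = c *s v" for v :: "complex^'s::finite"
proof -
 have "(if i = j then c else 0) * x = (if i = j then c * x else 0)" for i j :: 's and x by simp
 then show ?thesis by (simp add: matrix_vector_mult_def mat_def vec_eq_iff)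
qed

text \<open>Right twisted convolution: the operator implemented by \<open>J\<close>.\<close>

lemma rconv_has_sum:
 fixes F :: "'n::{finite, linorder} multi_index => complex^'t::finite"
 assumes b: "l1 b" and F: "F : l2"
 shows "((%p. (b (m - p) * cocycle Th p (m - p)) *s F p) has_sum rconv Th F b m) UNIV"
proof -
 have b': "(%p. cmod (b (m - p))) summable_on UNIV"
  using summable_on_UNIV_reindex[OF bij_diff_left, of "%p. cmod (b p)" m] b by (simp add: l1_def)
 have "(%p. norm ((b (m - p) * cocycle Th p (m - p)) *s F p)) summable_on UNIV"
 proof (rule norm_summable_le)
  show "(%p. cmod (b (m - p)) * nl2 F) summable_on UNIV" using b' by (rule summable_on_cmult_left)
  show "norm ((b (m - p) * cocycle Th p (m - p)) *s F p) <= cmod (b (m - p)) * nl2 F" for p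
   using norm_le_nl2[OF F, of p] by (simp add: norm_mult mult_left_mono)
 qed
 then have s: "((%p. (b (m - p) * cocycle Th p (m - p)) *s F p) has_sum
   (\<Sum>\<^sub>\<infinity>p. (b (m - p) * cocycle Th p (m - p)) *s F p)) UNIV"
  by (rule has_sum_infsum[OF norm_summable_summable])
 have "(\<Sum>\<^sub>\<infinity>p. (b (m - p) * cocycle Th p (m - p)) *s F p) $ i = rconv Th F b m $ i" for i
 proof -
  have "((%p. ((b (m - p) * cocycle Th p (m - p)) *s F p) $ i) has_sum
    (\<Sum>\<^sub>\<infinity>p. (b (m - p) * cocycle Th p (m - p)) *s F p) $ i) UNIV"
   using has_sum_bounded_linear[OF bounded_linear_nth s] by (simp add: o_def)
  then show ?thesis by (simp add: tconv_def infsumI[symmetric] mult_ac)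
 qed
 then have "(\<Sum>\<^sub>\<infinity>p. (b (m - p) * cocycle Th p (m - p)) *s F p) = rconv Th F b m"
  by (rule iffD2[OF vec_eq_iff, OF allI])
 then show ?thesis using s by (simp only:)
qed

lemma rconv_fibre:
 assumes L: "flin L" and b: "l1 b" and F: "F : l2" shows "L (rconv Th F b m) = rconv Th (%m. L (F m)) b m"
proof (rule has_sum_unique)
 show "((%p. L ((b (m - p) * cocycle Th p (m - p)) *s F p)) has_sum L (rconv Th F b m)) UNIV"
  using has_sum_bounded_linear[OF flin_bounded_linear[OF L] rconv_has_sum[OF b F]] by (simp add: o_def)
 show "((%p. L ((b (m - p) * cocycle Th p (m - p)) *s F p)) has_sum rconv Th (%m. L (F m)) b m) UNIV"
  using rconv_has_sum[OF b l2_fibre[OF L F], where Th = Th and m = m] by (simp add: flin_smult[OF L])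
qed

lemma smult_sum: "c *s (\<Sum>i\<in>I. f i) = (\<Sum>i\<in>I. c *s f i :: complex^'t::finite)"
 by (simp add: vec_eq_iff sum_distrib_left)

lemma rconv_sum:
 assumes b: "l1 b" and F: "!!i. i : I ==> F i : l2"
 shows "rconv Th (%m. \<Sum>i\<in>I. F i m) b m = (\<Sum>i\<in>I. rconv Th (F i) b m)"
proof (rule has_sum_unique)
 show "((%p. (b (m - p) * cocycle Th p (m - p)) *s (\<Sum>i\<in>I. F i p)) has_sum
   rconv Th (%m. \<Sum>i\<in>I. F i m) b m) UNIV" by (rule rconv_has_sum[OF b l2_sum[OF F]])
 have "((%p. \<Sum>i\<in>I. (b (m - p) * cocycle Th p (m - p)) *s F i p) has_sum (\<Sum>i\<in>I. rconv Th (F i) b m)) UNIV"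
  by (rule has_sum_sum_fin) (rule rconv_has_sum[OF b F])
 then show "((%p. (b (m - p) * cocycle Th p (m - p)) *s (\<Sum>i\<in>I. F i p)) has_sum (\<Sum>i\<in>I. rconv Th (F i) b m)) UNIV"
  by (simp add: smult_sum)
qed

lemma RD_rconv: "F : RD ==> rd b ==> rconv Th F b : RD" by (simp add: RD_def rd_tconv)

locale torus_spinor =
 fixes Th :: "'n::{finite, linorder} rmatrix" and ga :: "'n => complex^'s^'s::finite"
  and sg :: "complex^'s^'s"
  and JN :: "complex^'s => complex^'s" and ep ep'' :: complex
 assumes ga_skew: "ctranspose (ga j) = - ga j"
  and gaga: "ga j ** ga l + ga l ** ga j = (if j = l then mat (-2) else 0)"
  and sg: "ctranspose sg = sg" "sg ** sg = mat 1" "sg ** ga j = - (ga j ** sg)"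
  and J_add: "JN (v + w) = JN v + JN w" and J_smult: "JN (c *s v) = cnj c *s JN v"
  and J_hdot: "hdot (JN v) (JN w) = hdot w v"
  and J_J: "JN (JN v) = ep *s v" and ep: "ep : {1, -1}" "ep'' : {1, -1}"
  and J_ga: "JN (ga j *v v) = ga j *v JN v" and J_sg: "JN (sg *v v) = ep'' *s (sg *v JN v)"
begin

sublocale spin: torus_model spinor_space "%F :: ('n,'s) vf. F" Th by (rule spinor_torus_model)

abbreviation "Vs \<equiv> spinor_space :: (('n,'s) vf) ip_space"
abbreviation "X \<equiv> torus_N1 Th ga sg"
abbreviation "J \<equiv> torus_J Th JN"
abbreviation "Gm \<equiv> %j. (*v) (ga j)"

lemma ga_vec: "ga i *v (ga j *v v) + ga j *v (ga i *v v) = (if i = j then (-2) *s v else 0)"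
proof -
 have "ga i *v (ga j *v v) + ga j *v (ga i *v v) = (ga i ** ga j + ga j ** ga i) *v v"
  by (simp add: matrix_vector_mul_assoc matrix_vector_mult_add_rdistrib)
 then show ?thesis by (simp add: gaga matrix_mat_vector)
qed

lemma ga_hdot: "hdot (ga j *v v) w = - hdot v (ga j *v w)"
 by (simp add: hdot_matrix ga_skew matrix_uminus_vector hdot_minus)

lemma sg_hdot: "hdot (sg *v v) w = hdot v (sg *v w)" by (simp add: hdot_matrix sg)

lemma sg_sg: "sg *v (sg *v v) = v" by (simp add: matrix_vector_mul_assoc sg)

lemma sg_ga: "sg *v (ga j *v v) = - (ga j *v (sg *v v))"
 by (simp add: matrix_vector_mul_assoc sg matrix_uminus_vector)

lemma sel [simp]: "alg X = nc_torus Th" "spc X = Vs" "rep X = torus_rep Th" "grd X = fiber_op sg"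
 "dirac X = torus_dirac ga" by (simp_all add: torus_N1_def)

lemma torus_rep_eq: "l1 a ==> torus_rep Th a = spin.lop l2 (conv Th a)"
 by (auto simp: torus_rep_def spin.lop_def conv_l2 conv_def[abs_def] fun_eq_iff)
  (auto simp: conv_l2[unfolded conv_def[abs_def]])

lemma fiber_op_eq: "fiber_op M = spin.mop (%_. (*v) M)" unfolding spin.lop_fibre[OF flin_matrix]
 by (auto simp: fiber_op_def spin.lop_def mf_def l2_fibre[OF flin_matrix])

lemma torus_dirac_eq: "torus_dirac ga = spin.mop (fo Gm)"
proof -
 note l = fo_linear[of Gm, OF flin_matrix]
 have "{(F, %m. \<Sum>j\<in>UNIV. (\<i> * of_int (m $ j)) *s (ga j *v F m)) | F.
   \<forall>i. rd (%m. F m $ i)} = spin.lop RD (mf (fo Gm))"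
 proof (intro equalityI subsetI)
  have l2: "F : l2" "mf (fo Gm) F : l2" if "F : RD" for F :: "('n,'s) vf"
   using RD_l2 RD_fo[of Gm F, OF flin_matrix] that by blast+
  {
   fix p assume "p : {(F, %m. \<Sum>j\<in>UNIV. (\<i> * of_int (m $ j)) *s (ga j *v F m)) | F.
     \<forall>i. rd (%m. F m $ i)}"
   then obtain F where F: "p = (F, mf (fo Gm) F)" "F : RD" unfolding mf_def fo_def RD_def by blast
   then show "p : spin.lop RD (mf (fo Gm))" using l2[OF F(2)] by (simp add: spin.lop_def)
  next
   fix p assume "p : spin.lop RD (mf (fo Gm))"
   then obtain F where "p = (F, mf (fo Gm) F)" "F : RD" by (auto simp: spin.lop_def)
   then show "p : {(F, %m. \<Sum>j\<in>UNIV. (\<i> * of_int (m $ j)) *s (ga j *v F m)) | F.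
     \<forall>i. rd (%m. F m $ i)}" unfolding mf_def fo_def RD_def by blast
  }
 qed
 then show ?thesis unfolding torus_dirac_def
  by (simp only: spin.op_closure_mf[of "fo Gm", OF l fin_supp_RD RD_md_fo[of Gm, OF flin_matrix]])
qed

lemma is_N1: "is_N1_data X" by (rule spin.is_N1_model[where S = "(*v) sg" and A = Gm])
  (auto simp: fiber_op_eq torus_dirac_eq torus_rep_eq spin.lrep_def flin_matrix sg_hdot sg_sg ga_hdot ga_vec sg_ga)

subsection \<open>The real structure\<close>

lemma ep_sq [simp]: "ep * ep = 1" "cnj ep = ep" "ep'' * ep'' = 1" "cnj ep'' = ep''" using ep by auto

lemma norm_JN [simp]: "norm (JN v) = norm v"
proof -
 have "complex_of_real ((norm (JN v))\<^sup>2) = of_real ((norm v)\<^sup>2)"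
  using J_hdot[of v v] by (simp add: hdot_self del: of_real_power)
 then have "(norm (JN v))\<^sup>2 = (norm v)\<^sup>2" by (simp only: of_real_eq_iff)
 then show ?thesis by simp
qed

lemma JN_0: "JN 0 = 0" using J_smult[of 0 0] by simp

lemma JN_sum: "JN (\<Sum>i\<in>I. f i) = (\<Sum>i\<in>I. JN (f i))"
 by (induction I rule: infinite_finite_induct) (auto simp: JN_0 J_add)

definition Ji :: "(('n,'s) vf) => ('n,'s) vf" where "Ji F m = ep *s J F m"

lemma J_l2: "F : l2 ==> J F : l2" using l2_uminus_arg[of F] by (simp add: l2_def torus_J_def)

lemma Ji_l2: "F : l2 ==> Ji F : l2" unfolding Ji_def[abs_def] by (intro l2_smult J_l2)

lemma coc_minus: "cocycle Th (- m) (- m) = cocycle Th m m" by (simp add: cocycle_minus)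

lemma J_J_fun: "J (J F) = (%m. ep *s F m)"
 by (simp add: fun_eq_iff torus_J_def J_smult J_J coc_minus cocycle_minus vector_smult_assoc mult.assoc[symmetric])

lemma J_smult_fun: "J (%m. c *s F m) = (%m. cnj c *s J F m)"
 by (simp add: fun_eq_iff torus_J_def J_smult vector_smult_assoc mult.commute)

lemma J_add_fun: "J (%m. F m + G m) = (%m. J F m + J G m)"
 by (simp add: fun_eq_iff torus_J_def J_add vector_add_ldistrib)

lemma J_Ji: "J (Ji F) = F" and Ji_J: "Ji (J F) = F"
 unfolding Ji_def[abs_def] J_smult_fun J_J_fun by (simp_all add: vector_smult_assoc)

lemma J_ip: "l2_ip (J F) (J G) = l2_ip G F"
proof -
 have "hdot (J F m) (J G m) = hdot (G (- m)) (F (- m))" for m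
  by (simp add: torus_J_def hdot_smult J_hdot mult.assoc[symmetric])
 then show ?thesis
  unfolding l2_ip_def using infsum_UNIV_reindex[OF bij_uminus, of "%m. hdot (G m) (F m)"] by simp
qed

lemma Jstar_eq: "F : l2 ==> Jstar Vs J F = Ji F"
 unfolding Jstar_def by (rule inv_into_f_eq) (auto simp: Ji_l2 J_Ji inj_on_def, metis Ji_J)

lemma antiunitary_J: "antiunitary Vs J" unfolding antiunitary_def spinor_sel
proof (intro conjI ballI allI)
 show "J ` l2 = l2"
 proof (intro equalityI subsetI)
  fix F :: "('n,'s) vf" assume "F : l2"
  then show "F : J ` l2" by (intro image_eqI[of _ _ "Ji F"]) (simp_all add: J_Ji Ji_l2)
 qed (auto simp: J_l2)
qed (simp_all add: J_add_fun J_smult_fun J_ip)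

lemma Jconj_lop:
 assumes "D <= l2" "!!F. F : D ==> f F : l2"
 shows "Jconj Vs J (spin.lop D f) = spin.lop {F : l2. Ji F : D} (%F. J (f (Ji F)))"
proof (intro equalityI subsetI)
 fix p assume "p : Jconj Vs J (spin.lop D f)"
 then show "p : spin.lop {F : l2. Ji F : D} (%F. J (f (Ji F)))"
  by (auto simp: Jconj_def spin.lop_def J_l2 Ji_J)
next
 fix p assume p: "p : spin.lop {F : l2. Ji F : D} (%F. J (f (Ji F)))"
 obtain x y where xy: "p = (x, y)" by (cases p)
 have "x : l2" "Ji x : D" "y = J (f (Ji x))" using p xy by (auto simp: spin.lop_def)
 then have "p = (J (Ji x), J (f (Ji x)))" "(Ji x, f (Ji x)) : spin.lop D f"
  using assms by (auto simp: xy J_Ji spin.lop_def)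
 then show "p : Jconj Vs J (spin.lop D f)" unfolding Jconj_def by blast
qed

text \<open>Conjugating left multiplication by the antiunitary gives right multiplication by the adjoint.\<close>

lemma J_conv_Ji:
 assumes b: "l1 b" and F: "F : l2" shows "J (conv Th b (Ji F)) = rconv Th F (tstar Th b)"
proof
 fix m :: "'n mi"
 let ?q = "%p. - m - p"
 have bl: "bounded_linear (%v. cocycle Th m m *s JN v)" by (rule bounded_linear_intro[where K = 1])
   (simp_all add: J_add scaleR_eq_smult J_smult vector_add_ldistrib vector_smult_assoc mult.commute)
 have "((%p. cocycle Th m m *s JN ((b p * cocycle Th p (?q p)) *s Ji F (?q p))) has_sum J (conv Th b (Ji F)) m) UNIV"
  using has_sum_bounded_linear[OF bl conv_has_sum[OF b Ji_l2[OF F], where m = "- m" and Th = Th]]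
  by (simp add: o_def torus_J_def)
 moreover have "cocycle Th m m *s JN ((b p * cocycle Th p (?q p)) *s Ji F (?q p)) =
   (tstar Th b (m - (m + p)) * cocycle Th (m + p) (m - (m + p))) *s F (m + p)" for p
 proof -
  define s where "s = m + p"
  have m: "m = s - p" and q: "?q p = - s" by (simp_all add: s_def)
  have JF: "JN (Ji F (- s)) = cnj (cocycle Th s s) *s F s"
   by (simp add: Ji_def torus_J_def J_smult J_J vector_smult_assoc coc_minus mult_ac)
  have "cocycle Th m m * cocycle Th p s * cnj (cocycle Th s s) = cocycle Th p p * cnj (cocycle Th s p)"
  proof -
   have "cocycle Th m m = cocycle Th s s * cnj (cocycle Th s p) * (cnj (cocycle Th p s) * cocycle Th p p)"
    using cocycle_add(1)[of Th s "- p" "s + - p"] cocycle_add(2)[of Th s s "- p"] cocycle_add(2)[of Th "- p" s "- p"]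
    by (simp add: m cocycle_minus)
   then have "cocycle Th m m * cocycle Th p s * cnj (cocycle Th s s) =
     (cocycle Th s s * cnj (cocycle Th s s)) * (cocycle Th p s * cnj (cocycle Th p s)) * (cocycle Th p p * cnj (cocycle Th s p))"
    by (simp only: mult_ac)
   then show ?thesis by simp
  qed
  then have E: "cocycle Th m m * (cnj (b p) * cocycle Th p s * cnj (cocycle Th s s)) =
    cnj (b p) * (cocycle Th p p * cnj (cocycle Th s p))"
   by (metis (no_types, lifting) mult.assoc mult.commute)
  have l: "cnj (b p * cocycle Th p (- s)) = cnj (b p) * cocycle Th p s" by (simp add: cocycle_minus)
  have r: "tstar Th b (- p) * cocycle Th s (- p) = cnj (b p) * (cocycle Th p p * cnj (cocycle Th s p))"
   by (simp add: tstar_def cocycle_minus mult_ac)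
  have d: "m - s = - p" by (simp add: s_def)
  show ?thesis unfolding q J_smult s_def[symmetric] d l r JF vector_smult_assoc E ..
 qed
 ultimately have "((%p. (tstar Th b (m - (m + p)) * cocycle Th (m + p) (m - (m + p))) *s F (m + p)) has_sum
   J (conv Th b (Ji F)) m) UNIV" by simp
 moreover have "bij (%p. m + p)" by (rule bij_betw_byWitness[where f' = "%p. p - m"]) auto
 ultimately have "((%p. (tstar Th b (m - p) * cocycle Th p (m - p)) *s F p) has_sum J (conv Th b (Ji F)) m) UNIV"
  using has_sum_reindex_bij_betw[of "%p. m + p" UNIV UNIV
    "%p. (tstar Th b (m - p) * cocycle Th p (m - p)) *s F p"] by simp
 then show "J (conv Th b (Ji F)) m = rconv Th F (tstar Th b) m"
  using rconv_has_sum[OF l1_tstar[OF b] F] by (rule has_sum_unique)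
qed

lemma rconv_l2:
 fixes F :: "('n,'s) vf"
 assumes b: "l1 b" and F: "F : l2" shows "rconv Th F b : l2"
proof -
 have "rconv Th F b = J (conv Th (tstar Th b) (Ji F))"
  unfolding J_conv_Ji[OF l1_tstar[OF b] F] tstar_tstar ..
 then show ?thesis by (simp only: J_l2[OF conv_l2[OF l1_tstar[OF b] Ji_l2[OF F]]])
qed

lemma Jconj_rep:
 assumes b: "l1 b" shows "Jconj Vs J (torus_rep Th b) = spin.lop l2 (%F. rconv Th F (tstar Th b))"
 unfolding torus_rep_eq[OF b]
 by (subst Jconj_lop[OF order_refl conv_l2[OF b]], assumption, rule spin.lop_cong)
  (auto simp: Ji_l2 J_conv_Ji[OF b])

lemma J_fo: "mf (fo Gm) (J F) = J (mf (fo Gm) F)"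
proof
 fix m :: "'n mi"
 have c: "cnj (\<i> * of_int ((- m) $ j)) = \<i> * of_int (m $ j)" for j by simp
 have "JN ((\<i> * of_int ((- m) $ j)) *s (ga j *v F (- m))) = (\<i> * of_int (m $ j)) *s (ga j *v JN (F (- m)))" for j
  by (simp only: J_smult J_ga c)
 then have "J (mf (fo Gm) F) m = cocycle Th m m *s fo Gm m (JN (F (- m)))"
  by (simp only: torus_J_def mf_def fo_def JN_sum)
 then show "mf (fo Gm) (J F) m = J (mf (fo Gm) F) m"
  by (simp only: mf_def torus_J_def flin_smult[OF fo_linear[of Gm, OF flin_matrix]])
qed

lemma J_md: "Ji F : md (fo Gm) & F : l2 \<longleftrightarrow> F : md (fo Gm)"
proof -
 have f: "mf (fo Gm) (Ji F) = Ji (mf (fo Gm) F)" for F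
 proof -
  have "mf (fo Gm) (Ji F) = (%m. ep *s mf (fo Gm) (J F) m)"
   using flin_smult[OF fo_linear[of Gm, OF flin_matrix]] by (simp add: mf_def Ji_def fun_eq_iff)
  then show ?thesis by (simp add: J_fo Ji_def[abs_def])
 qed
 have g: "mf (fo Gm) F = J (mf (fo Gm) (Ji F))" by (simp only: f J_Ji)
 show ?thesis
 proof
  assume a: "Ji F : md (fo Gm) & F : l2"
  then have "mf (fo Gm) F : l2" unfolding g by (intro J_l2 md_mf) simp
  then show "F : md (fo Gm)" using a by (simp add: md_def)
 next
  assume a: "F : md (fo Gm)"
  have "mf (fo Gm) (Ji F) : l2" unfolding f by (rule Ji_l2[OF md_mf[OF a]])
  then show "Ji F : md (fo Gm) & F : l2" using mdD[OF a] Ji_l2 by (simp add: md_def)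
 qed
qed

lemma dD_eq: "rd a ==> dD X a = spin.lop l2 (oneform Th Gm (%j. pd j a))"
 unfolding dD_def sel torus_dirac_eq using spin.op_closure_comm_fo_lrep[of Gm a, OF flin_matrix]
 by (simp add: torus_rep_eq spin.lrep_def)

lemma oneform_rconv:
 assumes b: "!!j. l1 (b j)" and c: "l1 c" and F: "F : l2"
 shows "oneform Th Gm b (rconv Th F c) = rconv Th (oneform Th Gm b F) c"
proof
 fix m :: "'n mi"
 have "oneform Th Gm b (rconv Th F c) m = (\<Sum>j\<in>UNIV. rconv Th (%m. ga j *v conv Th (b j) F m) c m)"
  unfolding oneform_def
  by (simp add: conv_rconv b c F rconv_l2 rconv_fibre[OF flin_matrix c conv_l2[OF b F]])
 also have "... = rconv Th (oneform Th Gm b F) c m" unfolding oneform_def[abs_def]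
  by (rule rconv_sum[symmetric, OF c]) (intro l2_fibre[OF flin_matrix] conv_l2 b F)
 finally show "oneform Th Gm b (rconv Th F c) m = rconv Th (oneform Th Gm b F) c m" .
qed

lemma real_structure_J: "real_structure X J" unfolding real_structure_def Let_def sel spinor_sel
proof (intro conjI ballI)
 show "antiunitary Vs J" by (rule antiunitary_J)
 show "\<exists>e\<in>{1, -1}. \<forall>x\<in>l2. J (J x) = (%m. e *s x m)"
  using ep(1) J_J_fun by (intro bexI[of _ ep]) auto
 have "Jconj Vs J (torus_dirac ga) = op_scale Vs 1 (torus_dirac ga)"
  unfolding torus_dirac_eq unfolding spin.mop_def
  by (subst Jconj_lop[OF md_l2], erule md_mf, subst spin.op_scale_lop, erule md_mf, rule spin.lop_cong)
   (use J_md in \<open>auto simp: J_fo[symmetric] J_Ji\<close>)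
 then show "\<exists>e\<in>{1, -1}. Jconj Vs J (torus_dirac ga) = op_scale Vs e (torus_dirac ga)" by blast
 have "Jconj Vs J (fiber_op sg) = op_scale Vs ep'' (fiber_op sg)"
 proof -
  have "J (mf (%_. (*v) sg) (Ji F)) = (%m. ep'' *s mf (%_. (*v) sg) F m)" for F
  proof -
   have "J (mf (%_. (*v) sg) G) = (%m. ep'' *s mf (%_. (*v) sg) (J G) m)" for G
    by (simp add: torus_J_def mf_def J_sg vector_scalar_commute vector_smult_assoc mult.commute)
   then show ?thesis by (simp add: J_Ji)
  qed
  moreover have "mf (%_. (*v) sg) F : l2" if "F : l2" for F :: "('n,'s) vf"
   using l2_fibre[OF flin_matrix that] by (simp add: mf_def)
  ultimately show ?thesis unfolding fiber_op_eq spin.lop_fibre[OF flin_matrix]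
   by (subst Jconj_lop, simp, simp, subst spin.op_scale_lop, simp) (auto simp: Ji_l2 intro!: spin.lop_cong)
 qed
 then show "\<exists>e\<in>{1, -1}. Jconj Vs J (fiber_op sg) = op_scale Vs e (fiber_op sg)" using ep(2) by blast
 fix a b assume "a : carrier (nc_torus Th)" "b : carrier (nc_torus Th)"
 then have a: "rd a" and b: "rd b" by auto
 note la = l1_rd[OF a] and lb = l1_rd[OF b] and lb' = l1_tstar[OF l1_rd[OF b], of Th]
 show "comm Vs (torus_rep Th a) (Jconj Vs J (torus_rep Th b)) = op_zero_on Vs l2"
  unfolding Jconj_rep[OF lb] torus_rep_eq[OF la] spin.op_zero_lop[unfolded spinor_sel]
  by (subst spin.comm_lop) (auto simp: conv_l2 la rconv_l2 lb' conv_rconv intro!: spin.lop_eq_zeroI)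
 have l: "l1 (pd j a)" for j using rd_pd[OF a] by simp
 show "comm Vs (dD X a) (Jconj Vs J (torus_rep Th b)) = op_zero_on Vs l2"
  unfolding Jconj_rep[OF lb] dD_eq[OF a] spin.op_zero_lop[unfolded spinor_sel] by (subst spin.comm_lop)
   (auto simp: oneform_l2[of Gm, OF flin_matrix] l rconv_l2 lb' oneform_rconv intro!: spin.lop_eq_zeroI)
qed

end

section \<open>Formal sums and balanced tensor products\<close>

lemmas formal_eq_refl = formal_eq.intros(1) and formal_eq_sym = formal_eq.intros(2)
 and formal_eq_trans = formal_eq.intros(3) and formal_eq_app = formal_eq.intros(4)
 and formal_eq_commute = formal_eq.intros(5) and formal_eq_base = formal_eq.intros(6)

text \<open>A tensor is a class of lists, so a map out of a tensor product is well defined as soon as summing over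
  the list gives the same value on both sides of each generating relation.\<close>

lemma formal_eq_sum_list:
 fixes f :: "'p => 'b::comm_monoid_add"
 assumes "formal_eq R xs ys" "!!xs ys. R xs ys ==> sum_list (map f xs) = sum_list (map f ys)"
 shows "sum_list (map f xs) = sum_list (map f ys)"
 using assms by (induction rule: formal_eq.induct) (auto simp: add.commute)

lemma formal_eq_append:
 assumes "formal_eq R xs xs'" "formal_eq R ys ys'" shows "formal_eq R (xs @ ys) (xs' @ ys')"
proof -
 have "formal_eq R (xs @ ys) (xs' @ ys)" by (rule formal_eq_app[OF assms(1)])
 moreover have "formal_eq R (xs' @ ys) (ys @ xs')" by (rule formal_eq_commute)
 moreover have "formal_eq R (ys @ xs') (ys' @ xs')" by (rule formal_eq_app[OF assms(2)])
 moreover have "formal_eq R (ys' @ xs') (xs' @ ys')" by (rule formal_eq_commute)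
 ultimately show ?thesis by (meson formal_eq_trans)
qed

lemma formal_eq_concat: "(!!x. x : set xs ==> formal_eq R (f x) (g x)) ==>
  formal_eq R (concat (map f xs)) (concat (map g xs))"
 by (induction xs) (auto intro: formal_eq_refl formal_eq_append)

lemma tens2_self: "set xs <= carrier X \<times> carrier Y ==> xs : tens2 S X Y xs"
 by (simp add: tens2_def formal_eq_refl)

lemma tens2_rep:
 assumes "set xs <= carrier X \<times> carrier Y"
 shows "set (rep_of (tens2 S X Y xs)) <= carrier X \<times> carrier Y"
  and "formal_eq (tensor2_rel S X Y) xs (rep_of (tens2 S X Y xs))"
proof -
 have "rep_of (tens2 S X Y xs) : tens2 S X Y xs"
  unfolding rep_of_def by (rule someI[of _ xs]) (rule tens2_self[OF assms])
 then show "set (rep_of (tens2 S X Y xs)) <= carrier X \<times> carrier Y"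
  and "formal_eq (tensor2_rel S X Y) xs (rep_of (tens2 S X Y xs))" by (auto simp: tens2_def)
qed

lemma tens2_cong:
 assumes "formal_eq (tensor2_rel S X Y) xs ys" shows "tens2 S X Y xs = tens2 S X Y ys"
 unfolding tens2_def using assms by (meson formal_eq_sym formal_eq_trans)

lemma tens3_rep:
 assumes "set xs <= carrier X \<times> carrier Y \<times> carrier Z"
 shows "set (rep_of (tens3 S X Y Z xs)) <= carrier X \<times> carrier Y \<times> carrier Z"
  and "formal_eq (tensor3_rel S X Y Z) xs (rep_of (tens3 S X Y Z xs))"
proof -
 have "rep_of (tens3 S X Y Z xs) : tens3 S X Y Z xs"
  unfolding rep_of_def by (rule someI[of _ xs]) (simp add: tens3_def formal_eq_refl assms)
 then show "set (rep_of (tens3 S X Y Z xs)) <= carrier X \<times> carrier Y \<times> carrier Z"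
  and "formal_eq (tensor3_rel S X Y Z) xs (rep_of (tens3 S X Y Z xs))" by (auto simp: tens3_def)
qed

text \<open>If the right factor has a basis, every tensor has a canonical form, determined by its
 coefficients in the left factor.\<close>

text \<open>The type of coefficient algebras carries no algebraic class, so the module laws that the canonical form
  needs are assumptions; \<open>c\<close> are the coordinates in the basis \<open>e\<close> and \<open>z\<close> is the zero of the algebra.\<close>

locale based_tensor =
 fixes S :: "'a set" and X :: "('a, 'x) bimodule" and Y :: "('a, 'y) bimodule"
  and idx :: "'i list" and e :: "'i => 'y" and c :: "'y => 'i => 'a" and z :: 'a
 assumes addX: "x : carrier X ==> x' : carrier X ==> x \<oplus>\<^bsub>X\<^esub> x' : carrier X"
  and zeroX: "\<zero>\<^bsub>X\<^esub> : carrier X" and ractX: "x : carrier X ==> a : S ==> ract X x a : carrier X"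
  and eY: "e i : carrier Y" and cS: "y : carrier Y ==> c y i : S"
  and smultY: "a : S ==> y : carrier Y ==> a \<odot>\<^bsub>Y\<^esub> y : carrier Y"
  and addY: "y : carrier Y ==> y' : carrier Y ==> y \<oplus>\<^bsub>Y\<^esub> y' : carrier Y" and zeroY: "\<zero>\<^bsub>Y\<^esub> : carrier Y"
  and expand: "y : carrier Y ==> foldr (add Y) (map (%i. c y i \<odot>\<^bsub>Y\<^esub> e i) idx) \<zero>\<^bsub>Y\<^esub> = y"
  and z: "z : S" "x : carrier X ==> ract X x z = \<zero>\<^bsub>X\<^esub>" "z \<odot>\<^bsub>Y\<^esub> \<zero>\<^bsub>Y\<^esub> = \<zero>\<^bsub>Y\<^esub>"
begin

abbreviation feq (infix "\<doteq>" 50) where "xs \<doteq> ys \<equiv> formal_eq (tensor2_rel S X Y) xs ys"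

lemma right_zero:
 assumes x: "x : carrier X" shows "[(x, \<zero>\<^bsub>Y\<^esub>)] \<doteq> []"
proof -
 have "[(ract X x z, \<zero>\<^bsub>Y\<^esub>)] \<doteq> [(x, z \<odot>\<^bsub>Y\<^esub> \<zero>\<^bsub>Y\<^esub>)]"
  by (rule formal_eq_base) (rule tensor2_rel.intros(3)[OF x zeroY z(1)])
 then have "[(\<zero>\<^bsub>X\<^esub>, \<zero>\<^bsub>Y\<^esub>)] \<doteq> [(x, \<zero>\<^bsub>Y\<^esub>)]" by (simp add: z x)
 moreover have "[(\<zero>\<^bsub>X\<^esub>, \<zero>\<^bsub>Y\<^esub>)] \<doteq> []" by (rule formal_eq_base) (rule tensor2_rel.intros(4)[OF zeroY])
 ultimately show ?thesis by (meson formal_eq_sym formal_eq_trans)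
qed

lemma right_sum:
 assumes x: "x : carrier X" and ys: "set ys <= carrier Y"
 shows "foldr (add Y) ys \<zero>\<^bsub>Y\<^esub> : carrier Y & [(x, foldr (add Y) ys \<zero>\<^bsub>Y\<^esub>)] \<doteq> map (Pair x) ys"
 using ys
proof (induction ys)
 case Nil
 then show ?case using right_zero[OF x] by (simp add: zeroY)
next
 case (Cons y ys)
 then have IH: "foldr (add Y) ys \<zero>\<^bsub>Y\<^esub> : carrier Y" "[(x, foldr (add Y) ys \<zero>\<^bsub>Y\<^esub>)] \<doteq> map (Pair x) ys"
  and y: "y : carrier Y" by auto
 have "[(x, y \<oplus>\<^bsub>Y\<^esub> foldr (add Y) ys \<zero>\<^bsub>Y\<^esub>)] \<doteq> [(x, y)] @ [(x, foldr (add Y) ys \<zero>\<^bsub>Y\<^esub>)]"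
  using formal_eq_base[of "tensor2_rel S X Y", OF tensor2_rel.intros(2)[OF x y IH(1)]] by simp
 moreover have "[(x, y)] @ [(x, foldr (add Y) ys \<zero>\<^bsub>Y\<^esub>)] \<doteq> [(x, y)] @ map (Pair x) ys"
  by (rule formal_eq_append[OF formal_eq_refl IH(2)])
 ultimately show ?case using addY[OF y IH(1)] by (simp, meson formal_eq_trans)
qed

lemma canonical_single:
 assumes x: "x : carrier X" and y: "y : carrier Y"
 shows "[(x, y)] \<doteq> map (%i. (ract X x (c y i), e i)) idx"
proof -
 have "[(x, y)] \<doteq> map (Pair x) (map (%i. c y i \<odot>\<^bsub>Y\<^esub> e i) idx)"
  using right_sum[OF x, of "map (%i. c y i \<odot>\<^bsub>Y\<^esub> e i) idx"] expand[OF y] smultY[OF cS[OF y] eY] by auto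
 moreover have "concat (map (%i. [(x, c y i \<odot>\<^bsub>Y\<^esub> e i)]) idx) \<doteq> concat (map (%i. [(ract X x (c y i), e i)]) idx)"
  by (rule formal_eq_concat, rule formal_eq_sym, rule formal_eq_base, rule tensor2_rel.intros(3)[OF x eY cS[OF y]])
 ultimately show ?thesis by (simp add: concat_map_singleton o_def) (meson formal_eq_trans)
qed

lemma add_canonical:
 assumes "!!i. f i : carrier X" "!!i. g i : carrier X"
 shows "map (%i. (f i, e i)) is @ map (%i. (g i, e i)) is \<doteq> map (%i. (f i \<oplus>\<^bsub>X\<^esub> g i, e i)) is"
proof (induction "is")
 case (Cons i "is")
 let ?F = "map (%i. (f i, e i)) is" and ?G = "map (%i. (g i, e i)) is"
 have "?F @ [(g i, e i)] \<doteq> [(g i, e i)] @ ?F" by (rule formal_eq_commute)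
 from formal_eq_append[OF formal_eq_append[OF formal_eq_refl[of _ "[(f i, e i)]"] this] formal_eq_refl[of _ ?G]]
 have "(f i, e i) # ?F @ (g i, e i) # ?G \<doteq> [(f i, e i), (g i, e i)] @ (?F @ ?G)" by simp
 moreover have "[(f i, e i), (g i, e i)] @ (?F @ ?G) \<doteq> [(f i \<oplus>\<^bsub>X\<^esub> g i, e i)] @ map (%i. (f i \<oplus>\<^bsub>X\<^esub> g i, e i)) is"
  by (rule formal_eq_append[OF _ Cons.IH], rule formal_eq_sym, rule formal_eq_base,
    rule tensor2_rel.intros(1)[OF assms eY])
 ultimately show ?case by (simp, meson formal_eq_trans)
qed (simp add: formal_eq_refl)

definition coeff :: "('x \<times> 'y) list => 'i => 'x" where
 "coeff xs i = foldr (add X) (map (%(x, y). ract X x (c y i)) xs) \<zero>\<^bsub>X\<^esub>"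

lemma coeff_carrier: "set xs <= carrier X \<times> carrier Y ==> coeff xs i : carrier X"
 by (induction xs) (auto simp: coeff_def zeroX intro!: addX ractX cS)

lemma canonical: "set xs <= carrier X \<times> carrier Y ==> xs \<doteq> map (%i. (coeff xs i, e i)) idx"
proof (induction xs)
 case Nil
 have "concat (map (%i. []) idx) \<doteq> concat (map (%i. [(\<zero>\<^bsub>X\<^esub>, e i)]) idx)"
  by (rule formal_eq_concat, rule formal_eq_sym, rule formal_eq_base, rule tensor2_rel.intros(4)[OF eY])
 moreover have "concat (map (%i. []) idx) = ([] :: ('x \<times> 'y) list)" by (induction idx) auto
 ultimately show ?case by (simp add: coeff_def concat_map_singleton)
next
 case (Cons p xs)
 obtain x y where p: "p = (x, y)" by (cases p)
 have x: "x : carrier X" "y : carrier Y" "set xs <= carrier X \<times> carrier Y" using Cons.prems p by auto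
 have "[(x, y)] @ xs \<doteq> map (%i. (ract X x (c y i), e i)) idx @ map (%i. (coeff xs i, e i)) idx"
  by (rule formal_eq_append[OF canonical_single[OF x(1,2)] Cons.IH[OF x(3)]])
 moreover have "map (%i. (ract X x (c y i), e i)) idx @ map (%i. (coeff xs i, e i)) idx \<doteq>
   map (%i. (ract X x (c y i) \<oplus>\<^bsub>X\<^esub> coeff xs i, e i)) idx"
  by (rule add_canonical) (use x in \<open>auto intro: ractX cS coeff_carrier\<close>)
 ultimately show ?case by (simp add: p coeff_def) (meson formal_eq_trans)
qed

lemma formal_eq_by_coeff:
 assumes "set xs <= carrier X \<times> carrier Y" "set ys <= carrier X \<times> carrier Y"
  and "!!i. coeff xs i = coeff ys i" shows "xs \<doteq> ys"
 using canonical[OF assms(1)] canonical[OF assms(2)] unfolding assms(3)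
 by (meson formal_eq_sym formal_eq_trans)

end

section \<open>The module of smooth spinors\<close>

lemma conv_sum_vec:
 assumes a: "l1 a" and F: "!!i. i : I ==> F i : l2"
 shows "conv Th a (%m. \<Sum>i\<in>I. F i m) = (%m. \<Sum>i\<in>I. conv Th a (F i) m)" using F
proof (induction I rule: infinite_finite_induct)
 case (insert x I)
 then show ?case by (simp add: conv_add_vec[OF a])
qed (simp_all add: conv_eq_vec a fun_eq_iff vec_eq_iff)

lemma oneform_RD:
 assumes "!!j. flin (A j)" "!!j. rd (b j)" "F : RD" shows "oneform Th A b F : RD"
 unfolding oneform_def[abs_def] by (rule RD_sum, rule RD_fibre[OF assms(1)], rule RD_conv[OF assms(2,3)])

definition co :: "('n::finite multi_index => complex^'s::finite) => 's => 'n mi => complex" where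
 "co F i = (%m. F m $ i)"

lemma co_rd [simp]: "F : RD ==> rd (co F i)" by (simp add: RD_def co_def)

lemma co_add: "co (%m. F m + G m) i = (%m. co F i m + co G i m)"
 and co_smult: "co (%m. c *s F m) i = (%m. c * co F i m)"
 and co_zero: "co (%m. 0) i = (%m. 0)" by (simp_all add: co_def)

lemma co_conv: "rd a ==> F : RD ==> co (conv Th a F) i = tconv Th a (co F i)"
 using RD_l2 by (auto simp: co_def fun_eq_iff conv_component)

lemma co_rconv: "co (rconv Th F b) i = tconv Th (co F i) b" by (simp add: co_def fun_eq_iff)

definition eu :: "'s => 'n::finite multi_index => complex^'s::finite" where "eu i = delta 0 (axis i 1)"

lemma eu_RD: "eu i : RD" unfolding eu_def using delta_fin_supp fin_supp_RD by blast

lemma co_eu: "co (eu i) k = (if i = k then (%m. if m = 0 then 1 else 0) else (%m. 0))"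
 by (auto simp: co_def eu_def delta_def axis_def fun_eq_iff)

lemma conv_eu: "conv Th a (eu i) = (%m. a m *s axis i 1)" by (simp add: eu_def conv_delta fun_eq_iff)

lemma basis_sum: "(\<Sum>i\<in>UNIV. co F i m *s axis i 1) = F m" by (simp add: co_def basis_expansion)

definition idx :: "'s::finite list" where "idx = (SOME xs. set xs = UNIV & distinct xs)"

lemma idx: "set (idx :: 's::finite list) = UNIV" "distinct (idx :: 's list)"
proof -
 have "\<exists>xs :: 's list. set xs = UNIV & distinct xs" by (rule finite_distinct_list) simp
 from someI_ex[OF this] show "set (idx :: 's list) = UNIV" "distinct (idx :: 's list)"
  unfolding idx_def by auto
qed

lemma sum_list_idx: "(\<Sum>i\<leftarrow>idx. f i) = (\<Sum>i\<in>UNIV. f i)"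
 by (simp add: sum_list_distinct_conv_sum_set idx)

context torus_spinor
begin

lemma Winv_id: "F : l2 ==> spin.Winv F = F" using spin.W_Winv by blast

definition om :: "('n => 'n mi => complex) => (('n,'s) vf) oper" where
 "om b = spin.lop l2 (oneform Th Gm b)"

abbreviation "Nr \<equiv> rd :: ('n mi => complex) => bool"

lemma oneform_l2': "(!!j. Nr (b j)) ==> F : l2 ==> oneform Th Gm b F : l2"
 by (rule oneform_l2[of Gm, OF flin_matrix]) auto

lemma om_add:
 assumes "!!j. Nr (b j)" "!!j. Nr (b' j)" shows "op_add Vs (om b) (om b') = om (%j m. b j m + b' j m)"
 unfolding om_def
 by (subst spin.op_add_lop, rule oneform_l2'[OF assms(1)], assumption, rule oneform_l2'[OF assms(2)], assumption,
   rule spin.lop_cong) (use assms in \<open>auto simp: oneform_def[abs_def] conv_add flin_add[OF flin_matrix] sum.distrib\<close>)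

lemma om_zero: "op_zero_on Vs l2 = om (%j m. 0)" unfolding om_def spin.op_zero_lop[unfolded spinor_sel]
 by (rule spin.lop_cong) (auto simp: oneform_def[abs_def] conv_0 flin_0[OF flin_matrix])

lemma om_scale:
 assumes "!!j. Nr (b j)" shows "op_scale Vs c (om b) = om (%j m. c * b j m)" unfolding om_def
 by (subst spin.op_scale_lop, rule oneform_l2'[OF assms], assumption, rule spin.lop_cong)
  (use assms in \<open>auto simp: oneform_def[abs_def] conv_cmult flin_smult[OF flin_matrix] smult_sum\<close>)

lemma rep_om:
 assumes a: "Nr a" and b: "!!j. Nr (b j)"
 shows "op_comp (torus_rep Th a) (om b) = om (%j. tconv Th a (b j))"
proof -
 have "conv Th a (oneform Th Gm b F) = oneform Th Gm (%j. tconv Th a (b j)) F" if F: "F : l2" for F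
 proof -
  have "conv Th a (oneform Th Gm b F) = (%m. \<Sum>j\<in>UNIV. conv Th a (%m. ga j *v conv Th (b j) F m) m)"
   unfolding oneform_def[abs_def]
   by (rule conv_sum_vec) (use a b F in \<open>auto intro!: l2_fibre[OF flin_matrix] conv_l2\<close>)
  also have "... = oneform Th Gm (%j. tconv Th a (b j)) F"
   using a b F by (simp add: oneform_def[abs_def] conv_tconv conv_fibre[OF flin_matrix] conv_l2)
  finally show ?thesis .
 qed
 then show ?thesis unfolding om_def torus_rep_eq[OF l1_rd[OF a]]
  by (subst spin.op_comp_lop) (use b in \<open>auto intro!: spin.lop_cong oneform_l2'\<close>)
qed

lemma om_rep:
 assumes a: "Nr a" and b: "!!j. Nr (b j)"
 shows "op_comp (om b) (torus_rep Th a) = om (%j. tconv Th (b j) a)"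
 unfolding om_def torus_rep_eq[OF l1_rd[OF a]] by (subst spin.op_comp_lop)
  (use a b in \<open>auto intro!: spin.lop_cong simp: conv_l2 oneform_def[abs_def] conv_tconv\<close>)

lemma dD_om: "Nr a ==> dD X a = om (%j. pd j a)" by (simp add: dD_eq om_def)

lemma om_cong: "(!!j. b j = b' j) ==> om b = om b'" by (metis ext)

lemma op_sum_om:
 assumes "!!x j. x : set xs ==> Nr (b x j)"
 shows "op_sum Vs (map (%x. om (b x)) xs) = om (%j m. \<Sum>x\<leftarrow>xs. b x j m) & (\<forall>j. Nr (%m. \<Sum>x\<leftarrow>xs. b x j m))"
 using assms by (induction xs) (auto simp: op_sum_def om_zero om_add rd_0 intro: rd_add)

text \<open>The differentials of the unitary generators form a basis of the one-forms.\<close>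

lemma Omega1_eq: "Omega1 X = {om b | b. \<forall>j. Nr (b j)}"
proof (intro equalityI subsetI)
 fix ww assume "ww : Omega1 X"
 then obtain ps where ps: "ww = op_sum Vs (map (%(a, b). op_comp (torus_rep Th a) (dD X b)) ps)"
  "!!a b. (a, b) : set ps ==> Nr a & Nr b" unfolding Omega1_def by auto
 have Nps: "Nr (tconv Th (fst p) (pd j (snd p)))" if "p : set ps" for p j
  using ps(2)[of "fst p" "snd p"] that by (simp add: rd_tconv rd_pd)
 have "ww = op_sum Vs (map (%p. om (%j. tconv Th (fst p) (pd j (snd p)))) ps)" unfolding ps(1)
 proof (rule arg_cong[where f = "op_sum Vs"], rule map_cong[OF refl])
  fix p assume "p : set ps"
  then have p: "Nr (fst p)" "Nr (snd p)" using ps(2)[of "fst p" "snd p"] by simp_all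
  show "(case p of (a, b) => op_comp (torus_rep Th a) (dD X b)) = om (%j. tconv Th (fst p) (pd j (snd p)))"
   by (simp only: case_prod_beta dD_om[OF p(2)] rep_om[OF p(1) rd_pd[OF p(2)]])
 qed
 moreover note op_sum_om[of ps "%p j. tconv Th (fst p) (pd j (snd p))", OF Nps]
 ultimately show "ww : {om b | b. \<forall>j. Nr (b j)}"
  by (intro CollectI exI[of _ "%j m. \<Sum>p\<leftarrow>ps. tconv Th (fst p) (pd j (snd p)) m"]) simp
next
 fix ww assume "ww : {om b | b. \<forall>j. Nr (b j)}"
 then obtain b where ww: "ww = om b" and b: "!!j. Nr (b j)" by auto
 define u where "u = (torus_gen :: 'n => 'n mi => complex)"
 have u: "Nr (u j)" for j by (simp add: u_def torus_gen_def[abs_def] rd_single)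
 have us: "tconv Th (tstar Th (u j)) (u j) = (%m. if m = 0 then 1 else 0)" for j
  using torus_gen_unitary(1)[of Th j] by (simp add: u_def)
 have pu: "pd k (u j) = (if k = j then (%m. \<i> * u j m) else (%m. 0))" for j k
  by (auto simp: pd_def u_def torus_gen_def axis_def fun_eq_iff)
 define a where "a = (%j. tconv Th (%m. - \<i> * b j m) (tstar Th (u j)))"
 have a: "Nr (a j)" for j unfolding a_def by (intro rd_tconv rd_cmult b rd_tstar u)
 obtain js where js: "set js = (UNIV :: 'n set)" "distinct js"
  using finite_distinct_list[OF finite[of "UNIV::'n set"]] by auto
 have "tconv Th (a j) (pd k (u j)) m = (if k = j then b j m else 0)" for j k m
 proof -
  have "tconv Th (a j) (%m. \<i> * u j m) m = \<i> * tconv Th (a j) (u j) m" by (rule tconv_cmult(2))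
  also have "tconv Th (a j) (u j) = tconv Th (%m. - \<i> * b j m) (tconv Th (tstar Th (u j)) (u j))"
   unfolding a_def by (intro tconv_assoc_rd rd_cmult b rd_tstar u)
  finally show ?thesis by (simp add: pu us tconv_unit)
 qed
 then have "om b = om (%k m. \<Sum>j\<leftarrow>js. tconv Th (a j) (pd k (u j)) m)"
  by (simp add: sum_list_distinct_conv_sum_set js)
 also have "... = op_sum Vs (map (%j. om (%k. tconv Th (a j) (pd k (u j)))) js)"
  by (subst op_sum_om[THEN conjunct1]) (auto intro: rd_tconv a rd_pd u)
 also have "... = op_sum Vs (map (%(a, b). op_comp (torus_rep Th a) (dD X b)) (map (%j. (a j, u j)) js))"
  by (simp add: o_def dD_om[OF u] rep_om[OF a rd_pd[OF u]])
 finally show "ww : Omega1 X"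
  unfolding Omega1_def ww using a u by (auto intro!: exI[of _ "map (%j. (a j, u j)) js"])
qed

lemma op_adj_om:
 assumes b: "!!j. Nr (b j)" shows "op_adj Vs (om b) = om (%j m. - tstar Th (b j) m)"
proof -
 have mt: "(%m. - tstar Th (b j) m) = (%m. (-1) * tstar Th (b j) m)" for j by simp
 have bm: "Nr (%m. - tstar Th (b j) m)" for j unfolding mt by (intro rd_cmult rd_tstar b)
 have lb: "l1 (b j)" for j using b by simp
 have cm: "conv Th (%m. - tstar Th (b j) m) G = (%m. - conv Th (tstar Th (b j)) G m)" if "G : l2" for j G
  unfolding mt using conv_cmult[where c = "-1", OF l1_tstar[OF lb] that] by (simp add: vector_sneg_minus1[symmetric])
 have sm: "l2_ip G (%m. \<Sum>j\<in>I. F j m) = (\<Sum>j\<in>I. l2_ip G (F j))"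
  "l2_ip (%m. \<Sum>j\<in>I. F j m) G = (\<Sum>j\<in>I. l2_ip (F j) G)"
  if "G : l2" "!!j. F j : l2" for G and F :: "'n => ('n,'s) vf" and I
  using that by (induction I rule: infinite_finite_induct) (auto simp: l2_ip_add)
 have "l2_ip G (oneform Th Gm b F) = l2_ip (oneform Th Gm (%j m. - tstar Th (b j) m) G) F"
  if F: "F : l2" "G : l2" for F G
 proof -
  have t: "l2_ip G (%m. ga j *v conv Th (b j) F m) = l2_ip (%m. ga j *v conv Th (%m. - tstar Th (b j) m) G m) F" for j
  proof -
   have "l2_ip G (%m. ga j *v conv Th (b j) F m) = l2_ip (%m. - (ga j *v G m)) (conv Th (b j) F)"
    unfolding l2_ip_def by (rule infsum_cong) (simp add: hdot_minus ga_hdot)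
   also have "... = l2_ip (conv Th (tstar Th (b j)) (%m. - (ga j *v G m))) F"
    by (rule conv_adj[OF lb F(1)]) (intro l2_uminus l2_fibre[OF flin_matrix] F)
   also have "conv Th (tstar Th (b j)) (%m. - (ga j *v G m)) = (%m. ga j *v conv Th (%m. - tstar Th (b j) m) G m)"
    using conv_fibre[OF flin_intros(6)[OF flin_matrix[of "ga j"]] l1_tstar[OF lb, of Th j] F(2), of Th]
    by (simp add: cm[OF F(2)] fun_eq_iff flin_minus[OF flin_matrix])
   finally show ?thesis .
  qed
  have l: "(%m. ga j *v conv Th (b j) F m) : l2" "(%m. ga j *v conv Th (%m. - tstar Th (b j) m) G m) : l2" for j
   by (intro l2_fibre[OF flin_matrix] conv_l2 l1_rd b bm F)+
  show ?thesis unfolding oneform_def[abs_def] sm(1)[OF F(2) l(1)] sm(2)[OF F(1) l(2)] t ..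
 qed
 then show ?thesis unfolding om_def
  by (intro spin.op_adj_bdd spin.bdd_oneform flin_matrix lb oneform_l2' bm fin_supp_l2 order_refl)
qed

definition rone :: "('n => 'n mi => complex) => (('n,'s) vf) => ('n,'s) vf" where
 "rone b xi m = - (\<Sum>j\<in>UNIV. ga j *v rconv Th xi (b j) m)"

lemma ap_om: "(!!j. Nr (b j)) ==> xi : l2 ==> ap (om b) xi = oneform Th Gm b xi"
 unfolding om_def by (subst spin.ap_lop) (auto simp: oneform_l2' Winv_id)

lemma ap_rep: "Nr a ==> xi : l2 ==> ap (torus_rep Th a) xi = conv Th a xi" for xi :: "('n,'s) vf"
 by (subst torus_rep_eq) (auto simp: spin.ap_lop conv_l2 Winv_id)

lemma ap_fiber: "xi : l2 ==> ap (fiber_op M) xi = (%m. M *v xi m)"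
 for xi :: "('n,'s) vf" and M :: "complex^'s^'s" unfolding fiber_op_eq spin.lop_fibre[OF flin_matrix]
 by (subst spin.ap_lop) (auto simp: l2_fibre[OF flin_matrix] Winv_id mf_def)

lemma right_act_rep: "Nr a ==> xi : l2 ==> right_act X J xi (torus_rep Th a) = rconv Th xi a"
proof -
 assume a: "Nr a" and x: "xi : l2"
 have "op_adj Vs (torus_rep Th a) = torus_rep Th (tstar Th a)" using spin.op_adj_lrep[OF l1_rd[OF a]] a
  by (simp add: torus_rep_eq rd_tstar spin.lrep_def)
 then show ?thesis using J_conv_Ji[OF l1_tstar[OF l1_rd[OF a], of Th] x]
  by (simp add: right_act_def Jstar_eq[OF x] ap_rep rd_tstar a Ji_l2 x tstar_tstar)
qed

lemma J_sum_fun: "J (%m. \<Sum>i\<in>I. F i m) = (%m. \<Sum>i\<in>I. J (F i) m)"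
 by (simp add: torus_J_def JN_sum smult_sum)

lemma J_ga_fun: "J (%m. ga j *v F m) = (%m. ga j *v J F m)"
 by (simp add: torus_J_def J_ga vector_scalar_commute)

lemma right_act_om:
 assumes b: "!!j. Nr (b j)" and x: "xi : l2" shows "right_act X J xi (om b) = rone b xi"
proof -
 have mt: "(%m. - tstar Th (b j) m) = (%m. (-1) * tstar Th (b j) m)" for j by simp
 have bm: "Nr (%m. - tstar Th (b j) m)" for j unfolding mt by (intro rd_cmult rd_tstar b)
 have "right_act X J xi (om b) = J (oneform Th Gm (%j m. - tstar Th (b j) m) (Ji xi))"
  by (simp add: right_act_def Jstar_eq[OF x] op_adj_om[OF b] ap_om[OF bm] Ji_l2 x)
 also have "... = (%m. \<Sum>j\<in>UNIV. ga j *v rconv Th xi (tstar Th (%m. - tstar Th (b j) m)) m)"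
  unfolding oneform_def[abs_def] J_sum_fun J_ga_fun by (simp add: J_conv_Ji[OF l1_rd[OF bm] x])
 also have "... = rone b xi"
 proof -
  have "tstar Th (%m. - tstar Th (b j) m) = (%m. (-1) * b j m)" for j
   unfolding mt tstar_cmult tstar_tstar by simp
  moreover have "rconv Th xi (%m. (-1) * b j m) m = - rconv Th xi (b j) m" for j m
   by (simp only: vec_eq_iff rconv_component tconv_cmult) simp
  ultimately show ?thesis by (simp add: rone_def[abs_def] flin_minus[OF flin_matrix] sum_negf)
 qed
 finally show ?thesis .
qed

lemma J_RD:
 assumes "F : RD" shows "J F : RD"
proof -
 have "JN v = (\<Sum>k\<in>UNIV. cnj (v $ k) *s JN (axis k 1))" for v
 proof -
  have "JN v = JN (\<Sum>k\<in>UNIV. v $ k *s axis k 1)" by (simp add: basis_expansion)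
  then show ?thesis by (simp only: JN_sum J_smult)
 qed
 then have eq: "JN v $ i = (\<Sum>k\<in>UNIV. cnj (v $ k) * JN (axis k 1) $ i)" for v i
  by (metis (no_types, lifting) sum.cong sum_component vector_smult_component)
 have "J F m $ i = (\<Sum>k\<in>UNIV. JN (axis k 1) $ i * tstar Th (co F k) m)" for m i
  unfolding torus_J_def vector_smult_component eq[of "F (- m)" i]
  by (simp add: tstar_def co_def sum_distrib_left mult_ac)
 then show ?thesis using assms unfolding RD_def by (auto intro!: rd_sum rd_cmult rd_tstar simp: co_def)
qed

lemma rone_RD: "(!!j. Nr (b j)) ==> xi : RD ==> rone b xi : RD"
proof -
 assume b: "!!j. Nr (b j)" and x: "xi : RD"
 have "(%m. \<Sum>j\<in>UNIV. ga j *v rconv Th xi (b j) m) : RD"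
  by (rule RD_sum, rule RD_fibre[OF flin_matrix], rule RD_rconv[OF x b])
 from RD_smult[OF this, of "-1"] show ?thesis
  by (simp add: rone_def[abs_def] vector_sneg_minus1[symmetric])
qed

abbreviation "EB \<equiv> sub_bimodule X J RD"
abbreviation "OB \<equiv> Omega_bimodule X"

lemma EB_sel [simp]: "carrier EB = RD" "\<zero>\<^bsub>EB\<^esub> = (%m. 0)" "add EB = (%F G m. F m + G m)"
 by (simp_all add: sub_bimodule_def)

lemma EB_smult: "Nr a ==> xi : RD ==> a \<odot>\<^bsub>EB\<^esub> xi = conv Th a xi"
 and EB_ract: "Nr a ==> xi : RD ==> ract EB xi a = rconv Th xi a"
 using RD_l2 by (auto simp: sub_bimodule_def ap_rep right_act_rep)

lemma OB_sel [simp]: "carrier OB = {om b | b. \<forall>j. Nr (b j)}" "\<zero>\<^bsub>OB\<^esub> = om (%j m. 0)" "add OB = op_add Vs"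
 by (simp_all add: Omega_bimodule_def Omega1_eq om_zero)

lemma OB_ract: "ract OB ww a = op_comp ww (torus_rep Th a)" by (simp add: Omega_bimodule_def)

lemma OB_om: "ww : carrier OB ==> \<exists>b. ww = om b & (\<forall>j. Nr (b j))" by auto

lemma om_OB: "(!!j. Nr (b j)) ==> om b : carrier OB" by auto

lemma EB_expand:
 assumes y: "y : RD"
 shows "foldr (add EB) (map (%i. co y i \<odot>\<^bsub>EB\<^esub> eu i) idx) \<zero>\<^bsub>EB\<^esub> = y"
proof -
 have "foldr (add EB) (map (%i. co y i \<odot>\<^bsub>EB\<^esub> eu i) is) \<zero>\<^bsub>EB\<^esub> = (%m. \<Sum>i\<leftarrow>is. co y i m *s axis i 1)" for "is"
  by (induction "is") (auto simp: EB_smult y eu_RD conv_eu)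
 then show ?thesis by (simp add: sum_list_idx basis_sum)
qed

lemma rconv_0: "rconv Th F (%m. 0) = (%m. 0)" by (simp add: fun_eq_iff vec_eq_iff)

sublocale EEt: based_tensor "{a. Nr a}" EB EB idx eu co "%m. 0"
proof
 show "x : carrier EB ==> a : {a. Nr a} ==> ract EB x a : carrier EB" for x a
  by (simp add: EB_ract RD_rconv)
 show "a : {a. Nr a} ==> x : carrier EB ==> a \<odot>\<^bsub>EB\<^esub> x : carrier EB" for x a
  by (simp add: EB_smult RD_conv)
 show "y : carrier EB ==> foldr (add EB) (map (%i. co y i \<odot>\<^bsub>EB\<^esub> eu i) idx) \<zero>\<^bsub>EB\<^esub> = y" for y
  by (rule EB_expand) simp
 show "x : carrier EB ==> ract EB x (%m. 0) = \<zero>\<^bsub>EB\<^esub>" for x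
  by (simp add: EB_ract rd_0 rconv_0)
 show "(%m. 0) \<odot>\<^bsub>EB\<^esub> \<zero>\<^bsub>EB\<^esub> = \<zero>\<^bsub>EB\<^esub>"
  by (simp add: EB_smult rd_0 RD_zero conv_0)
qed (simp_all add: RD_add RD_zero eu_RD rd_0)

sublocale OEt: based_tensor "{a. Nr a}" OB EB idx eu co "%m. 0"
proof
 show "ww \<oplus>\<^bsub>OB\<^esub> ww' : carrier OB" if o: "ww : carrier OB" "ww' : carrier OB" for ww ww'
 proof -
  obtain b b' where b: "ww = om b" "!!j. Nr (b j)" "ww' = om b'" "!!j. Nr (b' j)"
   using OB_om[OF o(1)] OB_om[OF o(2)] by metis
  have "ww \<oplus>\<^bsub>OB\<^esub> ww' = om (%j m. b j m + b' j m)" by (simp add: b om_add)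
  then show ?thesis using om_OB[of "%j m. b j m + b' j m"] b by (simp add: rd_add)
 qed
 show "\<zero>\<^bsub>OB\<^esub> : carrier OB" using om_OB[of "%j m. 0"] by (simp add: rd_0)
 show "ract OB ww a : carrier OB" if o: "ww : carrier OB" "a : {a. Nr a}" for ww a
 proof -
  obtain b where b: "ww = om b" "!!j. Nr (b j)" using OB_om[OF o(1)] by metis
  have a: "Nr a" using o(2) by simp
  have "ract OB ww a = om (%j. tconv Th (b j) a)" by (simp only: OB_ract b(1) om_rep[OF a b(2)])
  then show ?thesis using om_OB[of "%j. tconv Th (b j) a", OF rd_tconv[OF b(2) a]] by simp
 qed
 show "ract OB ww (%m. 0) = \<zero>\<^bsub>OB\<^esub>" if o: "ww : carrier OB" for ww
 proof -
  obtain b where b: "ww = om b" "!!j. Nr (b j)" using OB_om[OF o] by metis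
  have "ract OB ww (%m. 0) = om (%j. tconv Th (b j) (%m. 0))"
   by (simp only: OB_ract b(1) om_rep[OF rd_0 b(2)])
  also have "... = om (%j m. 0)" by (rule om_cong) (simp add: tconv_def fun_eq_iff)
  finally show ?thesis by simp
 qed
qed (use EEt.eY EEt.cS EEt.smultY EEt.addY EEt.zeroY EEt.expand EEt.z in \<open>simp_all only:\<close>)

end

section \<open>The free Hermitian module of smooth spinors and its flat connection\<close>

lemma tstar_sum: "tstar Th (%m. \<Sum>i\<in>I. a i m) = (%m. \<Sum>i\<in>I. tstar Th (a i) m)"
 by (simp add: tstar_def fun_eq_iff sum_distrib_left)

lemma pd_tstar: "pd j (tstar Th a) = tstar Th (pd j a)" by (simp add: pd_def tstar_def fun_eq_iff)

text \<open>The momentum is additive under convolution.\<close>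

lemma pd_tconv:
 assumes "rd a" "rd b" shows "pd j (tconv Th a b) = (%m. tconv Th a (pd j b) m + tconv Th (pd j a) b m)"
proof
 fix m
 obtain B where B: "!!m. cmod (b m) <= B" using rd_bounded[OF assms(2)] by blast
 obtain B' where B': "!!m. cmod (pd j b m) <= B'" using rd_bounded[OF rd_pd[OF assms(2)]] by blast
 have s1: "(%p. a p * pd j b (m - p) * cocycle Th p (m - p)) summable_on UNIV"
  by (rule norm_summable_summable, rule summable_tconv_term[OF rd_norm_summable[OF assms(1)] B'])
 have s2: "(%p. pd j a p * b (m - p) * cocycle Th p (m - p)) summable_on UNIV"
  by (rule norm_summable_summable, rule summable_tconv_term[OF rd_norm_summable[OF rd_pd[OF assms(1)]] B])
 have "tconv Th a (pd j b) m + tconv Th (pd j a) b m =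
   (\<Sum>\<^sub>\<infinity>p. a p * pd j b (m - p) * cocycle Th p (m - p) + pd j a p * b (m - p) * cocycle Th p (m - p))"
  unfolding tconv_def by (rule infsum_add[OF s1 s2, symmetric])
 also have "... = (\<Sum>\<^sub>\<infinity>p. \<i> * of_int (m $ j) * (a p * b (m - p) * cocycle Th p (m - p)))"
  by (rule infsum_cong) (simp add: pd_def algebra_simps)
 also have "... = pd j (tconv Th a b) m" unfolding pd_def tconv_def by (rule infsum_cmult_right')
 finally show "pd j (tconv Th a b) m = tconv Th a (pd j b) m + tconv Th (pd j a) b m" by (rule HOL.sym)
qed

lemma co_sum: "co (%m. \<Sum>i\<in>I. F i m) k = (%m. \<Sum>i\<in>I. co (F i) k m)" by (simp add: co_def)

context torus_spinor
begin

lemma OB_E: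
 assumes "ww : carrier OB" obtains b where "ww = om b" "!!j. Nr (b j)" using OB_om[OF assms] by metis

lemma OB_lop:
 assumes "ww : carrier OB"
 shows "ww = spin.lop l2 (ap ww)" and "!!x. x : l2 ==> ap ww x : l2" and "!!x. x : RD ==> ap ww x : RD"
proof -
 obtain b where b: "ww = om b" "!!j. Nr (b j)" by (rule OB_E[OF assms]) simp
 have "om b = spin.lop l2 (ap (om b))"
  by (subst om_def, rule spin.lop_cong[OF refl]) (simp add: ap_om[OF b(2)])
 then show "ww = spin.lop l2 (ap ww)" by (simp only: b(1))
 show "ap ww x : l2" if "x : l2" for x
  using oneform_l2'[OF b(2) that] by (simp add: b(1) ap_om[OF b(2) that])
 show "ap ww x : RD" if "x : RD" for x
  using oneform_RD[OF flin_matrix b(2) that] ap_om[OF b(2) subsetD[OF RD_l2 that]] by (simp only: b(1))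
qed

lemma OB_eqI:
 assumes "ww : carrier OB" "ww' : carrier OB" "!!x m. x : l2 ==> ap ww x m = ap ww' x m" shows "ww = ww'"
proof -
 have "spin.lop l2 (ap ww) = spin.lop l2 (ap ww')" by (rule spin.lop_cong[OF refl]) (use assms(3) in blast)
 then show ?thesis using OB_lop(1)[OF assms(1)] OB_lop(1)[OF assms(2)] by simp
qed

lemma ap_lop_l2: "(!!F. F : l2 ==> f F : l2) ==> x : l2 ==> ap (spin.lop l2 f) x = f x"
 by (subst spin.ap_lop) (simp_all add: Winv_id)

lemma ap_OB_add:
 assumes "ww : carrier OB" "ww' : carrier OB" "x : l2"
 shows "ap (op_add Vs ww ww') x = (%m. ap ww x m + ap ww' x m)"
proof -
 have "op_add Vs ww ww' = op_add Vs (spin.lop l2 (ap ww)) (spin.lop l2 (ap ww'))"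
  using OB_lop(1)[OF assms(1)] OB_lop(1)[OF assms(2)] by simp
 also have "... = spin.lop (l2 \<inter> l2) (%F m. ap ww F m + ap ww' F m)"
  by (rule spin.op_add_lop) (rule OB_lop(2)[OF assms(1)], assumption, rule OB_lop(2)[OF assms(2)], assumption)
 finally show ?thesis
  using ap_lop_l2[of "%F m. ap ww F m + ap ww' F m", OF l2_add assms(3)] OB_lop(2)[OF assms(1)] OB_lop(2)[OF assms(2)]
  by simp
qed

lemma ap_OB_zero: "x : l2 ==> ap \<zero>\<^bsub>OB\<^esub> x = (%m. 0)"
 by (simp add: om_zero[symmetric] spin.op_zero_lop[unfolded spinor_sel] ap_lop_l2)

lemma OB_zero: "\<zero>\<^bsub>OB\<^esub> : carrier OB" by (rule OEt.zeroX)

lemma OB_add: "ww : carrier OB ==> ww' : carrier OB ==> op_add Vs ww ww' : carrier OB"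
 using OEt.addX by simp

lemma OB_comp_rep: "ww : carrier OB ==> Nr a ==> op_comp ww (torus_rep Th a) : carrier OB"
 using OEt.ractX[of ww a] unfolding OB_ract by blast

lemma OB_rep_comp:
 assumes "ww : carrier OB" "Nr a" shows "op_comp (torus_rep Th a) ww : carrier OB"
proof -
 obtain b where b: "ww = om b" "!!j. Nr (b j)" by (rule OB_E[OF assms(1)]) simp
 show ?thesis unfolding b(1) rep_om[OF assms(2) b(2)] by (rule om_OB) (rule rd_tconv[OF assms(2) b(2)])
qed

lemma OB_adj:
 assumes "ww : carrier OB" shows "op_adj Vs ww : carrier OB"
proof -
 obtain b where b: "ww = om b" "!!j. Nr (b j)" by (rule OB_E[OF assms(1)]) simp
 have "Nr (%m. (-1) * tstar Th (b j) m)" for j by (intro rd_cmult rd_tstar b)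
 then show ?thesis unfolding b(1) op_adj_om[OF b(2)] by (intro om_OB) simp
qed

lemma OB_dD: "Nr a ==> dD X a : carrier OB" by (simp only: dD_om) (rule om_OB, rule rd_pd)

lemma ap_comp_rep:
 assumes "ww : carrier OB" "Nr a" "x : l2" shows "ap (op_comp ww (torus_rep Th a)) x = ap ww (conv Th a x)"
proof -
 obtain b where b: "ww = om b" "!!j. Nr (b j)" by (rule OB_E[OF assms(1)]) simp
 have x: "conv Th a x : l2" by (rule conv_l2[OF l1_rd[OF assms(2)] assms(3)])
 show ?thesis
  unfolding b(1) om_rep[OF assms(2) b(2)] ap_om[OF rd_tconv[OF b(2) assms(2)] assms(3)] ap_om[OF b(2) x]
  using assms b by (simp add: oneform_def[abs_def] conv_tconv)
qed

lemma ap_rep_comp: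
 assumes "ww : carrier OB" "Nr a" "x : l2" shows "ap (op_comp (torus_rep Th a) ww) x = conv Th a (ap ww x)"
proof -
 have l: "l1 a" using assms(2) by simp
 have "op_comp (torus_rep Th a) ww = op_comp (spin.lop l2 (conv Th a)) (spin.lop l2 (ap ww))"
  using OB_lop(1)[OF assms(1)] torus_rep_eq[OF l] by simp
 also have "... = spin.lop l2 (%F. conv Th a (ap ww F))"
  by (subst spin.op_comp_lop) (auto intro!: spin.lop_cong OB_lop(2)[OF assms(1)] conv_l2[OF l])
 finally show ?thesis
  using ap_lop_l2[of "%F. conv Th a (ap ww F)", OF conv_l2[OF l OB_lop(2)[OF assms(1)]] assms(3)] by simp
qed

lemma ap_OB_add_vec:
 assumes "ww : carrier OB" "x : l2" "y : l2" shows "ap ww (%m. x m + y m) = (%m. ap ww x m + ap ww y m)"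
proof -
 obtain b where b: "ww = om b" "!!j. Nr (b j)" by (rule OB_E[OF assms(1)]) simp
 show ?thesis
  unfolding b(1) ap_om[OF b(2) assms(2)] ap_om[OF b(2) assms(3)] ap_om[OF b(2) l2_add[OF assms(2,3)]]
  using b(2) assms(2,3)
  by (simp add: oneform_def[abs_def] conv_add_vec flin_add[OF flin_matrix] sum.distrib)
qed

lemma op_sum_OB:
 assumes "set Ts <= carrier OB"
 shows "op_sum Vs Ts : carrier OB & (\<forall>x\<in>l2. ap (op_sum Vs Ts) x = (%m. \<Sum>T\<leftarrow>Ts. ap T x m))"
 using assms
proof (induction Ts)
 case Nil
 have "op_sum Vs [] = \<zero>\<^bsub>OB\<^esub>" by (simp add: op_sum_def om_zero)
 then show ?case using OB_zero ap_OB_zero by simp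
next
 case (Cons T Ts)
 have e: "op_sum Vs (T # Ts) = op_add Vs T (op_sum Vs Ts)" by (simp add: op_sum_def)
 have T: "T : carrier OB" and IH: "op_sum Vs Ts : carrier OB"
  "!!x. x : l2 ==> ap (op_sum Vs Ts) x = (%m. \<Sum>T\<leftarrow>Ts. ap T x m)"
  using Cons by (simp_all del: OB_sel)
 show ?case unfolding e using OB_add[OF T IH(1)] ap_OB_add[OF T IH(1)] IH(2) by (simp del: OB_sel)
qed

text \<open>The standard Hermitian structure of the free module, with the value off the module that a Hermitian
  structure must have.\<close>

definition gE :: "(('n,'s) vf) => (('n,'s) vf) => 'n mi => complex" where
 "gE xi et = (if xi : RD & et : RD then (%m. \<Sum>i\<in>UNIV. tconv Th (co xi i) (tstar Th (co et i)) m) else undefined)"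

text \<open>The flat connection, which differentiates the coordinates in the basis \<open>e\<close>.\<close>

definition nab :: "(('n,'s) vf) => ((('n,'s) vf) oper \<times> (('n,'s) vf)) list set" where
 "nab xi = OE X J RD (map (%i. (dD X (co xi i), eu i)) idx)"

lemma gE_eq: "xi : RD ==> et : RD ==> gE xi et = (%m. \<Sum>i\<in>UNIV. tconv Th (co xi i) (tstar Th (co et i)) m)"
 by (simp add: gE_def)

lemma gE_Nr: "xi : RD ==> et : RD ==> Nr (gE xi et)"
 unfolding gE_eq by (intro rd_sum rd_tconv rd_tstar co_rd)

lemma gE_eu:
 assumes "xi : RD" shows "gE xi (eu i) = co xi i" "gE (eu i) xi = tstar Th (co xi i)"
proof -
 have "tconv Th (co xi k) (tstar Th (co (eu i) k)) m = (if k = i then co xi i m else 0)"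
  "tconv Th (co (eu i) k) (tstar Th (co xi k)) m = (if k = i then tstar Th (co xi i) m else 0)" for k m
  using tstar_cmult[of Th 0 "%m. 0"] by (auto simp: co_eu tstar_unit)
 then show "gE xi (eu i) = co xi i" "gE (eu i) xi = tstar Th (co xi i)"
  by (simp_all add: gE_eq assms eu_RD)
qed

lemma gE_conv:
 assumes "Nr a" "Nr b" "xi : RD" "et : RD"
 shows "gE (conv Th a xi) (conv Th b et) = tconv Th (tconv Th a (gE xi et)) (tstar Th b)"
proof -
 have t: "tconv Th (co (conv Th a xi) i) (tstar Th (co (conv Th b et) i)) =
   tconv Th (tconv Th a (tconv Th (co xi i) (tstar Th (co et i)))) (tstar Th b)" for i
  using assms by (simp add: co_conv tstar_tconv tconv_assoc_rd rd_tconv rd_tstar)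
 have s1: "tconv Th a (%m. \<Sum>i\<in>UNIV. tconv Th (co xi i) (tstar Th (co et i)) m) =
   (%m. \<Sum>i\<in>UNIV. tconv Th a (tconv Th (co xi i) (tstar Th (co et i))) m)"
  by (rule tconv_sum_rd(2)) (use assms in \<open>simp_all add: rd_tconv rd_tstar\<close>)
 have s2: "tconv Th (%m. \<Sum>i\<in>UNIV. tconv Th a (tconv Th (co xi i) (tstar Th (co et i))) m) (tstar Th b) =
   (%m. \<Sum>i\<in>UNIV. tconv Th (tconv Th a (tconv Th (co xi i) (tstar Th (co et i)))) (tstar Th b) m)"
  by (rule tconv_sum_rd(1)) (use assms in \<open>simp_all add: rd_tconv rd_tstar\<close>)
 show ?thesis
  unfolding gE_eq[OF assms(3,4)] gE_eq[OF RD_conv[OF assms(1,3)] RD_conv[OF assms(2,4)]] s1 s2 t ..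
qed

lemma gE_add:
 assumes "xi : RD" "xi' : RD" "et : RD" shows "gE (%m. xi m + xi' m) et = (%m. gE xi et m + gE xi' et m)"
  and "gE et (%m. xi m + xi' m) = (%m. gE et xi m + gE et xi' m)" using assms
 by (simp_all add: gE_eq RD_add co_add tstar_add tconv_add_rd rd_tstar sum.distrib)

lemma conv_sum:
 fixes F :: "('n,'s) vf"
 assumes "!!i. i : I ==> Nr (a i)" "F : l2"
 shows "conv Th (%m. \<Sum>i\<in>I. a i m) F = (%m. \<Sum>i\<in>I. conv Th (a i) F m)" using assms(1)
proof (induction I rule: infinite_finite_induct)
 case (insert i I)
 have "Nr (%m. \<Sum>i\<in>I. a i m)" by (rule rd_sum) (use insert in simp)
 with insert show ?case by (simp add: conv_add assms(2))
qed (simp_all add: conv_0 assms(2))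

lemma gE_positive:
 assumes "xi : RD" shows "positive_op Vs (torus_rep Th (gE xi xi))"
proof -
 have l: "l1 (gE xi xi)" using gE_Nr[OF assms assms] by simp
 have "Im (l2_ip x y) = 0 & 0 <= Re (l2_ip x y)" if xy: "(x, y) : torus_rep Th (gE xi xi)"
  for x y :: "('n,'s) vf"
 proof -
  have x: "x : l2" using xy unfolding torus_rep_eq[OF l] spin.lop_def by simp
  have y: "y = conv Th (gE xi xi) x" using xy unfolding torus_rep_eq[OF l] spin.lop_def by simp
  let ?c = "%i. conv Th (tstar Th (co xi i)) x"
  have c: "?c i : l2" for i by (rule conv_l2[OF l1_tstar[OF l1_rd[OF co_rd[OF assms]]] x])
  have "y = (%m. \<Sum>i\<in>UNIV. conv Th (tconv Th (co xi i) (tstar Th (co xi i))) x m)"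
   unfolding y gE_eq[OF assms assms] by (rule conv_sum[OF _ x]) (intro rd_tconv rd_tstar co_rd assms)
  then have y': "y = (%m. \<Sum>i\<in>UNIV. conv Th (co xi i) (?c i) m)"
   using assms x by (simp add: conv_tconv rd_tstar)
  have sm: "l2_ip x (%m. \<Sum>j\<in>I. F j m) = (\<Sum>j\<in>I. l2_ip x (F j))"
   if "!!j. F j : l2" for F :: "'s => ('n,'s) vf" and I
   using that x by (induction I rule: infinite_finite_induct) (auto simp: l2_ip_add)
  have "l2_ip x y = (\<Sum>i\<in>UNIV. l2_ip x (conv Th (co xi i) (?c i)))"
   unfolding y' by (rule sm) (rule conv_l2[OF l1_rd[OF co_rd[OF assms]] c])
  also have "... = (\<Sum>i\<in>UNIV. l2_ip (?c i) (?c i))"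
   by (rule sum.cong[OF refl], rule conv_adj[OF l1_rd[OF co_rd[OF assms]] c x])
  also have "... = of_real (\<Sum>i\<in>UNIV. (nl2 (?c i))\<^sup>2)" using c by (simp add: l2_ip_self)
  finally show ?thesis by (simp add: sum_nonneg)
 qed
 moreover have "bounded_op Vs (torus_rep Th (gE xi xi))"
  unfolding torus_rep_eq[OF l] by (rule spin.bounded_op_lop[OF spin.bdd_conv[OF l]])
 ultimately show ?thesis unfolding positive_op_def by auto
qed

lemma expand_additive:
 assumes add: "!!et et'. et : RD ==> et' : RD ==> \<phi> (%m. et m + et' m) = (%m. \<phi> et m + \<phi> et' m)"
  and F: "!!i. F i : RD"
 shows "\<phi> (%m. \<Sum>i\<in>UNIV. F i m) = (%m. \<Sum>i\<in>(UNIV::'s set). \<phi> (F i) m :: complex)"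
proof -
 have z: "\<phi> (%m. 0) = (%m. 0)" using add[OF RD_zero RD_zero] by (simp add: fun_eq_iff)
 have "\<phi> (%m. \<Sum>i\<in>I. F i m) = (%m. \<Sum>i\<in>I. \<phi> (F i) m)" for I
  by (induction I rule: infinite_finite_induct) (simp_all add: z add F RD_sum)
 then show ?thesis .
qed

text \<open>A conjugate linear functional is represented by the vector of its values on the basis.\<close>

lemma hermitian_gE: "hermitian_structure X EB gE"
proof -
 have star: "tstar Th (gE xi et) = gE et xi" if "xi : RD" "et : RD" for xi et
  unfolding gE_eq[OF that] gE_eq[OF that(2,1)] tstar_sum by (simp add: tstar_tconv tstar_tstar)
 have riesz: "\<exists>!xi. xi : RD & (\<forall>et\<in>RD. gE xi et = \<phi> et)"
  if N: "!!et. et : RD ==> Nr (\<phi> et)"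
   and add: "!!et et'. et : RD ==> et' : RD ==> \<phi> (%m. et m + et' m) = (%m. \<phi> et m + \<phi> et' m)"
   and sm: "!!a et. Nr a ==> et : RD ==> \<phi> (a \<odot>\<^bsub>EB\<^esub> et) = tconv Th (\<phi> et) (tstar Th a)" for \<phi>
 proof
  define xi :: "('n,'s) vf" where "xi = (%m. \<chi> i. \<phi> (eu i) m)"
  have xi: "xi : RD" "co xi i = \<phi> (eu i)" for i
   using N[OF eu_RD] by (simp_all add: xi_def RD_def co_def)
  have "gE xi et = \<phi> et" if et: "et : RD" for et
  proof -
   have "\<phi> et = \<phi> (%m. \<Sum>i\<in>UNIV. conv Th (co et i) (eu i) m)" by (simp add: conv_eu basis_sum)
   also have "... = (%m. \<Sum>i\<in>UNIV. \<phi> (conv Th (co et i) (eu i)) m)"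
    by (rule expand_additive[OF add]) (simp_all add: RD_conv et eu_RD)
   also have "... = (%m. \<Sum>i\<in>UNIV. tconv Th (\<phi> (eu i)) (tstar Th (co et i)) m)"
    using sm[OF co_rd[OF et] eu_RD] by (simp add: EB_smult et eu_RD)
   finally show ?thesis by (simp add: gE_eq xi et)
  qed
  then show "xi : RD & (\<forall>et\<in>RD. gE xi et = \<phi> et)" using xi(1) by blast
  fix xi' assume x: "xi' : RD & (\<forall>et\<in>RD. gE xi' et = \<phi> et)"
  then have "co xi' i = co xi i" for i using gE_eu(1)[of xi' i] bspec[OF conjunct2[OF x] eu_RD[of i]] by (simp add: xi(2))
  then show "xi' = xi" by (simp add: co_def fun_eq_iff vec_eq_iff)
 qed
 show ?thesis unfolding hermitian_structure_def Let_def
 proof (intro conjI)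
  show "\<forall>xi et. xi \<notin> carrier EB \<or> et \<notin> carrier EB --> gE xi et = undefined" by (auto simp: gE_def)
  show "\<forall>xi\<in>carrier EB. \<forall>et\<in>carrier EB. gE xi et : carrier (alg X) & star (alg X) (gE xi et) = gE et xi"
   by (simp add: gE_Nr star)
  show "\<forall>xi\<in>carrier EB. \<forall>xi'\<in>carrier EB. \<forall>et\<in>carrier EB. gE (xi \<oplus>\<^bsub>EB\<^esub> xi') et = gE xi et \<oplus>\<^bsub>alg X\<^esub> gE xi' et \<and>
    gE et (xi \<oplus>\<^bsub>EB\<^esub> xi') = gE et xi \<oplus>\<^bsub>alg X\<^esub> gE et xi'"
   by (simp add: gE_add)
  show "\<forall>a\<in>carrier (alg X). \<forall>b\<in>carrier (alg X). \<forall>xi\<in>carrier EB. \<forall>et\<in>carrier EB.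
    gE (a \<odot>\<^bsub>EB\<^esub> xi) (b \<odot>\<^bsub>EB\<^esub> et) = a \<otimes>\<^bsub>alg X\<^esub> gE xi et \<otimes>\<^bsub>alg X\<^esub> star (alg X) b"
   by (simp add: EB_smult gE_conv)
  show "\<forall>xi\<in>carrier EB. positive_op (spc X) (rep X (gE xi xi))" by (simp add: gE_positive)
 qed (use riesz in simp)
qed

lemma fg_projective_EB: "fg_projective (nc_torus Th) EB"
proof -
 let ?k = "length (idx :: 's list)" and ?A = "nc_torus Th"
 have bij: "bij_betw ((!) (idx :: 's list)) {..<?k} UNIV" by (rule bij_betw_nth[OF idx(2)]) (simp_all add: idx)
 define pos where "pos = inv_into {..<?k} ((!) (idx :: 's list))"
 have pos: "pos i < ?k" "idx ! pos i = i" for i :: 's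
  using bij_betw_inv_into_right[OF bij, of i] bij_betw_apply[OF bij_betw_inv_into[OF bij], of i] by (simp_all add: pos_def)
 let ?s = "%xi :: ('n,'s) vf. \<lambda>i\<in>{..<?k}. co xi (idx ! i)"
 let ?r = "%f :: nat => 'n mi => complex. %m. (\<chi> i. f (pos i) m) :: complex^'s"
 have rRD: "?r f : RD" if "f : {..<?k} \<rightarrow>\<^sub>E {a. Nr a}" for f
  using that pos(1) by (auto simp: RD_def PiE_def Pi_def)
 have rs: "?r (?s xi) = xi" for xi by (simp add: pos co_def fun_eq_iff vec_eq_iff)
 have "left_hom ?A EB (free_left_module ?A ?k) ?s" unfolding left_hom_def
  by (simp add: free_left_module_def EB_smult co_conv co_add fun_eq_iff)
 moreover have "left_hom ?A (free_left_module ?A ?k) EB ?r" unfolding left_hom_def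
 proof (intro conjI ballI)
  fix f assume f: "f : carrier (free_left_module ?A ?k)"
  then have f': "f : {..<?k} \<rightarrow>\<^sub>E {a. Nr a}" by (simp add: free_left_module_def)
  show "?r f : carrier EB" using rRD[OF f'] by simp
  show "?r (f \<oplus>\<^bsub>free_left_module ?A ?k\<^esub> h) = ?r f \<oplus>\<^bsub>EB\<^esub> ?r h" for h
   by (simp add: free_left_module_def pos fun_eq_iff vec_eq_iff)
  fix a assume "a : carrier ?A"
  then have a: "Nr a" by simp
  have "co (conv Th a (?r f)) i m = tconv Th a (f (pos i)) m" for i m
   unfolding co_conv[OF a rRD[OF f']] by (simp add: co_def)
  then show "?r (a \<odot>\<^bsub>free_left_module ?A ?k\<^esub> f) = a \<odot>\<^bsub>EB\<^esub> ?r f"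
   unfolding EB_smult[OF a rRD[OF f']] by (simp add: free_left_module_def pos fun_eq_iff vec_eq_iff co_def)
 qed
 ultimately show ?thesis unfolding fg_projective_def using rs by blast
qed

lemma dense_RD: "dense_in Vs RD"
proof -
 have l: "(%m. 0 :: complex^'s) : l2" using RD_zero RD_l2 by blast
 have "Domain (spin.lop RD (%F m. 0)) = {x : carrier Vs. x : RD}" by (rule spin.Domain_lop) (rule l)
 also have "... = RD" using RD_l2 by auto
 finally show ?thesis using spin.dense_Domain_lop[OF fin_supp_RD RD_l2, of "%F m. 0"] l by simp
qed

lemma extension_module_RD: "extension_module X J RD" unfolding extension_module_def
proof (intro conjI ballI)
 fix ww and xi :: "('n,'s) vf" assume o: "ww : Omega1 X" and x: "xi : RD"
 obtain b where b: "ww = om b" "!!j. Nr (b j)" using o unfolding Omega1_eq by blast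
 show "ap ww xi : RD" using OB_lop(3)[OF om_OB[OF b(2)] x] by (simp only: b(1))
 show "right_act X J xi ww : RD"
  unfolding b(1) right_act_om[OF b(2) subsetD[OF RD_l2 x]] by (rule rone_RD[OF b(2) x])
next
 fix xi :: "('n,'s) vf" assume x: "xi : RD"
 show "J xi : RD" by (rule J_RD[OF x])
 show "ap (grd X) xi : RD" using ap_fiber[OF subsetD[OF RD_l2 x], of sg] RD_fibre[OF flin_matrix x] by simp
 show "ap (rep X a) xi : RD" if "a : carrier (alg X)" for a
  using that ap_rep[OF _ subsetD[OF RD_l2 x], of a] RD_conv[OF _ x, of a] by simp
qed (simp_all add: dense_RD RD_zero RD_add fg_projective_EB)

text \<open>Evaluating the one-form and a balanced functional of the module element, on a fixed vector, respects the
  relations of the tensor product over the algebra.\<close>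

lemma OE_invariant:
 fixes h :: "(('n,'s) vf) => 'b::ab_group_add"
 assumes eq: "formal_eq (tensor2_rel {a. Nr a} OB EB) xs ys"
  and h: "!!u v. u : l2 ==> v : l2 ==> h (%m. u m + v m) = h u + h v"
  and c: "!!y. y : RD ==> Nr (c y)"
   "!!y y'. y : RD ==> y' : RD ==> c (%m. y m + y' m) = (%m. c y m + c y' m)"
   "!!a y. Nr a ==> y : RD ==> c (conv Th a y) = tconv Th a (c y)"
  and x: "x : l2"
 shows "(\<Sum>(ww, y)\<leftarrow>xs. h (ap ww (conv Th (c y) x))) = (\<Sum>(ww, y)\<leftarrow>ys. h (ap ww (conv Th (c y) x)))"
proof (rule formal_eq_sum_list[OF eq])
 have l: "conv Th (c y) x : l2" if "y : RD" for y by (rule conv_l2[OF l1_rd[OF c(1)[OF that]] x])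
 have h0: "h (%m. 0) = 0" using h[OF subsetD[OF RD_l2 RD_zero] subsetD[OF RD_l2 RD_zero]] by simp
 fix xs ys assume "tensor2_rel {a. Nr a} OB EB xs ys"
 then show "(\<Sum>(ww, y)\<leftarrow>xs. h (ap ww (conv Th (c y) x))) = (\<Sum>(ww, y)\<leftarrow>ys. h (ap ww (conv Th (c y) x)))"
 proof cases
  case (1 ww ww' y)
  have y: "y : RD" using 1 by simp
  have "ap (op_add Vs ww ww') (conv Th (c y) x) = (%m. ap ww (conv Th (c y) x) m + ap ww' (conv Th (c y) x) m)"
   by (rule ap_OB_add[OF 1(3,4) l[OF y]])
  then show ?thesis using h[OF OB_lop(2)[OF 1(3) l[OF y]] OB_lop(2)[OF 1(4) l[OF y]]] by (simp add: 1(1,2))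
 next
  case (2 ww y y')
  have y: "y : RD" "y' : RD" using 2 by simp_all
  have "conv Th (c (%m. y m + y' m)) x = (%m. conv Th (c y) x m + conv Th (c y') x m)"
   unfolding c(2)[OF y] by (rule conv_add) (simp_all add: c(1) y x)
  then have "ap ww (conv Th (c (%m. y m + y' m)) x) = (%m. ap ww (conv Th (c y) x) m + ap ww (conv Th (c y') x) m)"
   using ap_OB_add_vec[OF 2(3) l[OF y(1)] l[OF y(2)]] by simp
  then show ?thesis using h[OF OB_lop(2)[OF 2(3) l[OF y(1)]] OB_lop(2)[OF 2(3) l[OF y(2)]]] by (simp add: 2(1,2))
 next
  case (3 ww y a)
  have y: "y : RD" and a: "Nr a" using 3 by simp_all
  have "ap (op_comp ww (torus_rep Th a)) (conv Th (c y) x) = ap ww (conv Th a (conv Th (c y) x))"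
   by (rule ap_comp_rep[OF 3(3) a l[OF y]])
  also have "conv Th a (conv Th (c y) x) = conv Th (c (conv Th a y)) x"
   using a y x c(1)[OF y] by (simp add: c(3) conv_tconv)
  finally show ?thesis by (simp add: 3(1,2) OB_ract EB_smult[OF a y])
 next
  case (4 y)
  then show ?thesis using ap_OB_zero[OF l[of y]] h0 by simp
 qed
qed

text \<open>Conversely these evaluations separate the tensors: with the coordinate functionals they determine the
  coefficients of the canonical form.\<close>

lemma OE_eqI:
 assumes xs: "set xs <= carrier OB \<times> carrier EB" and ys: "set ys <= carrier OB \<times> carrier EB"
  and eq: "!!k x m. x : l2 ==> (\<Sum>(ww, y)\<leftarrow>xs. ap ww (conv Th (co y k) x) m) = (\<Sum>(ww, y)\<leftarrow>ys. ap ww (conv Th (co y k) x) m)"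
 shows "OE X J RD xs = OE X J RD ys"
proof -
 have co: "OEt.coeff zs k : carrier OB \<and>
   (\<forall>x\<in>l2. \<forall>m. ap (OEt.coeff zs k) x m = (\<Sum>(ww, y)\<leftarrow>zs. ap ww (conv Th (co y k) x) m))"
  if zs: "set zs <= carrier OB \<times> carrier EB" for zs k
 proof (intro conjI ballI allI)
  show "OEt.coeff zs k : carrier OB" by (rule OEt.coeff_carrier[OF zs])
  fix x :: "('n,'s) vf" and m assume x: "x : l2"
  let ?Ts = "map (%(ww, y). op_comp ww (torus_rep Th (co y k))) zs"
  have mem: "fst p : carrier OB" "snd p : RD" if "p : set zs" for p
   using subsetD[OF zs that] by (simp_all add: mem_Times_iff del: OB_sel)
  have Ts: "set ?Ts <= carrier OB"
  proof
   fix T assume "T : set ?Ts"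
   then obtain p where p: "p : set zs" "T = op_comp (fst p) (torus_rep Th (co (snd p) k))" by auto
   show "T : carrier OB" unfolding p(2) by (rule OB_comp_rep[OF mem(1)[OF p(1)] co_rd[OF mem(2)[OF p(1)]]])
  qed
  have "OEt.coeff zs k = op_sum Vs ?Ts"
   unfolding OEt.coeff_def op_sum_def by (simp add: OB_ract om_zero[symmetric])
  then have "ap (OEt.coeff zs k) x m = (\<Sum>T\<leftarrow>?Ts. ap T x m)" using op_sum_OB[OF Ts] x by simp
  also have "... = (\<Sum>p\<leftarrow>zs. ap (fst p) (conv Th (co (snd p) k) x) m)" unfolding map_map
  proof (rule arg_cong[where f = sum_list], rule map_cong[OF refl])
   fix p assume p: "p : set zs"
   show "((%T. ap T x m) \<circ> (%(ww, y). op_comp ww (torus_rep Th (co y k)))) p = ap (fst p) (conv Th (co (snd p) k) x) m"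
    using ap_comp_rep[OF mem(1)[OF p] co_rd[OF mem(2)[OF p]] x] by (simp add: case_prod_beta)
  qed
  finally show "ap (OEt.coeff zs k) x m = (\<Sum>(ww, y)\<leftarrow>zs. ap ww (conv Th (co y k) x) m)" by (simp add: case_prod_unfold)
 qed
 have "OEt.coeff xs k = OEt.coeff ys k" for k by (rule OB_eqI) (use co[OF xs] co[OF ys] eq in simp_all)
 from OEt.formal_eq_by_coeff[OF xs ys this] show ?thesis by (intro tens2_cong) simp
qed

lemma nab_list:
 assumes "xi : RD" shows "set (map (%i. (dD X (co xi i), eu i)) idx) <= carrier OB \<times> carrier EB"
 using OB_dD[OF co_rd[OF assms]] eu_RD by auto

lemma nab_rep:
 assumes "xi : RD" shows "set (rep_of (nab xi)) <= carrier OB \<times> carrier EB"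
  and "formal_eq (tensor2_rel {a. Nr a} OB EB) (map (%i. (dD X (co xi i), eu i)) idx) (rep_of (nab xi))"
 using tens2_rep[OF nab_list[OF assms], of "{a. Nr a}"] unfolding nab_def by simp_all

lemma nab_sum:
 fixes h :: "(('n,'s) vf) => 'b::ab_group_add"
 assumes xi: "xi : RD" and h: "!!u v. u : l2 ==> v : l2 ==> h (%m. u m + v m) = h u + h v"
  and c: "!!y. y : RD ==> Nr (c y)"
   "!!y y'. y : RD ==> y' : RD ==> c (%m. y m + y' m) = (%m. c y m + c y' m)"
   "!!a y. Nr a ==> y : RD ==> c (conv Th a y) = tconv Th a (c y)"
  and x: "x : l2" shows "(\<Sum>(ww, y)\<leftarrow>rep_of (nab xi). h (ap ww (conv Th (c y) x))) =
  (\<Sum>i\<in>UNIV. h (ap (dD X (co xi i)) (conv Th (c (eu i)) x)))"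
proof -
 have "(\<Sum>(ww, y)\<leftarrow>rep_of (nab xi). h (ap ww (conv Th (c y) x))) =
   (\<Sum>(ww, y)\<leftarrow>map (%i. (dD X (co xi i), eu i)) idx. h (ap ww (conv Th (c y) x)))"
  by (rule OE_invariant[where h = h and c = c, OF nab_rep(2)[OF xi] h c x, THEN HOL.sym])
 also have "... = (\<Sum>i\<leftarrow>idx. h (ap (dD X (co xi i)) (conv Th (c (eu i)) x)))"
  by (simp only: map_map o_def prod.case)
 finally show ?thesis unfolding sum_list_idx .
qed

lemma nab_coeff:
 fixes h :: "(('n,'s) vf) => 'b::ab_group_add"
 assumes xi: "xi : RD" and h: "!!u v. u : l2 ==> v : l2 ==> h (%m. u m + v m) = h u + h v" and x: "x : l2"
 shows "(\<Sum>(ww, y)\<leftarrow>rep_of (nab xi). h (ap ww (conv Th (co y k) x))) = h (ap (dD X (co xi k)) x)"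
proof -
 have z: "(%m. 0) : (l2 :: (('n,'s) vf) set)" using RD_zero RD_l2 by blast
 have h0: "h (%m. 0) = 0" using h[OF z z] by simp
 have "ap (dD X (co xi i)) (%m. 0) = (%m. 0)" for i
  using ap_OB_add_vec[OF OB_dD[OF co_rd[OF xi]] z z, of i] by (simp add: fun_eq_iff)
 then have t: "h (ap (dD X (co xi i)) (conv Th (co (eu i) k) x)) = (if i = k then h (ap (dD X (co xi k)) x) else 0)" for i
  by (simp add: co_eu conv_unit conv_0 x h0)
 have "(\<Sum>(ww, y)\<leftarrow>rep_of (nab xi). h (ap ww (conv Th (co y k) x))) =
   (\<Sum>i\<in>UNIV. h (ap (dD X (co xi i)) (conv Th (co (eu i) k) x)))"
  by (rule nab_sum[where c = "%y. co y k", OF xi h co_rd co_add co_conv x])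
 then show ?thesis unfolding t by simp
qed

lemma ap_dD: "Nr a ==> x : l2 ==> ap (dD X a) x = (%m. \<Sum>j\<in>UNIV. ga j *v conv Th (pd j a) x m)"
 unfolding dD_om by (subst ap_om) (simp_all add: rd_pd oneform_def[abs_def])

lemma ap_dD_tconv:
 assumes a: "Nr a" and b: "Nr b" and x: "x : l2"
 shows "ap (dD X (tconv Th a b)) x = (%m. conv Th a (ap (dD X b) x) m + ap (dD X a) (conv Th b x) m)"
proof -
 have bx: "conv Th b x : l2" by (rule conv_l2[OF l1_rd[OF b] x])
 have px: "conv Th (pd j b) x : l2" for j by (rule conv_l2[OF l1_rd[OF rd_pd[OF b]] x])
 have s: "conv Th a (%m. \<Sum>j\<in>UNIV. ga j *v conv Th (pd j b) x m) = (%m. \<Sum>j\<in>UNIV. conv Th a (%m. ga j *v conv Th (pd j b) x m) m)"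
  by (rule conv_sum_vec[OF l1_rd[OF a]]) (rule l2_fibre[OF flin_matrix px])
 have f: "conv Th a (%m. ga j *v conv Th (pd j b) x m) m = ga j *v conv Th (tconv Th a (pd j b)) x m" for j m
  using conv_fibre[OF flin_matrix l1_rd[OF a] px, where Th = Th and m = m, of "ga j" j] a b x
  by (simp add: conv_tconv rd_pd)
 have g: "conv Th (pd j (tconv Th a b)) x m = conv Th (tconv Th a (pd j b)) x m + conv Th (pd j a) (conv Th b x) m" for j m
  unfolding pd_tconv[OF a b] using a b x by (simp add: conv_add conv_tconv rd_pd rd_tconv)
 show ?thesis unfolding ap_dD[OF rd_tconv[OF a b] x] ap_dD[OF b x] ap_dD[OF a bx] s f g
  by (simp add: matrix_vector_right_distrib sum.distrib)
qed

lemma ap_dD_sum: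
 assumes a: "!!i. i : I ==> Nr (a i)" and x: "x : l2"
 shows "ap (dD X (%m. \<Sum>i\<in>I. c i * a i m)) x = (%m. \<Sum>i\<in>I. c i *s ap (dD X (a i)) x m)"
proof -
 have p: "pd j (%m. \<Sum>i\<in>I. c i * a i m) = (%m. \<Sum>i\<in>I. c i * pd j (a i) m)" for j
  by (simp add: pd_def fun_eq_iff sum_distrib_left mult_ac)
 have c: "conv Th (%m. \<Sum>i\<in>I. c i * pd j (a i) m) x = (%m. \<Sum>i\<in>I. c i *s conv Th (pd j (a i)) x m)" for j
  using a x by (simp add: conv_sum rd_cmult rd_pd conv_cmult)
 have v: "ga j *v (\<Sum>i\<in>I. c i *s u i) = (\<Sum>i\<in>I. c i *s (ga j *v u i))" for j and u :: "_ => complex^'s"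
  by (simp add: flin_sum[OF flin_matrix] vector_scalar_commute)
 have N: "Nr (%m. \<Sum>i\<in>I. c i * a i m)" by (intro rd_sum rd_cmult a)
 have "ap (dD X (%m. \<Sum>i\<in>I. c i * a i m)) x m = (\<Sum>i\<in>I. c i *s ap (dD X (a i)) x m)" for m
 proof -
  have "ap (dD X (%m. \<Sum>i\<in>I. c i * a i m)) x m = (\<Sum>j\<in>UNIV. \<Sum>i\<in>I. c i *s (ga j *v conv Th (pd j (a i)) x m))"
   unfolding ap_dD[OF N x] p c v ..
  also have "... = (\<Sum>i\<in>I. \<Sum>j\<in>UNIV. c i *s (ga j *v conv Th (pd j (a i)) x m))" by (rule sum.swap)
  also have "... = (\<Sum>i\<in>I. c i *s ap (dD X (a i)) x m)"
   by (rule sum.cong[OF refl]) (simp add: ap_dD[OF a x] smult_sum)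
  finally show ?thesis .
 qed
 then show ?thesis by blast
qed

lemma ap_dD_add:
 assumes "Nr a" "Nr b" "x : l2"
 shows "ap (dD X (%m. a m + b m)) x = (%m. ap (dD X a) x m + ap (dD X b) x m)"
 using ap_dD_sum[of "UNIV :: bool set" "%i. if i then a else b" x "%_. 1"] assms by (simp add: UNIV_bool add.commute)

text \<open>All identities between tensors are checked on the separating evaluations, where they become the Leibniz
  rule for twisted convolution.\<close>

lemma connection_nab: "connection X J RD nab" unfolding connection_def
proof (intro conjI ballI)
 fix xi :: "('n,'s) vf" assume x: "xi : RD"
 show "nab xi : tensor2 (carrier (alg X)) OB EB"
  unfolding tensor2_def nab_def by (rule imageI) (use nab_list[OF x] in simp)
 show "nab (xi \<oplus>\<^bsub>spc X\<^esub> et) = OE X J RD (rep_of (nab xi) @ rep_of (nab et))" if e: "et : RD" for et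
 proof -
  have "nab (%m. xi m + et m) = OE X J RD (rep_of (nab xi) @ rep_of (nab et))"
   unfolding nab_def[of "%m. xi m + et m"]
  proof (rule OE_eqI[OF nab_list[OF RD_add[OF x e]]])
   show "set (rep_of (nab xi) @ rep_of (nab et)) <= carrier OB \<times> carrier EB"
    using nab_rep(1)[OF x] nab_rep(1)[OF e] by simp
   fix k m and z :: "('n,'s) vf" assume z: "z : l2"
   have n: "(\<Sum>(ww, y)\<leftarrow>rep_of (nab ze). ap ww (conv Th (co y k) z) m) = ap (dD X (co ze k)) z m" if "ze : RD" for ze
    by (rule nab_coeff[where h = "%u. u m", OF that refl z])
   have n': "(\<Sum>(ww, y)\<leftarrow>map (%i. (dD X (co ze i), eu i)) idx. ap ww (conv Th (co y k) z) m) = ap (dD X (co ze k)) z m" if "ze : RD" for ze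
    using OE_invariant[where h = "%u. u m" and c = "%y. co y k", OF nab_rep(2)[OF that] refl co_rd co_add co_conv z]
    unfolding n[OF that] .
   show "(\<Sum>(ww, y)\<leftarrow>map (%i. (dD X (co (%m. xi m + et m) i), eu i)) idx. ap ww (conv Th (co y k) z) m) =
     (\<Sum>(ww, y)\<leftarrow>rep_of (nab xi) @ rep_of (nab et). ap ww (conv Th (co y k) z) m)"
    unfolding n'[OF RD_add[OF x e]] map_append sum_list_append n[OF x] n[OF e]
    unfolding co_add ap_dD_add[OF co_rd[OF x] co_rd[OF e] z] ..
  qed
  then show ?thesis by simp
 qed
 show "nab (ap (rep X a) xi) = OE X J RD (map (%(ww, et). (op_comp (rep X a) ww, et)) (rep_of (nab xi)) @ [(dD X a, xi)])"
  if "a : carrier (alg X)" for a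
 proof -
  have a: "Nr a" using that by simp
  have ax: "ap (rep X a) xi = conv Th a xi" using ap_rep[OF a subsetD[OF RD_l2 x]] by simp
  have cx: "conv Th a xi : RD" by (rule RD_conv[OF a x])
  have mem: "fst p : carrier OB" "snd p : RD" if "p : set (rep_of (nab xi))" for p
   using subsetD[OF nab_rep(1)[OF x] that] by (simp_all add: mem_Times_iff del: OB_sel)
  show ?thesis unfolding ax unfolding nab_def[of "conv Th a xi"]
  proof (rule OE_eqI[OF nab_list[OF cx]])
   show "set (map (%(ww, et). (op_comp (rep X a) ww, et)) (rep_of (nab xi)) @ [(dD X a, xi)]) <= carrier OB \<times> carrier EB"
   proof
    fix q assume "q : set (map (%(ww, et). (op_comp (rep X a) ww, et)) (rep_of (nab xi)) @ [(dD X a, xi)])"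
    then consider p where "p : set (rep_of (nab xi))" "q = (op_comp (torus_rep Th a) (fst p), snd p)" | "q = (dD X a, xi)"
     by (auto simp: case_prod_beta)
    then show "q : carrier OB \<times> carrier EB"
    proof cases
     case 1
     then show ?thesis using OB_rep_comp[OF mem(1)[OF 1(1)] a] mem(2)[OF 1(1)] by (simp del: OB_sel)
    next
     case 2
     then show ?thesis using OB_dD[OF a] x by (simp del: OB_sel)
    qed
   qed
   fix k m and z :: "('n,'s) vf" assume z: "z : l2"
   have n': "(\<Sum>(ww, y)\<leftarrow>map (%i. (dD X (co (conv Th a xi) i), eu i)) idx. ap ww (conv Th (co y k) z) m) = ap (dD X (co (conv Th a xi) k)) z m"
    using OE_invariant[where h = "%u. u m" and c = "%y. co y k", OF nab_rep(2)[OF cx] refl co_rd co_add co_conv z]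
    unfolding nab_coeff[where h = "%u. u m", OF cx refl z] .
   have "(\<Sum>(ww, y)\<leftarrow>map (%(ww, et). (op_comp (rep X a) ww, et)) (rep_of (nab xi)). ap ww (conv Th (co y k) z) m) =
     (\<Sum>(ww, y)\<leftarrow>rep_of (nab xi). conv Th a (ap ww (conv Th (co y k) z)) m)"
    unfolding map_map
   proof (rule arg_cong[where f = sum_list], rule map_cong[OF refl])
    fix p assume p: "p : set (rep_of (nab xi))"
    show "((%(ww, y). ap ww (conv Th (co y k) z) m) \<circ> (%(ww, et). (op_comp (rep X a) ww, et))) p =
      (case p of (ww, y) => conv Th a (ap ww (conv Th (co y k) z)) m)"
     using ap_rep_comp[OF mem(1)[OF p] a conv_l2[OF l1_rd[OF co_rd[OF mem(2)[OF p], of k]] z, of Th]]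
     by (simp add: case_prod_beta)
   qed
   also have "... = conv Th a (ap (dD X (co xi k)) z) m"
    by (rule nab_coeff[where h = "%u. conv Th a u m", OF x _ z]) (simp add: conv_add_vec a)
   finally show "(\<Sum>(ww, y)\<leftarrow>map (%i. (dD X (co (conv Th a xi) i), eu i)) idx. ap ww (conv Th (co y k) z) m) =
     (\<Sum>(ww, y)\<leftarrow>map (%(ww, et). (op_comp (rep X a) ww, et)) (rep_of (nab xi)) @ [(dD X a, xi)]. ap ww (conv Th (co y k) z) m)"
    unfolding n' unfolding co_conv[OF a x] ap_dD_tconv[OF a co_rd[OF x] z] by simp
  qed
 qed
qed

lemma grading_nab: "commutes_with_grading X J RD nab" unfolding commutes_with_grading_def
proof
 fix xi :: "('n,'s) vf" assume x: "xi : RD"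
 let ?s = "%et :: ('n,'s) vf. %m. sg *v et m"
 have gr: "ap (grd X) et = ?s et" if "et : RD" for et using ap_fiber[OF subsetD[OF RD_l2 that]] by simp
 have sx: "?s et : RD" if "et : RD" for et by (rule RD_fibre[OF flin_matrix that])
 have mem: "fst p : carrier OB" "snd p : RD" if "p : set (rep_of (nab xi))" for p
   using subsetD[OF nab_rep(1)[OF x] that] by (simp_all add: mem_Times_iff del: OB_sel)
 show "nab (ap (grd X) xi) = OE X J RD (map (%(ww, et). (ww, ap (grd X) et)) (rep_of (nab xi)))"
  unfolding gr[OF x] unfolding nab_def[of "?s xi"]
 proof (rule OE_eqI[OF nab_list[OF sx[OF x]]])
  show "set (map (%(ww, et). (ww, ap (grd X) et)) (rep_of (nab xi))) <= carrier OB \<times> carrier EB"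
  proof
   fix q assume "q : set (map (%(ww, et). (ww, ap (grd X) et)) (rep_of (nab xi)))"
   then obtain p where p: "p : set (rep_of (nab xi))" "q = (fst p, ap (grd X) (snd p))" by (auto simp: case_prod_beta)
   show "q : carrier OB \<times> carrier EB"
    unfolding p(2) gr[OF mem(2)[OF p(1)]] using mem(1)[OF p(1)] sx[OF mem(2)[OF p(1)]] by (simp del: OB_sel)
  qed
  fix k m and z :: "('n,'s) vf" assume z: "z : l2"
  have n': "(\<Sum>(ww, y)\<leftarrow>map (%i. (dD X (co (?s xi) i), eu i)) idx. ap ww (conv Th (co y k) z) m) = ap (dD X (co (?s xi) k)) z m"
   using OE_invariant[where h = "%u. u m" and c = "%y. co y k", OF nab_rep(2)[OF sx[OF x]] refl co_rd co_add co_conv z]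
   unfolding nab_coeff[where h = "%u. u m", OF sx[OF x] refl z] .
  have sco: "co (?s et) k = (%m. \<Sum>i\<in>UNIV. sg $ k $ i * co et i m)" for et
   by (simp add: co_def matrix_vector_mult_def)
  have "(\<Sum>(ww, y)\<leftarrow>map (%(ww, et). (ww, ap (grd X) et)) (rep_of (nab xi)). ap ww (conv Th (co y k) z) m) =
    (\<Sum>(ww, y)\<leftarrow>rep_of (nab xi). ap ww (conv Th (co (?s y) k) z) m)" unfolding map_map
  proof (rule arg_cong[where f = sum_list], rule map_cong[OF refl])
   fix p assume p: "p : set (rep_of (nab xi))"
   show "((%(ww, y). ap ww (conv Th (co y k) z) m) \<circ> (%(ww, et). (ww, ap (grd X) et))) p =
     (case p of (ww, y) => ap ww (conv Th (co (?s y) k) z) m)"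
    using gr[OF mem(2)[OF p]] by (simp add: case_prod_beta)
  qed
  also have "... = (\<Sum>i\<in>UNIV. ap (dD X (co xi i)) (conv Th (co (?s (eu i)) k) z) m)"
  proof (rule nab_sum[where h = "%u. u m" and c = "%y. co (?s y) k", OF x refl _ _ _ z])
   show "Nr (co (?s y) k)" if "y : RD" for y by (rule co_rd[OF sx[OF that]])
   show "co (?s (%m. y m + y' m)) k = (%m. co (?s y) k m + co (?s y') k m)" for y y'
    by (simp add: matrix_vector_right_distrib co_add)
   show "co (?s (conv Th a y)) k = tconv Th a (co (?s y) k)" if "Nr a" "y : RD" for a y
    using conv_fibre[OF flin_matrix l1_rd[OF that(1)] subsetD[OF RD_l2 that(2)], where Th = Th, of sg]
     co_conv[OF that(1) sx[OF that(2)], of Th k] by simp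
  qed
  also have "... = (\<Sum>i\<in>UNIV. sg $ k $ i *s ap (dD X (co xi i)) z m)"
  proof (rule sum.cong[OF refl])
   fix i :: 's
   have "co (?s (eu i)) k = (%m. \<Sum>l\<in>UNIV. if l = i then sg $ k $ i * (if m = 0 then 1 else 0) else 0)"
    unfolding sco co_eu by (rule ext, rule sum.cong) auto
   then have c: "co (?s (eu i)) k = (%m. sg $ k $ i * (if m = 0 then 1 else 0))" by simp
   have "conv Th (co (?s (eu i)) k) z = (%m. sg $ k $ i *s z m)"
    unfolding c using conv_cmult[OF l1_rd[OF rd_unit] z] conv_unit[OF z] by simp
   moreover have "ap (dD X (co xi i)) (%m. sg $ k $ i *s z m) m = sg $ k $ i *s ap (dD X (co xi i)) z m"
    unfolding ap_dD[OF co_rd[OF x] z] ap_dD[OF co_rd[OF x] l2_smult[OF z]]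
    using x z by (simp add: conv_smult_vec rd_pd vector_scalar_commute smult_sum)
   ultimately show "ap (dD X (co xi i)) (conv Th (co (?s (eu i)) k) z) m = sg $ k $ i *s ap (dD X (co xi i)) z m" by simp
  qed
  also have "... = ap (dD X (co (?s xi) k)) z m"
   unfolding sco using ap_dD_sum[of UNIV "co xi" z "%i. sg $ k $ i", OF co_rd[OF x] z] by simp
  finally show "(\<Sum>(ww, y)\<leftarrow>map (%i. (dD X (co (?s xi) i), eu i)) idx. ap ww (conv Th (co y k) z) m) =
    (\<Sum>(ww, y)\<leftarrow>map (%(ww, et). (ww, ap (grd X) et)) (rep_of (nab xi)). ap ww (conv Th (co y k) z) m)"
   unfolding n' by (rule HOL.sym)
 qed
qed

lemma OB_sum_comp_rep:
 assumes zs: "set zs <= carrier OB \<times> carrier EB" and c: "!!y. y : RD ==> Nr (c y)"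
 shows "op_sum Vs (map (%(ww, y). op_comp ww (torus_rep Th (c y))) zs) : carrier OB"
  and "x : l2 ==> ap (op_sum Vs (map (%(ww, y). op_comp ww (torus_rep Th (c y))) zs)) x m =
   (\<Sum>(ww, y)\<leftarrow>zs. ap ww (conv Th (c y) x) m)"
  and "op_sum Vs (map (%(ww, y). op_comp (torus_rep Th (c y)) (op_adj Vs ww)) zs) : carrier OB"
  and "x : l2 ==> ap (op_sum Vs (map (%(ww, y). op_comp (torus_rep Th (c y)) (op_adj Vs ww)) zs)) x m =
   (\<Sum>(ww, y)\<leftarrow>zs. conv Th (c y) (ap (op_adj Vs ww) x) m)"
proof -
 have mem: "fst p : carrier OB" "snd p : RD" if "p : set zs" for p
  using subsetD[OF zs that] by (simp_all add: mem_Times_iff del: OB_sel)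
 let ?Ts = "map (%(ww, y). op_comp ww (torus_rep Th (c y))) zs"
 let ?Us = "map (%(ww, y). op_comp (torus_rep Th (c y)) (op_adj Vs ww)) zs"
 have Ts: "set ?Ts <= carrier OB"
 proof
  fix T assume "T : set ?Ts"
  then obtain p where p: "p : set zs" "T = op_comp (fst p) (torus_rep Th (c (snd p)))" by auto
  show "T : carrier OB" unfolding p(2) by (rule OB_comp_rep[OF mem(1)[OF p(1)] c[OF mem(2)[OF p(1)]]])
 qed
 have Us: "set ?Us <= carrier OB"
 proof
  fix T assume "T : set ?Us"
  then obtain p where p: "p : set zs" "T = op_comp (torus_rep Th (c (snd p))) (op_adj Vs (fst p))" by auto
  show "T : carrier OB" unfolding p(2) by (rule OB_rep_comp[OF OB_adj[OF mem(1)[OF p(1)]] c[OF mem(2)[OF p(1)]]])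
 qed
 show "op_sum Vs ?Ts : carrier OB" "op_sum Vs ?Us : carrier OB" using op_sum_OB[OF Ts] op_sum_OB[OF Us] by blast+
 assume x: "x : l2"
 have "ap (op_sum Vs ?Ts) x m = (\<Sum>T\<leftarrow>?Ts. ap T x m)" using op_sum_OB[OF Ts] x by simp
 also have "... = (\<Sum>p\<leftarrow>zs. ap (fst p) (conv Th (c (snd p)) x) m)" unfolding map_map
 proof (rule arg_cong[where f = sum_list], rule map_cong[OF refl])
  fix p assume p: "p : set zs"
  show "((%T. ap T x m) \<circ> (%(ww, y). op_comp ww (torus_rep Th (c y)))) p = ap (fst p) (conv Th (c (snd p)) x) m"
   using ap_comp_rep[OF mem(1)[OF p] c[OF mem(2)[OF p]] x] by (simp add: case_prod_beta)
 qed
 finally show "ap (op_sum Vs ?Ts) x m = (\<Sum>(ww, y)\<leftarrow>zs. ap ww (conv Th (c y) x) m)" by (simp add: case_prod_unfold)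
 have "ap (op_sum Vs ?Us) x m = (\<Sum>T\<leftarrow>?Us. ap T x m)" using op_sum_OB[OF Us] x by simp
 also have "... = (\<Sum>p\<leftarrow>zs. conv Th (c (snd p)) (ap (op_adj Vs (fst p)) x) m)"
  unfolding map_map
 proof (rule arg_cong[where f = sum_list], rule map_cong[OF refl])
  fix p assume p: "p : set zs"
  show "((%T. ap T x m) \<circ> (%(ww, y). op_comp (torus_rep Th (c y)) (op_adj Vs ww))) p = conv Th (c (snd p)) (ap (op_adj Vs (fst p)) x) m"
   using ap_rep_comp[OF OB_adj[OF mem(1)[OF p]] c[OF mem(2)[OF p]] x] by (simp add: case_prod_beta)
 qed
 finally show "ap (op_sum Vs ?Us) x m = (\<Sum>(ww, y)\<leftarrow>zs. conv Th (c y) (ap (op_adj Vs ww) x) m)" by (simp add: case_prod_unfold)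
qed

lemma op_adj_dD: "Nr a ==> x : l2 ==> ap (op_adj Vs (dD X a)) x = (%m. - ap (dD X (tstar Th a)) x m)"
proof -
 assume a: "Nr a" and x: "x : l2"
 have N: "Nr (%m. (-1) * tstar Th (pd j a) m)" for j by (intro rd_cmult rd_tstar rd_pd a)
 have cm: "conv Th (%m. (-1) * tstar Th (pd j a) m) x = (%m. (-1) *s conv Th (tstar Th (pd j a)) x m)" for j
  by (rule conv_cmult[OF l1_tstar[OF l1_rd[OF rd_pd[OF a]]] x])
 have "op_adj Vs (dD X a) = om (%j m. (-1) * tstar Th (pd j a) m)"
  unfolding dD_om[OF a] op_adj_om[OF rd_pd[OF a]] by simp
 then have "ap (op_adj Vs (dD X a)) x = (%m. \<Sum>j\<in>UNIV. ga j *v ((-1) *s conv Th (tstar Th (pd j a)) x m))"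
  by (simp only: ap_om[OF N x] oneform_def[abs_def] cm)
 also have "... = (%m. (-1) *s ap (dD X (tstar Th a)) x m)"
  by (simp only: ap_dD[OF rd_tstar[OF a] x] pd_tstar vector_scalar_commute smult_sum)
 finally show ?thesis by (simp add: vector_sneg_minus1[symmetric])
qed

lemma op_adj_comp_rep:
 assumes o: "ww : carrier OB" and a: "Nr a"
 shows "op_adj Vs (op_comp ww (torus_rep Th a)) = op_comp (torus_rep Th (tstar Th a)) (op_adj Vs ww)"
proof -
 obtain b where b: "ww = om b" "!!j. Nr (b j)" by (rule OB_E[OF o]) simp
 have N: "Nr (%m. (-1) * tstar Th (b j) m)" for j by (intro rd_cmult rd_tstar b)
 have "op_comp (torus_rep Th (tstar Th a)) (om (%j m. (-1) * tstar Th (b j) m)) =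
   om (%j. tconv Th (tstar Th a) (%m. (-1) * tstar Th (b j) m))" by (rule rep_om[OF rd_tstar[OF a] N])
 also have "... = om (%j m. - tstar Th (tconv Th (b j) a) m)"
  by (rule om_cong) (simp add: fun_eq_iff tstar_tconv tconv_cmult(2)[of _ _ "-1", simplified])
 finally show ?thesis
  unfolding b(1) om_rep[OF a b(2)] op_adj_om[OF rd_tconv[OF b(2) a]] op_adj_om[OF b(2)] by simp
qed

lemma op_adj_add:
 assumes o: "ww : carrier OB" "ww' : carrier OB"
 shows "op_adj Vs (op_add Vs ww ww') = op_add Vs (op_adj Vs ww) (op_adj Vs ww')"
proof -
 obtain b where b: "ww = om b" "!!j. Nr (b j)" by (rule OB_E[OF o(1)]) simp
 obtain b' where b': "ww' = om b'" "!!j. Nr (b' j)" by (rule OB_E[OF o(2)]) simp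
 have N: "Nr (%m. - tstar Th (c j) m)" if "!!j. Nr (c j)" for c :: "'n => 'n mi => complex" and j
  using rd_cmult[OF rd_tstar[OF that[of j]], of "-1" Th] by simp
 have N1: "Nr (%m. - tstar Th (b j) m)" "Nr (%m. - tstar Th (b' j) m)" for j
  by (rule N[of b, OF b(2)], rule N[of b', OF b'(2)])
 have "op_add Vs (om (%j m. - tstar Th (b j) m)) (om (%j m. - tstar Th (b' j) m)) =
   om (%j m. - tstar Th (b j) m + - tstar Th (b' j) m)" by (rule om_add) (rule N1)+
 also have "... = om (%j m. - tstar Th (%m. b j m + b' j m) m)" by (rule om_cong) (simp add: tstar_add)
 finally show ?thesis unfolding b(1) b'(1) om_add[OF b(2) b'(2)] op_adj_om[OF rd_add[OF b(2) b'(2)]]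
   op_adj_om[OF b(2)] op_adj_om[OF b'(2)] by (rule HOL.sym)
qed

lemma nab_adj_sum:
 assumes xi: "xi : RD" "et : RD" and x: "x : l2"
 shows "(\<Sum>(ww, y)\<leftarrow>rep_of (nab et). conv Th (gE xi y) (ap (op_adj Vs ww) x) m) =
  (\<Sum>i\<in>UNIV. conv Th (gE xi (eu i)) (ap (op_adj Vs (dD X (co et i))) x) m)"
proof -
 let ?f = "%(ww, y). conv Th (gE xi y) (ap (op_adj Vs ww) x) m"
 have l: "ap (op_adj Vs ww) x : l2" if "ww : carrier OB" for ww by (rule OB_lop(2)[OF OB_adj[OF that] x])
 have "(\<Sum>p\<leftarrow>map (%i. (dD X (co et i), eu i)) idx. ?f p) = (\<Sum>p\<leftarrow>rep_of (nab et). ?f p)"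
 proof (rule formal_eq_sum_list[OF nab_rep(2)[OF xi(2)]])
  fix xs ys assume "tensor2_rel {a. Nr a} OB EB xs ys"
  then show "(\<Sum>p\<leftarrow>xs. ?f p) = (\<Sum>p\<leftarrow>ys. ?f p)"
  proof cases
   case (1 ww ww' y)
   have y: "y : RD" using 1 by simp
   show ?thesis using conv_add_vec[OF l1_rd[OF gE_Nr[OF xi(1) y]] l[OF 1(3)] l[OF 1(4)], of Th]
     ap_OB_add[OF OB_adj[OF 1(3)] OB_adj[OF 1(4)] x] op_adj_add[OF 1(3,4)] by (simp add: 1(1,2))
  next
   case (2 ww y y')
   have y: "y : RD" "y' : RD" using 2 by simp_all
   show ?thesis
    using conv_add[OF l1_rd[OF gE_Nr[OF xi(1) y(1)]] l1_rd[OF gE_Nr[OF xi(1) y(2)]] l[OF 2(3)], of Th]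
    by (simp add: 2(1,2) gE_add(2)[OF y xi(1)])
  next
   case (3 ww y a)
   have y: "y : RD" and a: "Nr a" using 3 by simp_all
   have u: "conv Th (%m. if m = 0 then 1 else 0) xi = xi" by (rule conv_unit[OF subsetD[OF RD_l2 xi(1)]])
   have "gE xi (conv Th a y) = tconv Th (gE xi y) (tstar Th a)"
    using gE_conv[OF rd_unit a xi(1) y] by (simp add: u)
   then have "conv Th (gE xi (conv Th a y)) (ap (op_adj Vs ww) x) =
     conv Th (gE xi y) (conv Th (tstar Th a) (ap (op_adj Vs ww) x))"
    using conv_tconv[OF gE_Nr[OF xi(1) y] rd_tstar[OF a, of Th] l[OF 3(3)]] by simp
   then show ?thesis using ap_rep_comp[OF OB_adj[OF 3(3)] rd_tstar[OF a] x] op_adj_comp_rep[OF 3(3) a]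
    by (simp add: 3(1,2) OB_ract EB_smult[OF a y])
  next
   case (4 y)
   have y: "y : RD" using 4 by simp
   have z: "op_adj Vs (\<zero>\<^bsub>OB\<^esub>) = \<zero>\<^bsub>OB\<^esub>"
    using op_adj_om[OF rd_0] tstar_cmult[of Th 0 "%m. 0"] by simp
   have "?f (\<zero>\<^bsub>OB\<^esub>, y) = conv Th (gE xi y) (%m. 0) m"
    unfolding prod.case z ap_OB_zero[OF x] ..
   also have "... = 0" by (simp add: conv_def)
   finally show ?thesis unfolding 4(1,2) by (simp del: OB_sel)
  qed
 qed
 then have "(\<Sum>p\<leftarrow>rep_of (nab et). ?f p) = (\<Sum>p\<leftarrow>map (%i. (dD X (co et i), eu i)) idx. ?f p)" by (rule HOL.sym)
 also have "... = (\<Sum>i\<leftarrow>idx. conv Th (gE xi (eu i)) (ap (op_adj Vs (dD X (co et i))) x) m)"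
  by (simp only: map_map o_def prod.case)
 finally show ?thesis unfolding sum_list_idx .
qed

text \<open>Both sides are one-forms; since the adjoint of \<open>da\<close> is \<open>- d(a\<^sup>*)\<close>, the left side is the Leibniz expansion of
  \<open>d (\<Sum>\<^sub>i \<xi>\<^sub>i \<eta>\<^sub>i\<^sup>*)\<close>.\<close>

lemma metric_nab: "metric_compatible X RD gE nab" unfolding metric_compatible_def Let_def
proof (intro ballI)
 fix xi et :: "('n,'s) vf" assume x: "xi : RD" and e: "et : RD"
 let ?A = "op_sum Vs (map (%(ww, ze). op_comp ww (torus_rep Th (gE ze et))) (rep_of (nab xi)))"
 let ?B = "op_sum Vs (map (%(ww, ze). op_comp (torus_rep Th (gE xi ze)) (op_adj Vs ww)) (rep_of (nab et)))"
 have u: "conv Th (%m. if m = 0 then 1 else 0) et = et" by (rule conv_unit[OF subsetD[OF RD_l2 e]])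
 have A: "?A : carrier OB" by (rule OB_sum_comp_rep(1)[OF nab_rep(1)[OF x] gE_Nr[OF _ e]])
 have B: "?B : carrier OB" by (rule OB_sum_comp_rep(3)[OF nab_rep(1)[OF e] gE_Nr[OF x]])
 have apA: "ap ?A z m = (\<Sum>i\<in>UNIV. ap (dD X (co xi i)) (conv Th (tstar Th (co et i)) z) m)" if z: "z : l2" for z m
 proof -
  have "ap ?A z m = (\<Sum>(ww, y)\<leftarrow>rep_of (nab xi). ap ww (conv Th (gE y et) z) m)"
   by (rule OB_sum_comp_rep(2)[OF nab_rep(1)[OF x] gE_Nr[OF _ e] z])
  also have "... = (\<Sum>i\<in>UNIV. ap (dD X (co xi i)) (conv Th (gE (eu i) et) z) m)"
  proof (rule nab_sum[where h = "%u. u m" and c = "%y. gE y et", OF x refl gE_Nr[OF _ e] _ _ z])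
   show "gE (%m. y m + y' m) et = (%m. gE y et m + gE y' et m)" if "y : RD" "y' : RD" for y y'
    by (rule gE_add(1)[OF that e])
   show "gE (conv Th a y) et = tconv Th a (gE y et)" if "Nr a" "y : RD" for a y
    using gE_conv[OF that(1) rd_unit that(2) e] by (simp add: u tstar_unit)
  qed
  finally show ?thesis by (simp only: gE_eu(2)[OF e])
 qed
 have apB: "ap ?B z m = - (\<Sum>i\<in>UNIV. conv Th (co xi i) (ap (dD X (tstar Th (co et i))) z) m)" if z: "z : l2" for z m
 proof -
  have "ap ?B z m = (\<Sum>(ww, y)\<leftarrow>rep_of (nab et). conv Th (gE xi y) (ap (op_adj Vs ww) z) m)"
   by (rule OB_sum_comp_rep(4)[OF nab_rep(1)[OF e] gE_Nr[OF x] z])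
  also have "... = (\<Sum>i\<in>UNIV. conv Th (co xi i) (%m. - ap (dD X (tstar Th (co et i))) z m) m)"
   unfolding nab_adj_sum[OF x e z] gE_eu(1)[OF x] op_adj_dD[OF co_rd[OF e] z] ..
  also have "... = (\<Sum>i\<in>UNIV. - conv Th (co xi i) (ap (dD X (tstar Th (co et i))) z) m)"
  proof (rule sum.cong[OF refl])
   fix i :: 's
   let ?v = "ap (dD X (tstar Th (co et i))) z"
   have v: "?v : l2" by (rule OB_lop(2)[OF OB_dD[OF rd_tstar[OF co_rd[OF e]]] z])
   show "conv Th (co xi i) (%m. - ?v m) m = - conv Th (co xi i) ?v m"
    using conv_smult_vec[OF l1_rd[OF co_rd[OF x]] v, of Th i "-1"]
    by (simp add: vector_sneg_minus1[symmetric])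
  qed
  finally show ?thesis by (simp add: sum_negf)
 qed
 have N: "Nr (tconv Th (co xi i) (tstar Th (co et i)))" for i by (intro rd_tconv rd_tstar co_rd x e)
 have B': "op_scale Vs (-1) ?B : carrier OB" and apB': "ap (op_scale Vs (-1) ?B) z m = - ap ?B z m" if z: "z : l2" for z m
 proof -
  obtain b where b: "?B = om b" "!!j. Nr (b j)" by (rule OB_E[OF B]) simp
  have Nb: "Nr (%m. (-1) * b j m)" for j by (rule rd_cmult[OF b(2)])
  have s: "op_scale Vs (-1) ?B = om (%j m. (-1) * b j m)" unfolding b(1) by (rule om_scale[OF b(2)])
  show "op_scale Vs (-1) ?B : carrier OB" unfolding s by (rule om_OB[OF Nb])
  have c: "conv Th (%m. (-1) * b j m) z = (%m. (-1) *s conv Th (b j) z m)" for j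
   by (rule conv_cmult[OF l1_rd[OF b(2)] z])
  show "ap (op_scale Vs (-1) ?B) z m = - ap ?B z m"
   unfolding s unfolding b(1) ap_om[OF Nb z] ap_om[OF b(2) z] oneform_def c
   by (simp add: vector_sneg_minus1[symmetric] flin_minus[OF flin_matrix] sum_negf)
 qed
 have zl: "(%m. 0) : (l2 :: (('n,'s) vf) set)" using RD_zero RD_l2 by blast
 have "op_add Vs ?A (op_scale Vs (-1) ?B) = dD X (gE xi et)"
 proof (rule OB_eqI[OF OB_add[OF A B'[OF zl]] OB_dD[OF gE_Nr[OF x e]]])
  fix z :: "('n,'s) vf" and m assume z: "z : l2"
  have "ap (dD X (gE xi et)) z m = (\<Sum>i\<in>UNIV. ap (dD X (tconv Th (co xi i) (tstar Th (co et i)))) z m)"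
   unfolding gE_eq[OF x e] using ap_dD_sum[of UNIV "%i. tconv Th (co xi i) (tstar Th (co et i))" z "%_. 1", OF N z] by simp
  also have "... = ap ?A z m - ap ?B z m"
   unfolding ap_dD_tconv[OF co_rd[OF x] rd_tstar[OF co_rd[OF e]] z] apA[OF z] apB[OF z]
   by (simp add: sum.distrib)
  finally show "ap (op_add Vs ?A (op_scale Vs (-1) ?B)) z m = ap (dD X (gE xi et)) z m"
   using ap_OB_add[OF A B'[OF zl] z] apB'[OF z] by simp
 qed
 then show "op_add (spc X) (op_sum (spc X) (map (%(ww, ze). op_comp ww (rep X (gE ze et))) (rep_of (nab xi))))
   (op_scale (spc X) (-1) (op_sum (spc X) (map (%(ww, ze). op_comp (rep X (gE xi ze)) (op_adj (spc X) ww)) (rep_of (nab et))))) =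
   dD X (gE xi et)" by simp
qed

end

section \<open>Completion of a space of smooth vectors\<close>

text \<open>A space whose coefficients are all the rapidly decreasing functions. These are dense, so a Cauchy class is
  determined by the limit of the coefficients, and every square summable function is such a limit.\<close>

locale smooth_model =
 fixes V :: "'v ip_space" and w :: "'v => 'n::finite multi_index => complex^'t::finite"
 assumes w_bij: "bij_betw w (carrier V) RD"
  and zero_carrier [simp]: "\<zero>\<^bsub>V\<^esub> : carrier V" and w_zero [simp]: "w \<zero>\<^bsub>V\<^esub> = (%m. 0)"
  and add_carrier: "x : carrier V ==> y : carrier V ==> x \<oplus>\<^bsub>V\<^esub> y : carrier V"
  and w_add: "x : carrier V ==> y : carrier V ==> w (x \<oplus>\<^bsub>V\<^esub> y) = (%m. w x m + w y m)"
  and smult_carrier: "x : carrier V ==> c \<odot>\<^bsub>V\<^esub> x : carrier V"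
  and w_smult: "x : carrier V ==> w (c \<odot>\<^bsub>V\<^esub> x) = (%m. c *s w x m)"
  and w_ip: "x : carrier V ==> y : carrier V ==> ip V x y = l2_ip (w x) (w y)"
begin

lemma w_RD: "x : carrier V ==> w x : RD" using w_bij bij_betwE by blast

lemma w_l2 [simp]: "x : carrier V ==> w x : l2" using w_RD RD_l2 by blast

lemma eq_by_w: "x : carrier V ==> y : carrier V ==> (!!m. w x m = w y m) ==> x = y"
proof -
 assume a: "x : carrier V" "y : carrier V" "!!m. w x m = w y m"
 have "w x = w y" using a(3) by blast
 then show "x = y" using w_bij a(1,2) unfolding bij_betw_def inj_on_def by blast
qed

lemma w_surj: assumes "F : RD" obtains x where "x : carrier V" "w x = F"
proof -
 have "F : w ` carrier V" using assms w_bij by (simp add: bij_betw_def)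
 then obtain x where "x : carrier V" "F = w x" by (rule imageE)
 then show ?thesis using that by simp
qed

lemma abelian_group_V: "abelian_group V"
proof (rule abelian_groupI)
 show "\<exists>y\<in>carrier V. y \<oplus>\<^bsub>V\<^esub> x = \<zero>\<^bsub>V\<^esub>" if x: "x : carrier V" for x
 proof (rule bexI[of _ "(-1) \<odot>\<^bsub>V\<^esub> x"])
  show "(-1) \<odot>\<^bsub>V\<^esub> x : carrier V" by (rule smult_carrier[OF x])
  then show "(-1) \<odot>\<^bsub>V\<^esub> x \<oplus>\<^bsub>V\<^esub> x = \<zero>\<^bsub>V\<^esub>"
   by (intro eq_by_w) (use x in \<open>simp_all add: w_add w_smult add_carrier vec_eq_iff\<close>)
 qed
next
 fix x y z assume x: "x : carrier V" "y : carrier V" "z : carrier V"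
 show "x \<oplus>\<^bsub>V\<^esub> y \<oplus>\<^bsub>V\<^esub> z = x \<oplus>\<^bsub>V\<^esub> (y \<oplus>\<^bsub>V\<^esub> z)"
  by (rule eq_by_w) (use x in \<open>simp_all add: add_carrier w_add algebra_simps\<close>)
next
 fix x y assume x: "x : carrier V" "y : carrier V"
 show "x \<oplus>\<^bsub>V\<^esub> y = y \<oplus>\<^bsub>V\<^esub> x"
  by (rule eq_by_w) (use x in \<open>simp_all add: add_carrier w_add algebra_simps\<close>)
next
 fix x assume x: "x : carrier V"
 show "\<zero>\<^bsub>V\<^esub> \<oplus>\<^bsub>V\<^esub> x = x" by (rule eq_by_w) (use x in \<open>simp_all add: add_carrier w_add\<close>)
qed (simp_all add: add_carrier)

lemma minus_carrier: "x : carrier V ==> y : carrier V ==> x \<ominus>\<^bsub>V\<^esub> y : carrier V"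
 by (rule abelian_group.minus_closed[OF abelian_group_V])

lemma w_minus:
 assumes "x : carrier V" "y : carrier V" shows "w (x \<ominus>\<^bsub>V\<^esub> y) = (%m. w x m - w y m)"
proof -
 interpret abelian_group V by (rule abelian_group_V)
 have "(x \<ominus>\<^bsub>V\<^esub> y) \<oplus>\<^bsub>V\<^esub> y = x"
  using assms by (simp add: a_minus_def a_assoc l_neg)
 then have "(%m. w (x \<ominus>\<^bsub>V\<^esub> y) m + w y m) = w x"
  using w_add[OF minus_carrier[OF assms] assms(2)] by simp
 then show ?thesis by (auto simp: fun_eq_iff algebra_simps)
qed

lemma nrm_w: "x : carrier V ==> nrm V x = nl2 (w x)"
 by (simp add: nrm_def w_ip l2_ip_self del: of_real_power)

definition tends :: "(nat => 'v) => (('n,'t) vf) => bool" where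
 "tends s F \<longleftrightarrow> (\<forall>n. s n : carrier V) & F : l2 & (%n. nl2 (%m. w (s n) m - F m)) \<longlonglongrightarrow> 0"

lemma nrm_minus: "x : carrier V ==> y : carrier V ==> nrm V (x \<ominus>\<^bsub>V\<^esub> y) = nl2 (%m. w x m - w y m)"
 by (simp add: nrm_w minus_carrier w_minus)

lemma nl2_nonneg: "0 <= nl2 F" unfolding nl2_def by (simp add: infsum_nonneg)

lemma tends_squeeze:
 assumes "G \<longlonglongrightarrow> 0" "!!n. nl2 (F n) <= G n" shows "(%n. nl2 (F n)) \<longlonglongrightarrow> 0"
 by (rule tendsto_sandwich[OF _ _ tendsto_const assms(1)]) (use assms(2) in \<open>auto simp: nl2_nonneg\<close>)

lemma tends_cauchy:
 assumes t: "tends s F" shows "cauchy_in V s" unfolding cauchy_in_def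
proof (intro conjI allI impI)
 show s: "s n : carrier V" for n using t by (simp add: tends_def)
 fix e :: real assume e: "e > 0"
 have F: "F : l2" and l: "(%n. nl2 (%m. w (s n) m - F m)) \<longlonglongrightarrow> 0" using t by (simp_all add: tends_def)
 have "eventually (%n. nl2 (%m. w (s n) m - F m) < e/2) sequentially"
  using order_tendstoD(2)[OF l, of "e/2"] e by simp
 then obtain M where M: "!!n. n \<ge> M ==> nl2 (%m. w (s n) m - F m) < e/2"
  by (auto simp: eventually_sequentially)
 have "nrm V (s m \<ominus>\<^bsub>V\<^esub> s n) < e" if "m \<ge> M" "n \<ge> M" for m n
 proof -
  have "nrm V (s m \<ominus>\<^bsub>V\<^esub> s n) <= nl2 (%k. w (s m) k - F k) + nl2 (%k. F k - w (s n) k)"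
   unfolding nrm_minus[OF s s] by (rule nl2_triangle_diff) (simp_all add: s F)
  then show ?thesis using M[OF that(1)] M[OF that(2)] nl2_minus_commute[of F "w (s n)"] by linarith
 qed
 then show "\<exists>M. \<forall>m\<ge>M. \<forall>n\<ge>M. nrm V (s m \<ominus>\<^bsub>V\<^esub> s n) < e" by blast
qed

lemma cauchy_tends: assumes c: "cauchy_in V s" obtains F where "tends s F"
proof -
 have s: "s n : carrier V" for n using c by (simp add: cauchy_in_def)
 have "\<exists>F\<in>l2. (%n. nl2 (%k. w (s n) k - F k)) \<longlonglongrightarrow> 0"
  by (rule l2_complete) (use c s in \<open>simp_all add: cauchy_in_def nrm_minus[OF s s]\<close>)
 then show ?thesis using that s unfolding tends_def by blast
qed

lemma tends_unique: assumes "tends s F" "tends s G" shows "F = G"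
proof
 fix m
 show "F m = G m"
  by (rule LIMSEQ_unique[of "%n. w (s n) m"]; rule l2_limit_pointwise) (use assms in \<open>simp_all add: tends_def\<close>)
qed

lemma tends_class_iff:
 assumes t: "tends s F" shows "t : cauchy_class V s \<longleftrightarrow> tends t F"
proof
 have s: "s n : carrier V" for n using t by (simp add: tends_def)
 have F: "F : l2" and l: "(%n. nl2 (%m. w (s n) m - F m)) \<longlonglongrightarrow> 0" using t by (simp_all add: tends_def)
 {
  assume "t : cauchy_class V s"
  then have c: "cauchy_in V t" "(%n. nrm V (s n \<ominus>\<^bsub>V\<^esub> t n)) \<longlonglongrightarrow> 0" by (simp_all add: cauchy_class_def)
  have t: "t n : carrier V" for n using c(1) by (simp add: cauchy_in_def)
  have "(%n. nl2 (%m. w (t n) m - F m)) \<longlonglongrightarrow> 0"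
  proof (rule tends_squeeze)
   show "(%n. nrm V (s n \<ominus>\<^bsub>V\<^esub> t n) + nl2 (%m. w (s n) m - F m)) \<longlonglongrightarrow> 0"
    using tendsto_add[OF c(2) l] by simp
   show "nl2 (%m. w (t n) m - F m) <= nrm V (s n \<ominus>\<^bsub>V\<^esub> t n) + nl2 (%m. w (s n) m - F m)" for n
    using nl2_triangle_diff[of "w (t n)" F "w (s n)"] nl2_minus_commute[of "w (t n)" "w (s n)"]
    by (simp add: nrm_minus s t F)
  qed
  then show "tends t F" using t F by (simp add: tends_def)
 next
  assume tt: "tends t F"
  have t: "t n : carrier V" for n using tt by (simp add: tends_def)
  have l': "(%n. nl2 (%m. w (t n) m - F m)) \<longlonglongrightarrow> 0" using tt by (simp add: tends_def)
  have "(%n. nl2 (%m. w (s n) m - w (t n) m)) \<longlonglongrightarrow> 0"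
  proof (rule tends_squeeze)
   show "(%n. nl2 (%m. w (s n) m - F m) + nl2 (%m. w (t n) m - F m)) \<longlonglongrightarrow> 0"
    using tendsto_add[OF l l'] by simp
   show "nl2 (%m. w (s n) m - w (t n) m) <= nl2 (%m. w (s n) m - F m) + nl2 (%m. w (t n) m - F m)" for n
    using nl2_triangle_diff[of "w (s n)" "w (t n)" F] nl2_minus_commute[of F "w (t n)"]
    by (simp add: s t F)
  qed
  then show "t : cauchy_class V s"
   using tends_cauchy[OF tt] by (simp add: cauchy_class_def nrm_minus[OF s t])
 }
qed

lemma class_eq_iff:
 assumes "tends s F" "tends t G" shows "cauchy_class V s = cauchy_class V t \<longleftrightarrow> F = G"
proof
 assume "cauchy_class V s = cauchy_class V t"
 then have "t : cauchy_class V s" using tends_class_iff[OF assms(2)] assms(2) by blast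
 then show "F = G" using tends_class_iff[OF assms(1)] tends_unique assms(2) by blast
next
 assume "F = G"
 then show "cauchy_class V s = cauchy_class V t"
  using tends_class_iff[OF assms(1)] tends_class_iff[OF assms(2)] by blast
qed

definition Wc :: "(nat => 'v) set => ('n,'t) vf" where "Wc Z = (THE F. tends (rep_of Z) F)"

abbreviation "C \<equiv> completion V"

lemma tends_rep: assumes "tends s F" shows "tends (rep_of (cauchy_class V s)) F"
proof -
 have "rep_of (cauchy_class V s) : cauchy_class V s"
  unfolding rep_of_def by (rule someI[of _ s]) (use tends_class_iff[OF assms] assms in blast)
 then show ?thesis using tends_class_iff[OF assms] by blast
qed

lemma Wc_class: assumes "tends s F" shows "Wc (cauchy_class V s) = F" unfolding Wc_def
 by (rule the_equality[where a = F], rule tends_rep[OF assms], erule tends_unique[OF _ tends_rep[OF assms]])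

lemma C_E: assumes "Z : carrier C" obtains s where "Z = cauchy_class V s" "tends s (Wc Z)"
proof -
 obtain s where s: "Z = cauchy_class V s" "cauchy_in V s" using assms by (auto simp: completion_def)
 obtain F where F: "tends s F" by (rule cauchy_tends[OF s(2)])
 show ?thesis using that[OF s(1)] F Wc_class[OF F] s(1) by simp
qed

lemma C_rep: "Z : carrier C ==> tends (rep_of Z) (Wc Z)" using tends_rep by (metis C_E)

lemma C_I: "tends s F ==> cauchy_class V s : carrier C" using tends_cauchy by (simp add: completion_def)

lemma tends_const: "x : carrier V ==> tends (%_. x) (w x)" by (simp add: tends_def)

lemma tends_add:
 assumes "tends s F" "tends t G" shows "tends (%n. s n \<oplus>\<^bsub>V\<^esub> t n) (%m. F m + G m)"
proof -
 have a: "!!n. s n : carrier V" "F : l2" "(%n. nl2 (%m. w (s n) m - F m)) \<longlonglongrightarrow> 0"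
  "!!n. t n : carrier V" "G : l2" "(%n. nl2 (%m. w (t n) m - G m)) \<longlonglongrightarrow> 0"
  using assms by (simp_all add: tends_def)
 have "(%n. nl2 (%m. w (s n \<oplus>\<^bsub>V\<^esub> t n) m - (F m + G m))) \<longlonglongrightarrow> 0"
 proof (rule tends_squeeze)
  show "(%n. nl2 (%m. w (s n) m - F m) + nl2 (%m. w (t n) m - G m)) \<longlonglongrightarrow> 0"
   using tendsto_add[OF a(3,6)] by simp
  fix n
  have "(%m. w (s n \<oplus>\<^bsub>V\<^esub> t n) m - (F m + G m)) = (%m. (w (s n) m - F m) + (w (t n) m - G m))"
   by (simp add: w_add a fun_eq_iff)
  then show "nl2 (%m. w (s n \<oplus>\<^bsub>V\<^esub> t n) m - (F m + G m)) <= nl2 (%m. w (s n) m - F m) + nl2 (%m. w (t n) m - G m)"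
   using nl2_triangle[of "%m. w (s n) m - F m" "%m. w (t n) m - G m"] a by simp
 qed
 then show ?thesis using a by (simp add: tends_def add_carrier)
qed

lemma nl2_smult: "nl2 (%m. c *s F m) = cmod c * nl2 F" for F :: "('n,'t) vf"
 by (simp add: nl2_def power_mult_distrib infsum_cmult_right' real_sqrt_mult)

lemma tends_smult:
 assumes "tends s F" shows "tends (%n. c \<odot>\<^bsub>V\<^esub> s n) (%m. c *s F m)"
proof -
 have a: "!!n. s n : carrier V" "F : l2" "(%n. nl2 (%m. w (s n) m - F m)) \<longlonglongrightarrow> 0"
  using assms by (simp_all add: tends_def)
 have "(%m. w (c \<odot>\<^bsub>V\<^esub> s n) m - c *s F m) = (%m. c *s (w (s n) m - F m))" for n
  by (simp add: w_smult a fun_eq_iff vec_eq_iff right_diff_distrib)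
 then have "(%n. nl2 (%m. w (c \<odot>\<^bsub>V\<^esub> s n) m - c *s F m)) \<longlonglongrightarrow> 0"
  using tendsto_mult_right_zero[OF a(3), of "cmod c"] by (simp only: nl2_smult)
 then show ?thesis using a by (simp add: tends_def smult_carrier)
qed

lemma l2_ip_add4:
 fixes F G F' G' :: "('n,'t) vf"
 assumes "F : l2" "F' : l2" "G : l2" "G' : l2"
 shows "l2_ip (%m. F m + F' m) (%m. G m + G' m) = l2_ip F G + l2_ip F G' + l2_ip F' G + l2_ip F' G'"
 using assms by (simp add: l2_ip_add)

lemma tends_ip:
 assumes "tends s F" "tends t G" shows "(%n. ip V (s n) (t n)) \<longlonglongrightarrow> l2_ip F G"
proof -
 have a: "!!n. s n : carrier V" "F : l2" "(%n. nl2 (%m. w (s n) m - F m)) \<longlonglongrightarrow> 0"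
  "!!n. t n : carrier V" "G : l2" "(%n. nl2 (%m. w (t n) m - G m)) \<longlonglongrightarrow> 0"
  using assms by (simp_all add: tends_def)
 let ?f = "%n m. w (s n) m - F m" and ?g = "%n m. w (t n) m - G m"
 have l: "?f n : l2" "?g n : l2" for n using a by simp_all
 have e: "ip V (s n) (t n) - l2_ip F G = l2_ip (?f n) (?g n) + l2_ip (?f n) G + l2_ip F (?g n)" for n
  using l2_ip_add4[OF l(1) a(2) l(2) a(5), of n n] a(1,4) by (simp add: w_ip)
 have b: "cmod (ip V (s n) (t n) - l2_ip F G) <= nl2 (?f n) * nl2 (?g n) + nl2 (?f n) * nl2 G + nl2 F * nl2 (?g n)" for n
  unfolding e using norm_triangle_ineq[of "l2_ip (?f n) (?g n) + l2_ip (?f n) G" "l2_ip F (?g n)"]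
   norm_triangle_ineq[of "l2_ip (?f n) (?g n)" "l2_ip (?f n) G"]
   l2_Cauchy_Schwarz[OF l(1) l(2), of n n] l2_Cauchy_Schwarz[OF l(1) a(5), of n] l2_Cauchy_Schwarz[OF a(2) l(2), of n]
  by linarith
 have z: "(%n. nl2 (?f n) * nl2 (?g n) + nl2 (?f n) * nl2 G + nl2 F * nl2 (?g n)) \<longlonglongrightarrow> 0"
  using tendsto_add[OF tendsto_add[OF tendsto_mult[OF a(3) a(6)] tendsto_mult_left_zero[OF a(3)]] tendsto_mult_right_zero[OF a(6)], of "nl2 G" "nl2 F"]
  by simp
 have "(%n. ip V (s n) (t n) - l2_ip F G) \<longlonglongrightarrow> 0"
  by (rule Lim_null_comparison[OF always_eventually z]) (use b in blast)
 then show ?thesis by (rule LIM_zero_cancel)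
qed

lemma C_sel:
 "X : carrier C ==> Y : carrier C ==> X \<oplus>\<^bsub>C\<^esub> Y = cauchy_class V (%n. rep_of X n \<oplus>\<^bsub>V\<^esub> rep_of Y n)"
 "c \<odot>\<^bsub>C\<^esub> X = cauchy_class V (%n. c \<odot>\<^bsub>V\<^esub> rep_of X n)"
 "\<zero>\<^bsub>C\<^esub> = cauchy_class V (%_. \<zero>\<^bsub>V\<^esub>)" "ip C X Y = lim (%n. ip V (rep_of X n) (rep_of Y n))"
 by (simp_all add: completion_def)

lemma completion_model: "l2_model C Wc"
proof
 show "bij_betw Wc (carrier C) l2" unfolding bij_betw_def
 proof
  show "inj_on Wc (carrier C)"
  proof (rule inj_onI)
   fix X Y assume XY: "X : carrier C" "Y : carrier C" "Wc X = Wc Y"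
   obtain s where s: "X = cauchy_class V s" "tends s (Wc X)" by (rule C_E[OF XY(1)])
   obtain t where t: "Y = cauchy_class V t" "tends t (Wc Y)" by (rule C_E[OF XY(2)])
   show "X = Y" unfolding s(1) t(1) using class_eq_iff[OF s(2) t(2)] XY(3) by simp
  qed
  show "Wc ` carrier C = l2"
  proof (intro equalityI subsetI)
   fix F assume "F : Wc ` carrier C"
   then obtain X where X: "X : carrier C" "F = Wc X" by blast
   show "F : l2" using C_rep[OF X(1)] by (simp add: tends_def X(2))
  next
   fix F :: "('n,'t) vf" assume F: "F : l2"
   have "\<exists>x. x : carrier V & w x = trunc n F" for n
   proof -
    have "trunc n F : RD" using trunc_fin_supp fin_supp_RD by blast
    then show ?thesis by (metis w_surj)
   qed
   then obtain s where s: "!!n. s n : carrier V" "!!n. w (s n) = trunc n F" by metis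
   have "tends s F"
    using trunc_tendsto[OF F] s F by (simp add: tends_def nl2_minus_commute[of "trunc _ F" F])
   then show "F : Wc ` carrier C" using C_I[of s F] Wc_class[of s F] by blast
  qed
 qed
 have z: "tends (%_. \<zero>\<^bsub>V\<^esub>) (%m. 0)" using tends_const[OF zero_carrier] by simp
 show "\<zero>\<^bsub>C\<^esub> : carrier C" "Wc \<zero>\<^bsub>C\<^esub> = (%m. 0)"
  unfolding C_sel(3) using C_I[OF z] Wc_class[OF z] by simp_all
next
 fix X Y assume XY: "X : carrier C" "Y : carrier C"
 note t = tends_add[OF C_rep[OF XY(1)] C_rep[OF XY(2)]]
 show "X \<oplus>\<^bsub>C\<^esub> Y : carrier C" "Wc (X \<oplus>\<^bsub>C\<^esub> Y) = (%m. Wc X m + Wc Y m)"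
  unfolding C_sel(1)[OF XY] using C_I[OF t] Wc_class[OF t] by simp_all
 show "ip C X Y = l2_ip (Wc X) (Wc Y)"
  unfolding C_sel(4) by (rule limI[OF tends_ip[OF C_rep[OF XY(1)] C_rep[OF XY(2)]]])
next
 fix c X assume X: "X : carrier C"
 note t = tends_smult[OF C_rep[OF X], of c]
 show "c \<odot>\<^bsub>C\<^esub> X : carrier C" "Wc (c \<odot>\<^bsub>C\<^esub> X) = (%m. c *s Wc X m)"
  unfolding C_sel(2) using C_I[OF t] Wc_class[OF t] by simp_all
qed

sublocale cpl: l2_model "completion V" Wc by (rule completion_model)

lemma embed: "x : carrier V ==> embed V x : carrier C" "x : carrier V ==> Wc (embed V x) = w x"
 unfolding embed_def using C_I[OF tends_const] Wc_class[OF tends_const] by simp_all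

text \<open>An operator is known on the completion once its effect on the coefficients of smooth vectors is known.\<close>

lemma op_on_completion_lop:
 assumes f: "!!x. x : carrier V ==> f x : carrier V" "!!x. x : carrier V ==> w (f x) = \<phi> (w x)"
 shows "op_on_completion V f = cpl.lop RD \<phi>"
proof (intro equalityI subsetI)
 fix p assume "p : op_on_completion V f"
 then obtain x where x: "p = (embed V x, embed V (f x))" "x : carrier V" by (auto simp: op_on_completion_def)
 show "p : cpl.lop RD \<phi>" using x(2) f[OF x(2)] by (simp add: x(1) cpl.lop_def embed w_RD)
next
 fix p assume "p : cpl.lop RD \<phi>"
 then obtain X Y where p: "p = (X, Y)" "X : carrier C" "Y : carrier C" "Wc X : RD" "Wc Y = \<phi> (Wc X)"
  by (auto simp: cpl.lop_def)
 obtain x where x: "x : carrier V" "w x = Wc X" by (rule w_surj[OF p(4)])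
 have "X = embed V x" by (rule cpl.eq_by_W) (simp_all add: p embed x)
 moreover have "Y = embed V (f x)" by (rule cpl.eq_by_W) (simp_all add: p embed x f)
 ultimately show "p : op_on_completion V f" using x(1) by (auto simp: op_on_completion_def p(1))
qed

end

section \<open>Left and right matrix actions on the doubled fibre\<close>

definition LM :: "complex^'s^'s::finite => complex^('s \<times> 's) => complex^('s \<times> 's)" where
 "LM M v = (\<chi> p. \<Sum>i\<in>UNIV. M $ fst p $ i * v $ (i, snd p))"

definition RM :: "complex^'s^'s::finite => complex^('s \<times> 's) => complex^('s \<times> 's)" where
 "RM M v = (\<chi> p. \<Sum>k\<in>UNIV. M $ snd p $ k * v $ (fst p, k))"

definition lslice :: "'s => complex^('s \<times> 's) => complex^'s::finite" where
 "lslice k v = (\<chi> i. v $ (i, k))"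

definition rslice :: "'s => complex^('s \<times> 's) => complex^'s::finite" where
 "rslice i v = (\<chi> k. v $ (i, k))"

lemma slice_LM [simp]: "lslice k (LM M v) = M *v lslice k v"
 and slice_RM [simp]: "rslice i (RM M v) = M *v rslice i v"
 by (simp_all add: lslice_def rslice_def LM_def RM_def matrix_vector_mult_def vec_eq_iff)

lemma slice_linear [simp]:
 "lslice k (v + w) = lslice k v + lslice k w" "lslice k (c *s v) = c *s lslice k v"
 "lslice k (- v) = - lslice k v" "lslice k 0 = 0"
 "rslice k (v + w) = rslice k v + rslice k w" "rslice k (c *s v) = c *s rslice k v"
 "rslice k (- v) = - rslice k v" "rslice k 0 = 0" by (simp_all add: lslice_def rslice_def vec_eq_iff)

lemma lslice_eqI: "(!!k. lslice k v = lslice k w) ==> v = w"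
 and rslice_eqI: "(!!k. rslice k v = rslice k w) ==> v = w"
 by (simp_all add: lslice_def rslice_def vec_eq_iff)

lemma hdot_slices:
 "hdot v w = (\<Sum>k\<in>UNIV. hdot (lslice k v) (lslice k w))" "hdot v w = (\<Sum>k\<in>UNIV. hdot (rslice k v) (rslice k w))"
proof -
 have "hdot v w = (\<Sum>i\<in>UNIV. \<Sum>k\<in>UNIV. cnj (v $ (i, k)) * w $ (i, k))"
  by (simp add: hdot_def sum.cartesian_product UNIV_Times_UNIV case_prod_unfold)
 then show "hdot v w = (\<Sum>k\<in>UNIV. hdot (rslice k v) (rslice k w))"
  and "hdot v w = (\<Sum>k\<in>UNIV. hdot (lslice k v) (lslice k w))"
  by (simp_all add: hdot_def rslice_def lslice_def) (rule sum.swap)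
qed

lemma LM_lin: "flin (LM M)" and RM_lin: "flin (RM M)"
 by (simp_all add: flin_def LM_def RM_def vec_eq_iff distrib_left sum.distrib sum_distrib_left mult_ac)

lemmas LM_simps = flin_minus[OF LM_lin] flin_0[OF LM_lin] flin_add[OF LM_lin] flin_smult[OF LM_lin]
lemmas RM_simps = flin_minus[OF RM_lin] flin_0[OF RM_lin] flin_add[OF RM_lin] flin_smult[OF RM_lin]

lemma RM_LM: "RM N (LM M v) = LM M (RM N v)"
proof -
 have "(\<Sum>k\<in>UNIV. N $ b $ k * (\<Sum>i\<in>UNIV. M $ a $ i * v $ (i, k))) = (\<Sum>k\<in>UNIV. \<Sum>i\<in>UNIV. M $ a $ i * (N $ b $ k * v $ (i, k)))" for a b
  by (simp add: sum_distrib_left mult_ac)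
 also have "... a b = (\<Sum>i\<in>UNIV. \<Sum>k\<in>UNIV. M $ a $ i * (N $ b $ k * v $ (i, k)))" for a b by (rule sum.swap)
 finally show ?thesis by (simp add: LM_def RM_def vec_eq_iff sum_distrib_left)
qed

context torus_spinor
begin

lemma LM_ga: "LM (ga i) (LM (ga j) v) + LM (ga j) (LM (ga i) v) = (if i = j then (-2) *s v else 0)"
 by (rule lslice_eqI) (simp add: ga_vec)

lemma RM_ga: "RM (ga i) (RM (ga j) v) + RM (ga j) (RM (ga i) v) = (if i = j then (-2) *s v else 0)"
 by (rule rslice_eqI) (simp add: ga_vec)

lemma LM_sg: "LM sg (LM sg v) = v" and RM_sg: "RM sg (RM sg v) = v"
 by (rule lslice_eqI, simp add: sg_sg) (rule rslice_eqI, simp add: sg_sg)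

lemma LM_sgga: "LM sg (LM (ga j) v) = - LM (ga j) (LM sg v)" and RM_sgga: "RM sg (RM (ga j) v) = - RM (ga j) (RM sg v)"
 by (rule lslice_eqI, simp add: sg_ga) (rule rslice_eqI, simp add: sg_ga)

lemma LM_hdot: "hdot (LM (ga j) v) w = - hdot v (LM (ga j) w)" "hdot (LM sg v) w = hdot v (LM sg w)"
 unfolding hdot_slices(1) by (simp_all add: ga_hdot sg_hdot sum_negf)

lemma RM_hdot: "hdot (RM (ga j) v) w = - hdot v (RM (ga j) w)" "hdot (RM sg v) w = hdot v (RM sg w)"
 unfolding hdot_slices(2) by (simp_all add: ga_hdot sg_hdot sum_negf)

abbreviation "Rg \<equiv> %j. RM (ga j)"
abbreviation "Lg \<equiv> %j v. LM (ga j) (RM sg v)"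

lemma Lg_lin: "flin (Lg j)" by (simp add: flin_def LM_simps RM_simps)

lemma clifford_pair_doubled: "clifford_pair Rg Lg (RM sg) (%v. LM sg (RM sg v))"
proof
 show "flin (%v. LM sg (RM sg v))" by (simp add: flin_def LM_simps RM_simps)
 show "hdot (Lg j v) w = - hdot v (Lg j w)" for j v w by (simp add: LM_hdot RM_hdot RM_LM)
 show "hdot (LM sg (RM sg v)) w = hdot v (LM sg (RM sg w))" for v w by (simp add: LM_hdot RM_hdot RM_LM)
 show "Lg i (Lg j v) + Lg j (Lg i v) = (if i = j then (-2) *s v else 0)" for i j v
  using LM_ga[of i j v] by (simp add: RM_LM RM_sg)
 show "Rg i (Lg j v) + Lg j (Rg i v) = 0" for i j v by (simp add: LM_simps RM_LM RM_sgga)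
 show "LM sg (RM sg (LM sg (RM sg v))) = v" for v by (simp add: RM_LM RM_sg LM_sg)
qed (simp_all add: RM_lin Lg_lin RM_hdot RM_ga RM_sg RM_sgga LM_simps RM_simps RM_LM LM_sgga)

sublocale doubled: clifford_pair Rg Lg "RM sg" "%v. LM sg (RM sg v)" by (rule clifford_pair_doubled)

section \<open>The tensor square of the spinor module\<close>

text \<open>The coefficients \<open>\<xi>\<^sub>i \<eta>\<^sub>k\<close>; associativity of the algebra makes the map balanced.\<close>

definition Phi :: "(('n,'s) vf) => (('n,'s) vf) => 'n mi => complex^('s \<times> 's)" where
 "Phi xi et m = (\<chi> p. tconv Th (co xi (fst p)) (co et (snd p)) m)"

lemma co_Phi: "co (Phi xi et) p = tconv Th (co xi (fst p)) (co et (snd p))"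
 by (simp add: co_def Phi_def fun_eq_iff)

lemma co_eqI: "(!!i. co F i = co G i) ==> F = G" by (simp add: co_def fun_eq_iff vec_eq_iff)

lemma RD_iff_co: "F : RD \<longleftrightarrow> (\<forall>i. rd (co F i))" by (simp add: RD_def co_def)

lemma Phi_RD: "xi : RD ==> et : RD ==> Phi xi et : RD" by (simp add: RD_iff_co co_Phi rd_tconv)

lemma Phi_add:
 assumes "xi : RD" "xi' : RD" "et : RD"
 shows "Phi (%m. xi m + xi' m) et = (%m. Phi xi et m + Phi xi' et m)"
  "Phi et (%m. xi m + xi' m) = (%m. Phi et xi m + Phi et xi' m)"
 by (rule co_eqI, use assms in \<open>simp add: co_Phi co_add tconv_add_rd\<close>)+

lemma Phi_smult: "Phi (%m. c *s xi m) et = (%m. c *s Phi xi et m)" "Phi xi (%m. c *s et m) = (%m. c *s Phi xi et m)"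
 by (simp_all add: Phi_def fun_eq_iff vec_eq_iff co_smult tconv_cmult)

lemma Phi_zero: "Phi (%m. 0) et = (%m. 0)" "Phi xi (%m. 0) = (%m. 0)"
 by (simp_all add: Phi_def fun_eq_iff vec_eq_iff co_zero)

lemma Phi_sum:
 assumes "!!i. i : I ==> F i : RD" "et : RD"
 shows "Phi (%m. \<Sum>i\<in>I. F i m) et = (%m. \<Sum>i\<in>I. Phi (F i) et m)"
  "Phi et (%m. \<Sum>i\<in>I. F i m) = (%m. \<Sum>i\<in>I. Phi et (F i) m)"
 by (rule co_eqI, use assms in \<open>simp add: co_Phi co_sum tconv_sum_rd\<close>)+

lemma Phi_conv:
 assumes "Nr a" "xi : RD" "et : RD" shows "Phi (conv Th a xi) et = conv Th a (Phi xi et)"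
 by (rule co_eqI) (use assms in \<open>simp add: co_Phi co_conv Phi_RD tconv_assoc_rd\<close>)

lemma Phi_balanced:
 assumes "Nr a" "xi : RD" "et : RD" shows "Phi (rconv Th xi a) et = Phi xi (conv Th a et)"
 by (rule co_eqI) (use assms in \<open>simp add: co_Phi co_conv co_rconv tconv_assoc_rd\<close>)

lemma co_matrix: "co (%m. M *v F m) i = (%m. \<Sum>k\<in>UNIV. M $ i $ k * co F k m)"
 by (simp add: co_def matrix_vector_mult_def)

lemma Phi_matrix:
 assumes "xi : RD" "et : RD"
 shows "Phi (%m. M *v xi m) et = (%m. LM M (Phi xi et m))" "Phi xi (%m. M *v et m) = (%m. RM M (Phi xi et m))"
proof -
 have t: "tconv Th (%m. \<Sum>k\<in>UNIV. c k * co xi k m) b m = (\<Sum>k\<in>UNIV. c k * tconv Th (co xi k) b m)"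
  "tconv Th a (%m. \<Sum>k\<in>UNIV. c k * co et k m) m = (\<Sum>k\<in>UNIV. c k * tconv Th a (co et k) m)"
  if "Nr a" "Nr b" for a b c m using assms that by (simp_all add: tconv_sum_rd rd_cmult tconv_cmult)
 show "Phi (%m. M *v xi m) et = (%m. LM M (Phi xi et m))" "Phi xi (%m. M *v et m) = (%m. RM M (Phi xi et m))"
  using t[OF co_rd[OF assms(1)] co_rd[OF assms(2)]]
  by (simp_all add: fun_eq_iff vec_eq_iff Phi_def LM_def RM_def co_matrix)
qed

definition PhiL :: "((('n,'s) vf) \<times> (('n,'s) vf)) list => 'n mi => complex^('s \<times> 's)" where
 "PhiL xs = (%m. \<Sum>(xi, et)\<leftarrow>xs. Phi xi et m)"

lemma PhiL_simps: "PhiL [] = (%m. 0)" "PhiL ((xi, et) # xs) = (%m. Phi xi et m + PhiL xs m)"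
 "PhiL (xs @ ys) = (%m. PhiL xs m + PhiL ys m)" by (simp_all add: PhiL_def)

lemma PhiL_RD: "set xs <= RD \<times> RD ==> PhiL xs : RD"
 by (induction xs) (auto simp: PhiL_simps RD_zero intro!: RD_add Phi_RD)

lemma PhiL_invariant:
 assumes "formal_eq (tensor2_rel {a. Nr a} EB EB) xs ys" shows "PhiL xs = PhiL ys"
proof
 fix m
 have "(\<Sum>p\<leftarrow>xs. (%(xi, et). Phi xi et m) p) = (\<Sum>p\<leftarrow>ys. (%(xi, et). Phi xi et m) p)"
 proof (rule formal_eq_sum_list[OF assms])
  fix xs ys assume "tensor2_rel {a. Nr a} EB EB xs ys"
  then show "(\<Sum>p\<leftarrow>xs. (%(xi, et). Phi xi et m) p) = (\<Sum>p\<leftarrow>ys. (%(xi, et). Phi xi et m) p)"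
   by cases (simp_all add: Phi_add Phi_balanced EB_smult EB_ract Phi_zero)
 qed
 then show "PhiL xs m = PhiL ys m" by (simp add: PhiL_def)
qed

abbreviation "EEl \<equiv> tens2 {a. Nr a} EB EB"

text \<open>In the canonical form \<open>\<Sum>\<^sub>k \<zeta>\<^sub>k \<otimes> e\<^sub>k\<close> the \<open>i\<close>-th coordinate of \<open>\<zeta>\<^sub>k\<close> is the \<open>(i, k)\<close> entry of the coefficients, so
  these determine the tensor.\<close>

lemma EEl_eqI:
 assumes xs: "set xs <= RD \<times> RD" and ys: "set ys <= RD \<times> RD" and eq: "PhiL xs = PhiL ys"
 shows "EEl xs = EEl ys"
proof -
 have c: "co (EEt.coeff zs k) i = co (PhiL zs) (i, k)" if "set zs <= RD \<times> RD" for zs k i using that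
 proof (induction zs)
  case (Cons p zs)
  obtain x y where p: "p = (x, y)" by (cases p)
  then have xy: "x : RD" "y : RD" using Cons.prems by auto
  have "EEt.coeff (p # zs) k = (%m. rconv Th x (co y k) m + EEt.coeff zs k m)"
   by (simp add: EEt.coeff_def p EB_ract xy)
  then show ?case using Cons by (simp add: co_add co_rconv p PhiL_simps co_Phi)
 qed (simp add: EEt.coeff_def PhiL_simps co_def)
 have "EEt.coeff xs k = EEt.coeff ys k" for k by (rule co_eqI) (simp only: c[OF xs] c[OF ys] eq)
 then have "formal_eq (tensor2_rel {a. Nr a} EB EB) xs ys"
  by (intro EEt.formal_eq_by_coeff) (use xs ys in simp_all)
 then show ?thesis by (rule tens2_cong)
qed

abbreviation "TS \<equiv> tensor_space X J RD gE"

definition w :: "((('n,'s) vf) \<times> (('n,'s) vf)) list set => 'n mi => complex^('s \<times> 's)" where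
 "w P = PhiL (rep_of P)"

lemma TS_carrier: "carrier TS = EEl ` {xs. set xs <= RD \<times> RD}"
 by (simp add: tensor_space_def Let_def tensor2_def)

lemma EEl_carrier: "set xs <= RD \<times> RD ==> EEl xs : carrier TS" unfolding TS_carrier by blast

lemma EEl_rep:
 assumes "set xs <= RD \<times> RD" shows "set (rep_of (EEl xs)) <= RD \<times> RD" "w (EEl xs) = PhiL xs"
proof -
 have s: "set xs <= carrier EB \<times> carrier EB" using assms by simp
 show "set (rep_of (EEl xs)) <= RD \<times> RD" using tens2_rep(1)[OF s, of "{a. Nr a}"] by simp
 show "w (EEl xs) = PhiL xs" unfolding w_def by (rule PhiL_invariant[OF tens2_rep(2)[OF s], THEN HOL.sym])
qed

lemma TS_rep:
 assumes "P : carrier TS" shows "set (rep_of P) <= RD \<times> RD" "P = EEl (rep_of P)" "w P : RD"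
proof -
 obtain xs where xs: "P = EEl xs" "set xs <= RD \<times> RD" using assms unfolding TS_carrier by blast
 show r: "set (rep_of P) <= RD \<times> RD" unfolding xs(1) by (rule EEl_rep(1)[OF xs(2)])
 show "P = EEl (rep_of P)" unfolding xs(1)
  by (rule EEl_eqI[OF xs(2) EEl_rep(1)[OF xs(2)]]) (use EEl_rep(2)[OF xs(2)] in \<open>simp add: w_def\<close>)
 show "w P : RD" unfolding w_def by (rule PhiL_RD[OF r])
qed

lemma TS_sel: "\<zero>\<^bsub>TS\<^esub> = EEl []"
 "P : carrier TS ==> Q : carrier TS ==> P \<oplus>\<^bsub>TS\<^esub> Q = EEl (rep_of P @ rep_of Q)"
 "P : carrier TS ==> c \<odot>\<^bsub>TS\<^esub> P = EEl (map (%(xi, et). (%m. c *s xi m, et)) (rep_of P))"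
 "P : carrier TS ==> Q : carrier TS ==> ip TS P Q = (\<Sum>(xi, et)\<leftarrow>rep_of P. \<Sum>(xi', et')\<leftarrow>rep_of Q.
  l2_ip et (ap (torus_rep Th (gE (J xi) (J xi'))) et'))" by (simp_all add: tensor_space_def Let_def)

lemma w_map:
 assumes P: "P : carrier TS"
  and F: "!!xi et. xi : RD ==> et : RD ==> f xi : RD & g et : RD & Phi (f xi) (g et) = \<phi> (Phi xi et)"
  and \<phi>: "\<phi> (%m. 0) = (%m. 0)" "!!u v. u : RD ==> v : RD ==> \<phi> (%m. u m + v m) = (%m. \<phi> u m + \<phi> v m)"
 shows "EEl (map (%(xi, et). (f xi, g et)) (rep_of P)) : carrier TS"
  and "w (EEl (map (%(xi, et). (f xi, g et)) (rep_of P))) = \<phi> (w P)"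
proof -
 have *: "set (map (%(xi, et). (f xi, g et)) xs) <= RD \<times> RD & PhiL (map (%(xi, et). (f xi, g et)) xs) = \<phi> (PhiL xs)"
  if "set xs <= RD \<times> RD" for xs using that
 proof (induction xs)
  case (Cons p xs)
  obtain x y where p: "p = (x, y)" by (cases p)
  then have xy: "x : RD" "y : RD" "set xs <= RD \<times> RD" using Cons.prems by auto
  show ?case using Cons.IH[OF xy(3)] F[OF xy(1,2)] \<phi>(2)[OF Phi_RD[OF xy(1,2)] PhiL_RD[OF xy(3)]]
   by (simp add: p PhiL_simps)
 qed (simp add: PhiL_simps \<phi>(1))
 show "EEl (map (%(xi, et). (f xi, g et)) (rep_of P)) : carrier TS"
  by (rule EEl_carrier) (rule *[OF TS_rep(1)[OF P], THEN conjunct1])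
 show "w (EEl (map (%(xi, et). (f xi, g et)) (rep_of P))) = \<phi> (w P)"
  using EEl_rep(2)[OF *[OF TS_rep(1)[OF P], THEN conjunct1]] *[OF TS_rep(1)[OF P], THEN conjunct2] by (simp add: w_def)
qed

lemma J_component: "co (J F) i = (%m. \<Sum>k\<in>UNIV. JN (axis k 1) $ i * tstar Th (co F k) m)"
proof
 fix m
 have "JN v = (\<Sum>k\<in>UNIV. cnj (v $ k) *s JN (axis k 1))" for v
 proof -
  have "JN v = JN (\<Sum>k\<in>UNIV. v $ k *s axis k 1)" by (simp add: basis_expansion)
  then show ?thesis by (simp only: JN_sum J_smult)
 qed
 from arg_cong[OF this[of "F (- m)"], of "%u. u $ i"]
 have "JN (F (- m)) $ i = (\<Sum>k\<in>UNIV. cnj (F (- m) $ k) * JN (axis k 1) $ i)"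
  by (simp only: sum_component vector_smult_component)
 then show "co (J F) i m = (\<Sum>k\<in>UNIV. JN (axis k 1) $ i * tstar Th (co F k) m)"
  by (simp add: co_def torus_J_def tstar_def sum_distrib_left mult_ac)
qed

text \<open>The antiunitary on the fibre is orthonormal on the basis, so it drops out and only turns \<open>\<xi>\<^sub>k \<xi>'\<^sub>k\<^sup>*\<close> into
  \<open>\<xi>\<^sub>k\<^sup>* \<xi>'\<^sub>k\<close>.\<close>

lemma gE_J:
 assumes "xi : RD" "xi' : RD"
 shows "gE (J xi) (J xi') = (%m. \<Sum>k\<in>UNIV. tconv Th (tstar Th (co xi k)) (co xi' k) m)"
proof
 fix m
 let ?c = "%i k. JN (axis k 1) $ i"
 have N: "Nr (co xi k)" "Nr (co xi' k)" "Nr (tstar Th (co xi k))" for k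
  using assms by (simp_all add: rd_tstar)
 have t: "tstar Th (co (J xi') i) = (%m. \<Sum>l\<in>UNIV. cnj (?c i l) * co xi' l m)" for i
  unfolding J_component tstar_sum tstar_cmult tstar_tstar ..
 have orth: "(\<Sum>i\<in>UNIV. ?c i k * cnj (?c i l)) = (if k = l then 1 else 0)" for k l
 proof -
  have "hdot (axis k 1) (axis l 1 :: complex^'s) = (if k = l then 1 else 0)"
   unfolding hdot_axis(1) by (simp add: axis_def)
  then show ?thesis
   using J_hdot[of "axis l 1" "axis k 1"] unfolding hdot_def[of "JN _" "JN _"] by (simp add: mult.commute)
 qed
 have "tconv Th (co (J xi) i) (tstar Th (co (J xi') i)) m =
   (\<Sum>k\<in>UNIV. \<Sum>l\<in>UNIV. ?c i k * cnj (?c i l) * tconv Th (tstar Th (co xi k)) (co xi' l) m)" for i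
 proof -
  have "tconv Th (co (J xi) i) b m = (\<Sum>k\<in>UNIV. ?c i k * tconv Th (tstar Th (co xi k)) b m)" if "Nr b" for b
   unfolding J_component using N that by (simp add: tconv_sum_rd rd_cmult tconv_cmult)
  moreover have "tconv Th a (tstar Th (co (J xi') i)) m = (\<Sum>l\<in>UNIV. cnj (?c i l) * tconv Th a (co xi' l) m)" if "Nr a" for a
   unfolding t using N that by (simp add: tconv_sum_rd rd_cmult tconv_cmult)
  moreover have "Nr (tstar Th (co (J xi') i))" by (rule rd_tstar[OF co_rd[OF J_RD[OF assms(2)]]])
  ultimately show ?thesis using N by (simp add: sum_distrib_left mult.assoc)
 qed
 then have "gE (J xi) (J xi') m =
   (\<Sum>i\<in>UNIV. \<Sum>k\<in>UNIV. \<Sum>l\<in>UNIV. ?c i k * cnj (?c i l) * tconv Th (tstar Th (co xi k)) (co xi' l) m)"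
  by (simp add: gE_eq[OF J_RD[OF assms(1)] J_RD[OF assms(2)]])
 also have "... = (\<Sum>k\<in>UNIV. \<Sum>i\<in>UNIV. \<Sum>l\<in>UNIV. ?c i k * cnj (?c i l) * tconv Th (tstar Th (co xi k)) (co xi' l) m)"
  by (rule sum.swap)
 also have "... = (\<Sum>k\<in>UNIV. \<Sum>l\<in>UNIV. (\<Sum>i\<in>UNIV. ?c i k * cnj (?c i l)) * tconv Th (tstar Th (co xi k)) (co xi' l) m)"
  unfolding sum_distrib_right by (rule sum.cong[OF refl], rule sum.swap)
 also have "... = (\<Sum>k\<in>UNIV. \<Sum>l\<in>UNIV. if k = l then tconv Th (tstar Th (co xi k)) (co xi' l) m else 0)"
  unfolding orth by (intro sum.cong refl) simp
 also have "... = (\<Sum>k\<in>UNIV. tconv Th (tstar Th (co xi k)) (co xi' k) m)" by simp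
 finally show "gE (J xi) (J xi') m = (\<Sum>k\<in>UNIV. tconv Th (tstar Th (co xi k)) (co xi' k) m)" .
qed

lemma l2_ip_sum_right:
 fixes F :: "'b => 'n mi => complex^'t::finite"
 assumes "x : l2" "!!j. j : I ==> F j : l2" shows "l2_ip x (%m. \<Sum>j\<in>I. F j m) = (\<Sum>j\<in>I. l2_ip x (F j))"
 using assms(2) by (induction I rule: infinite_finite_induct) (simp_all add: l2_ip_add assms(1))

text \<open>The adjoint of multiplication by \<open>\<xi>\<^sub>k\<^sup>*\<close> is multiplication by \<open>\<xi>\<^sub>k\<close>, which moves it to the other side of
  the inner product.\<close>

lemma Phi_ip:
 assumes "xi : RD" "et : RD" "xi' : RD" "et' : RD"
 shows "l2_ip et (ap (torus_rep Th (gE (J xi) (J xi'))) et') = l2_ip (Phi xi et) (Phi xi' et')"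
proof -
 have l: "et : l2" "et' : l2" using assms RD_l2 by blast+
 have N: "Nr (co xi k)" "Nr (co xi' k)" "Nr (tstar Th (co xi k))" for k
  using assms by (simp_all add: rd_tstar)
 have "ap (torus_rep Th (gE (J xi) (J xi'))) et' = conv Th (gE (J xi) (J xi')) et'"
  by (rule ap_rep[OF gE_Nr[OF J_RD[OF assms(1)] J_RD[OF assms(3)]] l(2)])
 also have "... = (%m. \<Sum>k\<in>UNIV. conv Th (tstar Th (co xi k)) (conv Th (co xi' k) et') m)"
  unfolding gE_J[OF assms(1,3)] using N l by (simp add: conv_sum rd_tconv conv_tconv)
 finally have "l2_ip et (ap (torus_rep Th (gE (J xi) (J xi'))) et') =
   (\<Sum>k\<in>UNIV. l2_ip et (conv Th (tstar Th (co xi k)) (conv Th (co xi' k) et')))"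
  using N l by (simp add: l2_ip_sum_right conv_l2)
 also have "... = (\<Sum>k\<in>UNIV. l2_ip (conv Th (co xi k) et) (conv Th (co xi' k) et'))"
  using N l by (simp add: conv_adj conv_l2 tstar_tstar)
 also have "... = (\<Sum>k\<in>UNIV. \<Sum>i\<in>UNIV. \<Sum>\<^sub>\<infinity>m. cnj (Phi xi et m $ (k, i)) * Phi xi' et' m $ (k, i))"
  using N l by (simp add: l2_ip_components conv_l2 conv_component Phi_def co_def[symmetric])
 also have "... = l2_ip (Phi xi et) (Phi xi' et')"
  using l2_ip_components[OF subsetD[OF RD_l2 Phi_RD[OF assms(1,2)]] subsetD[OF RD_l2 Phi_RD[OF assms(3,4)]]]
  by (simp add: sum.cartesian_product UNIV_Times_UNIV case_prod_unfold)
 finally show ?thesis .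
qed

lemma PhiL_ip:
 assumes "set xs <= RD \<times> RD" "set ys <= RD \<times> RD"
 shows "(\<Sum>(xi, et)\<leftarrow>xs. \<Sum>(xi', et')\<leftarrow>ys. l2_ip et (ap (torus_rep Th (gE (J xi) (J xi'))) et')) = l2_ip (PhiL xs) (PhiL ys)"
 using assms(1)
proof (induction xs)
 case (Cons p xs)
 obtain xi et where p: "p = (xi, et)" by (cases p)
 then have x: "xi : RD" "et : RD" "set xs <= RD \<times> RD" using Cons.prems by auto
 have l: "Phi xi et : l2" "PhiL xs : l2" "PhiL ys : l2"
  using Phi_RD[OF x(1,2)] PhiL_RD[OF x(3)] PhiL_RD[OF assms(2)] RD_l2 by blast+
 have "(\<Sum>(xi', et')\<leftarrow>ys. l2_ip et (ap (torus_rep Th (gE (J xi) (J xi'))) et')) = l2_ip (Phi xi et) (PhiL ys)"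
  using assms(2)
 proof (induction ys)
  case (Cons q ys)
  obtain xi' et' where q: "q = (xi', et')" by (cases q)
  then have y: "xi' : RD" "et' : RD" "set ys <= RD \<times> RD" using Cons.prems by auto
  have "Phi xi' et' : l2" "PhiL ys : l2" using Phi_RD[OF y(1,2)] PhiL_RD[OF y(3)] RD_l2 by blast+
  then show ?case using Cons.IH[OF y(3)] l(1) by (simp add: q PhiL_simps l2_ip_add Phi_ip[OF x(1,2) y(1,2)])
 qed (simp add: PhiL_simps)
 then show ?case using Cons.IH[OF x(3)] l by (simp add: p PhiL_simps l2_ip_add)
qed (simp add: PhiL_simps)

sublocale ten: smooth_model TS w
proof
 have e: "set [] <= (RD :: (('n,'s) vf) set) \<times> (RD :: (('n,'s) vf) set)" by simp
 show "\<zero>\<^bsub>TS\<^esub> : carrier TS" "w \<zero>\<^bsub>TS\<^esub> = (%m. 0)"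
  unfolding TS_sel(1) using EEl_carrier[OF e] EEl_rep(2)[OF e] by (simp_all add: PhiL_simps)
 show "bij_betw w (carrier TS) RD" unfolding bij_betw_def
 proof
  show "inj_on w (carrier TS)"
  proof (rule inj_onI)
   fix P Q assume PQ: "P : carrier TS" "Q : carrier TS" "w P = w Q"
   have "EEl (rep_of P) = EEl (rep_of Q)"
    by (rule EEl_eqI[OF TS_rep(1)[OF PQ(1)] TS_rep(1)[OF PQ(2)]]) (use PQ(3) in \<open>simp add: w_def\<close>)
   then show "P = Q" using TS_rep(2)[OF PQ(1)] TS_rep(2)[OF PQ(2)] by simp
  qed
  show "w ` carrier TS = RD"
  proof (intro equalityI subsetI)
   fix F assume "F : w ` carrier TS"
   then show "F : RD" using TS_rep(3) by blast
  next
   fix F :: "'n mi => complex^('s \<times> 's)" assume F: "F : RD"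
   let ?f = "%k m. (\<chi> i. F m $ (i, k)) :: complex^'s"
   let ?xs = "map (%k. (?f k, eu k)) idx"
   have f: "?f k : RD" for k using F by (simp add: RD_def)
   have xs: "set ?xs <= RD \<times> RD" using f eu_RD by auto
   have "PhiL ?xs m $ (i, l) = F m $ (i, l)" for m i l
   proof -
    have "PhiL ?xs m = (\<Sum>k\<in>UNIV. Phi (?f k) (eu k) m)" by (simp add: PhiL_def o_def sum_list_idx)
    then have "PhiL ?xs m $ (i, l) = (\<Sum>k\<in>UNIV. tconv Th (co (?f k) i) (co (eu k) l) m)" by (simp add: Phi_def)
    also have "... = (\<Sum>k\<in>UNIV. if k = l then F m $ (i, k) else 0)"
     by (rule sum.cong[OF refl]) (simp add: co_eu, simp add: co_def)
    finally show ?thesis by simp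
   qed
   then have "PhiL ?xs = F" by (simp add: fun_eq_iff vec_eq_iff split_paired_all)
   then have "F = w (EEl ?xs)" by (simp only: EEl_rep(2)[OF xs])
   then show "F : w ` carrier TS" by (rule image_eqI[OF _ EEl_carrier[OF xs]])
  qed
 qed
next
 fix P Q assume PQ: "P : carrier TS" "Q : carrier TS"
 have s: "set (rep_of P @ rep_of Q) <= RD \<times> RD" using TS_rep(1)[OF PQ(1)] TS_rep(1)[OF PQ(2)] by simp
 show "P \<oplus>\<^bsub>TS\<^esub> Q : carrier TS" "w (P \<oplus>\<^bsub>TS\<^esub> Q) = (%m. w P m + w Q m)"
  unfolding TS_sel(2)[OF PQ] using EEl_carrier[OF s] EEl_rep(2)[OF s] by (simp_all add: PhiL_simps w_def)
 show "ip TS P Q = l2_ip (w P) (w Q)"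
  unfolding TS_sel(4)[OF PQ] w_def by (rule PhiL_ip[OF TS_rep(1)[OF PQ(1)] TS_rep(1)[OF PQ(2)]])
next
 fix c P assume P: "P : carrier TS"
 note m = w_map[OF P, of "%xi m. c *s xi m" "%et. et" "%F m. c *s F m"]
 show "c \<odot>\<^bsub>TS\<^esub> P : carrier TS" "w (c \<odot>\<^bsub>TS\<^esub> P) = (%m. c *s w P m)"
  unfolding TS_sel(3)[OF P] by (rule m; simp add: RD_smult Phi_smult vector_add_ldistrib)+
qed

end

section \<open>The two Dirac operators on the tensor square\<close>

context torus_spinor
begin

definition pdv :: "'n => (('n,'s) vf) => ('n,'s) vf" where "pdv j F m = (\<i> * of_int (m $ j)) *s F m"

lemma pdv_RD: "F : RD ==> pdv j F : RD" unfolding pdv_def[abs_def] by (rule RD_mult_coord)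

lemma co_pdv: "co (pdv j F) i = pd j (co F i)" by (simp add: co_def pdv_def pd_def fun_eq_iff)

lemma Phi_pdv:
 assumes "xi : RD" "et : RD"
 shows "(\<i> * of_int (m $ j)) *s Phi xi et m = Phi (pdv j xi) et m + Phi xi (pdv j et) m"
proof -
 have "\<i> * of_int (m $ j) * tconv Th (co xi i) (co et k) m =
   tconv Th (co (pdv j xi) i) (co et k) m + tconv Th (co xi i) (co (pdv j et) k) m" for i k
  using fun_cong[OF pd_tconv[OF co_rd[OF assms(1)] co_rd[OF assms(2)], of j Th i k], of m]
  by (simp add: co_pdv pd_def add.commute)
 then show ?thesis by (simp add: Phi_def vec_eq_iff)
qed

lemma sum_conv_eu: "(%m. \<Sum>i\<in>UNIV. conv Th (co F i) (eu i) m) = F" for F :: "('n,'s) vf"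
 by (simp add: conv_eu basis_sum)

lemma J_pdv: "J (pdv j F) = pdv j (J F)"
 unfolding fun_eq_iff torus_J_def pdv_def J_smult by (simp add: vector_smult_assoc mult_ac)

lemma Ji_RD: "F : RD ==> Ji F : RD" unfolding Ji_def[abs_def] by (rule RD_smult[OF J_RD])

text \<open>Both Clifford actions of \<open>\<xi> \<otimes> \<omega> \<otimes> \<eta>\<close> have, on coefficients, the form \<open>q\<close> below: a fixed family of
  matrices \<open>R\<^sub>j\<close> applied to the product of \<open>\<xi>\<close>, the coefficient \<open>b\<^sub>j\<close> of the one-form, and \<open>\<eta>\<close>. The computation of the two
  Dirac operators is carried out once, for such a \<open>q\<close>.\<close>

definition qsym :: "((('n,'s) vf) => (('n,'s) vf) oper => (('n,'s) vf) =>
  'n mi => complex^('s \<times> 's)) => ('n => complex^('s \<times> 's) => complex^('s \<times> 's)) => bool" where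
 "qsym q R \<longleftrightarrow> (\<forall>j. flin (R j)) & (\<forall>b xi et. (\<forall>j. Nr (b j)) --> xi : RD --> et : RD -->
  q xi (om b) et = (%m. \<Sum>j\<in>UNIV. R j (Phi xi (conv Th (b j) et) m)))"

lemma qsym_lin: "qsym q R ==> flin (R j)" by (simp add: qsym_def)

lemma qsym_om:
 "qsym q R ==> (!!j. Nr (b j)) ==> xi : RD ==> et : RD ==> q xi (om b) et = (%m. \<Sum>j\<in>UNIV. R j (Phi xi (conv Th (b j) et) m))"
 by (simp add: qsym_def)

context
 fixes q R assumes q: "qsym q R"
begin

lemma q_add1:
 assumes "xi : RD" "xi' : RD" "ww : carrier OB" "et : RD"
 shows "q (%m. xi m + xi' m) ww et = (%m. q xi ww et m + q xi' ww et m)"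
proof -
 obtain b where b: "ww = om b" "!!j. Nr (b j)" by (rule OB_E[OF assms(3)]) simp
 have c: "conv Th (b j) et : RD" for j by (rule RD_conv[OF b(2) assms(4)])
 show ?thesis
  unfolding b(1) qsym_om[OF q b(2) RD_add[OF assms(1,2)] assms(4)] qsym_om[OF q b(2) assms(1,4)] qsym_om[OF q b(2) assms(2,4)]
   Phi_add(1)[OF assms(1,2) c] flin_add[OF qsym_lin[OF q]] sum.distrib ..
qed

lemma q_smult1:
 assumes "xi : RD" "ww : carrier OB" "et : RD" shows "q (%m. c *s xi m) ww et = (%m. c *s q xi ww et m)"
proof -
 obtain b where b: "ww = om b" "!!j. Nr (b j)" by (rule OB_E[OF assms(2)]) simp
 show ?thesis
  unfolding b(1) qsym_om[OF q b(2) RD_smult[OF assms(1)] assms(3)] qsym_om[OF q b(2) assms(1,3)]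
   Phi_smult(1) flin_smult[OF qsym_lin[OF q]] smult_sum ..
qed

lemma q_zero1: "ww : carrier OB ==> et : RD ==> q (%m. 0) ww et = (%m. 0)"
 using q_smult1[OF RD_zero, of ww et 0] by simp

lemma q_uminus1: "xi : RD ==> ww : carrier OB ==> et : RD ==> q (%m. - xi m) ww et = (%m. - q xi ww et m)"
 using q_smult1[of xi ww et "-1"] by (simp add: vector_sneg_minus1[symmetric])

lemma q_add2:
 assumes "xi : RD" "ww : carrier OB" "ww' : carrier OB" "et : RD"
 shows "q xi (op_add Vs ww ww') et = (%m. q xi ww et m + q xi ww' et m)"
proof -
 obtain b where b: "ww = om b" "!!j. Nr (b j)" by (rule OB_E[OF assms(2)]) simp
 obtain b' where b': "ww' = om b'" "!!j. Nr (b' j)" by (rule OB_E[OF assms(3)]) simp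
 have c: "conv Th (b j) et : RD" "conv Th (b' j) et : RD" for j by (rule RD_conv[OF b(2) assms(4)], rule RD_conv[OF b'(2) assms(4)])
 have d: "conv Th (%m. b j m + b' j m) et = (%m. conv Th (b j) et m + conv Th (b' j) et m)" for j
  by (rule conv_add[OF l1_rd[OF b(2)] l1_rd[OF b'(2)] subsetD[OF RD_l2 assms(4)]])
 show ?thesis unfolding b(1) b'(1) om_add[OF b(2) b'(2)] qsym_om[OF q rd_add[OF b(2) b'(2)] assms(1,4)]
   qsym_om[OF q b(2) assms(1,4)] qsym_om[OF q b'(2) assms(1,4)]
   d Phi_add(2)[OF c assms(1)] flin_add[OF qsym_lin[OF q]] sum.distrib ..
qed

lemma q_add3:
 assumes "xi : RD" "ww : carrier OB" "et : RD" "et' : RD"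
 shows "q xi ww (%m. et m + et' m) = (%m. q xi ww et m + q xi ww et' m)"
proof -
 obtain b where b: "ww = om b" "!!j. Nr (b j)" by (rule OB_E[OF assms(2)]) simp
 have c: "conv Th (b j) et : RD" "conv Th (b j) et' : RD" for j by (rule RD_conv[OF b(2) assms(3)], rule RD_conv[OF b(2) assms(4)])
 have d: "conv Th (b j) (%m. et m + et' m) = (%m. conv Th (b j) et m + conv Th (b j) et' m)" for j
  by (rule conv_add_vec[OF l1_rd[OF b(2)] subsetD[OF RD_l2 assms(3)] subsetD[OF RD_l2 assms(4)]])
 show ?thesis
  unfolding b(1) qsym_om[OF q b(2) assms(1) RD_add[OF assms(3,4)]] qsym_om[OF q b(2) assms(1,3)] qsym_om[OF q b(2) assms(1,4)]
   d Phi_add(2)[OF c assms(1)] flin_add[OF qsym_lin[OF q]] sum.distrib ..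
qed

lemma q_balanced1:
 assumes "xi : RD" "ww : carrier OB" "et : RD" "Nr a"
 shows "q (rconv Th xi a) ww et = q xi (op_comp (torus_rep Th a) ww) et"
proof -
 obtain b where b: "ww = om b" "!!j. Nr (b j)" by (rule OB_E[OF assms(2)]) simp
 have c: "conv Th (b j) et : RD" for j by (rule RD_conv[OF b(2) assms(3)])
 have d: "conv Th (tconv Th a (b j)) et = conv Th a (conv Th (b j) et)" for j
  by (rule conv_tconv[OF assms(4) b(2) subsetD[OF RD_l2 assms(3)]])
 show ?thesis unfolding b(1) rep_om[OF assms(4) b(2)] qsym_om[OF q b(2) RD_rconv[OF assms(1,4)] assms(3)]
   qsym_om[OF q rd_tconv[OF assms(4) b(2)] assms(1,3)] d Phi_balanced[OF assms(4,1) c] ..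
qed

lemma q_balanced2:
 assumes "xi : RD" "ww : carrier OB" "et : RD" "Nr a"
 shows "q xi (op_comp ww (torus_rep Th a)) et = q xi ww (conv Th a et)"
proof -
 obtain b where b: "ww = om b" "!!j. Nr (b j)" by (rule OB_E[OF assms(2)]) simp
 have d: "conv Th (tconv Th (b j) a) et = conv Th (b j) (conv Th a et)" for j
  by (rule conv_tconv[OF b(2) assms(4) subsetD[OF RD_l2 assms(3)]])
 show ?thesis unfolding b(1) om_rep[OF assms(4) b(2)] qsym_om[OF q b(2) assms(1) RD_conv[OF assms(4,3)]]
   qsym_om[OF q rd_tconv[OF b(2) assms(4)] assms(1,3)] d ..
qed

lemma q_zero2: "xi : RD ==> et : RD ==> q xi \<zero>\<^bsub>OB\<^esub> et = (%m. 0)"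
proof -
 assume x: "xi : RD" and e: "et : RD"
 have "conv Th (%m. 0) et = (%m. 0)" by (rule conv_0[OF subsetD[OF RD_l2 e]])
 then show ?thesis using qsym_om[OF q rd_0 x e] by (simp add: Phi_zero flin_0[OF qsym_lin[OF q]])
qed

lemma tensor3_invariant:
 assumes eq: "formal_eq (tensor3_rel {a. Nr a} EB OB EB) xs ys"
 shows "(\<Sum>(xi, ww, et)\<leftarrow>xs. q xi ww et m) = (\<Sum>(xi, ww, et)\<leftarrow>ys. q xi ww et m)"
proof (rule formal_eq_sum_list[OF eq])
 fix xs ys assume "tensor3_rel {a. Nr a} EB OB EB xs ys"
 then show "(\<Sum>(xi, ww, et)\<leftarrow>xs. q xi ww et m) = (\<Sum>(xi, ww, et)\<leftarrow>ys. q xi ww et m)"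
 proof cases
  case (1 xi xi' ww et)
  have r: "xi : RD" "xi' : RD" "et : RD" using 1 by simp_all
  show ?thesis by (simp add: 1(1,2) q_add1[OF r(1,2) 1(5) r(3)])
 next
  case (2 xi ww ww' et)
  have r: "xi : RD" "et : RD" using 2 by simp_all
  show ?thesis by (simp add: 2(1,2) q_add2[OF r(1) 2(4,5) r(2)])
 next
  case (3 xi ww et et')
  have r: "xi : RD" "et : RD" "et' : RD" using 3 by simp_all
  show ?thesis by (simp add: 3(1,2) q_add3[OF r(1) 3(4) r(2,3)])
 next
  case (4 xi ww et a)
  have r: "xi : RD" "et : RD" "Nr a" using 4 by simp_all
  have s: "a \<odot>\<^bsub>OB\<^esub> ww = op_comp (torus_rep Th a) ww" by (simp add: Omega_bimodule_def)
  show ?thesis by (simp add: 4(1,2) s EB_ract[OF r(3,1)] q_balanced1[OF r(1) 4(4) r(2,3)])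
 next
  case (5 xi ww et a)
  have r: "xi : RD" "et : RD" "Nr a" using 5 by simp_all
  show ?thesis by (simp add: 5(1,2) OB_ract EB_smult[OF r(3,2)] q_balanced2[OF r(1) 5(4) r(2,3)])
 next
  case (6 ww et)
  have r: "et : RD" using 6 by simp
  show ?thesis by (simp add: 6(1,2) q_zero1[OF 6(3) r])
 qed
qed

text \<open>The flat connection differentiates the right factor.\<close>

lemma q_nab:
 assumes x: "xi : RD" and e: "et : RD"
 shows "(\<Sum>(ww, y)\<leftarrow>rep_of (nab et). q xi ww y m) = (\<Sum>j\<in>UNIV. R j (Phi xi (pdv j et) m))"
proof -
 let ?f = "%(ww, y). q xi ww y m"
 have "(\<Sum>p\<leftarrow>map (%i. (dD X (co et i), eu i)) idx. ?f p) = (\<Sum>p\<leftarrow>rep_of (nab et). ?f p)"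
 proof (rule formal_eq_sum_list[OF nab_rep(2)[OF e]])
  fix xs ys assume "tensor2_rel {a. Nr a} OB EB xs ys"
  then show "(\<Sum>p\<leftarrow>xs. ?f p) = (\<Sum>p\<leftarrow>ys. ?f p)"
  proof cases
   case (1 ww ww' y)
   then have r: "y : RD" by simp
   show ?thesis by (simp add: 1(1,2) q_add2[OF x 1(3,4) r])
  next
   case (2 ww y y')
   then have r: "y : RD" "y' : RD" by simp_all
   show ?thesis by (simp add: 2(1,2) q_add3[OF x 2(3) r])
  next
   case (3 ww y a)
   then have r: "y : RD" "Nr a" by simp_all
   show ?thesis by (simp add: 3(1,2) OB_ract EB_smult[OF r(2,1)] q_balanced2[OF x 3(3) r])
  next
   case (4 y)
   then have r: "y : RD" by simp
   show ?thesis using q_zero2[OF x r] by (simp add: 4(1,2))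
  qed
 qed
 then have "(\<Sum>p\<leftarrow>rep_of (nab et). ?f p) = (\<Sum>p\<leftarrow>map (%i. (dD X (co et i), eu i)) idx. ?f p)" by (rule HOL.sym)
 also have "... = (\<Sum>i\<leftarrow>idx. q xi (dD X (co et i)) (eu i) m)" by (simp only: map_map o_def prod.case)
 also have "... = (\<Sum>i\<in>UNIV. q xi (dD X (co et i)) (eu i) m)" by (rule sum_list_idx)
 also have "... = (\<Sum>i\<in>UNIV. \<Sum>j\<in>UNIV. R j (Phi xi (conv Th (co (pdv j et) i) (eu i)) m))"
  by (rule sum.cong[OF refl])
   (simp only: dD_om[OF co_rd[OF e]] qsym_om[OF q rd_pd[OF co_rd[OF e]] x eu_RD] co_pdv)
 also have "... = (\<Sum>j\<in>UNIV. \<Sum>i\<in>UNIV. R j (Phi xi (conv Th (co (pdv j et) i) (eu i)) m))" by (rule sum.swap)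
 also have "... = (\<Sum>j\<in>UNIV. R j (Phi xi (pdv j et) m))"
 proof (rule sum.cong[OF refl])
  fix j :: 'n
  have c: "conv Th (co (pdv j et) i) (eu i) : RD" for i by (rule RD_conv[OF co_rd[OF pdv_RD[OF e]] eu_RD])
  have "Phi xi (pdv j et) = Phi xi (%m. \<Sum>i\<in>UNIV. conv Th (co (pdv j et) i) (eu i) m)" by (simp only: sum_conv_eu)
  also have "... = (%m. \<Sum>i\<in>UNIV. Phi xi (conv Th (co (pdv j et) i) (eu i)) m)" by (rule Phi_sum(2)[OF c x])
  finally show "(\<Sum>i\<in>UNIV. R j (Phi xi (conv Th (co (pdv j et) i) (eu i)) m)) = R j (Phi xi (pdv j et) m)"
   by (simp add: flin_sum[OF qsym_lin[OF q]])
 qed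
 finally show ?thesis .
qed

lemma EO_invariant:
 assumes eq: "formal_eq (tensor2_rel {a. Nr a} EB OB) xs ys" and e: "et : RD"
 shows "(\<Sum>(xi, ww)\<leftarrow>xs. q xi ww et m) = (\<Sum>(xi, ww)\<leftarrow>ys. q xi ww et m)"
proof (rule formal_eq_sum_list[OF eq])
 fix xs ys assume "tensor2_rel {a. Nr a} EB OB xs ys"
 then show "(\<Sum>(xi, ww)\<leftarrow>xs. q xi ww et m) = (\<Sum>(xi, ww)\<leftarrow>ys. q xi ww et m)"
 proof cases
  case (1 xi xi' ww)
  then have r: "xi : RD" "xi' : RD" by simp_all
  show ?thesis by (simp add: 1(1,2) q_add1[OF r 1(5) e])
 next
  case (2 xi ww ww')
  then have r: "xi : RD" by simp
  show ?thesis by (simp add: 2(1,2) q_add2[OF r 2(4,5) e])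
 next
  case (3 xi ww a)
  then have r: "xi : RD" "Nr a" by simp_all
  have s: "a \<odot>\<^bsub>OB\<^esub> ww = op_comp (torus_rep Th a) ww" by (simp add: Omega_bimodule_def)
  show ?thesis by (simp add: 3(1,2) s EB_ract[OF r(2,1)] q_balanced1[OF r(1) 3(4) e r(2)])
 next
  case (4 ww)
  show ?thesis by (simp add: 4(1,2) q_zero1[OF 4(3) e])
 qed
qed

lemma J_conv: "Nr a ==> F : l2 ==> J (conv Th a F) = rconv Th (J F) (tstar Th a)"
 using J_conv_Ji[of a "J F"] by (simp add: Ji_J J_l2)

lemma nabla_bar_rep:
 assumes x: "xi : RD" shows "set (rep_of (nabla_bar X J RD nab xi)) <= RD \<times> carrier OB"
  and "et : RD ==> (\<Sum>(ze, ww)\<leftarrow>rep_of (nabla_bar X J RD nab xi). q ze ww et m) =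
   - (\<Sum>(ww, ze)\<leftarrow>rep_of (nab (Ji xi)). q (J ze) (op_adj Vs ww) et m)"
proof -
 let ?L1 = "rep_of (nab (Ji xi))"
 let ?M1 = "map (%(ww, ze). (J ze, op_adj Vs ww)) ?L1"
 let ?L2 = "rep_of (tens2 {a. Nr a} EB OB ?M1)"
 let ?M2 = "map (%(ze, ww). (\<ominus>\<^bsub>Vs\<^esub> ze, ww)) ?L2"
 let ?L3 = "rep_of (tens2 {a. Nr a} EB OB ?M2)"
 have L3: "rep_of (nabla_bar X J RD nab xi) = ?L3"
  unfolding nabla_bar_def Psi_def using Jstar_eq[OF subsetD[OF RD_l2 x]] by simp
 have L1: "set ?L1 <= carrier OB \<times> carrier EB" by (rule nab_rep(1)[OF Ji_RD[OF x]])
 have mem1: "fst p : carrier OB" "snd p : RD" if "p : set ?L1" for p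
  using subsetD[OF L1 that] by (simp_all add: mem_Times_iff del: OB_sel)
 have M1: "set ?M1 <= carrier EB \<times> carrier OB"
 proof
  fix r assume "r : set ?M1"
  then obtain p where p: "p : set ?L1" "r = (J (snd p), op_adj Vs (fst p))" by auto
  show "r : carrier EB \<times> carrier OB"
   unfolding p(2) using J_RD[OF mem1(2)[OF p(1)]] OB_adj[OF mem1(1)[OF p(1)]] by (simp del: OB_sel)
 qed
 note L2 = tens2_rep[OF M1, of "{a. Nr a}"]
 have mem2: "fst p : RD" "snd p : carrier OB" if "p : set ?L2" for p
  using subsetD[OF L2(1) that] by (simp_all add: mem_Times_iff del: OB_sel)
 have neg: "\<ominus>\<^bsub>Vs\<^esub> ze = (%m. - ze m)" if "ze : RD" for ze
  using spin.W_uminus[of ze] subsetD[OF RD_l2 that] by simp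
 have negRD: "(%m. - ze m) : RD" if "ze : RD" for ze :: "('n,'s) vf"
  using RD_smult[OF that, of "-1"] by (simp add: vector_sneg_minus1[symmetric])
 have M2: "set ?M2 <= carrier EB \<times> carrier OB"
 proof
  fix r assume "r : set ?M2"
  then obtain p where p: "p : set ?L2" "r = (\<ominus>\<^bsub>Vs\<^esub> fst p, snd p)" by auto
  show "r : carrier EB \<times> carrier OB"
   unfolding p(2) neg[OF mem2(1)[OF p(1)]] using negRD[OF mem2(1)[OF p(1)]] mem2(2)[OF p(1)] by (simp del: OB_sel)
 qed
 note L3' = tens2_rep[OF M2, of "{a. Nr a}"]
 show "set (rep_of (nabla_bar X J RD nab xi)) <= RD \<times> carrier OB"
  unfolding L3 using L3'(1) by (simp del: OB_sel)
 assume e: "et : RD"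
 have "(\<Sum>(ze, ww)\<leftarrow>?L3. q ze ww et m) = (\<Sum>(ze, ww)\<leftarrow>?M2. q ze ww et m)"
  by (rule EO_invariant[OF L3'(2) e, THEN HOL.sym])
 also have "... = (\<Sum>p\<leftarrow>?L2. - q (fst p) (snd p) et m)" unfolding map_map
 proof (rule arg_cong[where f = sum_list], rule map_cong[OF refl])
  fix p assume p: "p : set ?L2"
  show "((%(ze, ww). q ze ww et m) \<circ> (%(ze, ww). (\<ominus>\<^bsub>Vs\<^esub> ze, ww))) p = - q (fst p) (snd p) et m"
   using neg[OF mem2(1)[OF p]] q_uminus1[OF mem2[OF p] e] by (simp add: case_prod_beta)
 qed
 also have "... = - (\<Sum>(ze, ww)\<leftarrow>?L2. q ze ww et m)"
  by (simp add: uminus_sum_list_map o_def case_prod_unfold)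
 also have "(\<Sum>(ze, ww)\<leftarrow>?L2. q ze ww et m) = (\<Sum>(ze, ww)\<leftarrow>?M1. q ze ww et m)"
  by (rule EO_invariant[OF L2(2) e, THEN HOL.sym])
 also have "... = (\<Sum>(ww, ze)\<leftarrow>?L1. q (J ze) (op_adj Vs ww) et m)"
  by (simp only: map_map o_def case_prod_unfold fst_conv snd_conv)
 finally show "(\<Sum>(ze, ww)\<leftarrow>rep_of (nabla_bar X J RD nab xi). q ze ww et m) =
   - (\<Sum>(ww, ze)\<leftarrow>?L1. q (J ze) (op_adj Vs ww) et m)" unfolding L3 .
qed

text \<open>Conjugating by \<open>J\<close> turns the left module structure into the right one and the two signs, from the
  adjoint of \<open>da\<close> and from the definition of the conjugate connection, cancel: the conjugate connection
  differentiates the left factor.\<close>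

lemma q_nab_bar:
 assumes x: "xi : RD" and e: "et : RD"
 shows "(\<Sum>(ze, ww)\<leftarrow>rep_of (nabla_bar X J RD nab xi). q ze ww et m) = (\<Sum>j\<in>UNIV. R j (Phi (pdv j xi) et m))"
proof -
 let ?f = "%(ww, ze). q (J ze) (op_adj Vs ww) et m" and ?z = "Ji xi"
 have z: "?z : RD" by (rule Ji_RD[OF x])
 have "(\<Sum>p\<leftarrow>map (%i. (dD X (co ?z i), eu i)) idx. ?f p) = (\<Sum>p\<leftarrow>rep_of (nab ?z). ?f p)"
 proof (rule formal_eq_sum_list[OF nab_rep(2)[OF z]])
  fix xs ys assume "tensor2_rel {a. Nr a} OB EB xs ys"
  then show "(\<Sum>p\<leftarrow>xs. ?f p) = (\<Sum>p\<leftarrow>ys. ?f p)"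
  proof cases
   case (1 ww ww' y)
   then have r: "y : RD" by simp
   show ?thesis by (simp add: 1(1,2) op_adj_add[OF 1(3,4)] q_add2[OF J_RD[OF r] OB_adj[OF 1(3)] OB_adj[OF 1(4)] e])
  next
   case (2 ww y y')
   then have r: "y : RD" "y' : RD" by simp_all
   show ?thesis by (simp add: 2(1,2) J_add_fun q_add1[OF J_RD[OF r(1)] J_RD[OF r(2)] OB_adj[OF 2(3)] e])
  next
   case (3 ww y a)
   then have r: "y : RD" "Nr a" by simp_all
   show ?thesis
    by (simp add: 3(1,2) OB_ract EB_smult[OF r(2,1)] op_adj_comp_rep[OF 3(3) r(2)] J_conv[OF r(2) subsetD[OF RD_l2 r(1)]]
      q_balanced1[OF J_RD[OF r(1)] OB_adj[OF 3(3)] e rd_tstar[OF r(2)]])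
  next
   case (4 y)
   then have r: "y : RD" by simp
   have t: "(%m. - tstar Th (%m. 0) m) = (%m. 0)" by (simp add: tstar_def fun_eq_iff)
   have "op_adj Vs \<zero>\<^bsub>OB\<^esub> = \<zero>\<^bsub>OB\<^esub>" using op_adj_om[OF rd_0] by (simp add: t)
   then show ?thesis using q_zero2[OF J_RD[OF r] e] by (simp add: 4(1,2))
  qed
 qed
 then have "- (\<Sum>p\<leftarrow>rep_of (nab ?z). ?f p) = - (\<Sum>p\<leftarrow>map (%i. (dD X (co ?z i), eu i)) idx. ?f p)" by (rule arg_cong[OF HOL.sym])
 also have "... = - (\<Sum>i\<leftarrow>idx. q (J (eu i)) (op_adj Vs (dD X (co ?z i))) et m)" by (simp only: map_map o_def prod.case)
 also have "... = (\<Sum>i\<in>UNIV. - q (J (eu i)) (op_adj Vs (dD X (co ?z i))) et m)" by (simp only: sum_list_idx sum_negf)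
 also have "... = (\<Sum>i\<in>UNIV. \<Sum>j\<in>UNIV. R j (Phi (J (conv Th (co (pdv j ?z) i) (eu i))) et m))"
 proof (rule sum.cong[OF refl])
  fix i :: 's
  let ?b = "%j. tstar Th (pd j (co ?z i))"
  have b: "Nr (?b j)" for j by (rule rd_tstar[OF rd_pd[OF co_rd[OF z]]])
  have Je: "J (eu i) : RD" "(%m. (-1) *s J (eu i) m) : RD" by (rule J_RD[OF eu_RD], rule RD_smult[OF J_RD[OF eu_RD]])
  have mb: "Nr (%m. (-1) * ?b j m)" for j by (rule rd_cmult[OF b])
  have cb: "conv Th (%m. (-1) * ?b j m) et = (%m. (-1) *s conv Th (?b j) et m)" for j
   by (rule conv_cmult[OF l1_rd[OF b] subsetD[OF RD_l2 e]])
  have "op_adj Vs (dD X (co ?z i)) = om (%j m. (-1) * ?b j m)"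
   unfolding dD_om[OF co_rd[OF z]] op_adj_om[OF rd_pd[OF co_rd[OF z]]] by simp
  then have "q (J (eu i)) (op_adj Vs (dD X (co ?z i))) et m = (\<Sum>j\<in>UNIV. (-1) *s R j (Phi (J (eu i)) (conv Th (?b j) et) m))"
   by (simp only: qsym_om[OF q mb Je(1) e] cb Phi_smult(2) flin_smult[OF qsym_lin[OF q]])
  then have "- q (J (eu i)) (op_adj Vs (dD X (co ?z i))) et m = (\<Sum>j\<in>UNIV. R j (Phi (J (eu i)) (conv Th (?b j) et) m))"
   by (simp add: sum_negf vector_sneg_minus1[symmetric])
  also have "... = (\<Sum>j\<in>UNIV. R j (Phi (rconv Th (J (eu i)) (?b j)) et m))"
   by (simp only: Phi_balanced[OF b Je(1) e])
  also have "... = (\<Sum>j\<in>UNIV. R j (Phi (J (conv Th (co (pdv j ?z) i) (eu i))) et m))"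
   by (simp only: co_pdv J_conv[OF rd_pd[OF co_rd[OF z]] subsetD[OF RD_l2 eu_RD]])
  finally show "- q (J (eu i)) (op_adj Vs (dD X (co ?z i))) et m = (\<Sum>j\<in>UNIV. R j (Phi (J (conv Th (co (pdv j ?z) i) (eu i))) et m))" .
 qed
 also have "... = (\<Sum>j\<in>UNIV. \<Sum>i\<in>UNIV. R j (Phi (J (conv Th (co (pdv j ?z) i) (eu i))) et m))" by (rule sum.swap)
 also have "... = (\<Sum>j\<in>UNIV. R j (Phi (pdv j xi) et m))"
 proof (rule sum.cong[OF refl])
  fix j :: 'n
  have c: "J (conv Th (co (pdv j ?z) i) (eu i)) : RD" for i by (rule J_RD[OF RD_conv[OF co_rd[OF pdv_RD[OF z]] eu_RD]])
  have "pdv j xi = J (pdv j ?z)" by (simp add: J_pdv J_Ji)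
  also have "... = J (%m. \<Sum>i\<in>UNIV. conv Th (co (pdv j ?z) i) (eu i) m)" by (simp only: sum_conv_eu)
  also have "... = (%m. \<Sum>i\<in>UNIV. J (conv Th (co (pdv j ?z) i) (eu i)) m)" by (rule J_sum_fun)
  finally have "Phi (pdv j xi) et = (%m. \<Sum>i\<in>UNIV. Phi (J (conv Th (co (pdv j ?z) i) (eu i))) et m)"
   using Phi_sum(1)[OF c e] by (simp only:)
  then show "(\<Sum>i\<in>UNIV. R j (Phi (J (conv Th (co (pdv j ?z) i) (eu i))) et m)) = R j (Phi (pdv j xi) et m)"
   by (simp add: flin_sum[OF qsym_lin[OF q]])
 qed
 finally have s: "- (\<Sum>p\<leftarrow>rep_of (nab ?z). ?f p) = (\<Sum>j\<in>UNIV. R j (Phi (pdv j xi) et m))" .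
 show ?thesis unfolding nabla_bar_rep(2)[OF x e] by (rule s)
qed

text \<open>Differentiating both factors is differentiating the product, that is multiplying its coefficients by the
  momentum.\<close>

lemma q_nabla_tilde:
 assumes P: "P : carrier TS"
 shows "set (rep_of (nabla_tilde X J RD nab P)) <= RD \<times> carrier OB \<times> RD"
  and "(\<Sum>(xi, ww, et)\<leftarrow>rep_of (nabla_tilde X J RD nab P). q xi ww et m) = mf (fo R) (w P) m"
proof -
 let ?G = "%(xi\<^sub>1, xi\<^sub>2). map (%(et, ww). (et, ww, xi\<^sub>2)) (rep_of (nabla_bar X J RD nab xi\<^sub>1)) @
   map (%(ww, et). (xi\<^sub>1, ww, et)) (rep_of (nab xi\<^sub>2))"
 let ?f = "%(xi, ww, et). q xi ww et m"
 have G: "set (?G p) <= RD \<times> carrier OB \<times> RD & sum_list (map ?f (?G p)) = fo R m (Phi (fst p) (snd p) m)"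
  if p: "fst p : RD" "snd p : RD" for p
 proof
  have n: "set (rep_of (nab (snd p))) <= carrier OB \<times> RD" using nab_rep(1)[OF p(2)] by (simp del: OB_sel)
  show "set (?G p) <= RD \<times> carrier OB \<times> RD"
  proof
   fix r assume "r : set (?G p)"
   then consider s where "s : set (rep_of (nabla_bar X J RD nab (fst p)))" "r = (fst s, snd s, snd p)"
    | s where "s : set (rep_of (nab (snd p)))" "r = (fst p, fst s, snd s)" by (auto simp: case_prod_beta)
   then show "r : RD \<times> carrier OB \<times> RD"
   proof cases
    case 1
    then show ?thesis using subsetD[OF nabla_bar_rep(1)[OF p(1)] 1(1)] p by (simp add: mem_Times_iff del: OB_sel)
   next
    case 2
    then show ?thesis using subsetD[OF n 2(1)] p by (simp add: mem_Times_iff del: OB_sel)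
   qed
  qed
  have a: "sum_list (map ?f (map (%(et, ww). (et, ww, xi\<^sub>2)) xs)) = (\<Sum>(ze, ww)\<leftarrow>xs. q ze ww xi\<^sub>2 m)" for xi\<^sub>2 xs
   by (simp only: map_map o_def case_prod_unfold fst_conv snd_conv)
  have b: "sum_list (map ?f (map (%(ww, et). (xi\<^sub>1, ww, et)) xs)) = (\<Sum>(ww, y)\<leftarrow>xs. q xi\<^sub>1 ww y m)" for xi\<^sub>1 xs
   by (simp only: map_map o_def case_prod_unfold fst_conv snd_conv)
  have "sum_list (map ?f (?G p)) = (\<Sum>j\<in>UNIV. R j (Phi (pdv j (fst p)) (snd p) m)) + (\<Sum>j\<in>UNIV. R j (Phi (fst p) (pdv j (snd p)) m))"
  proof -
   obtain x y where xy: "p = (x, y)" by (cases p)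
   have r: "x : RD" "y : RD" using p by (simp_all add: xy)
   show ?thesis unfolding xy prod.case map_append sum_list_append a b q_nab[OF r] q_nab_bar[OF r] fst_conv snd_conv ..
  qed
  also have "... = fo R m (Phi (fst p) (snd p) m)" unfolding fo_def sum.distrib[symmetric]
   by (rule sum.cong[OF refl])
    (simp only: flin_smult[OF qsym_lin[OF q], symmetric] Phi_pdv[OF p] flin_add[OF qsym_lin[OF q]])
  finally show "sum_list (map ?f (?G p)) = fo R m (Phi (fst p) (snd p) m)" .
 qed
 have fo_lin: "flin (fo R m)" by (rule fo_linear[OF qsym_lin[OF q]])
 have C: "set (concat (map ?G xs)) <= RD \<times> carrier OB \<times> RD & sum_list (map ?f (concat (map ?G xs))) = fo R m (PhiL xs m)"
  if "set xs <= RD \<times> RD" for xs using that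
 proof (induction xs)
  case (Cons p xs)
  have p: "fst p : RD" "snd p : RD" "set xs <= RD \<times> RD" using Cons.prems by auto
  have e: "PhiL (p # xs) m = Phi (fst p) (snd p) m + PhiL xs m" by (simp add: PhiL_def case_prod_unfold)
  show ?case unfolding e flin_add[OF fo_lin] using G[OF p(1,2)] Cons.IH[OF p(3)]
   by (simp del: OB_sel split_paired_all)
 qed (simp add: PhiL_simps flin_0[OF fo_lin])
 let ?xs = "concat (map ?G (rep_of P))"
 note c = C[OF TS_rep(1)[OF P]]
 have s: "set ?xs <= carrier EB \<times> carrier OB \<times> carrier EB" using c by (simp del: OB_sel)
 have n: "nabla_tilde X J RD nab P = tens3 {a. Nr a} EB OB EB ?xs" unfolding nabla_tilde_def by simp
 note r = tens3_rep[OF s, of "{a. Nr a}"]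
 show "set (rep_of (nabla_tilde X J RD nab P)) <= RD \<times> carrier OB \<times> RD"
  unfolding n using r(1) by (simp del: OB_sel)
 have "(\<Sum>(xi, ww, et)\<leftarrow>rep_of (nabla_tilde X J RD nab P). q xi ww et m) = sum_list (map ?f ?xs)"
  unfolding n by (rule tensor3_invariant[OF r(2), THEN HOL.sym])
 then show "(\<Sum>(xi, ww, et)\<leftarrow>rep_of (nabla_tilde X J RD nab P). q xi ww et m) = mf (fo R) (w P) m"
  using c by (simp only: mf_def w_def)
qed

end

end

section \<open>The extended spectral data\<close>

lemma fo_clifford_square:
 assumes A: "!!j. flin (A j)"
  and cliff: "!!i j v. A i (A j v) + A j (A i v) = (if i = j then (-2) *s v else 0)"
 shows "fo A m (fo A m v) = of_real (msq m) *s v"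
proof -
 have "fo A m (fo A m v) + fo A m (fo A m v) = - ((-2) * of_real (msq m)) *s v"
  by (rule fo_anticommutator[OF A A]) (simp only: cliff, simp add: vec_eq_iff)
 then have "fo A m (fo A m v) + fo A m (fo A m v) = (2 * of_real (msq m)) *s v"
  by (simp only: mult_minus_left minus_minus)
 then show ?thesis by (rule vec_half)
qed

lemma fo_skew:
 assumes "!!j v w. hdot (A j v) w = - hdot v (A j w)" shows "hdot (fo A m v) w = hdot v (fo A m w)"
 using fo_adj_uminus[of A "%j v. - A j v" m v w] by (simp add: assms hdot_minus)

context torus_spinor
begin

lemma qsym_right: "qsym (%xi ww et. Phi xi (ap ww et)) Rg" unfolding qsym_def
proof (intro conjI allI impI)
 show "flin (Rg j)" for j by (rule RM_lin)
 fix b :: "'n => 'n mi => complex" and xi et :: "('n,'s) vf" assume b: "\<forall>j. Nr (b j)" and x: "xi : RD" and e: "et : RD"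
 have b': "Nr (b j)" for j using b by blast
 have c: "conv Th (b j) et : RD" for j by (rule RD_conv[OF b' e])
 have c': "(%m. ga j *v conv Th (b j) et m) : RD" for j by (rule RD_fibre[OF flin_matrix c])
 have "ap (om b) et = (%m. \<Sum>j\<in>UNIV. ga j *v conv Th (b j) et m)"
  using ap_om[OF b' subsetD[OF RD_l2 e]] by (simp only: oneform_def[abs_def])
 then show "Phi xi (ap (om b) et) = (%m. \<Sum>j\<in>UNIV. Rg j (Phi xi (conv Th (b j) et) m))"
  by (simp only: Phi_sum(2)[OF c' x] Phi_matrix(2)[OF x c])
qed

lemma qsym_left: "qsym (%xi ww et. Phi (right_act X J xi ww) (ap (fiber_op sg) et)) (%j v. - Lg j v)"
 unfolding qsym_def
proof (intro conjI allI impI)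
 show "flin (%v. - Lg j v)" for j by (rule flin_intros(6)[OF Lg_lin])
 fix b :: "'n => 'n mi => complex" and xi et :: "('n,'s) vf" assume b: "\<forall>j. Nr (b j)" and x: "xi : RD" and e: "et : RD"
 have b': "Nr (b j)" for j using b by blast
 have c: "rconv Th xi (b j) : RD" for j by (rule RD_rconv[OF x b'])
 have c': "(%m. ga j *v rconv Th xi (b j) m) : RD" for j by (rule RD_fibre[OF flin_matrix c])
 have s: "(%m. sg *v et m) : RD" by (rule RD_fibre[OF flin_matrix e])
 have r: "right_act X J xi (om b) = (%m. (-1) *s (\<Sum>j\<in>UNIV. ga j *v rconv Th xi (b j) m))"
  unfolding right_act_om[OF b' subsetD[OF RD_l2 x]] by (simp add: rone_def[abs_def] vector_sneg_minus1[symmetric])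
 show "Phi (right_act X J xi (om b)) (ap (fiber_op sg) et) = (%m. \<Sum>j\<in>UNIV. - Lg j (Phi xi (conv Th (b j) et) m))"
  unfolding r ap_fiber[OF subsetD[OF RD_l2 e]] Phi_smult Phi_sum(1)[OF c' s] Phi_matrix(1)[OF c s] Phi_matrix(2)[OF c e]
   Phi_balanced[OF b' x e] by (simp add: sum_negf vector_sneg_minus1[symmetric])
qed

abbreviation "H \<equiv> completion TS"
abbreviation "hmop \<equiv> ten.cpl.mop"
abbreviation "hlop \<equiv> ten.cpl.lop"
abbreviation "grS \<equiv> %v. LM sg (RM sg v)"

sublocale ext: torus_model "completion TS" ten.Wc Th
 unfolding torus_model_def by (rule ten.completion_model)

lemma EE_EEl: "EE X J RD xs = EEl xs" by simp

lemma nabla_tilde_mem: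
 assumes P: "P : carrier TS" and p: "p : set (rep_of (nabla_tilde X J RD nab P))"
 shows "fst p : RD" "fst (snd p) : carrier OB" "snd (snd p) : RD"
 using subsetD[OF q_nabla_tilde(1)[OF qsym_right P] p] by (simp_all add: mem_Times_iff del: OB_sel)

lemma ext_D_eq: "ext_D X J RD gE nab = hlop RD (mf (fo Rg))" unfolding ext_D_def
proof (rule ten.op_on_completion_lop)
 fix P assume P: "P : carrier TS"
 let ?N = "rep_of (nabla_tilde X J RD nab P)"
 let ?xs = "map (%(xi, ww, et). (xi, ap ww et)) ?N"
 have xs: "set ?xs <= RD \<times> RD"
 proof
  fix r assume "r : set ?xs"
  then obtain p where p: "p : set ?N" "r = (fst p, ap (fst (snd p)) (snd (snd p)))" by (auto simp: case_prod_beta)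
  show "r : RD \<times> RD"
   unfolding p(2) using nabla_tilde_mem[OF P p(1)] OB_lop(3)[OF nabla_tilde_mem(2,3)[OF P p(1)]] by (simp del: OB_sel)
 qed
 have c: "cliff X J RD (nabla_tilde X J RD nab P) = EEl ?xs" unfolding cliff_def by simp
 show "cliff X J RD (nabla_tilde X J RD nab P) : carrier TS" unfolding c by (rule EEl_carrier[OF xs])
 have "PhiL ?xs m = mf (fo Rg) (w P) m" for m
 proof -
  have "PhiL ?xs m = (\<Sum>(xi, ww, et)\<leftarrow>?N. Phi xi (ap ww et) m)"
   unfolding PhiL_def by (simp only: map_map o_def case_prod_unfold fst_conv snd_conv)
  then show ?thesis using q_nabla_tilde(2)[OF qsym_right P, of m] by simp
 qed
 then show "w (cliff X J RD (nabla_tilde X J RD nab P)) = mf (fo Rg) (w P)" unfolding c EEl_rep(2)[OF xs] by blast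
qed

lemma ext_D_bar_eq: "ext_D_bar X J RD gE nab = hlop RD (mf (fo (%j v. - Lg j v)))" unfolding ext_D_bar_def
proof (rule ten.op_on_completion_lop)
 fix P assume P: "P : carrier TS"
 let ?N = "rep_of (nabla_tilde X J RD nab P)"
 let ?xs = "map (%(xi, ww, et). (right_act X J xi ww, ap (fiber_op sg) et)) ?N"
 have xs: "set ?xs <= RD \<times> RD"
 proof
  fix r assume "r : set ?xs"
  then obtain p where p: "p : set ?N" "r = (right_act X J (fst p) (fst (snd p)), ap (fiber_op sg) (snd (snd p)))"
   by (auto simp: case_prod_beta)
  note m = nabla_tilde_mem[OF P p(1)]
  obtain b where b: "fst (snd p) = om b" "!!j. Nr (b j)" by (rule OB_E[OF m(2)]) simp
  show "r : RD \<times> RD"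
   unfolding p(2) b(1) right_act_om[OF b(2) subsetD[OF RD_l2 m(1)]] ap_fiber[OF subsetD[OF RD_l2 m(3)]]
   using rone_RD[OF b(2) m(1)] RD_fibre[OF flin_matrix m(3)] by simp
 qed
 have c: "cliff_bar X J RD (nabla_tilde X J RD nab P) = EEl ?xs" unfolding cliff_bar_def by simp
 show "cliff_bar X J RD (nabla_tilde X J RD nab P) : carrier TS" unfolding c by (rule EEl_carrier[OF xs])
 have "PhiL ?xs m = mf (fo (%j v. - Lg j v)) (w P) m" for m
 proof -
  have "PhiL ?xs m = (\<Sum>(xi, ww, et)\<leftarrow>?N. Phi (right_act X J xi ww) (ap (fiber_op sg) et) m)"
   unfolding PhiL_def by (simp only: map_map o_def case_prod_unfold fst_conv snd_conv)
  then show ?thesis using q_nabla_tilde(2)[OF qsym_left P, of m] by simp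
 qed
 then show "w (cliff_bar X J RD (nabla_tilde X J RD nab P)) = mf (fo (%j v. - Lg j v)) (w P)"
  unfolding c EEl_rep(2)[OF xs] by blast
qed

lemma ext_op_eq:
 assumes F: "!!xi et. xi : RD ==> et : RD ==> ap S xi : RD & ap T et : RD & Phi (ap S xi) (ap T et) = \<phi> (Phi xi et)"
  and \<phi>: "\<phi> (%m. 0) = (%m. 0)" "!!u v. u : RD ==> v : RD ==> \<phi> (%m. u m + v m) = (%m. \<phi> u m + \<phi> v m)"
 shows "ext_op X J RD gE S T = op_closure H (hlop RD \<phi>)"
proof -
 have "op_on_completion TS (%P. EE X J RD (map (%(xi, et). (ap S xi, ap T et)) (rep_of P))) = hlop RD \<phi>"
 proof (rule ten.op_on_completion_lop)
  fix P assume P: "P : carrier TS"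
  show "EE X J RD (map (%(xi, et). (ap S xi, ap T et)) (rep_of P)) : carrier TS" unfolding EE_EEl
   by (rule w_map(1)[where f = "ap S" and g = "ap T" and \<phi> = \<phi>, OF P], erule (1) F, rule \<phi>(1), erule (1) \<phi>(2))
  show "w (EE X J RD (map (%(xi, et). (ap S xi, ap T et)) (rep_of P))) = \<phi> (w P)" unfolding EE_EEl
   by (rule w_map(2)[where f = "ap S" and g = "ap T" and \<phi> = \<phi>, OF P], erule (1) F, rule \<phi>(1), erule (1) \<phi>(2))
 qed
 then show ?thesis unfolding ext_op_def by (simp only:)
qed

lemma ap_id: "et : RD ==> ap (op_id Vs) et = et"
 using subsetD[OF RD_l2, of et] by (simp add: spin.op_id_lop ap_lop_l2)

lemma ext_rep: assumes a: "Nr a" shows "ext_op X J RD gE (torus_rep Th a) (op_id Vs) = ext.lrep a"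
proof -
 have l: "l1 a" using a by simp
 have "ext_op X J RD gE (torus_rep Th a) (op_id Vs) = op_closure H (hlop RD (conv Th a))"
 proof (rule ext_op_eq)
  fix xi et :: "('n,'s) vf" assume x: "xi : RD" and e: "et : RD"
  show "ap (torus_rep Th a) xi : RD & ap (op_id Vs) et : RD \<and>
    Phi (ap (torus_rep Th a) xi) (ap (op_id Vs) et) = conv Th a (Phi xi et)"
   unfolding ap_rep[OF a subsetD[OF RD_l2 x]] ap_id[OF e] using Phi_conv[OF a x e] RD_conv[OF a x] e by simp
 next
  show "conv Th a (%m. 0) = (%m. 0 :: complex^('s \<times> 's))" by (simp add: conv_def fun_eq_iff)
  show "conv Th a (%m. u m + v m) = (%m. conv Th a u m + conv Th a v m)" if "u : RD" "v : RD"
   for u v :: "'n mi => complex^('s \<times> 's)"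
   by (rule conv_add_vec[OF l subsetD[OF RD_l2 that(1)] subsetD[OF RD_l2 that(2)]])
 qed
 also have "... = hlop l2 (conv Th a)" by (rule ten.cpl.op_closure_bdd[OF ext.bdd_conv[OF l] fin_supp_RD RD_l2])
 finally show ?thesis by (simp only: ext.lrep_def)
qed

lemma ext_fibre:
 assumes F: "!!xi et. xi : RD ==> et : RD ==> ap S xi : RD & ap T et : RD & Phi (ap S xi) (ap T et) = (%m. L (Phi xi et m))"
  and L: "flin L" shows "ext_op X J RD gE S T = hmop (%_. L)"
proof -
 have "ext_op X J RD gE S T = op_closure H (hlop RD (mf (%_. L)))"
 proof (rule ext_op_eq)
  show "ap S xi : RD & ap T et : RD & Phi (ap S xi) (ap T et) = mf (%_. L) (Phi xi et)" if "xi : RD" "et : RD" for xi et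
   unfolding mf_def by (rule F[OF that])
  show "mf (%_. L) (%m. 0) = (%m. 0)" unfolding mf_def flin_0[OF L] ..
  show "mf (%_. L) (%m. u m + v m) = (%m. mf (%_. L) u m + mf (%_. L) v m)" for u v
   unfolding mf_def flin_add[OF L] ..
 qed
 also have "... = hmop (%_. L)"
  by (rule ten.cpl.op_closure_mf[where L = "%_. L", OF L fin_supp_RD]) (simp only: ten.cpl.bdd_map_fibre(2)[OF L] RD_l2)
 finally show ?thesis .
qed

lemma ext_grading: "ext_op X J RD gE (fiber_op sg) (fiber_op sg) = hmop (%_. grS)"
proof (rule ext_fibre)
 fix xi et :: "('n,'s) vf" assume x: "xi : RD" and e: "et : RD"
 have s: "(%m. sg *v ze m) : RD" if "ze : RD" for ze :: "('n,'s) vf" by (rule RD_fibre[OF flin_matrix that])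
 show "ap (fiber_op sg) xi : RD & ap (fiber_op sg) et : RD & Phi (ap (fiber_op sg) xi) (ap (fiber_op sg) et) = (%m. grS (Phi xi et m))"
  unfolding ap_fiber[OF subsetD[OF RD_l2 x]] ap_fiber[OF subsetD[OF RD_l2 e]]
  using s[OF x] s[OF e] Phi_matrix(1)[OF x s[OF e], of sg] Phi_matrix(2)[OF x e, of sg] by simp
qed (rule doubled.S_lin)

lemma ext_hodge: "ext_op X J RD gE (op_id Vs) (fiber_op sg) = hmop (%_. RM sg)"
proof (rule ext_fibre)
 fix xi et :: "('n,'s) vf" assume x: "xi : RD" and e: "et : RD"
 show "ap (op_id Vs) xi : RD & ap (fiber_op sg) et : RD & Phi (ap (op_id Vs) xi) (ap (fiber_op sg) et) = (%m. RM sg (Phi xi et m))"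
  unfolding ap_id[OF x] ap_fiber[OF subsetD[OF RD_l2 e]]
  using x RD_fibre[OF flin_matrix e, of sg] Phi_matrix(2)[OF x e, of sg] by simp
qed (rule RM_lin)

lemma ess_self_adjoint_fo:
 assumes "!!j. flin (A j)" "!!j v w. hdot (A j v) w = - hdot v (A j w)"
 shows "essentially_self_adjoint H (hlop RD (mf (fo A)))"
 by (rule ten.cpl.essentially_self_adjoint_mf[where L = "fo A", OF fo_linear[of A, OF assms(1)] fo_skew[of A, OF assms(2)]
   fin_supp_RD RD_md_fo[of A, OF assms(1)] RD_add RD_smult])

lemma fo_minus_Lg: "fo (%j v. - Lg j v) m v = - fo Lg m v" by (rule fo_uminus)

lemma mf_RD: "F : RD ==> mf (fo Rg) F : RD" "F : RD ==> mf (fo (%j v. - Lg j v)) F : RD"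
 by (rule RD_fo[of Rg, OF RM_lin], assumption)
  (rule RD_fo[of "%j v. - Lg j v", OF flin_intros(6)[OF Lg_lin]], assumption)

lemma mf_RD_l2: "F : RD ==> mf (fo Rg) F : l2" "F : RD ==> mf (fo (%j v. - Lg j v)) F : l2"
 using mf_RD RD_l2 by blast+

lemma admissible: "admissible_extension X J RD gE nab"
 unfolding admissible_extension_def Let_def ext_D_eq ext_D_bar_eq
proof (intro conjI)
 let ?L = "%j v. - Lg j v"
 note lin = fo_linear[of Rg, OF RM_lin] fo_linear[of Lg, OF Lg_lin]
 show "extension_module X J RD" by (rule extension_module_RD)
 show "hermitian_structure X EB gE" by (rule hermitian_gE)
 show "connection X J RD nab" by (rule connection_nab)
 show "metric_compatible X RD gE nab" by (rule metric_nab)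
 show "commutes_with_grading X J RD nab" by (rule grading_nab)
 show "essentially_self_adjoint H (hlop RD (mf (fo Rg)))"
  by (rule ess_self_adjoint_fo[of Rg, OF RM_lin RM_hdot(1)])
 show "essentially_self_adjoint H (hlop RD (mf (fo ?L)))"
  by (rule ess_self_adjoint_fo[of ?L, OF flin_intros(6)[OF Lg_lin]]) (simp add: hdot_minus doubled.Gb_skew)
 have sq: "mf (fo Rg) (mf (fo Rg) F) = mf (fo ?L) (mf (fo ?L) F)" for F
  unfolding mf_def fo_minus_Lg flin_minus[OF lin(2)] minus_minus
   fo_clifford_square[of Rg, OF RM_lin doubled.GG] fo_clifford_square[of Lg, OF Lg_lin doubled.GbGb] ..
 have "op_comp (hlop RD (mf (fo Rg))) (hlop RD (mf (fo Rg))) = hlop RD (%F. mf (fo Rg) (mf (fo Rg) F))"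
  by (subst ten.cpl.op_comp_lop, rule mf_RD_l2(1), assumption, rule ten.cpl.lop_cong) (use mf_RD in auto)
 moreover have "op_comp (hlop RD (mf (fo ?L))) (hlop RD (mf (fo ?L))) = hlop RD (%F. mf (fo ?L) (mf (fo ?L) F))"
  by (subst ten.cpl.op_comp_lop, rule mf_RD_l2(2), assumption, rule ten.cpl.lop_cong) (use mf_RD in auto)
 ultimately show "op_comp (hlop RD (mf (fo Rg))) (hlop RD (mf (fo Rg))) = op_comp (hlop RD (mf (fo ?L))) (hlop RD (mf (fo ?L)))"
  by (simp only: sq)
 have ac: "fo Rg m (fo Lg m v) = - fo Lg m (fo Rg m v)" for m v
  by (rule fo_anticommute[OF RM_lin Lg_lin]) (rule eq_neg_iff_add_eq_0[THEN iffD2, OF doubled.GGb])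
 have "acomm H (hlop RD (mf (fo Rg))) (hlop RD (mf (fo ?L))) =
   hlop {F. F : RD & F : RD & mf (fo ?L) F : RD & mf (fo Rg) F : RD} (%F m. mf (fo Rg) (mf (fo ?L) F) m + mf (fo ?L) (mf (fo Rg) F) m)"
  by (rule ten.cpl.acomm_lop) (rule mf_RD_l2(1), assumption, rule mf_RD_l2(2), assumption)
 also have "... = hlop RD (%F m. 0)"
 proof (rule ten.cpl.lop_eq_zeroI)
  show "{F. F : RD & F : RD & mf (fo ?L) F : RD & mf (fo Rg) F : RD} = RD" using mf_RD by blast
  show "(%m. mf (fo Rg) (mf (fo ?L) F) m + mf (fo ?L) (mf (fo Rg) F) m) = (%m. 0)" for F
   by (simp add: mf_def fo_minus_Lg flin_minus[OF lin(1)] ac)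
 qed
 also have "... = op_zero_on H (Domain (hlop RD (mf (fo Rg))))"
  by (rule ten.cpl.op_zero_Domain[symmetric]) (rule mf_RD_l2(1))
 finally show "acomm H (hlop RD (mf (fo Rg))) (hlop RD (mf (fo ?L))) = op_zero_on H (Domain (hlop RD (mf (fo Rg))))" .
qed

lemma ext_diff: "op_closure H (op_scale H (1/2) (op_add H (ext_D X J RD gE nab) (op_scale H (-\<i>) (ext_D_bar X J RD gE nab)))) =
  hmop (fo doubled.cr)"
proof -
 let ?L = "%j v. - Lg j v"
 have l: "(%m. (-\<i>) *s mf (fo ?L) F m) : l2" if "F : RD" for F by (rule l2_smult[OF mf_RD_l2(2)[OF that]])
 have l': "(%m. mf (fo Rg) F m + (-\<i>) *s mf (fo ?L) F m) : l2" if "F : RD \<inter> RD" for F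
  using l2_add[OF mf_RD_l2(1) l, of F F] that by simp
 have s: "(%F m. (1/2) *s (mf (fo Rg) F m + (-\<i>) *s mf (fo ?L) F m)) = mf (fo doubled.cr)"
  by (simp add: fun_eq_iff mf_def fo_def doubled.cr_def vec_eq_iff sum_distrib_left sum_negf sum.distrib[symmetric] algebra_simps)
 have "op_scale H (1/2) (op_add H (ext_D X J RD gE nab) (op_scale H (-\<i>) (ext_D_bar X J RD gE nab))) =
   hlop RD (mf (fo doubled.cr))" unfolding ext_D_eq ext_D_bar_eq
  by (subst ten.cpl.op_scale_lop, rule mf_RD_l2(2), assumption, subst ten.cpl.op_add_lop, rule mf_RD_l2(1), assumption,
    rule l, assumption, subst ten.cpl.op_scale_lop, rule l', assumption) (simp only: s Int_absorb)
 then show ?thesis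
  using ten.cpl.op_closure_mf[where L = "fo doubled.cr", OF fo_linear[of doubled.cr, OF doubled.cr_lin] fin_supp_RD
    RD_md_fo[of doubled.cr, OF doubled.cr_lin]] by simp
qed

definition KS :: "('n => 'n => complex) => ('n mi => complex,
  (nat => ((('n,'s) vf) \<times> (('n,'s) vf)) list set) set) N22_data" where
 "KS al = \<lparr>alg = nc_torus Th, spc = H, rep = (%a. ext_op X J RD gE (torus_rep Th a) (op_id Vs)), grd = hmop (%_. grS),
  del = hmop (fo (doubled.Pf al)), delbar = hmop (fo (doubled.Qf al)), Tdeg = hmop (%_. doubled.Tf al), Tbar = hmop (%_. doubled.Tf' al),
  hodge = hmop (%_. RM sg)\<rparr>"

lemma Pf_lin: "flin (doubled.Pf al j)" and Qf_lin: "flin (doubled.Qf al j)"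
 by (simp_all add: doubled.Pf_def doubled.Qf_def doubled.cc_lin)

lemma KS_Kaehler:
 assumes al: "doubled.holo al" shows "KS al : Kaehler_structures X J"
proof -
 note K = doubled.kaehler_fibre_holo[OF al]
 have PQ: "(%j v. doubled.Pf al j v + doubled.Qf al j v) = doubled.cr"
  by (intro ext doubled.Pf_plus_Qf[OF al])
 have k: "is_N22_Kaehler_data (KS al)" by (rule ext.is_N22_model[OF K]) (simp_all add: KS_def ext_rep)
 have e: "extended_N11 X J RD gE nab = \<lparr>alg = nc_torus Th, spc = H, rep = (%a. ext_op X J RD gE (torus_rep Th a) (op_id Vs)),
   grd = hmop (%_. grS), diff = hmop (fo doubled.cr), hodge = hmop (%_. RM sg)\<rparr>"
  unfolding extended_N11_def Let_def ext_diff by (simp add: ext_grading ext_hodge)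
 have c: "op_closure H (op_add H (hmop (fo (doubled.Pf al))) (hmop (fo (doubled.Qf al)))) = hmop (fo doubled.cr)"
  using ext.closure_sum_fo[of "doubled.Pf al" "doubled.Qf al", OF Pf_lin Qf_lin] unfolding PQ .
 have n: "N11_of_N22 (KS al) = extended_N11 X J RD gE nab"
  unfolding e N11_of_N22_def by (simp add: KS_def c)
 have "is_N11_data (extended_N11 X J RD gE nab)"
  using k unfolding is_N22_Kaehler_data_def Let_def n by (rule conjunct1)
 then show ?thesis unfolding Kaehler_structures_def using k n admissible by blast
qed

text \<open>Apply both operators to a vector supported at one lattice point.\<close>

lemma hmop_inj:
 assumes L: "!!m. flin (L m)" and eq: "hmop L = hmop L'" shows "L m v = L' m v"
proof -
 let ?F = "delta m v"
 have F: "?F : l2" "?F : md L" using delta_fin_supp fin_supp_md[of L, OF L] by auto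
 have "(ten.cpl.Winv ?F, ten.cpl.Winv (mf L ?F)) : hmop L"
  using F md_mf[OF F(2)] by (simp add: ten.cpl.mop_def ten.cpl.lop_def)
 then have "mf L ?F = mf L' ?F"
  unfolding eq using F(1) md_mf[OF F(2)] by (simp add: ten.cpl.mop_def ten.cpl.lop_def)
 from fun_cong[OF this, of m] show ?thesis by (simp add: mf_def delta_def)
qed

lemma KS_inj: "inj KS"
proof (rule injI)
 fix al \<beta> assume "KS al = KS \<beta>"
 then have "hmop (fo (doubled.Pf al)) = hmop (fo (doubled.Pf \<beta>))" by (simp add: KS_def)
 then have "fo (doubled.Pf al) m v = fo (doubled.Pf \<beta>) m v" for m v
  by (rule hmop_inj[of "fo (doubled.Pf al)", OF fo_linear[of "doubled.Pf al", OF Pf_lin]])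
 then show "al = \<beta>" by (rule doubled.Pf_inj)
qed

end

section \<open>Perfect matchings\<close>

text \<open>Perfect matchings as fixed point free involutions, extended by the identity so that a matching is determined
  by its values.\<close>

definition matchings :: "'a set => ('a => 'a) set" where
 "matchings A = {\<pi>. (\<forall>x\<in>A. \<pi> x : A & \<pi> x ~= x & \<pi> (\<pi> x) = x) & (\<forall>x. x \<notin> A --> \<pi> x = x)}"

lemma odd_product_step:
 "(\<Prod>j | j : {1..2 * Suc k} & odd j. 2 * Suc k - j) = Suc (2 * k) * (\<Prod>j | j : {1..2 * k} & odd j. 2 * k - j)"
proof -
 have s: "{j. j : {1..2 * Suc k} & odd j} = insert 1 ((%j. j + 2) ` {j. j : {1..2 * k} & odd j})" (is "?A = ?B")
 proof (intro equalityI subsetI)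
  fix j assume j: "j : ?A"
  show "j : ?B"
  proof (cases "j = 1")
   case False
   with j have "3 <= j" by (cases "j = 2") auto
   then show ?thesis using j by (intro insertI2 image_eqI[of _ _ "j - 2"]) auto
  qed simp
 qed auto
 have "(\<Prod>j\<in>?B. 2 * Suc k - j) = (2 * Suc k - 1) * (\<Prod>j\<in>(%j. j + 2) ` {j. j : {1..2 * k} & odd j}. 2 * Suc k - j)"
  by (rule prod.insert) auto
 also have "(\<Prod>j\<in>(%j. j + 2) ` {j. j : {1..2 * k} & odd j}. 2 * Suc k - j) = (\<Prod>j | j : {1..2 * k} & odd j. 2 * k - j)"
  by (subst prod.reindex) (auto simp: inj_on_def)
 finally show ?thesis unfolding s by simp
qed

text \<open>Match a chosen element with any of the other \<open>2 k - 1\<close> ones and the rest arbitrarily.\<close>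

lemma matchings_count: "finite A ==> card A = 2 * k ==>
  \<exists>M \<subseteq> matchings A. finite M & card M = (\<Prod>j | j : {1..2 * k} & odd j. 2 * k - j)"
proof (induction k arbitrary: A)
 case 0
 then have "A = {}" by simp
 then show ?case by (intro exI[of _ "{id}"]) (auto simp: matchings_def)
next
 case (Suc k)
 let ?p = "\<Prod>j | j : {1..2 * k} & odd j. 2 * k - j"
 obtain a where a: "a : A" using Suc.prems by fastforce
 have "\<forall>b. \<exists>M. b : A - {a} --> M \<subseteq> matchings (A - {a, b}) & finite M & card M = ?p"
 proof
  fix b
  show "\<exists>M. b : A - {a} --> M \<subseteq> matchings (A - {a, b}) & finite M & card M = ?p"
  proof (cases "b : A - {a}")
   case True
   then have "card {a, b} = 2" by auto
   then have "card (A - {a, b}) = 2 * k" using card_Diff_subset[of "{a, b}" A] Suc.prems a True by simp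
   then show ?thesis using Suc.IH[of "A - {a, b}"] Suc.prems by blast
  qed blast
 qed
 from choice[OF this] obtain M where
  M0: "\<forall>b. b : A - {a} --> M b <= matchings (A - {a, b}) & finite (M b) & card (M b) = ?p" ..
 have M: "M b <= matchings (A - {a, b}) & finite (M b) & card (M b) = ?p" if "b : A - {a}" for b
  using spec[OF M0, of b] that by (rule mp)
 let ?f = "%(b, rh). rh(a := b, b := a)"
 let ?S = "SIGMA b:A - {a}. M b"
 have fix_out: "rh a = a" "rh b = b" if "b : A - {a}" "rh : M b" for b rh
  using M[OF that(1)] that(2) by (auto simp: matchings_def)
 have inj: "inj_on ?f ?S"
 proof (rule inj_onI)
  fix p q assume p: "p : ?S" and q: "q : ?S" and "?f p = ?f q"
  moreover obtain b rh where p': "p = (b, rh)" by (cases p)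
  moreover obtain b' rh' where q': "q = (b', rh')" by (cases q)
  ultimately have eq: "rh(a := b, b := a) = rh'(a := b', b' := a)" by simp
  have h: "b : A - {a}" "rh : M b" "b' : A - {a}" "rh' : M b'" using p q p' q' by auto
  have ne: "a ~= b" "a ~= b'" using h(1,3) by auto
  have bb: "b = b'" using fun_cong[OF eq, of a] ne by simp
  have "rh x = rh' x" for x
  proof (cases "x = a \<or> x = b")
   case True
   then show ?thesis using fix_out[OF h(1,2)] fix_out[OF h(3,4)] bb by auto
  next
   case False
   then show ?thesis using fun_cong[OF eq, of x] bb by simp
  qed
  then show "p = q" using bb p' q' by auto
 qed
 have sub: "?f ` ?S <= matchings A"
 proof
  fix \<pi> assume "\<pi> : ?f ` ?S"
  then obtain b rh where b: "b : A" "b ~= a" "rh : M b" "\<pi> = rh(a := b, b := a)" by auto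
  have r: "!!x. x : A - {a, b} ==> rh x : A - {a, b} & rh x ~= x & rh (rh x) = x" "!!x. x \<notin> A - {a, b} ==> rh x = x"
   using M[of b] b unfolding matchings_def by blast+
  show "\<pi> : matchings A" unfolding matchings_def mem_Collect_eq
  proof (intro conjI ballI allI impI)
   fix x assume x: "x : A"
   show "\<pi> x : A" "\<pi> x ~= x" "\<pi> (\<pi> x) = x"
    using r(1)[of x] x a b by (cases "x = a \<or> x = b", auto)+
  next
   fix x assume "x \<notin> A"
   then show "\<pi> x = x" using r(2)[of x] a b by auto
  qed
 qed
 have finA: "finite (A - {a})" using Suc.prems by simp
 have "card (?f ` ?S) = (\<Sum>b\<in>A - {a}. card (M b))"
  using card_image[OF inj] finA M by (simp add: card_SigmaI)
 also have "... = (\<Sum>b\<in>A - {a}. ?p)" by (rule sum.cong) (use M in auto)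
 also have "... = Suc (2 * k) * ?p" using Suc.prems a by simp
 also have "... = (\<Prod>j | j : {1..2 * Suc k} & odd j. 2 * Suc k - j)" by (rule odd_product_step[symmetric])
 finally have "card (?f ` ?S) = (\<Prod>j | j : {1..2 * Suc k} & odd j. 2 * Suc k - j)" .
 moreover have "finite (?f ` ?S)" by (rule finite_imageI, rule finite_SigmaI[OF finA]) (use M in auto)
 ultimately show ?case using sub by blast
qed

text \<open>The projection \<open>(1 + i I) / 2\<close> for the complex structure \<open>I\<close> that rotates each matched pair by a right
  angle. The order makes the rotation of a pair antisymmetric.\<close>

definition mproj :: "('n::{finite, linorder} => 'n) => 'n => 'n => complex" where
 "mproj \<pi> j l = ((if l = j then 1 else 0) + (if l = \<pi> j then (if j < \<pi> j then \<i> else - \<i>) else 0)) / 2"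

lemma mproj_inj: "inj_on mproj (matchings (UNIV :: 'n::{finite, linorder} set))"
proof (rule inj_onI)
 fix \<pi> rh :: "'n => 'n"
 assume p: "\<pi> : matchings UNIV" "rh : matchings UNIV" and eq: "mproj \<pi> = mproj rh"
 show "\<pi> = rh"
 proof
  fix j
  have ne: "\<pi> j ~= j" using p by (simp add: matchings_def)
  then have "mproj \<pi> j (\<pi> j) ~= 0" by (simp add: mproj_def)
  then have "mproj rh j (\<pi> j) ~= 0" unfolding eq .
  with ne show "\<pi> j = rh j" by (auto simp: mproj_def split: if_splits)
 qed
qed

context torus_spinor
begin

lemma holo_matching:
 assumes p: "\<pi> : matchings (UNIV :: 'n set)" shows "doubled.holo (mproj \<pi>)"
proof -
 define s where "s = (%j. if j < \<pi> j then \<i> else - \<i>)"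
 have \<pi>: "\<pi> j ~= j" "\<pi> (\<pi> j) = j" for j using p by (simp_all add: matchings_def)
 have s: "s (\<pi> j) = - s j" for j using \<pi>[of j] by (cases "j < \<pi> j") (auto simp: s_def)
 have s2: "s j * s j = -1" and cs: "cnj (s j) = - s j" for j by (simp_all add: s_def)
 let ?al = "mproj \<pi>"
 have m: "?al j l = (if l = j then 1/2 else 0) + (if l = \<pi> j then s j / 2 else 0)" for j l
  by (simp add: mproj_def s_def add_divide_distrib)
 have v1: "?al i (\<pi> i) = s i / 2" for i unfolding m using \<pi>(1)[of i] by simp
 have v2: "?al i j = (if j = i then 1/2 else 0)" if "j ~= \<pi> i" for i j unfolding m using that by simp
 have v3: "?al (\<pi> i) i = - (s i / 2)" for i using v1[of "\<pi> i"] unfolding \<pi>(2) s by simp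
 have inv: "i ~= \<pi> j" if "j ~= \<pi> i" for i j using \<pi>(2)[of j] that by metis
 have "(\<Sum>l\<in>UNIV. ?al i l * ?al l j) = ?al i j" for i j
 proof -
  have "(\<Sum>l\<in>UNIV. ?al i l * ?al l j) =
    (\<Sum>l\<in>UNIV. if l = i then 1/2 * ?al l j else 0) + (\<Sum>l\<in>UNIV. if l = \<pi> i then s i / 2 * ?al l j else 0)"
   unfolding sum.distrib[symmetric] by (rule sum.cong[OF refl]) (simp add: m[of i] distrib_right)
  also have "... = 1/2 * ?al i j + s i / 2 * ?al (\<pi> i) j" by simp
  also have "... = ?al i j"
  proof (cases "j = \<pi> i")
   case True
   have h: "?al (\<pi> i) (\<pi> i) = 1/2" using v2[of "\<pi> i" "\<pi> i"] \<pi>(2)[of i] \<pi>(1)[of i] by simp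
   show ?thesis unfolding True v1 h by simp
  next
   case False
   show ?thesis
   proof (cases "j = i")
    case True
    have h: "?al (\<pi> i) j = - (s i / 2)" "?al i j = 1/2" using v3[of i] v2[OF False] True by simp_all
    have "s i / 2 * - (s i / 2) = - (s i * s i) / 4" by simp
    also have "... = 1/4" unfolding s2 by simp
    finally have q: "s i / 2 * - (s i / 2) = 1/4" .
    show ?thesis unfolding h q by simp
   next
    case ne: False
    have h: "?al (\<pi> i) j = 0" "?al i j = 0" using v2[of j "\<pi> i"] v2[OF False] \<pi>(2)[of i] ne False by simp_all
    show ?thesis unfolding h by simp
   qed
  qed
  finally show ?thesis .
 qed
 moreover have "?al i j + ?al j i = (if i = j then 1 else 0)" for i j
 proof (cases "j = \<pi> i")
  case True
  show ?thesis unfolding True v1 v3 using \<pi>(1)[of i, symmetric] by simp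
 next
  case False
  show ?thesis unfolding v2[OF False] v2[OF inv[OF False]] by simp
 qed
 moreover have "cnj (?al i j) = ?al j i" for i j
 proof (cases "j = \<pi> i")
  case True
  show ?thesis unfolding True v1 v3 by (simp add: cs)
 next
  case False
  show ?thesis unfolding v2[OF False] v2[OF inv[OF False]] by simp
 qed
 ultimately show ?thesis unfolding doubled.holo_def by (intro conjI allI)
qed

lemma matching_structures: "(%\<pi>. KS (mproj \<pi>)) ` matchings UNIV <= Kaehler_structures X J"
 "inj_on (%\<pi>. KS (mproj \<pi>)) (matchings UNIV)"
proof -
 show "(%\<pi>. KS (mproj \<pi>)) ` matchings UNIV <= Kaehler_structures X J"
  by (rule image_subsetI) (rule KS_Kaehler[OF holo_matching])
 show "inj_on (%\<pi>. KS (mproj \<pi>)) (matchings UNIV)"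
 proof (rule inj_onI)
  fix \<pi> rh :: "'n => 'n"
  assume p: "\<pi> : matchings UNIV" "rh : matchings UNIV" "KS (mproj \<pi>) = KS (mproj rh)"
  have "mproj \<pi> = mproj rh" by (rule injD[OF KS_inj]) (rule p(3))
  then show "\<pi> = rh" by (rule inj_onD[OF mproj_inj _ p(1,2)])
 qed
qed

end

theorem corollary1p3:
  fixes \<Theta> :: "'n::{finite, linorder} rmatrix"
    and \<gamma> :: "'n \<Rightarrow> complex^'s^'s::finite"
    and \<sigma> :: "complex^'s^'s"
    and J\<^sub>N :: "complex^'s \<Rightarrow> complex^'s"
  assumes "even CARD('n)"
    and "torus_parameter \<Theta>"
    and "CARD('s) = 2 ^ (CARD('n) div 2)"
    and "clifford_rep \<gamma>"
    and "clifford_grading \<gamma> \<sigma>"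
    and "clifford_conjugation \<gamma> \<sigma> J\<^sub>N"
  shows "inherits_Kaehler_structure (torus_N1 \<Theta> \<gamma> \<sigma>) (torus_J \<Theta> J\<^sub>N) \<and>
    (\<exists>\<K> \<subseteq> Kaehler_structures (torus_N1 \<Theta> \<gamma> \<sigma>) (torus_J \<Theta> J\<^sub>N).
       finite \<K> \<and> card \<K> = (\<Prod>j | j \<in> {1..CARD('n)} \<and> odd j. CARD('n) - j))"
proof -
  obtain \<epsilon> \<epsilon>' \<epsilon>'' where KO: "KO_signs CARD('n) = (\<epsilon>, \<epsilon>', \<epsilon>'')" by (cases "KO_signs CARD('n)")
  have e: "\<epsilon> \<in> {1, -1}" "\<epsilon>' = 1" "\<epsilon>'' \<in> {1, -1}" using KO by (auto simp: KO_signs_def split: if_splits)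
  have cj: "\<And>v w. J\<^sub>N (v + w) = J\<^sub>N v + J\<^sub>N w" "\<And>c v. J\<^sub>N (c *s v) = cnj c *s J\<^sub>N v" "\<And>v w. hdot (J\<^sub>N v) (J\<^sub>N w) = hdot w v"
    "\<And>v. J\<^sub>N (J\<^sub>N v) = \<epsilon> *s v" "\<And>j v. J\<^sub>N (\<gamma> j *v v) = \<epsilon>' *s (\<gamma> j *v J\<^sub>N v)" "\<And>v. J\<^sub>N (\<sigma> *v v) = \<epsilon>'' *s (\<sigma> *v J\<^sub>N v)"
    using assms(6) unfolding clifford_conjugation_def KO by simp_all
  interpret torus_spinor \<Theta> \<gamma> \<sigma> J\<^sub>N \<epsilon> \<epsilon>''
  proof
    show "ctranspose (\<gamma> j) = - \<gamma> j" "\<gamma> j ** \<gamma> l + \<gamma> l ** \<gamma> j = (if j = l then mat (- 2) else 0)" for j l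
      using assms(4) by (simp_all add: clifford_rep_def)
    show "ctranspose \<sigma> = \<sigma>" "\<sigma> ** \<sigma> = mat 1" "\<sigma> ** \<gamma> j = - (\<gamma> j ** \<sigma>)" for j
      using assms(5) by (simp_all add: clifford_grading_def)
    show "J\<^sub>N (\<gamma> j *v v) = \<gamma> j *v J\<^sub>N v" for j v using cj(5) by (simp add: e(2))
  qed (use cj e in simp_all)
  obtain k where k: "CARD('n) = 2 * k" using assms(1) by (rule evenE)
  obtain M where M: "M \<subseteq> matchings (UNIV :: 'n set)" "finite M"
    "card M = (\<Prod>j | j \<in> {1..CARD('n)} \<and> odd j. CARD('n) - j)"
    using matchings_count[OF finite k] unfolding k by blast
  let ?K = "(\<lambda>\<pi>. KS (mproj \<pi>)) ` M"
  have K: "?K \<subseteq> Kaehler_structures X J"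
    by (rule order_trans[OF image_mono[OF M(1)] matching_structures(1)])
  have "inj_on (\<lambda>\<pi>. KS (mproj \<pi>)) M"
    by (rule inj_on_subset[OF matching_structures(2) M(1)])
  then have c: "card ?K = (\<Prod>j | j \<in> {1..CARD('n)} \<and> odd j. CARD('n) - j)"
    using M(3) by (simp only: card_image)
  have pos: "0 < CARD('n) - j" if j: "j \<in> {1..CARD('n)} \<and> odd j" for j
  proof -
    have "j \<noteq> CARD('n)" using j assms(1) by metis
    then show ?thesis using j by simp
  qed
  have "0 < card ?K" unfolding c by (rule prod_pos) (rule pos, simp)
  then have "?K \<noteq> {}" unfolding card_gt_0_iff by (rule conjunct1)
  then have ne: "Kaehler_structures X J \<noteq> {}" using K by blast
  have "inherits_Kaehler_structure X J"
    unfolding inherits_Kaehler_structure_def by (intro conjI is_N1 real_structure_J ne)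
  moreover have "finite ?K" by (rule finite_imageI[OF M(2)])
  ultimately show ?thesis using K c by (intro conjI exI[of _ ?K])
qed

end
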